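(* Let $H\in(\frac12,1)$ and $\theta>1$. Let $X$ be the fractional Ornstein–Uhlenbeck process of the second kind with $X_0=0$, i.e. the solution of $\mathrm{d}X_t=-\theta X_t\,\mathrm{d}t+\mathrm{d}Y^{(1)}_t$, $X_0=0$, and let, for $T>0$, $$\widehat\theta_T=-\frac{\int_0^T X_t\,\delta X_t}{\int_0^T X_t^2\,\mathrm{d}t}$$ be the least squares estimator. Then $\widehat\theta_T$ is weakly consistent: $\widehat\theta_T\to\theta$ in probability as $T\to\infty$.
   Context: Let $B=\{B_t\}_{t\ge0}$ be a fractional Brownian motion with Hurst parameter $H$: a continuous centered Gaussian process with covariance $R_H(t,s)=\frac12(t^{2H}+s^{2H}-|t-s|^{2H})$. Put $a_t=He^{t/H}$ and $Y^{(1)}_t=\int_0^t e^{-s}\,\mathrm{d}B_{a_s}$ for $t\ge0$ (path-wise Riemann–Stieltjes integral). The solution of the Langevin equation with $X_0=0$ is $X_t=\int_0^t e^{-\theta(t-s)}\,\mathrm{d}Y^{(1)}_s$. The symbol $\delta$ denotes the Skorokhod integral (divergence operator, i.e. the adjoint of the Malliavin derivative) with respect to the Gaussian process $Y^{(1)}$, whose associated Hilbert space $\mathcal H$ on $[0,T]$ is the closure of the step functions under $\langle \mathbf 1_{[0,t]},\mathbf 1_{[0,s]}\rangle_{\mathcal H}=\mathbb E(Y^{(1)}_tY^{(1)}_s)$. The integral $\int_0^TX_t\,\delta X_t$ means $-\theta\int_0^TX_t^2\,\mathrm{d}t+\int_0^TX_t\,\delta Y^{(1)}_t$, so that $$\widehat\theta_T=\theta-\frac{\int_0^TX_t\,\delta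 Y^{(1)}_t}{\int_0^TX_t^2\,\mathrm{d}t},\qquad \int_0^TX_t\,\delta Y^{(1)}_t=I_2^{Y^{(1)}}\big(\tfrac12e^{-\theta|t-s|}\big),$$ where $I_2^{Y^{(1)}}$ is the double Wiener–Itô integral with respect to $Y^{(1)}$ (normalized by $I_2^{Y^{(1)}}(\varphi^{\otimes2})=Y^{(1)}(\varphi)^2-1$ for $\|\varphi\|_{\mathcal H}=1$, where $\varphi\mapsto Y^{(1)}(\varphi)$ is the isometry extending $\mathbf 1_{[0,t]}\mapsto Y^{(1)}_t$). *)

theory Defs
  imports "HOL-Probability.Probability" "HOL-Library.Poly_Mapping"
begin

section \<open>Fractional Brownian motion\<close>

definition fbm_cov :: "real \<Rightarrow> real \<Rightarrow> real \<Rightarrow> real" where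
  "fbm_cov H t s = (t powr (2 * H) + s powr (2 * H) - \<bar>t - s\<bar> powr (2 * H)) / 2"

text \<open>Degenerate Gaussian variables (variance \<open>0\<close>) are allowed.\<close>

definition centered_gaussian_rv :: "'w measure \<Rightarrow> ('w \<Rightarrow> real) \<Rightarrow> bool" where
  "centered_gaussian_rv M Z \<longleftrightarrow>
     Z \<in> borel_measurable M \<and>
     ((AE \<omega> in M. Z \<omega> = 0) \<or>
      (\<exists>\<sigma>>0. distributed M lborel Z (\<lambda>x. ennreal (normal_density 0 \<sigma> x))))"

definition centered_gaussian_process :: "'w measure \<Rightarrow> (real \<Rightarrow> 'w \<Rightarrow> real) \<Rightarrow> bool" where
  "centered_gaussian_process M B \<longleftrightarrow>
     (\<forall>F c. finite F \<and> F \<subseteq> {0..} \<longrightarrow> centered_gaussian_rv M (\<lambda>\<omega>. \<Sum>t\<in>F. c t * B t \<omega>))"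

definition fractional_brownian_motion ::
  "'w measure \<Rightarrow> real \<Rightarrow> (real \<Rightarrow> 'w \<Rightarrow> real) \<Rightarrow> bool" where
  "fractional_brownian_motion M H B \<longleftrightarrow>
     prob_space M \<and>
     centered_gaussian_process M B \<and>
     (\<forall>\<omega>\<in>space M. continuous_on {0..} (\<lambda>t. B t \<omega>)) \<and>
     (\<forall>t\<ge>0. \<forall>s\<ge>0. (\<integral>\<omega>. B t \<omega> * B s \<omega> \<partial>M) = fbm_cov H t s)"


section \<open>Riemann--Stieltjes integral and the Langevin equation\<close>

definition has_RS_integral ::
  "(real \<Rightarrow> real) \<Rightarrow> (real \<Rightarrow> real) \<Rightarrow> real \<Rightarrow> real \<Rightarrow> real \<Rightarrow> bool" where
  "has_RS_integral f g a b I \<longleftrightarrow>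
     (\<forall>\<epsilon>>0. \<exists>\<eta>>0. \<forall>(n::nat) (t::nat \<Rightarrow> real) (\<xi>::nat \<Rightarrow> real).
        t 0 = a \<and> t n = b \<and>
        (\<forall>i<n. t i \<le> \<xi> i \<and> \<xi> i \<le> t (Suc i) \<and> t (Suc i) - t i < \<eta>) \<longrightarrow>
        \<bar>(\<Sum>i<n. f (\<xi> i) * (g (t (Suc i)) - g (t i))) - I\<bar> < \<epsilon>)"

definition RS_integral ::
  "(real \<Rightarrow> real) \<Rightarrow> (real \<Rightarrow> real) \<Rightarrow> real \<Rightarrow> real \<Rightarrow> real" where
  "RS_integral f g a b = (THE I. has_RS_integral f g a b I)"

text \<open>\<open>noise2 H B\<close> is \<open>Y\<^sup>(\<^sup>1\<^sup>)\<close>, the driving noise of the process of the second kind.\<close>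

definition noise2 :: "real \<Rightarrow> (real \<Rightarrow> 'w \<Rightarrow> real) \<Rightarrow> real \<Rightarrow> 'w \<Rightarrow> real" where
  "noise2 H B t \<omega> = RS_integral (\<lambda>s. exp (- s)) (\<lambda>s. B (H * exp (s / H)) \<omega>) 0 t"

text \<open>The equation \<open>dx = - \<theta> x dt + dy\<close>, \<open>x(0) = 0\<close>, for paths, in integrated form. For a
  continuous \<open>y\<close> with \<open>y(0) = 0\<close> it has exactly one solution on \<open>[0,\<infinity>)\<close>.\<close>

definition langevin_solution :: "real \<Rightarrow> (real \<Rightarrow> real) \<Rightarrow> (real \<Rightarrow> real) \<Rightarrow> bool" where
  "langevin_solution \<theta> y x \<longleftrightarrow>
     x 0 = 0 \<and> continuous_on {0..} x \<and>
     (\<forall>t\<ge>0. x t = - \<theta> * integral {0..t} x + y t)"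


section \<open>The Hilbert space of a Gaussian process on \<open>[0,T]\<close>\<close>

text \<open>The indicators of \<open>[0,t]\<close> are linearly independent, so the step functions they span are the
  finitely supported functions \<open>\<phi>\<close> on the time axis: \<open>\<phi>\<close> stands for the step function
  \<open>\<Sum>t. \<phi>(t) 1\<^bsub>[0,t]\<^esub>\<close>.\<close>

type_synonym step = "real \<Rightarrow>\<^sub>0 real"

definition steps :: "real \<Rightarrow> step set" where
  "steps T = {\<phi>. Poly_Mapping.keys \<phi> \<subseteq> {0..T}}"

definition step_fun :: "step \<Rightarrow> real \<Rightarrow> real" where
  "step_fun \<phi> x = (\<Sum>t\<in>Poly_Mapping.keys \<phi>. Poly_Mapping.lookup \<phi> t * indicator {0..t} x)"

definition step_scale :: "real \<Rightarrow> step \<Rightarrow> step" where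
  "step_scale c \<phi> = Poly_Mapping.map (\<lambda>a. c * a) \<phi>"

definition step_inner :: "'w measure \<Rightarrow> (real \<Rightarrow> 'w \<Rightarrow> real) \<Rightarrow> step \<Rightarrow> step \<Rightarrow> real" where
  "step_inner M Y \<phi> \<psi> =
     (\<Sum>t\<in>Poly_Mapping.keys \<phi>. \<Sum>s\<in>Poly_Mapping.keys \<psi>.
        Poly_Mapping.lookup \<phi> t * Poly_Mapping.lookup \<psi> s * (\<integral>\<omega>. Y t \<omega> * Y s \<omega> \<partial>M))"

text \<open>The Hilbert space is the completion of the step functions. Its elements are represented by
  Cauchy sequences of step functions; two sequences whose difference has seminorm tending to \<open>0\<close>
  represent the same element. A step function \<open>\<phi>\<close> is represented by a constant sequence.\<close>

definition hilb :: "'w measure \<Rightarrow> (real \<Rightarrow> 'w \<Rightarrow> real) \<Rightarrow> real \<Rightarrow> (nat \<Rightarrow> step) set" where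
  "hilb M Y T = {\<Phi>. (\<forall>k. \<Phi> k \<in> steps T) \<and>
     (\<forall>\<epsilon>>0. \<exists>N. \<forall>m\<ge>N. \<forall>k\<ge>N. step_inner M Y (\<Phi> m - \<Phi> k) (\<Phi> m - \<Phi> k) < \<epsilon>)}"

definition hilb_inner ::
  "'w measure \<Rightarrow> (real \<Rightarrow> 'w \<Rightarrow> real) \<Rightarrow> (nat \<Rightarrow> step) \<Rightarrow> (nat \<Rightarrow> step) \<Rightarrow> real" where
  "hilb_inner M Y \<Phi> \<Psi> = lim (\<lambda>k. step_inner M Y (\<Phi> k) (\<Psi> k))"

text \<open>A function \<open>g\<close> on \<open>[0,T]\<close>, seen as an element of the Hilbert space, is the limit of step
  functions that converge to \<open>g\<close> uniformly. For the noise considered here (\<open>H > 1/2\<close>) the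
  covariance has an integrable mixed second derivative, whence the seminorm is dominated by the
  supremum norm: a uniformly convergent sequence of step functions is Cauchy, and the element does
  not depend on its choice. Every continuous function \<open>g\<close> is such a limit.\<close>

definition represents ::
  "'w measure \<Rightarrow> (real \<Rightarrow> 'w \<Rightarrow> real) \<Rightarrow> real \<Rightarrow> (real \<Rightarrow> real) \<Rightarrow> (nat \<Rightarrow> step) \<Rightarrow> bool" where
  "represents M Y T g \<Phi> \<longleftrightarrow>
     \<Phi> \<in> hilb M Y T \<and> uniform_limit {0..T} (\<lambda>k. step_fun (\<Phi> k)) g sequentially"

text \<open>\<open>W\<close> is (a version of) the Wiener integral \<open>Y(\<Phi>)\<close>, the value at \<open>\<Phi>\<close> of the isometry extending
  \<open>1\<^bsub>[0,t]\<^esub> \<mapsto> Y\<^sub>t\<close>.\<close>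

definition has_wiener_integral ::
  "'w measure \<Rightarrow> (real \<Rightarrow> 'w \<Rightarrow> real) \<Rightarrow> (nat \<Rightarrow> step) \<Rightarrow> ('w \<Rightarrow> real) \<Rightarrow> bool" where
  "has_wiener_integral M Y \<Phi> W \<longleftrightarrow>
     W \<in> borel_measurable M \<and> integrable M (\<lambda>\<omega>. (W \<omega>)\<^sup>2) \<and>
     (\<lambda>k. \<integral>\<omega>. ((\<Sum>t\<in>Poly_Mapping.keys (\<Phi> k). Poly_Mapping.lookup (\<Phi> k) t * Y t \<omega>) - W \<omega>)\<^sup>2 \<partial>M)
       \<longlonglongrightarrow> 0"


section \<open>Malliavin derivative and Skorokhod integral\<close>

text \<open>Functions of \<open>n\<close> real variables are functions on sequences that depend only on the
  coordinates below \<open>n\<close>.\<close>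

definition partial_deriv :: "nat \<Rightarrow> ((nat \<Rightarrow> real) \<Rightarrow> real) \<Rightarrow> (nat \<Rightarrow> real) \<Rightarrow> real" where
  "partial_deriv i f x = deriv (\<lambda>s. f (x(i := s))) (x i)"

text \<open>The class \<open>C\<^sub>b\<^sup>\<infinity>(\<real>\<^sup>n)\<close>: all iterated partial derivatives exist and are bounded. Boundedness of
  the partial derivatives of a function makes it Lipschitz, so continuity of the derivatives of
  every order is automatic.\<close>

definition smooth_bounded :: "nat \<Rightarrow> ((nat \<Rightarrow> real) \<Rightarrow> real) \<Rightarrow> bool" where
  "smooth_bounded n f \<longleftrightarrow>
     (\<forall>x y. (\<forall>i<n. x i = y i) \<longrightarrow> f x = f y) \<and>
     (\<forall>is. set is \<subseteq> {..<n} \<longrightarrow>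
        (let g = foldr partial_deriv is f in
           bounded (range g) \<and>
           (\<forall>i<n. \<forall>x. (\<lambda>s. g (x(i := s))) field_differentiable at (x i))))"

text \<open>The smooth functional \<open>f(Y(\<Phi>\<^sub>0),\<dots>,Y(\<Phi>\<^bsub>n-1\<^esub>))\<close>, with \<open>W\<^sub>i\<close> a version of \<open>Y(\<Phi>\<^sub>i)\<close>, and its
  Malliavin derivative \<open>\<Sum>i<n. \<partial>\<^sub>if(Y(\<Phi>\<^sub>0),\<dots>,Y(\<Phi>\<^bsub>n-1\<^esub>)) \<Phi>\<^sub>i\<close>.\<close>

definition smooth_functional ::
  "((nat \<Rightarrow> real) \<Rightarrow> real) \<Rightarrow> (nat \<Rightarrow> 'w \<Rightarrow> real) \<Rightarrow> 'w \<Rightarrow> real" where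
  "smooth_functional f W \<omega> = f (\<lambda>i. W i \<omega>)"

definition malliavin_deriv ::
  "nat \<Rightarrow> ((nat \<Rightarrow> real) \<Rightarrow> real) \<Rightarrow> (nat \<Rightarrow> nat \<Rightarrow> step) \<Rightarrow> (nat \<Rightarrow> 'w \<Rightarrow> real)
     \<Rightarrow> 'w \<Rightarrow> nat \<Rightarrow> step" where
  "malliavin_deriv n f \<Phi> W \<omega> k =
     (\<Sum>i<n. step_scale (partial_deriv i f (\<lambda>j. W j \<omega>)) (\<Phi> i k))"

definition generated_sigma ::
  "'w measure \<Rightarrow> (real \<Rightarrow> 'w \<Rightarrow> real) \<Rightarrow> real \<Rightarrow> 'w measure" where
  "generated_sigma M Y T =
     sigma (space M) {Y t -` A \<inter> space M | t A. t \<in> {0..T} \<and> A \<in> sets borel}"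

text \<open>Square integrable random elements of the Hilbert space. Weak measurability suffices because
  the Hilbert space is separable.\<close>

definition L2_hilb ::
  "'w measure \<Rightarrow> (real \<Rightarrow> 'w \<Rightarrow> real) \<Rightarrow> real \<Rightarrow> ('w \<Rightarrow> nat \<Rightarrow> step) set" where
  "L2_hilb M Y T = {U.
     (\<forall>\<omega>\<in>space M. U \<omega> \<in> hilb M Y T) \<and>
     (\<forall>\<psi>\<in>steps T. (\<lambda>\<omega>. hilb_inner M Y (\<lambda>_. \<psi>) (U \<omega>)) \<in> borel_measurable (generated_sigma M Y T)) \<and>
     integrable M (\<lambda>\<omega>. hilb_inner M Y (U \<omega>) (U \<omega>))}"

text \<open>The divergence operator is the adjoint of the Malliavin derivative as an unbounded operator
  from \<open>L\<^sup>2(\<Omega>, \<sigma>(Y\<^sub>t : t \<le> T))\<close> to \<open>L\<^sup>2(\<Omega>; \<H>)\<close>: the relation below says that \<open>U\<close> is in its domain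
  with value \<open>Z\<close>. An operator and its closure have the same adjoint, so testing with the smooth
  functionals, a core of the Malliavin derivative, is enough.\<close>

definition has_divergence ::
  "'w measure \<Rightarrow> (real \<Rightarrow> 'w \<Rightarrow> real) \<Rightarrow> real \<Rightarrow> ('w \<Rightarrow> nat \<Rightarrow> step) \<Rightarrow> ('w \<Rightarrow> real) \<Rightarrow> bool" where
  "has_divergence M Y T U Z \<longleftrightarrow>
     U \<in> L2_hilb M Y T \<and>
     Z \<in> borel_measurable (generated_sigma M Y T) \<and> integrable M (\<lambda>\<omega>. (Z \<omega>)\<^sup>2) \<and>
     (\<forall>n f \<Phi> W. smooth_bounded n f \<and>
        (\<forall>i<n. \<Phi> i \<in> hilb M Y T \<and> has_wiener_integral M Y (\<Phi> i) (W i)) \<longrightarrow>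
        (\<integral>\<omega>. smooth_functional f W \<omega> * Z \<omega> \<partial>M) =
        (\<integral>\<omega>. hilb_inner M Y (malliavin_deriv n f \<Phi> W \<omega>) (U \<omega>) \<partial>M))"

definition has_skorokhod_integral ::
  "'w measure \<Rightarrow> (real \<Rightarrow> 'w \<Rightarrow> real) \<Rightarrow> real \<Rightarrow> (real \<Rightarrow> 'w \<Rightarrow> real) \<Rightarrow> ('w \<Rightarrow> real) \<Rightarrow> bool" where
  "has_skorokhod_integral M Y T u Z \<longleftrightarrow>
     (\<exists>U. (AE \<omega> in M. represents M Y T (\<lambda>t. u t \<omega>) (U \<omega>)) \<and> has_divergence M Y T U Z)"

text \<open>The Skorokhod integral is determined up to almost sure equality; a version is chosen.\<close>

definition skorokhod_integral ::
  "'w measure \<Rightarrow> (real \<Rightarrow> 'w \<Rightarrow> real) \<Rightarrow> real \<Rightarrow> (real \<Rightarrow> 'w \<Rightarrow> real) \<Rightarrow> 'w \<Rightarrow> real" where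
  "skorokhod_integral M Y T u = (SOME Z. has_skorokhod_integral M Y T u Z)"


section \<open>Least squares estimator\<close>

text \<open>\<open>\<integral>\<^sub>0\<^sup>T X \<delta>X\<close>, with \<open>\<delta>X = - \<theta> X dt + \<delta>Y\<close>.\<close>

definition skorokhod_XdX ::
  "'w measure \<Rightarrow> real \<Rightarrow> (real \<Rightarrow> 'w \<Rightarrow> real) \<Rightarrow> (real \<Rightarrow> 'w \<Rightarrow> real) \<Rightarrow> real \<Rightarrow> 'w \<Rightarrow> real" where
  "skorokhod_XdX M \<theta> Y X T \<omega> =
     - \<theta> * integral {0..T} (\<lambda>t. (X t \<omega>)\<^sup>2) + skorokhod_integral M Y T X \<omega>"

definition least_squares_estimator ::
  "'w measure \<Rightarrow> real \<Rightarrow> (real \<Rightarrow> 'w \<Rightarrow> real) \<Rightarrow> (real \<Rightarrow> 'w \<Rightarrow> real) \<Rightarrow> real \<Rightarrow> 'w \<Rightarrow> real" where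
  "least_squares_estimator M \<theta> Y X T \<omega> =
     - (skorokhod_XdX M \<theta> Y X T \<omega> / integral {0..T} (\<lambda>t. (X t \<omega>)\<^sup>2))"

text \<open>Measurability is demanded explicitly because \<open>measure\<close> is \<open>0\<close> on non-measurable sets.\<close>

definition tendsto_in_probability ::
  "'w measure \<Rightarrow> ('i \<Rightarrow> 'w \<Rightarrow> real) \<Rightarrow> real \<Rightarrow> 'i filter \<Rightarrow> bool" where
  "tendsto_in_probability M Z c F \<longleftrightarrow>
     (\<forall>\<^sub>F i in F. Z i \<in> borel_measurable M) \<and>
     (\<forall>\<epsilon>>0. ((\<lambda>i. measure M {\<omega>\<in>space M. \<epsilon> < \<bar>Z i \<omega> - c\<bar>}) \<longlongrightarrow> 0) F)"

end

theory Submission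
  imports Defs
begin

text \<open>The path-wise integral of \<open>X\<close> against \<open>Y\<close> is the limit of Riemann sums
  \<open>\<Sum> X\<^bsub>t\<^sub>j\<^esub> (Y\<^bsub>t\<^sub>j\<^sub>+\<^sub>1\<^esub> - Y\<^bsub>t\<^sub>j\<^esub>)\<close>. As \<open>H > 1/2\<close>, the quadratic variation of \<open>X\<close> vanishes, so the limit is
  \<open>X\<^sub>T\<^sup>2 / 2 + \<theta> \<integral>\<^sub>0\<^sup>T X\<^sup>2\<close>. Gaussian integration by parts, applied to each term of the sum, shows that the
  Skorokhod integral is the same variable minus its expectation; it is unique because trigonometric
  functions of \<open>Y\<close> determine a \<open>\<sigma>(Y)\<close>-measurable variable. By the Lamperti transform the covariance of
  \<open>X\<close> decays exponentially, hence \<open>\<integral>\<^sub>0\<^sup>T X\<^sup>2\<close> has a variance of order \<open>T\<close>, and so has the Skorokhod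
  integral. The expectation of \<open>\<integral>\<^sub>0\<^sup>T X\<^sup>2\<close> grows at least linearly, and Chebyshev's inequality gives
  \<open>P(\<bar>\<theta>\<^sub>T - \<theta>\<bar> > \<epsilon>) = O(1/T)\<close> for the estimator \<open>\<theta>\<^sub>T\<close>.\<close>

section \<open>Mean-square calculus\<close>

text \<open>\<open>skorokhod_integral\<close> is a choice from a duality relation, so nothing is
  known about it until one variable is shown to satisfy the relation and all such variables agree
  almost surely; most of the length goes there. The relation quantifies over all
  \<open>smooth_bounded\<close> functions of Wiener integrals, which may be linearly dependent and
  have no joint density. Integration by parts is therefore obtained for trigonometric functions
  first, by differentiating E cos Z = exp(-Var Z / 2), and carried over to general functions by
  uniqueness of characteristic functions. The Hilbert space is never formed as a quotient: the
  isometry moves its inner products into L^2, into one closed linear space of Gaussian variables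
  where pointwise convergence already gives mean-square convergence. H > 1/2 makes increments of B,
  and hence of Y, non-negatively correlated; this bounds the Hilbert seminorm by the supremum norm
  and, with \<theta> > 1, the variance of X from below. Moreover \<theta> exceeds the rate 1/H - 1 <
  1 at which the covariance of the Lamperti transform decays, so X inherits that decay.\<close>

definition sq_int :: "'w measure \<Rightarrow> ('w \<Rightarrow> real) set" where
  "sq_int M = {Z. Z \<in> borel_measurable M \<and> integrable M (\<lambda>\<omega>. (Z \<omega>)\<^sup>2)}"

text \<open>The L^2 seminorm. Functions are kept instead of classes, because the path-wise limits
  below are taken at every point.\<close>

definition rms :: "'w measure \<Rightarrow> ('w \<Rightarrow> real) \<Rightarrow> real" where
  "rms M Z = sqrt (\<integral>\<omega>. (Z \<omega>)\<^sup>2 \<partial>M)"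

lemma sq_int_measurable [measurable_dest]: "Z \<in> sq_int M \<Longrightarrow> Z \<in> borel_measurable M"
  by (simp add: sq_int_def)

lemma sq_int_square: "Z \<in> sq_int M \<Longrightarrow> integrable M (\<lambda>\<omega>. (Z \<omega>)\<^sup>2)"
  by (simp add: sq_int_def)

lemma sq_intI:
  "Z \<in> borel_measurable M \<Longrightarrow> integrable M (\<lambda>\<omega>. (Z \<omega>)\<^sup>2) \<Longrightarrow> Z \<in> sq_int M"
  by (simp add: sq_int_def)

lemma rms_nonneg [simp]: "0 \<le> rms M Z"
  by (simp add: rms_def)

lemma rms_square: "(rms M Z)\<^sup>2 = (\<integral>\<omega>. (Z \<omega>)\<^sup>2 \<partial>M)"
  by (simp add: rms_def)

lemma rms_cmult: "rms M (\<lambda>\<omega>. c * Z \<omega>) = \<bar>c\<bar> * rms M Z"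
  by (simp add: rms_def power_mult_distrib real_sqrt_mult)

lemma rms_minus_commute: "rms M (\<lambda>\<omega>. W \<omega> - Z \<omega>) = rms M (\<lambda>\<omega>. Z \<omega> - W \<omega>)"
  by (simp add: rms_def power2_commute)

lemma integrable_sq_int_mult:
  assumes "W \<in> sq_int M" "Z \<in> sq_int M"
  shows "integrable M (\<lambda>\<omega>. W \<omega> * Z \<omega> :: real)"
proof (rule Bochner_Integration.integrable_bound)
  show "integrable M (\<lambda>\<omega>. (W \<omega>)\<^sup>2 + (Z \<omega>)\<^sup>2)"
    using assms by (intro Bochner_Integration.integrable_add sq_int_square)
  show "(\<lambda>\<omega>. W \<omega> * Z \<omega>) \<in> borel_measurable M"
    using assms by (intro borel_measurable_times sq_int_measurable)
  have "\<bar>a * b\<bar> \<le> a\<^sup>2 + b\<^sup>2" for a b :: real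
    using sum_squares_bound[of "\<bar>a\<bar>" "\<bar>b\<bar>"] zero_le_power2[of a] zero_le_power2[of b]
    unfolding abs_mult power2_abs using mult_nonneg_nonneg[of "\<bar>a\<bar>" "\<bar>b\<bar>"] by linarith
  then show "AE \<omega> in M. norm (W \<omega> * Z \<omega>) \<le> norm ((W \<omega>)\<^sup>2 + (Z \<omega>)\<^sup>2)"
    by (intro AE_I2) (simp add: order_trans[OF _ abs_ge_self])
qed

lemma sq_int_cmult: "Z \<in> sq_int M \<Longrightarrow> (\<lambda>\<omega>. c * Z \<omega>) \<in> sq_int M"
  by (auto simp: sq_int_def power_mult_distrib)

lemma sq_int_add:
  assumes "W \<in> sq_int M" "Z \<in> sq_int M"
  shows "(\<lambda>\<omega>. W \<omega> + Z \<omega>) \<in> sq_int M"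
proof (rule sq_intI)
  have "integrable M (\<lambda>\<omega>. (W \<omega>)\<^sup>2 + (Z \<omega>)\<^sup>2 + 2 * (W \<omega> * Z \<omega>))"
    using assms by (intro Bochner_Integration.integrable_add sq_int_square integrable_mult_right
        integrable_sq_int_mult)
  then show "integrable M (\<lambda>\<omega>. (W \<omega> + Z \<omega>)\<^sup>2)"
    by (simp add: power2_sum mult.assoc)
qed (use assms in measurable)

lemma sq_int_diff:
  assumes "W \<in> sq_int M" "Z \<in> sq_int M"
  shows "(\<lambda>\<omega>. W \<omega> - Z \<omega>) \<in> sq_int M"
  using sq_int_add[OF assms(1) sq_int_cmult[OF assms(2), of "-1"]] by simp

lemma sq_int_zero [simp]: "(\<lambda>\<omega>. 0) \<in> sq_int M"
  by (simp add: sq_int_def)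

lemma sq_int_sum: "(\<And>i. i \<in> I \<Longrightarrow> Z i \<in> sq_int M) \<Longrightarrow> (\<lambda>\<omega>. \<Sum>i\<in>I. Z i \<omega>) \<in> sq_int M"
  by (induction I rule: infinite_finite_induct) (auto intro: sq_int_add)

text \<open>The polynomial t -> E (W + t Z)^2 is non-negative, which bounds its
  discriminant.\<close>

lemma cauchy_schwarz_integral:
  assumes "W \<in> sq_int M" "Z \<in> sq_int M"
  shows "\<bar>\<integral>\<omega>. W \<omega> * Z \<omega> \<partial>M\<bar> \<le> rms M W * rms M Z"
proof -
  define a b c where "a = (\<integral>\<omega>. (W \<omega>)\<^sup>2 \<partial>M)" and "b = (\<integral>\<omega>. W \<omega> * Z \<omega> \<partial>M)" and "c = (\<integral>\<omega>. (Z \<omega>)\<^sup>2 \<partial>M)"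
  have nonneg: "0 \<le> a + 2 * t * b + t\<^sup>2 * c" for t
  proof -
    have "0 \<le> (\<integral>\<omega>. (W \<omega> + t * Z \<omega>)\<^sup>2 \<partial>M)" by simp
    also have "(\<lambda>\<omega>. (W \<omega> + t * Z \<omega>)\<^sup>2) = (\<lambda>\<omega>. (W \<omega>)\<^sup>2 + (2 * t) * (W \<omega> * Z \<omega>) + t\<^sup>2 * (Z \<omega>)\<^sup>2)"
      by (auto simp: power2_eq_square algebra_simps)
    also have "(\<integral>\<omega>. \<dots> \<omega> \<partial>M) = a + 2 * t * b + t\<^sup>2 * c"
      unfolding a_def b_def c_def using assms
      by (simp add: integrable_sq_int_mult sq_int_square)
    finally show ?thesis .
  qed
  have "a \<ge> 0" "c \<ge> 0" by (auto simp: a_def c_def)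
  have "b\<^sup>2 \<le> a * c"
  proof (cases "c = 0")
    case True
    have "b = 0"
    proof (rule ccontr)
      assume "b \<noteq> 0"
      \<comment> \<open>With c = 0 the polynomial is affine in t, and this t gives it the value
        -1.\<close>
      with nonneg[of "- (a + 1) / (2 * b)"] True show False by (simp add: field_simps)
    qed
    then show ?thesis using \<open>a \<ge> 0\<close> \<open>c \<ge> 0\<close> by simp
  next
    case False
    with \<open>c \<ge> 0\<close> have "c > 0" by simp
    \<comment> \<open>The point where the polynomial is minimal.\<close>
    with nonneg[of "- b / c"] show ?thesis
      by (simp add: field_simps power2_eq_square)
  qed
  then have "sqrt (b\<^sup>2) \<le> sqrt (a * c)" by (rule real_sqrt_le_mono)
  then show ?thesis by (simp add: real_sqrt_mult rms_def a_def b_def c_def)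
qed

lemma rms_add_le:
  assumes "W \<in> sq_int M" "Z \<in> sq_int M"
  shows "rms M (\<lambda>\<omega>. W \<omega> + Z \<omega>) \<le> rms M W + rms M Z"
proof (rule power2_le_imp_le)
  have "(\<integral>\<omega>. (W \<omega> + Z \<omega>)\<^sup>2 \<partial>M) = (\<integral>\<omega>. (W \<omega>)\<^sup>2 + (Z \<omega>)\<^sup>2 + 2 * (W \<omega> * Z \<omega>) \<partial>M)"
    by (simp add: power2_sum mult.assoc)
  also have "\<dots> = (rms M W)\<^sup>2 + (rms M Z)\<^sup>2 + 2 * (\<integral>\<omega>. W \<omega> * Z \<omega> \<partial>M)"
    using assms by (simp add: rms_square integrable_sq_int_mult sq_int_square)
  also have "\<dots> \<le> (rms M W + rms M Z)\<^sup>2"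
    using cauchy_schwarz_integral[OF assms] by (simp add: power2_sum)
  finally show "(rms M (\<lambda>\<omega>. W \<omega> + Z \<omega>))\<^sup>2 \<le> (rms M W + rms M Z)\<^sup>2"
    by (simp add: rms_square)
qed simp

lemma rms_diff_le:
  assumes "W \<in> sq_int M" "Z \<in> sq_int M"
  shows "rms M (\<lambda>\<omega>. W \<omega> - Z \<omega>) \<le> rms M W + rms M Z"
  using rms_add_le[OF assms(1) sq_int_cmult[OF assms(2), of "-1"]] rms_cmult[of M "-1" Z] by simp

lemma rms_triangle:
  assumes "W \<in> sq_int M" "Z \<in> sq_int M" "U \<in> sq_int M"
  shows "rms M (\<lambda>\<omega>. W \<omega> - U \<omega>) \<le> rms M (\<lambda>\<omega>. W \<omega> - Z \<omega>) + rms M (\<lambda>\<omega>. Z \<omega> - U \<omega>)"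
  using rms_add_le[OF sq_int_diff[OF assms(1,2)] sq_int_diff[OF assms(2,3)]] by simp

lemma rms_sum_le:
  assumes "\<And>i. i \<in> I \<Longrightarrow> Z i \<in> sq_int M"
  shows "rms M (\<lambda>\<omega>. \<Sum>i\<in>I. Z i \<omega>) \<le> (\<Sum>i\<in>I. rms M (Z i))"
  using assms
proof (induction I rule: infinite_finite_induct)
  case (insert i I)
  then have "rms M (\<lambda>\<omega>. Z i \<omega> + (\<Sum>i\<in>I. Z i \<omega>)) \<le> rms M (Z i) + rms M (\<lambda>\<omega>. \<Sum>i\<in>I. Z i \<omega>)"
    by (intro rms_add_le sq_int_sum) auto
  with insert show ?case by simp
qed (auto simp: rms_def)

lemma rms_tendsto_zero_iff:
  "(\<lambda>n. rms M (Z n)) \<longlonglongrightarrow> 0 \<longleftrightarrow> (\<lambda>n. \<integral>\<omega>. (Z n \<omega>)\<^sup>2 \<partial>M) \<longlonglongrightarrow> 0"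
proof
  assume "(\<lambda>n. rms M (Z n)) \<longlonglongrightarrow> 0"
  from tendsto_power[OF this, of 2] show "(\<lambda>n. \<integral>\<omega>. (Z n \<omega>)\<^sup>2 \<partial>M) \<longlonglongrightarrow> 0"
    by (simp add: rms_square)
next
  assume "(\<lambda>n. \<integral>\<omega>. (Z n \<omega>)\<^sup>2 \<partial>M) \<longlonglongrightarrow> 0"
  from tendsto_real_sqrt[OF this] show "(\<lambda>n. rms M (Z n)) \<longlonglongrightarrow> 0"
    by (simp add: rms_def)
qed

lemma integral_mult_tendsto:
  assumes "\<And>n. Z n \<in> sq_int M" "Z' \<in> sq_int M" "W \<in> sq_int M"
    and lim: "(\<lambda>n. rms M (\<lambda>\<omega>. Z n \<omega> - Z' \<omega>)) \<longlonglongrightarrow> 0"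
  shows "(\<lambda>n. \<integral>\<omega>. W \<omega> * Z n \<omega> \<partial>M) \<longlonglongrightarrow> (\<integral>\<omega>. W \<omega> * Z' \<omega> \<partial>M)"
proof (rule Lim_null[THEN iffD2], rule Lim_null_comparison)
  show "(\<lambda>n. rms M W * rms M (\<lambda>\<omega>. Z n \<omega> - Z' \<omega>)) \<longlonglongrightarrow> 0"
    using tendsto_mult_left[OF lim, of "rms M W"] by simp
  have "(\<integral>\<omega>. W \<omega> * Z n \<omega> \<partial>M) - (\<integral>\<omega>. W \<omega> * Z' \<omega> \<partial>M) = (\<integral>\<omega>. W \<omega> * (Z n \<omega> - Z' \<omega>) \<partial>M)" for n
    using assms by (simp add: right_diff_distrib integrable_sq_int_mult)
  then show "\<forall>\<^sub>F n in sequentially. norm ((\<integral>\<omega>. W \<omega> * Z n \<omega> \<partial>M) - (\<integral>\<omega>. W \<omega> * Z' \<omega> \<partial>M))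
      \<le> rms M W * rms M (\<lambda>\<omega>. Z n \<omega> - Z' \<omega>)"
    using assms by (auto intro!: always_eventually cauchy_schwarz_integral sq_int_diff)
qed

lemma rms_tendsto:
  assumes "\<And>n. Z n \<in> sq_int M" "Z' \<in> sq_int M"
    and lim: "(\<lambda>n. rms M (\<lambda>\<omega>. Z n \<omega> - Z' \<omega>)) \<longlonglongrightarrow> 0"
  shows "(\<lambda>n. rms M (Z n)) \<longlonglongrightarrow> rms M Z'"
proof (rule Lim_null[THEN iffD2], rule Lim_null_comparison[OF _ lim])
  have "\<bar>rms M (Z n) - rms M Z'\<bar> \<le> rms M (\<lambda>\<omega>. Z n \<omega> - Z' \<omega>)" for n
    using rms_add_le[OF sq_int_diff[OF assms(1,2)] assms(2), of n]
      rms_diff_le[OF assms(1) sq_int_diff[OF assms(1,2)], of n n] by simp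
  then show "\<forall>\<^sub>F n in sequentially. norm (rms M (Z n) - rms M Z') \<le> rms M (\<lambda>\<omega>. Z n \<omega> - Z' \<omega>)"
    by simp
qed

text \<open>Fatou's lemma bounds the distance from \<open>Z n\<close> to the pointwise limit by the
  distances to later members, so the Cauchy property passes to \<open>L\<close>. The mean-square
  limit is thereby the given function \<open>L\<close> itself and not merely some element of L^2
  supplied by completeness.\<close>

lemma rms_Cauchy_limit:
  assumes Z: "\<And>n. Z n \<in> sq_int M"
    and lim: "\<And>\<omega>. \<omega> \<in> space M \<Longrightarrow> (\<lambda>n. Z n \<omega>) \<longlonglongrightarrow> L \<omega>"
    and Cauchy: "\<And>e. e > 0 \<Longrightarrow> \<exists>N. \<forall>m\<ge>N. \<forall>n\<ge>N. rms M (\<lambda>\<omega>. Z m \<omega> - Z n \<omega>) < e"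
  shows "L \<in> sq_int M" "(\<lambda>n. rms M (\<lambda>\<omega>. Z n \<omega> - L \<omega>)) \<longlonglongrightarrow> 0"
proof -
  have [measurable]: "Z n \<in> borel_measurable M" for n
    using Z by (rule sq_int_measurable)
  have [measurable]: "L \<in> borel_measurable M"
    by (rule borel_measurable_LIMSEQ_real[OF lim]) auto
  have fatou: "(\<integral>\<^sup>+\<omega>. ennreal ((Z n \<omega> - L \<omega>)\<^sup>2) \<partial>M) \<le> ennreal (e\<^sup>2)"
    if e: "e > 0" and N: "\<forall>m\<ge>N. rms M (\<lambda>\<omega>. Z n \<omega> - Z m \<omega>) < e" for n N e
  proof -
    have "(\<integral>\<^sup>+\<omega>. ennreal ((Z n \<omega> - L \<omega>)\<^sup>2) \<partial>M)
        = (\<integral>\<^sup>+\<omega>. liminf (\<lambda>m. ennreal ((Z n \<omega> - Z m \<omega>)\<^sup>2)) \<partial>M)"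
    proof (rule nn_integral_cong)
      fix \<omega> assume "\<omega> \<in> space M"
      then have "(\<lambda>m. ennreal ((Z n \<omega> - Z m \<omega>)\<^sup>2)) \<longlonglongrightarrow> ennreal ((Z n \<omega> - L \<omega>)\<^sup>2)"
        by (intro tendsto_ennrealI tendsto_power tendsto_diff tendsto_const lim)
      from lim_imp_Liminf[OF _ this]
      show "ennreal ((Z n \<omega> - L \<omega>)\<^sup>2) = liminf (\<lambda>m. ennreal ((Z n \<omega> - Z m \<omega>)\<^sup>2))"
        by simp
    qed
    also have "\<dots> \<le> liminf (\<lambda>m. \<integral>\<^sup>+\<omega>. ennreal ((Z n \<omega> - Z m \<omega>)\<^sup>2) \<partial>M)"
      by (rule nn_integral_liminf) simp
    also have "\<dots> \<le> ennreal (e\<^sup>2)"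
    proof (rule Liminf_le)
      have "(\<integral>\<^sup>+\<omega>. ennreal ((Z n \<omega> - Z m \<omega>)\<^sup>2) \<partial>M) = ennreal ((rms M (\<lambda>\<omega>. Z n \<omega> - Z m \<omega>))\<^sup>2)" for m
        unfolding rms_square
        by (rule nn_integral_eq_integral) (auto intro!: sq_int_square sq_int_diff Z)
      moreover have "ennreal ((rms M (\<lambda>\<omega>. Z n \<omega> - Z m \<omega>))\<^sup>2) \<le> ennreal (e\<^sup>2)" if "m \<ge> N" for m
        using less_imp_le[OF N[rule_format, OF that]] by (intro ennreal_leI power_mono) simp_all
      ultimately show "\<forall>\<^sub>F m in sequentially. (\<integral>\<^sup>+\<omega>. ennreal ((Z n \<omega> - Z m \<omega>)\<^sup>2) \<partial>M) \<le> ennreal (e\<^sup>2)"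
        by (intro eventually_sequentiallyI[of N]) simp
    qed simp
    finally show ?thesis .
  qed
  have in_sq: "(\<lambda>\<omega>. Z n \<omega> - L \<omega>) \<in> sq_int M \<and> rms M (\<lambda>\<omega>. Z n \<omega> - L \<omega>) \<le> e"
    if e: "e > 0" and N: "\<forall>m\<ge>N. rms M (\<lambda>\<omega>. Z n \<omega> - Z m \<omega>) < e" for n N e
  proof
    have int: "integrable M (\<lambda>\<omega>. (Z n \<omega> - L \<omega>)\<^sup>2)"
    proof (rule integrableI_bounded)
      show "(\<integral>\<^sup>+\<omega>. ennreal (norm ((Z n \<omega> - L \<omega>)\<^sup>2)) \<partial>M) < \<infinity>"
        using le_less_trans[OF fatou[OF that] ennreal_less_top] by simp
    qed measurable
    then show "(\<lambda>\<omega>. Z n \<omega> - L \<omega>) \<in> sq_int M" by (intro sq_intI) measurable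
    have "ennreal (\<integral>\<omega>. (Z n \<omega> - L \<omega>)\<^sup>2 \<partial>M) \<le> ennreal (e\<^sup>2)"
      using fatou[OF that] nn_integral_eq_integral[OF int] by simp
    then have "(rms M (\<lambda>\<omega>. Z n \<omega> - L \<omega>))\<^sup>2 \<le> e\<^sup>2"
      unfolding rms_square by (simp add: ennreal_le_iff)
    then show "rms M (\<lambda>\<omega>. Z n \<omega> - L \<omega>) \<le> e"
      using e by (rule power2_le_imp_le[OF _ less_imp_le])
  qed
  obtain N where N: "\<forall>m\<ge>N. \<forall>n\<ge>N. rms M (\<lambda>\<omega>. Z m \<omega> - Z n \<omega>) < 1"
    using Cauchy[OF zero_less_one] by blast
  then have "(\<lambda>\<omega>. Z N \<omega> - L \<omega>) \<in> sq_int M" using in_sq[of 1 N N] by simp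
  from sq_int_diff[OF Z[of N] this] show "L \<in> sq_int M" by simp
  show "(\<lambda>n. rms M (\<lambda>\<omega>. Z n \<omega> - L \<omega>)) \<longlonglongrightarrow> 0"
  proof (rule LIMSEQ_I)
    fix r :: real assume "r > 0"
    then obtain N where N: "\<forall>m\<ge>N. \<forall>n\<ge>N. rms M (\<lambda>\<omega>. Z m \<omega> - Z n \<omega>) < r / 2"
      using Cauchy[OF half_gt_zero] by blast
    have "rms M (\<lambda>\<omega>. Z n \<omega> - L \<omega>) < r" if "n \<ge> N" for n
    proof -
      have "rms M (\<lambda>\<omega>. Z n \<omega> - L \<omega>) \<le> r / 2"
        using in_sq[of "r / 2" N n] N that \<open>r > 0\<close> by simp
      then show ?thesis using \<open>r > 0\<close> by simp
    qed
    then show "\<exists>N. \<forall>n\<ge>N. norm (rms M (\<lambda>\<omega>. Z n \<omega> - L \<omega>) - 0) < r"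
      by (intro exI[of _ N]) simp
  qed
qed

context prob_space
begin

lemma sq_int_const [simp]: "(\<lambda>\<omega>. c) \<in> sq_int M"
  by (simp add: sq_int_def)

lemma sq_int_integrable: "Z \<in> sq_int M \<Longrightarrow> integrable M Z"
  using integrable_sq_int_mult[of "\<lambda>_. 1" M Z] by simp

lemma expectation_abs_le_rms:
  assumes "Z \<in> sq_int M"
  shows "(\<integral>\<omega>. \<bar>Z \<omega>\<bar> \<partial>M) \<le> rms M Z"
proof -
  have "(\<lambda>\<omega>. \<bar>Z \<omega>\<bar>) \<in> sq_int M" using assms by (auto simp: sq_int_def)
  from cauchy_schwarz_integral[OF sq_int_const[of 1] this] show ?thesis
    by (simp add: rms_def prob_space)
qed

lemma sq_int_bounded_mult:
  assumes "Z \<in> sq_int M" "W \<in> borel_measurable M" "\<And>\<omega>. \<omega> \<in> space M \<Longrightarrow> \<bar>W \<omega>\<bar> \<le> C"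
  shows "(\<lambda>\<omega>. W \<omega> * Z \<omega>) \<in> sq_int M"
proof (rule sq_intI)
  show "integrable M (\<lambda>\<omega>. (W \<omega> * Z \<omega>)\<^sup>2)"
  proof (rule Bochner_Integration.integrable_bound)
    show "integrable M (\<lambda>\<omega>. C\<^sup>2 * (Z \<omega>)\<^sup>2)" using assms(1) by (simp add: sq_int_square)
    have "(W \<omega>)\<^sup>2 \<le> C\<^sup>2" if "\<omega> \<in> space M" for \<omega>
      using assms(3)[OF that] abs_le_square_iff[of "W \<omega>" C] by auto
    then show "AE \<omega> in M. norm ((W \<omega> * Z \<omega>)\<^sup>2) \<le> norm (C\<^sup>2 * (Z \<omega>)\<^sup>2)"
      by (intro AE_I2) (simp add: power_mult_distrib mult_right_mono)
  qed (use assms in measurable)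
qed (use assms in measurable)

lemma sq_int_bounded:
  assumes "W \<in> borel_measurable M" "\<And>\<omega>. \<omega> \<in> space M \<Longrightarrow> \<bar>W \<omega>\<bar> \<le> C"
  shows "W \<in> sq_int M"
  using sq_int_bounded_mult[OF sq_int_const[of 1] assms] by simp

end

section \<open>Riemann sums and integration in mean square\<close>

definition riemann_sum :: "(real \<Rightarrow> real) \<Rightarrow> real \<Rightarrow> real \<Rightarrow> nat \<Rightarrow> real" where
  "riemann_sum z a b n = (\<Sum>i<n. (b - a) / n * z (a + real i * ((b - a) / n)))"

lemma grid_mem:
  assumes "a \<le> (b::real)" "i \<le> n"
  shows "a + real i * ((b - a) / real n) \<in> {a..b}"
proof (cases "n = 0")
  case False
  then have "real i * ((b - a) / real n) \<le> real n * ((b - a) / real n)"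
    using assms by (intro mult_right_mono) auto
  then show ?thesis using assms False by auto
qed (use assms in auto)

lemma integral_grid:
  fixes z :: "real \<Rightarrow> real"
  assumes "a \<le> b" "continuous_on {a..b} z" "n > 0"
  shows "integral {a..b} z = (\<Sum>i<n. integral {a + i * ((b - a) / n)..a + Suc i * ((b - a) / n)} z)"
proof -
  have "(\<Sum>i<m. integral {a + i * ((b - a) / n)..a + Suc i * ((b - a) / n)} z)
      = integral {a..a + m * ((b - a) / n)} z" if "m \<le> n" for m
    using that
  proof (induction m)
    case (Suc m)
    have "a + Suc m * ((b - a) / n) \<in> {a..b}" using Suc.prems assms by (intro grid_mem) auto
    then have "z integrable_on {a..a + Suc m * ((b - a) / n)}"
      by (intro integrable_continuous_real continuous_on_subset[OF assms(2)]) auto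
    then have "integral {a..a + m * ((b - a) / n)} z
      + integral {a + m * ((b - a) / n)..a + Suc m * ((b - a) / n)} z
        = integral {a..a + Suc m * ((b - a) / n)} z"
      using assms by (intro Henstock_Kurzweil_Integration.integral_combine)
        (auto intro!: mult_right_mono divide_right_mono)
    with Suc show ?case by simp
  qed simp
  from this[of n] show ?thesis using assms by (simp add: field_simps)
qed

lemma riemann_sum_tendsto:
  fixes z :: "real \<Rightarrow> real"
  assumes "a \<le> b" "continuous_on {a..b} z"
  shows "riemann_sum z a b \<longlonglongrightarrow> integral {a..b} z"
proof (cases "a = b")
  case True then show ?thesis by (simp add: riemann_sum_def[abs_def])
next
  case False
  with assms have "a < b" by simp
  show ?thesis
  proof (rule LIMSEQ_I)
    fix r :: real assume "r > 0"
    \<comment> \<open>The cells together contribute at most e (b - a) = r / 2, strictly less than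
      r.\<close>
    define e where "e = r / (2 * (b - a))"
    have "e > 0" using \<open>r > 0\<close> \<open>a < b\<close> by (simp add: e_def)
    have "uniformly_continuous_on {a..b} z"
      using assms(2) by (intro compact_uniformly_continuous) auto
    then obtain d where d: "d > 0" "\<And>s u. s \<in> {a..b} \<Longrightarrow> u \<in> {a..b} \<Longrightarrow> \<bar>s - u\<bar> < d \<Longrightarrow> \<bar>z s - z u\<bar> < e"
      using \<open>e > 0\<close> unfolding uniformly_continuous_on_def dist_real_def by metis
    obtain N :: nat where N: "real N > (b - a) / d" using reals_Archimedean2 by blast
    have "norm (riemann_sum z a b n - integral {a..b} z) < r" if "n \<ge> Suc N" for n
    proof -
      have n: "n > 0" and h: "(b - a) / n < d"
      proof -
        show "n > 0" using that by simp
        have "real n > (b - a) / d" using that N by linarith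
        then show "(b - a) / n < d" using \<open>d > 0\<close> \<open>n > 0\<close> by (simp add: field_simps)
      qed
      define t where "t i = a + real i * ((b - a) / n)" for i
      have tS: "t (Suc i) - t i = (b - a) / n" for i by (simp add: t_def distrib_right add_divide_distrib)
      have "\<bar>(b - a) / n * z (t i) - integral {t i..t (Suc i)} z\<bar> \<le> e * ((b - a) / n)" if "i < n" for i
      proof -
        have mem: "t i \<in> {a..b}" "t (Suc i) \<in> {a..b}"
          unfolding t_def using assms(1) that by (intro grid_mem; simp)+
        have le: "t i \<le> t (Suc i)" using tS[of i] divide_nonneg_nonneg[of "b - a" "real n"] \<open>a < b\<close> by linarith
        have int: "z integrable_on {t i..t (Suc i)}"
          using mem by (intro integrable_continuous_real continuous_on_subset[OF assms(2)]) auto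
        have "(b - a) / n * z (t i) - integral {t i..t (Suc i)} z = integral {t i..t (Suc i)} (\<lambda>s. z (t i) - z s)"
          using le tS[of i] int
          by (subst Henstock_Kurzweil_Integration.integral_diff) auto
        moreover have "norm (integral {t i..t (Suc i)} (\<lambda>s. z (t i) - z s)) \<le> e * (t (Suc i) - t i)"
        proof (rule integral_bound[OF le])
          show "continuous_on {t i..t (Suc i)} (\<lambda>s. z (t i) - z s)"
            using mem by (intro continuous_intros continuous_on_subset[OF assms(2)]) auto
          fix s assume "s \<in> {t i..t (Suc i)}"
          then show "norm (z (t i) - z s) \<le> e"
            using d(2)[of "t i" s] mem tS[of i] h by (auto intro!: less_imp_le)
        qed
        ultimately show ?thesis using tS[of i] by simp
      qed
      then have "(\<Sum>i<n. \<bar>(b - a) / n * z (t i) - integral {t i..t (Suc i)} z\<bar>) \<le> (\<Sum>i<n. e * ((b - a) / n))"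
        by (intro sum_mono) auto
      also have "\<dots> = r / 2" using n \<open>a < b\<close> by (simp add: e_def field_simps)
      also have "\<dots> < r" using \<open>r > 0\<close> by simp
      finally have "(\<Sum>i<n. \<bar>(b - a) / n * z (t i) - integral {t i..t (Suc i)} z\<bar>) < r" .
      moreover have "riemann_sum z a b n - integral {a..b} z
          = (\<Sum>i<n. (b - a) / n * z (t i) - integral {t i..t (Suc i)} z)"
        using integral_grid[OF assms n] by (simp add: riemann_sum_def t_def sum_subtractf)
      ultimately show ?thesis
        by (simp only: real_norm_def) (rule le_less_trans[OF sum_abs])
    qed
    then show "\<exists>N. \<forall>n\<ge>N. norm (riemann_sum z a b n - integral {a..b} z) < r" by blast
  qed
qed

text \<open>Mean-square continuity is required in uniform form so that no separate compactness argument
  is needed.\<close>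

definition ms_process :: "'w measure \<Rightarrow> real \<Rightarrow> real \<Rightarrow> (real \<Rightarrow> 'w \<Rightarrow> real) \<Rightarrow> bool" where
  "ms_process M a b Z \<longleftrightarrow>
     (\<forall>s\<in>{a..b}. Z s \<in> sq_int M) \<and>
     (\<forall>\<omega>\<in>space M. continuous_on {a..b} (\<lambda>s. Z s \<omega>)) \<and>
     (\<forall>e>0. \<exists>d>0. \<forall>s\<in>{a..b}. \<forall>r\<in>{a..b}. \<bar>s - r\<bar> < d \<longrightarrow> rms M (\<lambda>\<omega>. Z s \<omega> - Z r \<omega>) < e)"

lemma ms_process_sq_int: "ms_process M a b Z \<Longrightarrow> s \<in> {a..b} \<Longrightarrow> Z s \<in> sq_int M"
  by (simp add: ms_process_def)

text \<open>Grids with n and with m cells cannot be compared directly, but each can be compared with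
  the grid of n m cells: fine cell j lies in coarse cell \<open>j div m\<close>.\<close>

lemma riemann_sum_refine:
  assumes "m > 0" "n > 0"
  shows "riemann_sum z a b n - riemann_sum z a b (n * m)
    = (\<Sum>j<n*m. (b - a) / (n * m) * (z (a + real (j div m) * ((b - a) / n)) - z (a + real j * ((b - a) / (n * m)))))"
proof -
  have "(\<Sum>j<n*m. (b - a) / (n * m) * z (a + real (j div m) * ((b - a) / n)))
      = (\<Sum>i<n. \<Sum>j\<in>{i*m..<i*m+m}. (b - a) / (n * m) * z (a + real (j div m) * ((b - a) / n)))"
    by (rule sum.nat_group[symmetric])
  also have "\<dots> = (\<Sum>i<n. (b - a) / n * z (a + real i * ((b - a) / n)))"
  proof (rule sum.cong[OF refl])
    fix i
    have "(\<Sum>j\<in>{i*m..<i*m+m}. (b - a) / (n * m) * z (a + real (j div m) * ((b - a) / n)))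
        = (\<Sum>j\<in>{i*m..<i*m+m}. (b - a) / (n * m) * z (a + real i * ((b - a) / n)))"
    proof (rule sum.cong[OF refl])
      fix j assume "j \<in> {i*m..<i*m+m}"
      then have "j div m = i" by (intro div_nat_eqI) (auto simp: algebra_simps)
      then show "(b - a) / (n * m) * z (a + real (j div m) * ((b - a) / n))
        = (b - a) / (n * m) * z (a + real i * ((b - a) / n))" by simp
    qed
    also have "\<dots> = (b - a) / n * z (a + real i * ((b - a) / n))"
      using assms by simp
    finally show "(\<Sum>j\<in>{i*m..<i*m+m}. (b - a) / (n * m) * z (a + real (j div m) * ((b - a) / n)))
        = (b - a) / n * z (a + real i * ((b - a) / n))" .
  qed
  finally have eq: "(\<Sum>j<n*m. (b - a) / (n * m) * z (a + real (j div m) * ((b - a) / n)))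
      = riemann_sum z a b n"
    by (simp only: riemann_sum_def)
  have "(\<Sum>j\<in>J. c * (f j - g j)) = (\<Sum>j\<in>J. c * f j) - (\<Sum>j\<in>J. c * g j)" for J c and f g :: "nat \<Rightarrow> real"
    by (simp add: sum_subtractf right_diff_distrib)
  then show ?thesis
    unfolding eq[symmetric] by (simp only: riemann_sum_def of_nat_mult)
qed

lemma riemann_sum_sq_int:
  assumes "ms_process M a b Z" "a \<le> b"
  shows "(\<lambda>\<omega>. riemann_sum (\<lambda>s. Z s \<omega>) a b n) \<in> sq_int M"
  unfolding riemann_sum_def
proof (intro sq_int_sum sq_int_cmult)
  fix i assume "i \<in> {..<n}"
  then have "a + real i * ((b - a) / real n) \<in> {a..b}" using assms by (intro grid_mem) auto
  then show "Z (a + real i * ((b - a) / real n)) \<in> sq_int M"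
    using assms unfolding ms_process_def by blast
qed

text \<open>The left end points of a fine cell and of the coarse cell containing it are less than d
  apart. The bound is the same for every m, as the Cauchy property requires.\<close>

lemma riemann_sum_refine_rms:
  assumes Z: "ms_process M a b Z" and "a \<le> b" and d: "d > 0"
    "\<forall>s\<in>{a..b}. \<forall>r\<in>{a..b}. \<bar>s - r\<bar> < d \<longrightarrow> rms M (\<lambda>\<omega>. Z s \<omega> - Z r \<omega>) < e"
    and n: "(b - a) / n < d" "n > 0" and m: "m > 0"
  shows "rms M (\<lambda>\<omega>. riemann_sum (\<lambda>s. Z s \<omega>) a b n - riemann_sum (\<lambda>s. Z s \<omega>) a b (n * m)) \<le> (b - a) * e"
proof -
  define u where "u j = a + real (j div m) * ((b - a) / n)" for j
  define v where "v j = a + real j * ((b - a) / (n * m))" for j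
  have uv: "u j \<in> {a..b}" "v j \<in> {a..b}" "\<bar>u j - v j\<bar> < d" if "j < n * m" for j
  proof -
    have "j div m < n" using that by (simp add: less_mult_imp_div_less)
    then show u: "u j \<in> {a..b}" unfolding u_def using \<open>a \<le> b\<close> by (intro grid_mem) auto
    show v: "v j \<in> {a..b}" unfolding v_def using \<open>a \<le> b\<close> that grid_mem[of a b j "n * m"] by simp
    have "real j = real (j div m) * m + real (j mod m)"
      by (metis div_mult_mod_eq of_nat_add of_nat_mult)
    then have "v j - u j = (real (j div m) * m + real (j mod m)) * ((b - a) / (n * m)) - real (j div m) * ((b - a) / n)"
      unfolding u_def v_def by simp
    also have "\<dots> = real (j mod m) * ((b - a) / (n * m))"
      using n m unfolding distrib_right by simp
    also have "\<dots> = (real (j mod m) / m) * ((b - a) / n)" by simp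
    finally have eq: "v j - u j = (real (j mod m) / m) * ((b - a) / n)" .
    have "0 \<le> (real (j mod m) / m) * ((b - a) / n)" using \<open>a \<le> b\<close> by simp
    moreover have "(real (j mod m) / m) * ((b - a) / n) \<le> 1 * ((b - a) / n)"
      using \<open>a \<le> b\<close> m by (intro mult_right_mono) (auto simp: less_imp_le)
    ultimately show "\<bar>u j - v j\<bar> < d" using eq n by linarith
  qed
  have sq: "(\<lambda>\<omega>. Z (u j) \<omega> - Z (v j) \<omega>) \<in> sq_int M" if "j < n * m" for j
    using uv[OF that] Z by (intro sq_int_diff) (auto simp: ms_process_def)
  have "rms M (\<lambda>\<omega>. riemann_sum (\<lambda>s. Z s \<omega>) a b n - riemann_sum (\<lambda>s. Z s \<omega>) a b (n * m))
      = rms M (\<lambda>\<omega>. \<Sum>j<n*m. (b - a) / (n * m) * (Z (u j) \<omega> - Z (v j) \<omega>))"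
    by (subst riemann_sum_refine[OF m n(2)]) (simp add: u_def v_def)
  also have "\<dots> \<le> (\<Sum>j<n*m. rms M (\<lambda>\<omega>. (b - a) / (n * m) * (Z (u j) \<omega> - Z (v j) \<omega>)))"
    by (intro rms_sum_le sq_int_cmult sq) auto
  also have "\<dots> \<le> (\<Sum>j<n*m. (b - a) / (n * m) * e)"
    using uv d \<open>a \<le> b\<close> unfolding rms_cmult
    by (intro sum_mono mult_mono) (auto simp: less_imp_le)
  also have "\<dots> = (b - a) * e" using n m by simp
  finally show ?thesis .
qed

text \<open>The sums for m and n are both close to the sum for m n, so they form a Cauchy sequence
  in mean square. Their path-wise limit is the ordinary integral, and
  \<open>rms_Cauchy_limit\<close> identifies it as the mean-square limit.\<close>

lemma ms_integral:
  assumes Z: "ms_process M a b Z" and "a \<le> b"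
  shows ms_integral_sq_int: "(\<lambda>\<omega>. integral {a..b} (\<lambda>s. Z s \<omega>)) \<in> sq_int M"
    and ms_integral_tendsto:
      "(\<lambda>n. rms M (\<lambda>\<omega>. riemann_sum (\<lambda>s. Z s \<omega>) a b n - integral {a..b} (\<lambda>s. Z s \<omega>))) \<longlonglongrightarrow> 0"
proof -
  have Cauchy: "\<exists>N. \<forall>m\<ge>N. \<forall>n\<ge>N.
     rms M (\<lambda>\<omega>. riemann_sum (\<lambda>s. Z s \<omega>) a b m - riemann_sum (\<lambda>s. Z s \<omega>) a b n) < e" if "e > 0" for e
  proof -
    \<comment> \<open>Adding 1 keeps the quotient defined when a = b and makes the final inequality
      strict.\<close>
    define e' where "e' = e / (2 * (b - a) + 1)"
    have e': "e' > 0" "2 * ((b - a) * e') < e"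
      using \<open>e > 0\<close> \<open>a \<le> b\<close> by (auto simp: e'_def field_simps)
    obtain d where d: "d > 0" "\<forall>s\<in>{a..b}. \<forall>r\<in>{a..b}. \<bar>s - r\<bar> < d \<longrightarrow> rms M (\<lambda>\<omega>. Z s \<omega> - Z r \<omega>) < e'"
      using Z e' unfolding ms_process_def by metis
    obtain N :: nat where N: "real N > (b - a) / d" using reals_Archimedean2 by blast
    have small: "(b - a) / n < d \<and> n > 0" if "n \<ge> Suc N" for n
    proof -
      have "real n > (b - a) / d" using that N by linarith
      then show ?thesis using \<open>d > 0\<close> that by (simp add: field_simps)
    qed
    let ?R = "\<lambda>n \<omega>. riemann_sum (\<lambda>s. Z s \<omega>) a b n"
    have "rms M (\<lambda>\<omega>. ?R m \<omega> - ?R n \<omega>) < e" if "m \<ge> Suc N" "n \<ge> Suc N" for m n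
    proof -
      have "rms M (\<lambda>\<omega>. ?R m \<omega> - ?R n \<omega>)
          \<le> rms M (\<lambda>\<omega>. ?R m \<omega> - ?R (m * n) \<omega>) + rms M (\<lambda>\<omega>. ?R (m * n) \<omega> - ?R n \<omega>)"
        by (intro rms_triangle riemann_sum_sq_int assms)
      also have "rms M (\<lambda>\<omega>. ?R (m * n) \<omega> - ?R n \<omega>) = rms M (\<lambda>\<omega>. ?R n \<omega> - ?R (n * m) \<omega>)"
        by (simp add: rms_minus_commute mult.commute)
      also have "rms M (\<lambda>\<omega>. ?R m \<omega> - ?R (m * n) \<omega>) + \<dots> \<le> (b - a) * e' + (b - a) * e'"
        using small[OF that(1)] small[OF that(2)] d
        by (intro add_mono riemann_sum_refine_rms assms) auto
      also have "\<dots> < e" using e' by (simp add: mult.commute)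
      finally show ?thesis .
    qed
    then show ?thesis by blast
  qed
  have lim: "(\<lambda>n. riemann_sum (\<lambda>s. Z s \<omega>) a b n) \<longlonglongrightarrow> integral {a..b} (\<lambda>s. Z s \<omega>)" if "\<omega> \<in> space M" for \<omega>
    using that Z \<open>a \<le> b\<close> by (intro riemann_sum_tendsto) (auto simp: ms_process_def)
  show "(\<lambda>\<omega>. integral {a..b} (\<lambda>s. Z s \<omega>)) \<in> sq_int M"
    "(\<lambda>n. rms M (\<lambda>\<omega>. riemann_sum (\<lambda>s. Z s \<omega>) a b n - integral {a..b} (\<lambda>s. Z s \<omega>))) \<longlonglongrightarrow> 0"
    by (rule rms_Cauchy_limit[OF riemann_sum_sq_int[OF assms] lim Cauchy]; assumption)+
qed

lemma continuous_on_expectation_mult: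
  assumes Z: "ms_process M a b Z" and W: "W \<in> sq_int M"
  shows "continuous_on {a..b} (\<lambda>s. \<integral>\<omega>. W \<omega> * Z s \<omega> \<partial>M)"
  unfolding continuous_on_iff dist_real_def
proof (intro ballI allI impI)
  fix s e :: real assume s: "s \<in> {a..b}" and "e > 0"
  define e' where "e' = e / (rms M W + 1)"
  have pos: "rms M W + 1 > 0" using rms_nonneg[of M W] by linarith
  then have e': "e' > 0" using \<open>e > 0\<close> by (simp add: e'_def)
  obtain d where d: "d > 0" "\<forall>s\<in>{a..b}. \<forall>r\<in>{a..b}. \<bar>s - r\<bar> < d \<longrightarrow> rms M (\<lambda>\<omega>. Z s \<omega> - Z r \<omega>) < e'"
    using Z e' unfolding ms_process_def by metis
  show "\<exists>d>0. \<forall>r\<in>{a..b}. \<bar>r - s\<bar> < d \<longrightarrow>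
      \<bar>(\<integral>\<omega>. W \<omega> * Z r \<omega> \<partial>M) - (\<integral>\<omega>. W \<omega> * Z s \<omega> \<partial>M)\<bar> < e"
  proof (intro exI[of _ d] conjI ballI impI d(1))
    fix r assume r: "r \<in> {a..b}" "\<bar>r - s\<bar> < d"
    have Zs: "Z r \<in> sq_int M" "Z s \<in> sq_int M" using Z s r by (auto simp: ms_process_def)
    have "(\<integral>\<omega>. W \<omega> * Z r \<omega> \<partial>M) - (\<integral>\<omega>. W \<omega> * Z s \<omega> \<partial>M) = (\<integral>\<omega>. W \<omega> * (Z r \<omega> - Z s \<omega>) \<partial>M)"
      using Zs W by (simp add: right_diff_distrib integrable_sq_int_mult)
    also have "\<bar>\<dots>\<bar> \<le> rms M W * rms M (\<lambda>\<omega>. Z r \<omega> - Z s \<omega>)"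
      using Zs W by (intro cauchy_schwarz_integral sq_int_diff)
    also have "\<dots> \<le> rms M W * e'" using d r s by (intro mult_left_mono) (auto simp: less_imp_le)
    also have "\<dots> < (rms M W + 1) * e'" using e' by simp
    also have "\<dots> = e" using pos by (simp add: e'_def)
    finally show "\<bar>(\<integral>\<omega>. W \<omega> * Z r \<omega> \<partial>M) - (\<integral>\<omega>. W \<omega> * Z s \<omega> \<partial>M)\<bar> < e" .
  qed
qed

text \<open>A Fubini theorem without a product measure: both sides are limits of the same finite
  sums, the left one by mean-square convergence, the right one by continuity of the expectation in
  s.\<close>

lemma expectation_mult_integral:
  assumes Z: "ms_process M a b Z" and "a \<le> b" and W: "W \<in> sq_int M"
  shows "(\<integral>\<omega>. W \<omega> * integral {a..b} (\<lambda>s. Z s \<omega>) \<partial>M) = integral {a..b} (\<lambda>s. \<integral>\<omega>. W \<omega> * Z s \<omega> \<partial>M)"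
proof (rule LIMSEQ_unique)
  show "(\<lambda>n. \<integral>\<omega>. W \<omega> * riemann_sum (\<lambda>s. Z s \<omega>) a b n \<partial>M)
      \<longlonglongrightarrow> (\<integral>\<omega>. W \<omega> * integral {a..b} (\<lambda>s. Z s \<omega>) \<partial>M)"
    by (intro integral_mult_tendsto riemann_sum_sq_int ms_integral assms)
  have "(\<integral>\<omega>. W \<omega> * riemann_sum (\<lambda>s. Z s \<omega>) a b n \<partial>M)
      = riemann_sum (\<lambda>s. \<integral>\<omega>. W \<omega> * Z s \<omega> \<partial>M) a b n" for n
  proof -
    have int: "integrable M (\<lambda>\<omega>. W \<omega> * Z (a + real i * ((b - a) / n)) \<omega>)" if "i < n" for i
    proof -
      have "Z (a + real i * ((b - a) / n)) \<in> sq_int M"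
        using that by (intro ms_process_sq_int[OF Z] grid_mem[OF \<open>a \<le> b\<close>]) simp
      then show ?thesis by (intro integrable_sq_int_mult W)
    qed
    have "(\<integral>\<omega>. W \<omega> * riemann_sum (\<lambda>s. Z s \<omega>) a b n \<partial>M)
      = (\<integral>\<omega>. (\<Sum>i<n. (b - a) / n * (W \<omega> * Z (a + real i * ((b - a) / n)) \<omega>)) \<partial>M)"
      by (simp add: riemann_sum_def sum_distrib_left mult_ac)
    also have "\<dots> = (\<Sum>i<n. \<integral>\<omega>. (b - a) / n * (W \<omega> * Z (a + real i * ((b - a) / n)) \<omega>) \<partial>M)"
      using int by (intro Bochner_Integration.integral_sum integrable_mult_right) auto
    also have "\<dots> = riemann_sum (\<lambda>s. \<integral>\<omega>. W \<omega> * Z s \<omega> \<partial>M) a b n"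
      unfolding riemann_sum_def by simp
    finally show ?thesis .
  qed
  then show "(\<lambda>n. \<integral>\<omega>. W \<omega> * riemann_sum (\<lambda>s. Z s \<omega>) a b n \<partial>M)
      \<longlonglongrightarrow> integral {a..b} (\<lambda>s. \<integral>\<omega>. W \<omega> * Z s \<omega> \<partial>M)"
    using riemann_sum_tendsto[OF \<open>a \<le> b\<close> continuous_on_expectation_mult[OF Z W]] by simp
qed

text \<open>Minkowski's inequality for integrals, passed to the limit from Riemann sums.\<close>

lemma ms_process_integral_rms_le:
  assumes Z: "ms_process M a b Z" and "a \<le> b" and K: "\<And>s. s \<in> {a..b} \<Longrightarrow> rms M (Z s) \<le> K"
  shows "rms M (\<lambda>\<omega>. integral {a..b} (\<lambda>s. Z s \<omega>)) \<le> (b - a) * K"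
proof (rule LIMSEQ_le_const2)
  show "(\<lambda>n. rms M (\<lambda>\<omega>. riemann_sum (\<lambda>s. Z s \<omega>) a b n)) \<longlonglongrightarrow> rms M (\<lambda>\<omega>. integral {a..b} (\<lambda>s. Z s \<omega>))"
    by (intro rms_tendsto riemann_sum_sq_int ms_integral assms)
  have "rms M (\<lambda>\<omega>. riemann_sum (\<lambda>s. Z s \<omega>) a b n) \<le> (b - a) * K" if "n > 0" for n
  proof -
    have mem: "a + real i * ((b - a) / n) \<in> {a..b}" if "i < n" for i
      using that by (intro grid_mem[OF \<open>a \<le> b\<close>]) simp
    have "rms M (\<lambda>\<omega>. riemann_sum (\<lambda>s. Z s \<omega>) a b n)
        \<le> (\<Sum>i<n. rms M (\<lambda>\<omega>. (b - a) / n * Z (a + real i * ((b - a) / n)) \<omega>))"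
      unfolding riemann_sum_def
      by (intro rms_sum_le sq_int_cmult ms_process_sq_int[OF Z] mem) simp
    also have "\<dots> \<le> (\<Sum>i<n. (b - a) / n * K)"
      unfolding rms_cmult using \<open>a \<le> b\<close> by (intro sum_mono mult_mono K mem) auto
    also have "\<dots> = (b - a) * K" using that by simp
    finally show ?thesis .
  qed
  then show "\<exists>N. \<forall>n\<ge>N. rms M (\<lambda>\<omega>. riemann_sum (\<lambda>s. Z s \<omega>) a b n) \<le> (b - a) * K"
    by (intro exI[of _ 1]) auto
qed

section \<open>Gaussian spaces\<close>

text \<open>A closed linear subspace of L^2 consisting of centered Gaussian variables. The
  characteristic function is prescribed at frequency 1 only, in real form; closure under scaling
  supplies all other frequencies, and zero variance is included without a case distinction.\<close>

locale gaussian_space = prob_space M for M :: "'w measure" +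
  fixes G :: "('w \<Rightarrow> real) set"
  assumes G_sq_int: "Z \<in> G \<Longrightarrow> Z \<in> sq_int M"
    and G_zero: "(\<lambda>\<omega>. 0) \<in> G"
    and G_lin: "Z \<in> G \<Longrightarrow> W \<in> G \<Longrightarrow> (\<lambda>\<omega>. a * Z \<omega> + b * W \<omega>) \<in> G"
    and G_closed: "(\<And>n. Zs n \<in> G) \<Longrightarrow> L \<in> sq_int M \<Longrightarrow>
      (\<lambda>n. rms M (\<lambda>\<omega>. Zs n \<omega> - L \<omega>)) \<longlonglongrightarrow> 0 \<Longrightarrow> L \<in> G"
    and G_cos: "Z \<in> G \<Longrightarrow> (\<integral>\<omega>. cos (Z \<omega>) \<partial>M) = exp (- ((rms M Z)\<^sup>2 / 2))"
    and G_sin: "Z \<in> G \<Longrightarrow> (\<integral>\<omega>. sin (Z \<omega>) \<partial>M) = 0"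
begin

lemma G_measurable [measurable_dest]: "Z \<in> G \<Longrightarrow> Z \<in> borel_measurable M"
  by (intro sq_int_measurable G_sq_int)

lemma G_cmult: "Z \<in> G \<Longrightarrow> (\<lambda>\<omega>. a * Z \<omega>) \<in> G"
  using G_lin[of Z Z a 0] by simp

lemma G_add: "Z \<in> G \<Longrightarrow> W \<in> G \<Longrightarrow> (\<lambda>\<omega>. Z \<omega> + W \<omega>) \<in> G"
  using G_lin[of Z W 1 1] by simp

lemma G_diff: "Z \<in> G \<Longrightarrow> W \<in> G \<Longrightarrow> (\<lambda>\<omega>. Z \<omega> - W \<omega>) \<in> G"
  using G_lin[of Z W 1 "-1"] by simp

lemma G_sum: "(\<And>i. i \<in> I \<Longrightarrow> Z i \<in> G) \<Longrightarrow> (\<lambda>\<omega>. \<Sum>i\<in>I. Z i \<omega>) \<in> G"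
  by (induction I rule: infinite_finite_induct) (auto intro: G_add G_zero)

lemma G_cos_shift:
  assumes "Z \<in> G"
  shows "(\<integral>\<omega>. cos (Z \<omega> + b) \<partial>M) = cos b * exp (- ((rms M Z)\<^sup>2 / 2))"
proof -
  have [measurable]: "Z \<in> borel_measurable M" using assms by measurable
  have "integrable M (\<lambda>\<omega>. cos (Z \<omega>))" "integrable M (\<lambda>\<omega>. sin (Z \<omega>))"
    by (auto intro!: integrable_const_bound[of _ 1])
  then have "(\<integral>\<omega>. cos (Z \<omega> + b) \<partial>M) = (\<integral>\<omega>. cos (Z \<omega>) \<partial>M) * cos b - (\<integral>\<omega>. sin (Z \<omega>) \<partial>M) * sin b"
    by (simp add: cos_add)
  then show ?thesis using assms by (simp add: G_cos G_sin)
qed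

text \<open>For Gaussian variables, pointwise convergence implies convergence in mean square. If
  \<open>Z m - Z n\<close> kept mean-square size at least e along a sequence of indices, the
  expectation of its cosine would stay below exp(-e^2/2) < 1, whereas dominated convergence sends it
  to 1.\<close>

lemma G_pointwise_limit:
  assumes Z: "\<And>n. Z n \<in> G"
    and lim: "\<And>\<omega>. \<omega> \<in> space M \<Longrightarrow> (\<lambda>n. Z n \<omega>) \<longlonglongrightarrow> L \<omega>"
  shows "L \<in> G" "(\<lambda>n. rms M (\<lambda>\<omega>. Z n \<omega> - L \<omega>)) \<longlonglongrightarrow> 0"
proof -
  have [measurable]: "Z n \<in> borel_measurable M" for n using Z by measurable
  have Cauchy: "\<exists>N. \<forall>m\<ge>N. \<forall>n\<ge>N. rms M (\<lambda>\<omega>. Z m \<omega> - Z n \<omega>) < e" if "e > 0" for e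
  proof (rule ccontr)
    assume "\<not> ?thesis"
    then have "\<forall>N. \<exists>m n. m \<ge> N \<and> n \<ge> N \<and> rms M (\<lambda>\<omega>. Z m \<omega> - Z n \<omega>) \<ge> e"
      by (metis not_less)
    then obtain m n where mn: "\<And>N. m N \<ge> N" "\<And>N. n N \<ge> N"
      "\<And>N. rms M (\<lambda>\<omega>. Z (m N) \<omega> - Z (n N) \<omega>) \<ge> e"
      by metis
    have top: "filterlim m at_top sequentially" "filterlim n at_top sequentially"
      using mn by (auto intro: filterlim_at_top_mono[OF filterlim_ident])
    have lim1: "(\<lambda>N. \<integral>\<omega>. cos (Z (m N) \<omega> - Z (n N) \<omega>) \<partial>M) \<longlonglongrightarrow> (\<integral>\<omega>. 1 \<partial>M)"
    proof (rule integral_dominated_convergence[where w="\<lambda>_. 1"])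
      show "AE \<omega> in M. (\<lambda>N. cos (Z (m N) \<omega> - Z (n N) \<omega>)) \<longlonglongrightarrow> 1"
      proof (rule AE_I2)
        fix \<omega> assume "\<omega> \<in> space M"
        note * = filterlim_compose[OF lim[OF this]]
        have "(\<lambda>N. cos (Z (m N) \<omega> - Z (n N) \<omega>)) \<longlonglongrightarrow> cos (L \<omega> - L \<omega>)"
          by (intro tendsto_cos tendsto_diff * top)
        then show "(\<lambda>N. cos (Z (m N) \<omega> - Z (n N) \<omega>)) \<longlonglongrightarrow> 1" by simp
      qed
    qed auto
    have "(\<integral>\<omega>. cos (Z (m N) \<omega> - Z (n N) \<omega>) \<partial>M) \<le> exp (- (e\<^sup>2 / 2))" for N
    proof -
      have "e\<^sup>2 \<le> (rms M (\<lambda>\<omega>. Z (m N) \<omega> - Z (n N) \<omega>))\<^sup>2"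
        using mn(3)[of N] \<open>e > 0\<close> by (intro power_mono) auto
      then show ?thesis by (subst G_cos[OF G_diff[OF Z Z]]) simp
    qed
    then have "(\<integral>\<omega>. 1 \<partial>M) \<le> exp (- (e\<^sup>2 / 2))"
      by (intro LIMSEQ_le_const2[OF lim1]) blast
    then have "1 \<le> exp (- (e\<^sup>2 / 2))" by (simp add: prob_space)
    then show False using \<open>e > 0\<close> by simp
  qed
  note lims = rms_Cauchy_limit[OF G_sq_int[OF Z] lim Cauchy]
  show "(\<lambda>n. rms M (\<lambda>\<omega>. Z n \<omega> - L \<omega>)) \<longlonglongrightarrow> 0" by (rule lims(2))
  then show "L \<in> G" using G_closed[OF Z lims(1)] by simp
qed

text \<open>Continuity of the paths suffices. Along pairs violating uniform mean-square continuity,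
  \<open>Z (s n) - Z (r n)\<close> would tend to 0 pointwise by uniform continuity of each path,
  hence also in mean square.\<close>

lemma G_ms_process:
  assumes Z: "\<And>s. s \<in> {a..b} \<Longrightarrow> Z s \<in> G"
    and cont: "\<And>\<omega>. \<omega> \<in> space M \<Longrightarrow> continuous_on {a..b} (\<lambda>s. Z s \<omega>)"
  shows "ms_process M a b Z"
  unfolding ms_process_def
proof (intro conjI ballI allI impI)
  fix e :: real assume "e > 0"
  show "\<exists>d>0. \<forall>s\<in>{a..b}. \<forall>r\<in>{a..b}. \<bar>s - r\<bar> < d \<longrightarrow> rms M (\<lambda>\<omega>. Z s \<omega> - Z r \<omega>) < e"
  proof (rule ccontr)
    assume neg: "\<not> ?thesis"
    have "\<exists>s r. s \<in> {a..b} \<and> r \<in> {a..b} \<and> \<bar>s - r\<bar> < inverse (Suc n) \<and> e \<le> rms M (\<lambda>\<omega>. Z s \<omega> - Z r \<omega>)" for n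
    proof -
      have "inverse (real (Suc n)) > 0" by simp
      with neg show ?thesis by (meson not_less)
    qed
    then obtain s r where sr: "\<And>n. s n \<in> {a..b}" "\<And>n. r n \<in> {a..b}" "\<And>n. \<bar>s n - r n\<bar> < inverse (Suc n)"
      "\<And>n. e \<le> rms M (\<lambda>\<omega>. Z (s n) \<omega> - Z (r n) \<omega>)" by metis
    have "(\<lambda>n. rms M (\<lambda>\<omega>. (Z (s n) \<omega> - Z (r n) \<omega>) - 0)) \<longlonglongrightarrow> 0"
    proof (rule G_pointwise_limit(2))
      fix \<omega> assume "\<omega> \<in> space M"
      then have uc: "uniformly_continuous_on {a..b} (\<lambda>s. Z s \<omega>)"
        by (intro compact_uniformly_continuous cont) auto
      have "(\<lambda>n. dist (s n) (r n)) \<longlonglongrightarrow> 0"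
        by (rule Lim_null_comparison[OF _ LIMSEQ_inverse_real_of_nat])
          (use sr(3) in \<open>auto simp: dist_real_def intro!: always_eventually less_imp_le\<close>)
      then have "(\<lambda>n. dist (Z (s n) \<omega>) (Z (r n) \<omega>)) \<longlonglongrightarrow> 0"
        using uc sr unfolding uniformly_continuous_on_sequentially by blast
      then show "(\<lambda>n. Z (s n) \<omega> - Z (r n) \<omega>) \<longlonglongrightarrow> 0"
        by (simp add: dist_real_def tendsto_rabs_zero_iff)
    qed (use Z sr in \<open>auto intro: G_diff\<close>)
    then have "e \<le> 0" using sr(4) by (intro LIMSEQ_le_const) auto
    then show False using \<open>e > 0\<close> by simp
  qed
qed (simp_all add: Z cont G_sq_int)

lemma G_integral:
  fixes a b :: real
  assumes "a \<le> b" and Z: "\<And>s. s \<in> {a..b} \<Longrightarrow> Z s \<in> G"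
    and cont: "\<And>\<omega>. \<omega> \<in> space M \<Longrightarrow> continuous_on {a..b} (\<lambda>s. Z s \<omega>)"
  shows "(\<lambda>\<omega>. integral {a..b} (\<lambda>s. Z s \<omega>)) \<in> G"
proof (rule G_pointwise_limit(1))
  show "(\<lambda>\<omega>. riemann_sum (\<lambda>s. Z s \<omega>) a b n) \<in> G" for n
    unfolding riemann_sum_def
    by (intro G_sum G_cmult Z grid_mem \<open>a \<le> b\<close>) simp
  show "(\<lambda>n. riemann_sum (\<lambda>s. Z s \<omega>) a b n) \<longlonglongrightarrow> integral {a..b} (\<lambda>s. Z s \<omega>)" if "\<omega> \<in> space M" for \<omega>
    by (intro riemann_sum_tendsto \<open>a \<le> b\<close> cont that)
qed

end

section \<open>Moments of Gaussian variables\<close>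

lemma char_cos_sin:
  assumes "real_distribution N"
  shows "char N t = Complex (\<integral>x. cos (t * x) \<partial>N) (\<integral>x. sin (t * x) \<partial>N)"
proof -
  interpret real_distribution N by fact
  have int: "integrable N (\<lambda>x. iexp (t * x))"
    by (rule integrable_const_bound[of _ 1]) auto
  show ?thesis
    unfolding char_def
    by (rule complex_eqI) (simp_all only: integral_Re[OF int, symmetric] integral_Im[OF int, symmetric], simp_all add: Re_exp Im_exp)
qed

context gaussian_space
begin

text \<open>After normalization the characteristic function is that of the standard normal law, so
  Levy's uniqueness theorem hands over its moments. A variable of variance zero cannot be
  normalized; it vanishes almost surely.\<close>

lemma G_fourth_moment:
  assumes Z: "Z \<in> G"
  shows "integrable M (\<lambda>\<omega>. (Z \<omega>) ^ 4)" "(\<integral>\<omega>. (Z \<omega>) ^ 4 \<partial>M) = 3 * ((rms M Z)\<^sup>2)\<^sup>2"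
proof -
  have [measurable]: "Z \<in> borel_measurable M" using Z by measurable
  have "integrable M (\<lambda>\<omega>. (Z \<omega>) ^ 4) \<and> (\<integral>\<omega>. (Z \<omega>) ^ 4 \<partial>M) = 3 * ((rms M Z)\<^sup>2)\<^sup>2"
  proof (cases "rms M Z = 0")
    case True
    then have "(\<integral>\<omega>. (Z \<omega>)\<^sup>2 \<partial>M) = 0" by (simp add: rms_square[symmetric])
    then have "AE \<omega> in M. (Z \<omega>)\<^sup>2 = 0"
      using Z by (subst (asm) integral_nonneg_eq_0_iff_AE) (auto intro: sq_int_square G_sq_int)
    then have AE: "AE \<omega> in M. (Z \<omega>) ^ 4 = 0" by eventually_elim auto
    have "integrable M (\<lambda>\<omega>. (Z \<omega>) ^ 4) = integrable M (\<lambda>\<omega>. 0 :: real)"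
      by (rule integrable_cong_AE) (use AE in auto)
    moreover have "(\<integral>\<omega>. (Z \<omega>) ^ 4 \<partial>M) = (\<integral>\<omega>. 0 \<partial>M)"
      by (rule integral_cong_AE) (use AE in auto)
    ultimately show ?thesis using True by simp
  next
    case False
    define \<sigma> where "\<sigma> = rms M Z"
    have \<sigma>: "\<sigma> > 0" using False rms_nonneg[of M Z] unfolding \<sigma>_def by linarith
    define S where "S = (\<lambda>\<omega>. Z \<omega> / \<sigma>)"
    have [measurable]: "S \<in> borel_measurable M" unfolding S_def by measurable
    have rd: "real_distribution (distr M borel S)" by (rule real_distribution_distr) simp
    have eq: "distr M borel S = std_normal_distribution"
    proof (rule Levy_uniqueness[OF rd real_dist_normal_dist], rule ext)
      fix t
      have tZ: "(\<lambda>\<omega>. t * S \<omega>) \<in> G" using G_cmult[OF Z, of "t / \<sigma>"] by (simp add: S_def)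
      have "rms M (\<lambda>\<omega>. t * S \<omega>) = \<bar>t\<bar>"
        using rms_cmult[of M "t / \<sigma>" Z] \<sigma> by (simp add: S_def \<sigma>_def[symmetric])
      then show "char (distr M borel S) t = char std_normal_distribution t"
        using G_cos[OF tZ] G_sin[OF tZ]
        by (simp add: char_cos_sin[OF rd] char_std_normal_distribution integral_distr complex_of_real_def)
    qed
    have "integrable (distr M borel S) (\<lambda>x. x ^ 4)"
      unfolding eq by (rule integrable_std_normal_distribution_moment)
    then have i: "integrable M (\<lambda>\<omega>. (S \<omega>) ^ 4)" by (simp add: integrable_distr_eq)
    have "(\<integral>x. x ^ 4 \<partial>distr M borel S) = 3"
      unfolding eq using std_normal_distribution_even_moments(1)[of 2] by (simp add: fact_numeral)
    then have e: "(\<integral>\<omega>. (S \<omega>) ^ 4 \<partial>M) = 3" by (simp add: integral_distr)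
    have "(Z \<omega>) ^ 4 = \<sigma> ^ 4 * (S \<omega>) ^ 4" for \<omega>
      using \<sigma> by (simp add: S_def power_divide)
    then have "(\<lambda>\<omega>. (Z \<omega>) ^ 4) = (\<lambda>\<omega>. \<sigma> ^ 4 * (S \<omega>) ^ 4)" by auto
    then show ?thesis using i e by (simp add: \<sigma>_def flip: power_mult)
  qed
  then show "integrable M (\<lambda>\<omega>. (Z \<omega>) ^ 4)" "(\<integral>\<omega>. (Z \<omega>) ^ 4 \<partial>M) = 3 * ((rms M Z)\<^sup>2)\<^sup>2"
    by auto
qed

lemma G_square_sq_int: "Z \<in> G \<Longrightarrow> (\<lambda>\<omega>. (Z \<omega>)\<^sup>2) \<in> sq_int M"
  using G_fourth_moment(1)[of Z] by (auto intro!: sq_intI simp flip: power_mult)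

lemma G_mult_sq_int:
  assumes A: "A \<in> G" and B: "B \<in> G"
  shows "(\<lambda>\<omega>. A \<omega> * B \<omega>) \<in> sq_int M"
proof -
  have "(\<lambda>\<omega>. 1 / 4 * ((A \<omega> + B \<omega>)\<^sup>2 - (A \<omega> - B \<omega>)\<^sup>2)) \<in> sq_int M"
    by (intro sq_int_cmult sq_int_diff G_square_sq_int G_add G_diff A B)
  moreover have "(\<lambda>\<omega>. 1 / 4 * ((A \<omega> + B \<omega>)\<^sup>2 - (A \<omega> - B \<omega>)\<^sup>2)) = (\<lambda>\<omega>. A \<omega> * B \<omega>)"
    by (auto simp: power2_eq_square algebra_simps)
  ultimately show ?thesis by simp
qed

text \<open>Polarization of the fourth moments of \<open>A + B\<close> and \<open>A - B\<close>.\<close>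

lemma G_square_square:
  assumes A: "A \<in> G" and B: "B \<in> G"
  shows "(\<integral>\<omega>. (A \<omega>)\<^sup>2 * (B \<omega>)\<^sup>2 \<partial>M) = (\<integral>\<omega>. (A \<omega>)\<^sup>2 \<partial>M) * (\<integral>\<omega>. (B \<omega>)\<^sup>2 \<partial>M) + 2 * (\<integral>\<omega>. A \<omega> * B \<omega> \<partial>M)\<^sup>2"
proof -
  define a b c where "a = (\<integral>\<omega>. (A \<omega>)\<^sup>2 \<partial>M)" and "b = (\<integral>\<omega>. (B \<omega>)\<^sup>2 \<partial>M)" and "c = (\<integral>\<omega>. A \<omega> * B \<omega> \<partial>M)"
  note int = G_fourth_moment(1) G_add[OF A B] G_diff[OF A B] A B
  have i2: "integrable M (\<lambda>\<omega>. (A \<omega>)\<^sup>2 * (B \<omega>)\<^sup>2)"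
    by (intro integrable_sq_int_mult G_square_sq_int A B)
  have sq: "(\<integral>\<omega>. (A \<omega> + e * B \<omega>)\<^sup>2 \<partial>M) = a + e\<^sup>2 * b + 2 * e * c" for e
  proof -
    have "(\<integral>\<omega>. (A \<omega> + e * B \<omega>)\<^sup>2 \<partial>M) = (\<integral>\<omega>. (A \<omega>)\<^sup>2 + e\<^sup>2 * (B \<omega>)\<^sup>2 + 2 * e * (A \<omega> * B \<omega>) \<partial>M)"
      by (rule arg_cong[where f="integral\<^sup>L M"]) (auto simp: power2_eq_square algebra_simps)
    also have "\<dots> = a + e\<^sup>2 * b + 2 * e * c"
      unfolding a_def b_def c_def
      using sq_int_square[OF G_sq_int[OF A]] sq_int_square[OF G_sq_int[OF B]]
        integrable_sq_int_mult[OF G_sq_int[OF A] G_sq_int[OF B]] by simp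
    finally show ?thesis .
  qed
  have "(\<integral>\<omega>. (A \<omega> + B \<omega>) ^ 4 + (A \<omega> - B \<omega>) ^ 4 \<partial>M)
      = (\<integral>\<omega>. 2 * (A \<omega>) ^ 4 + 12 * ((A \<omega>)\<^sup>2 * (B \<omega>)\<^sup>2) + 2 * (B \<omega>) ^ 4 \<partial>M)"
    by (rule arg_cong[where f="integral\<^sup>L M"]) (auto simp: power4_eq_xxxx power2_eq_square algebra_simps)
  also have "\<dots> = 2 * (3 * a\<^sup>2) + 12 * (\<integral>\<omega>. (A \<omega>)\<^sup>2 * (B \<omega>)\<^sup>2 \<partial>M) + 2 * (3 * b\<^sup>2)"
    using int i2 by (simp add: G_fourth_moment(2) rms_square a_def b_def)
  finally have "(\<integral>\<omega>. (A \<omega> + B \<omega>) ^ 4 + (A \<omega> - B \<omega>) ^ 4 \<partial>M)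
    = 2 * (3 * a\<^sup>2) + 12 * (\<integral>\<omega>. (A \<omega>)\<^sup>2 * (B \<omega>)\<^sup>2 \<partial>M) + 2 * (3 * b\<^sup>2)" .
  moreover have "(\<integral>\<omega>. (A \<omega> + B \<omega>) ^ 4 + (A \<omega> - B \<omega>) ^ 4 \<partial>M)
      = 3 * (a + b + 2 * c)\<^sup>2 + 3 * (a + b - 2 * c)\<^sup>2"
    using int sq[of 1] sq[of "-1"] by (simp add: G_fourth_moment(2) rms_square)
  ultimately show ?thesis
    unfolding a_def[symmetric] b_def[symmetric] c_def[symmetric]
    by (simp add: power2_eq_square algebra_simps)
qed

end

section \<open>Differentiation under the expectation\<close>

lemma DERIV_sequence:
  assumes "(f has_real_derivative D) (at x)"
  shows "(\<lambda>n. (f (x + inverse (real (Suc n))) - f x) * real (Suc n)) \<longlonglongrightarrow> D"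
proof -
  have "((\<lambda>h. (f (x + h) - f x) / h) \<longlongrightarrow> D) (at 0)"
    using assms by (simp add: DERIV_def)
  moreover have "filterlim (\<lambda>n. inverse (real (Suc n))) (at 0) sequentially"
    unfolding filterlim_at using LIMSEQ_inverse_real_of_nat by auto
  ultimately have "(\<lambda>n. (f (x + inverse (real (Suc n))) - f x) / inverse (real (Suc n))) \<longlonglongrightarrow> D"
    by (rule filterlim_compose)
  then show ?thesis by (simp add: field_simps)
qed

context prob_space
begin

text \<open>As |f'| is at most 1, f is 1-Lipschitz, so the difference quotients are dominated by |D
  K| and the limit may be taken inside. The steps 1/(n+1) make dominated convergence for sequences
  applicable; f will be sine or cosine.\<close>

lemma expectation_difference_quotient:
  fixes f f' :: "real \<Rightarrow> real"
  assumes D: "integrable M D" and DK: "integrable M (\<lambda>\<omega>. D \<omega> * K \<omega>)"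
    and [measurable]: "K \<in> borel_measurable M" "A \<in> borel_measurable M"
    and f: "\<And>u. (f has_real_derivative f' u) (at u)" "\<And>u. \<bar>f u\<bar> \<le> 1" "\<And>u. \<bar>f' u\<bar> \<le> 1"
    and [measurable]: "f \<in> borel_measurable borel" "f' \<in> borel_measurable borel"
  shows "(\<lambda>n. ((\<integral>\<omega>. D \<omega> * f (A \<omega> + inverse (real (Suc n)) * K \<omega>) \<partial>M) - (\<integral>\<omega>. D \<omega> * f (A \<omega>) \<partial>M)) * real (Suc n))
    \<longlonglongrightarrow> (\<integral>\<omega>. D \<omega> * K \<omega> * f' (A \<omega>) \<partial>M)"
proof -
  note [measurable] = borel_measurable_integrable[OF D]
  have int: "integrable M (\<lambda>\<omega>. D \<omega> * f (U \<omega>))" if [measurable]: "U \<in> borel_measurable M" for U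
    by (rule Bochner_Integration.integrable_bound[OF D])
      (auto simp: abs_mult f intro!: mult_left_le)
  let ?q = "\<lambda>n \<omega>. D \<omega> * ((f (A \<omega> + inverse (real (Suc n)) * K \<omega>) - f (A \<omega>)) * real (Suc n))"
  have "(\<lambda>n. \<integral>\<omega>. ?q n \<omega> \<partial>M) \<longlonglongrightarrow> (\<integral>\<omega>. D \<omega> * K \<omega> * f' (A \<omega>) \<partial>M)"
  proof (rule integral_dominated_convergence[where w="\<lambda>\<omega>. \<bar>D \<omega> * K \<omega>\<bar>"])
    show "AE \<omega> in M. (\<lambda>n. ?q n \<omega>) \<longlonglongrightarrow> D \<omega> * K \<omega> * f' (A \<omega>)"
    proof (rule AE_I2)
      fix \<omega>
      have "((\<lambda>s. f (A \<omega> + s * K \<omega>)) has_real_derivative f' (A \<omega>) * K \<omega>) (at 0)"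
        by (rule DERIV_chain'[where f="\<lambda>s. A \<omega> + s * K \<omega>", THEN DERIV_cong])
          (auto intro!: derivative_eq_intros f)
      from DERIV_sequence[OF this] have "(\<lambda>n. (f (A \<omega> + inverse (real (Suc n)) * K \<omega>) - f (A \<omega>)) * real (Suc n))
        \<longlonglongrightarrow> f' (A \<omega>) * K \<omega>" by simp
      from tendsto_mult_left[OF this, of "D \<omega>"] show "(\<lambda>n. ?q n \<omega>) \<longlonglongrightarrow> D \<omega> * K \<omega> * f' (A \<omega>)"
        by (simp only: mult_ac)
    qed
    have lip: "\<bar>f x - f y\<bar> \<le> \<bar>x - y\<bar>" for x y
      using field_differentiable_bound[of UNIV f f' 1 x y] f by simp
    show "AE \<omega> in M. norm (?q n \<omega>) \<le> \<bar>D \<omega> * K \<omega>\<bar>" for n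
    proof (rule AE_I2)
      fix \<omega>
      have "\<bar>f (A \<omega> + inverse (real (Suc n)) * K \<omega>) - f (A \<omega>)\<bar> * real (Suc n)
          \<le> \<bar>inverse (real (Suc n)) * K \<omega>\<bar> * real (Suc n)"
        using lip[of "A \<omega> + inverse (real (Suc n)) * K \<omega>" "A \<omega>"] by (intro mult_right_mono) auto
      also have "\<dots> = \<bar>K \<omega>\<bar>" by (simp add: abs_mult)
      finally show "norm (?q n \<omega>) \<le> \<bar>D \<omega> * K \<omega>\<bar>"
        by (simp add: abs_mult mult_left_mono)
    qed
  qed (use DK in auto)
  moreover have "(\<integral>\<omega>. ?q n \<omega> \<partial>M)
    = ((\<integral>\<omega>. D \<omega> * f (A \<omega> + inverse (real (Suc n)) * K \<omega>) \<partial>M) - (\<integral>\<omega>. D \<omega> * f (A \<omega>) \<partial>M)) * real (Suc n)" for n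
  proof -
    have "(\<integral>\<omega>. ?q n \<omega> \<partial>M)
        = (\<integral>\<omega>. (D \<omega> * f (A \<omega> + inverse (real (Suc n)) * K \<omega>) - D \<omega> * f (A \<omega>)) * real (Suc n) \<partial>M)"
      by (rule arg_cong[where f="integral\<^sup>L M"]) (auto simp: algebra_simps)
    also have "\<dots> = ((\<integral>\<omega>. D \<omega> * f (A \<omega> + inverse (real (Suc n)) * K \<omega>) \<partial>M) - (\<integral>\<omega>. D \<omega> * f (A \<omega>) \<partial>M)) * real (Suc n)"
      by (subst integral_mult_left_zero, subst Bochner_Integration.integral_diff) (auto intro!: int)
    finally show ?thesis .
  qed
  ultimately show ?thesis by simp
qed

end

context gaussian_space
begin

lemma rms_square_add_cmult:
  assumes "A \<in> sq_int M" "K \<in> sq_int M"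
  shows "(rms M (\<lambda>\<omega>. A \<omega> + s * K \<omega>))\<^sup>2 = (rms M A)\<^sup>2 + 2 * s * (\<integral>\<omega>. A \<omega> * K \<omega> \<partial>M) + s\<^sup>2 * (rms M K)\<^sup>2"
proof -
  have "(\<integral>\<omega>. (A \<omega> + s * K \<omega>)\<^sup>2 \<partial>M) = (\<integral>\<omega>. (A \<omega>)\<^sup>2 + 2 * s * (A \<omega> * K \<omega>) + s\<^sup>2 * (K \<omega>)\<^sup>2 \<partial>M)"
    by (rule arg_cong[where f="integral\<^sup>L M"]) (auto simp: power2_eq_square algebra_simps)
  then show ?thesis
    unfolding rms_square using assms by (simp add: integrable_sq_int_mult sq_int_square)
qed

text \<open>The function s -> E cos(A + b + s K) is known in closed form because A + s K stays in
  the space. Its derivative at 0 is computed once from the formula and once under the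
  expectation.\<close>

lemma G_mult_sin:
  assumes A: "A \<in> G" and K: "K \<in> G"
  shows "(\<integral>\<omega>. K \<omega> * sin (A \<omega> + b) \<partial>M) = (\<integral>\<omega>. A \<omega> * K \<omega> \<partial>M) * cos b * exp (- ((rms M A)\<^sup>2 / 2))"
proof -
  have [measurable]: "A \<in> borel_measurable M" "K \<in> borel_measurable M" using A K by measurable
  define c where "c = (\<integral>\<omega>. A \<omega> * K \<omega> \<partial>M)"
  define h where "h s = cos b * exp (- (((rms M A)\<^sup>2 + 2 * s * c + s\<^sup>2 * (rms M K)\<^sup>2) / 2))" for s
  have h: "(\<integral>\<omega>. 1 * cos (A \<omega> + b + s * K \<omega>) \<partial>M) = h s" for s
    using G_cos_shift[OF G_add[OF A G_cmult[OF K, of s]], of b]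
    by (simp add: h_def c_def rms_square_add_cmult[OF G_sq_int[OF A] G_sq_int[OF K]] add_ac)
  have "(h has_real_derivative (- c * cos b * exp (- ((rms M A)\<^sup>2 / 2)))) (at 0)"
    unfolding h_def by (auto intro!: derivative_eq_intros)
  from DERIV_sequence[OF this]
  have l1: "(\<lambda>n. (h (inverse (real (Suc n))) - h 0) * real (Suc n))
    \<longlonglongrightarrow> - c * cos b * exp (- ((rms M A)\<^sup>2 / 2))" by simp
  have "(\<lambda>n. ((\<integral>\<omega>. 1 * cos (A \<omega> + b + inverse (real (Suc n)) * K \<omega>) \<partial>M) - (\<integral>\<omega>. 1 * cos (A \<omega> + b) \<partial>M)) * real (Suc n))
    \<longlonglongrightarrow> (\<integral>\<omega>. 1 * K \<omega> * (- sin (A \<omega> + b)) \<partial>M)"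
    by (rule expectation_difference_quotient)
      (use sq_int_integrable[OF G_sq_int[OF K]] in \<open>auto intro!: derivative_eq_intros\<close>)
  then have "(\<lambda>n. (h (inverse (real (Suc n))) - h 0) * real (Suc n)) \<longlonglongrightarrow> (\<integral>\<omega>. 1 * K \<omega> * (- sin (A \<omega> + b)) \<partial>M)"
    unfolding h using h[of 0] by simp
  from LIMSEQ_unique[OF l1 this] show ?thesis by (simp add: c_def)
qed

text \<open>\<open>G_mult_sin\<close> is differentiated once more, now in the direction L. The
  outcome is Gaussian integration by parts for trigonometric functions of A, in the shape that
  \<open>integration_by_parts\<close> takes as its hypothesis.\<close>

lemma G_mult_mult_cos:
  assumes A: "A \<in> G" and K: "K \<in> G" and L: "L \<in> G"
  shows "(\<integral>\<omega>. (K \<omega> * L \<omega> - (\<integral>\<omega>. K \<omega> * L \<omega> \<partial>M)) * cos (A \<omega> + b) \<partial>M)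
    = - (\<integral>\<omega>. A \<omega> * L \<omega> \<partial>M) * (\<integral>\<omega>. K \<omega> * sin (A \<omega> + b) \<partial>M)"
proof -
  have [measurable]: "A \<in> borel_measurable M" "K \<in> borel_measurable M" "L \<in> borel_measurable M"
    using A K L by measurable
  note sq = G_sq_int[OF A] G_sq_int[OF K] G_sq_int[OF L]
  define c c' g where "c = (\<integral>\<omega>. A \<omega> * K \<omega> \<partial>M)" and "c' = (\<integral>\<omega>. A \<omega> * L \<omega> \<partial>M)"
    and "g = (\<integral>\<omega>. K \<omega> * L \<omega> \<partial>M)"
  define \<phi> where "\<phi> = exp (- ((rms M A)\<^sup>2 / 2))"
  define h where "h s = (c + s * g) * cos b * exp (- (((rms M A)\<^sup>2 + 2 * s * c' + s\<^sup>2 * (rms M L)\<^sup>2) / 2))" for s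
  have h: "(\<integral>\<omega>. K \<omega> * sin (A \<omega> + b + s * L \<omega>) \<partial>M) = h s" for s
  proof -
    have "(\<integral>\<omega>. (A \<omega> + s * L \<omega>) * K \<omega> \<partial>M) = (\<integral>\<omega>. A \<omega> * K \<omega> + s * (K \<omega> * L \<omega>) \<partial>M)"
      by (simp add: algebra_simps)
    also have "\<dots> = c + s * g"
      using sq by (simp add: integrable_sq_int_mult c_def g_def)
    finally show ?thesis
      using G_mult_sin[OF G_add[OF A G_cmult[OF L, of s]] K, of b]
      by (simp add: h_def c'_def rms_square_add_cmult[OF sq(1,3)] add_ac)
  qed
  have "(h has_real_derivative (g - c * c') * cos b * \<phi>) (at 0)"
    unfolding h_def \<phi>_def by (auto intro!: derivative_eq_intros simp: algebra_simps)
  from DERIV_sequence[OF this]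
  have l1: "(\<lambda>n. (h (inverse (real (Suc n))) - h 0) * real (Suc n)) \<longlonglongrightarrow> (g - c * c') * cos b * \<phi>" by simp
  have "(\<lambda>n. ((\<integral>\<omega>. K \<omega> * sin (A \<omega> + b + inverse (real (Suc n)) * L \<omega>) \<partial>M) - (\<integral>\<omega>. K \<omega> * sin (A \<omega> + b) \<partial>M)) * real (Suc n))
    \<longlonglongrightarrow> (\<integral>\<omega>. K \<omega> * L \<omega> * cos (A \<omega> + b) \<partial>M)"
    by (rule expectation_difference_quotient)
      (use sq_int_integrable[OF sq(2)] integrable_sq_int_mult[OF sq(2,3)] in \<open>auto intro!: derivative_eq_intros\<close>)
  then have "(\<lambda>n. (h (inverse (real (Suc n))) - h 0) * real (Suc n)) \<longlonglongrightarrow> (\<integral>\<omega>. K \<omega> * L \<omega> * cos (A \<omega> + b) \<partial>M)"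
    unfolding h using h[of 0] by simp
  from LIMSEQ_unique[OF l1 this]
  have KL: "(\<integral>\<omega>. K \<omega> * L \<omega> * cos (A \<omega> + b) \<partial>M) = (g - c * c') * cos b * \<phi>" by simp
  have int: "integrable M (\<lambda>\<omega>. cos (A \<omega> + b))" "integrable M (\<lambda>\<omega>. K \<omega> * L \<omega> * cos (A \<omega> + b))"
  proof -
    show "integrable M (\<lambda>\<omega>. cos (A \<omega> + b))" by (rule integrable_const_bound[of _ 1]) auto
    show "integrable M (\<lambda>\<omega>. K \<omega> * L \<omega> * cos (A \<omega> + b))"
      by (rule Bochner_Integration.integrable_bound[OF integrable_sq_int_mult[OF sq(2,3)]])
        (auto simp: abs_mult intro!: mult_left_le)
  qed
  have "(\<integral>\<omega>. (K \<omega> * L \<omega> - g) * cos (A \<omega> + b) \<partial>M) = (\<integral>\<omega>. K \<omega> * L \<omega> * cos (A \<omega> + b) \<partial>M) - g * (cos b * \<phi>)"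
    using int G_cos_shift[OF A, of b] by (simp add: left_diff_distrib \<phi>_def)
  also have "\<dots> = - c' * (c * cos b * \<phi>)" unfolding KL by (simp add: algebra_simps)
  finally show ?thesis
    using G_mult_sin[OF A K, of b] by (simp add: c'_def c_def g_def \<phi>_def)
qed

end

section \<open>Gaussian integration by parts\<close>

lemma integrable_mult_bounded:
  fixes D g :: "'a \<Rightarrow> real"
  assumes D: "integrable N D" and [measurable]: "g \<in> borel_measurable N"
    and bound: "\<And>x. x \<in> space N \<Longrightarrow> \<bar>g x\<bar> \<le> C"
  shows "integrable N (\<lambda>x. D x * g x)"
proof (rule Bochner_Integration.integrable_bound)
  show "integrable N (\<lambda>x. C * D x)" using D by simp
  show "(\<lambda>x. D x * g x) \<in> borel_measurable N" using D by measurable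
  show "AE x in N. norm (D x * g x) \<le> norm (C * D x)"
  proof (rule AE_I2)
    fix x assume "x \<in> space N"
    then have "\<bar>g x\<bar> \<le> \<bar>C\<bar>" using bound by (meson abs_ge_self order_trans)
    then have "\<bar>D x\<bar> * \<bar>g x\<bar> \<le> \<bar>D x\<bar> * \<bar>C\<bar>" by (rule mult_left_mono) simp
    then show "norm (D x * g x) \<le> norm (C * D x)" by (simp add: abs_mult mult.commute)
  qed
qed

lemma integral_abs_mult_le:
  fixes D g :: "'a \<Rightarrow> real"
  assumes D: "integrable N D" and Dg: "integrable N (\<lambda>x. D x * g x)" and g: "\<And>x. \<bar>g x\<bar> \<le> B"
  shows "\<bar>\<integral>x. D x * g x \<partial>N\<bar> \<le> B * (\<integral>x. \<bar>D x\<bar> \<partial>N)"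
proof -
  have "\<bar>\<integral>x. D x * g x \<partial>N\<bar> \<le> (\<integral>x. \<bar>D x * g x\<bar> \<partial>N)" by (rule integral_abs_bound)
  also have "\<dots> \<le> (\<integral>x. B * \<bar>D x\<bar> \<partial>N)"
  proof (rule integral_mono)
    fix x
    have "\<bar>D x\<bar> * \<bar>g x\<bar> \<le> \<bar>D x\<bar> * B" using g by (rule mult_left_mono) simp
    then show "\<bar>D x * g x\<bar> \<le> B * \<bar>D x\<bar>" by (simp add: abs_mult mult.commute)
  qed (use D Dg in \<open>auto intro!: integrable_abs simp del: abs_mult\<close>)
  finally show ?thesis by simp
qed

text \<open>Normalized positive and negative parts of \<open>D\<close> are densities of two probability laws for
  which the images under \<open>V\<close> have the same characteristic function.\<close>

lemma integral_indicator_zeroI: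
  fixes D V :: "'a \<Rightarrow> real"
  assumes D: "integrable N D" and V [measurable]: "V \<in> borel_measurable N"
    and zero: "\<And>s b. (\<integral>x. D x * cos (s * V x + b) \<partial>N) = 0"
    and A: "A \<in> sets borel"
  shows "(\<integral>x. D x * indicator A (V x) \<partial>N) = 0"
proof -
  have [measurable]: "D \<in> borel_measurable N" "A \<in> sets borel" using D A by auto
  define D1 D2 where "D1 x = max 0 (D x)" and "D2 x = max 0 (- D x)" for x
  have [measurable]: "D1 \<in> borel_measurable N" "D2 \<in> borel_measurable N"
    unfolding D1_def[abs_def] D2_def[abs_def] by measurable
  have int: "integrable N D1" "integrable N D2"
    unfolding D1_def[abs_def] D2_def[abs_def] using D by auto
  have D12: "D x = D1 x - D2 x" "0 \<le> D1 x" "0 \<le> D2 x" for x by (auto simp: D1_def D2_def)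
  note intm = integrable_mult_bounded[OF int(1)] integrable_mult_bounded[OF int(2)]
  have eq: "(\<integral>x. D1 x * cos (s * V x + b) \<partial>N) = (\<integral>x. D2 x * cos (s * V x + b) \<partial>N)" for s b
  proof -
    have "integrable N (\<lambda>x. D1 x * cos (s * V x + b))" "integrable N (\<lambda>x. D2 x * cos (s * V x + b))"
      by (rule intm[where C=1]; simp)+
    then show ?thesis using zero[of s b] by (simp add: D12(1) left_diff_distrib)
  qed
  define p where "p = (\<integral>x. D1 x \<partial>N)"
  have p2: "p = (\<integral>x. D2 x \<partial>N)" using eq[of 0 0] by (simp add: p_def)
  have "p \<ge> 0" unfolding p_def using D12 by (intro Bochner_Integration.integral_nonneg) auto
  have "(\<integral>x. D1 x * indicator A (V x) \<partial>N) = (\<integral>x. D2 x * indicator A (V x) \<partial>N)"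
  proof (cases "p = 0")
    case True
    have "AE x in N. D1 x = 0"
      using True p_def integral_nonneg_eq_0_iff_AE[OF int(1)] D12 by simp
    moreover have "AE x in N. D2 x = 0"
      using True p2 integral_nonneg_eq_0_iff_AE[OF int(2)] D12 by simp
    ultimately have "AE x in N. D1 x * indicator A (V x) = D2 x * indicator A (V x)"
      by eventually_elim simp
    then show ?thesis by (intro integral_cong_AE) auto
  next
    case False
    with \<open>p \<ge> 0\<close> have "p > 0" by simp
    define P where "P E = distr (density N (\<lambda>x. ennreal (E x / p))) borel V" for E
    have P: "real_distribution (P E)" "(\<integral>y. g y \<partial>P E) = (\<integral>x. E x * g (V x) \<partial>N) / p"
      if E: "integrable N E" "\<And>x. 0 \<le> E x" "(\<integral>x. E x \<partial>N) = p"
        and [measurable]: "g \<in> borel_measurable borel" for E g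
    proof -
      have [measurable]: "E \<in> borel_measurable N" using E by auto
      have "emeasure (density N (\<lambda>x. ennreal (E x / p))) (space N) = (\<integral>\<^sup>+x. ennreal (E x / p) \<partial>N)"
        by (simp add: emeasure_density cong: nn_integral_cong)
      also have "\<dots> = ennreal (\<integral>x. E x / p \<partial>N)"
        using E \<open>p > 0\<close> by (intro nn_integral_eq_integral) auto
      also have "\<dots> = 1" using E \<open>p > 0\<close> by simp
      finally have "prob_space (density N (\<lambda>x. ennreal (E x / p)))"
        by (intro prob_spaceI) simp
      then show "real_distribution (P E)"
        unfolding P_def by (intro prob_space.real_distribution_distr) auto
      show "(\<integral>y. g y \<partial>P E) = (\<integral>x. E x * g (V x) \<partial>N) / p"
        unfolding P_def using E(2) \<open>p > 0\<close> by (simp add: integral_distr integral_density)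
    qed
    note P1 = P[OF int(1) D12(2) p_def[symmetric]] and P2 = P[OF int(2) D12(3) p2[symmetric]]
    have rd: "real_distribution (P D1)" "real_distribution (P D2)"
      using P1(1)[of "\<lambda>_. 0"] P2(1)[of "\<lambda>_. 0"] by auto
    have "P D1 = P D2"
    proof (rule Levy_uniqueness[OF rd], rule ext)
      fix t
      \<comment> \<open>The phase in \<open>zero\<close> is arbitrary, so the identity for cosines
        covers sines as well.\<close>
      have sin: "sin y = cos (y + (- (pi / 2)))" for y :: real by (simp add: cos_diff)
      have "(\<integral>y. cos (t * y) \<partial>P D1) = (\<integral>y. cos (t * y) \<partial>P D2)"
        using eq[of t 0] by (simp add: P1 P2)
      moreover have "(\<integral>y. sin (t * y) \<partial>P D1) = (\<integral>y. sin (t * y) \<partial>P D2)"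
        unfolding sin using eq[of t "- (pi / 2)"] by (simp add: P1 P2)
      ultimately show "char (P D1) t = char (P D2) t"
        using rd by (simp add: char_cos_sin)
    qed
    then have "(\<integral>y. indicator A y \<partial>P D1) = (\<integral>y. indicator A y \<partial>P D2 :: real)" by simp
    then show ?thesis
      using P1(2)[of "indicator A"] P2(2)[of "indicator A"] \<open>p > 0\<close> by simp
  qed
  moreover have "integrable N (\<lambda>x. D1 x * indicator A (V x))" "integrable N (\<lambda>x. D2 x * indicator A (V x))"
    by (rule intm[where C=1]; simp add: indicator_def)+
  ultimately show ?thesis by (simp add: D12(1) left_diff_distrib)
qed

text \<open>The coordinates are turned from phases into indicators one at a time; the remaining ones stay
  inside the cosine, where the addition formulas absorb the new frequency.\<close>

lemma integral_prod_indicator_zeroI: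
  fixes D :: "'a \<Rightarrow> real" and V :: "'i \<Rightarrow> 'a \<Rightarrow> real"
  assumes D: "integrable N D" and V: "\<And>i. i \<in> S \<Longrightarrow> V i \<in> borel_measurable N"
    and "finite S"
    and zero: "\<And>l b. (\<integral>x. D x * cos ((\<Sum>i\<in>S. l i * V i x) + b) \<partial>N) = 0"
    and "J \<subseteq> S" and A: "\<And>i. i \<in> J \<Longrightarrow> A i \<in> sets borel"
  shows "(\<integral>x. D x * (\<Prod>i\<in>J. indicator (A i) (V i x)) * cos ((\<Sum>i\<in>S. l i * V i x) + b) \<partial>N) = 0"
proof -
  have [measurable]: "D \<in> borel_measurable N" using D by auto
  have "finite J" using \<open>J \<subseteq> S\<close> \<open>finite S\<close> by (rule finite_subset)
  then show ?thesis using \<open>J \<subseteq> S\<close> A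
  proof (induction J arbitrary: l b)
    case empty
    then show ?case using zero by simp
  next
    case (insert k J)
    have k: "k \<in> S" and [measurable]: "V k \<in> borel_measurable N" using insert.prems V by auto
    have meas [measurable]: "(\<lambda>x. \<Sum>i\<in>S. l i * V i x) \<in> borel_measurable N" for l
      using V by (intro borel_measurable_sum borel_measurable_times) auto
    have ind: "(\<lambda>x. indicator (A i) (V i x) :: real) \<in> borel_measurable N" if "i \<in> J" for i
      using that insert.prems V[of i] by (intro measurable_compose[OF _ borel_measurable_indicator]) auto
    define P where "P x = (\<Prod>i\<in>J. indicator (A i) (V i x) :: real)" for x
    have [measurable]: "P \<in> borel_measurable N"
      unfolding P_def[abs_def] by (intro borel_measurable_prod ind)
    have P: "\<bar>P x\<bar> \<le> 1" for x unfolding P_def by (simp add: abs_prod prod_le_1)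
    define D' where "D' x = D x * P x * cos ((\<Sum>i\<in>S. l i * V i x) + b)" for x
    have int: "integrable N (\<lambda>x. D x * (P x * cos ((\<Sum>i\<in>S. l i * V i x) + b)))" for l b
    proof (rule integrable_mult_bounded[OF D, where C=1])
      show "\<bar>P x * cos ((\<Sum>i\<in>S. l i * V i x) + b)\<bar> \<le> 1" for x
        using mult_mono[OF P abs_cos_le_one] by (simp add: abs_mult)
    qed measurable
    have D': "integrable N D'" using int[of l b] by (simp add: D'_def[abs_def] mult_ac)
    have IH: "(\<integral>x. D x * P x * cos ((\<Sum>i\<in>S. l i * V i x) + b) \<partial>N) = 0" for l b
      unfolding P_def using insert.prems by (intro insert.IH) auto
    have "(\<integral>x. D' x * cos (s * V k x + b') \<partial>N) = 0" for s b'
    proof -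
      define l1 l2 where "l1 i = (if i = k then l k + s else l i)"
        and "l2 i = (if i = k then l k - s else l i)" for i
      have l12: "(\<Sum>i\<in>S. l1 i * V i x) = (\<Sum>i\<in>S. l i * V i x) + s * V k x"
        "(\<Sum>i\<in>S. l2 i * V i x) = (\<Sum>i\<in>S. l i * V i x) - s * V k x" for x
        unfolding l1_def l2_def sum.remove[OF \<open>finite S\<close> k] by (simp_all add: algebra_simps)
      have "D' x * cos (s * V k x + b')
        = 1 / 2 * (D x * P x * cos ((\<Sum>i\<in>S. l1 i * V i x) + (b + b')))
        + 1 / 2 * (D x * P x * cos ((\<Sum>i\<in>S. l2 i * V i x) + (b - b')))" for x
      proof -
        have e: "(\<Sum>i\<in>S. l1 i * V i x) + (b + b') = ((\<Sum>i\<in>S. l i * V i x) + b) + (s * V k x + b')"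
          "(\<Sum>i\<in>S. l2 i * V i x) + (b - b') = ((\<Sum>i\<in>S. l i * V i x) + b) - (s * V k x + b')"
          by (simp_all add: l12)
        have cc: "u * (cos a * cos c) = 1 / 2 * (u * cos (a + c)) + 1 / 2 * (u * cos (a - c))" for a c u :: real
          by (simp add: cos_add cos_diff algebra_simps)
        show ?thesis unfolding e D'_def by (subst cc[symmetric]) (simp only: mult.assoc)
      qed
      then have "(\<integral>x. D' x * cos (s * V k x + b') \<partial>N)
        = (\<integral>x. 1 / 2 * (D x * P x * cos ((\<Sum>i\<in>S. l1 i * V i x) + (b + b')))
          + 1 / 2 * (D x * P x * cos ((\<Sum>i\<in>S. l2 i * V i x) + (b - b'))) \<partial>N)"
        by presburger
      also have "\<dots> = 0"
        using int[of l1 "b + b'"] int[of l2 "b - b'"]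
        by (subst Bochner_Integration.integral_add) (simp_all add: IH mult.assoc[symmetric])
      finally show ?thesis .
    qed
    then have "(\<integral>x. D' x * indicator (A k) (V k x) \<partial>N) = 0"
      using insert.prems by (intro integral_indicator_zeroI[OF D']) auto
    also have "(\<lambda>x. D' x * indicator (A k) (V k x))
      = (\<lambda>x. D x * (\<Prod>i\<in>insert k J. indicator (A i) (V i x)) * cos ((\<Sum>i\<in>S. l i * V i x) + b))"
      using insert.hyps by (simp add: D'_def P_def mult_ac fun_eq_iff)
    finally show ?case .
  qed
qed

text \<open>The positive and negative parts of D, pushed forward by the family V, are two finite
  measures on the product space. They agree on cylinders by the finite-dimensional result, hence
  everywhere. The index set may be uncountable: it will be {..<n} for smooth functions and the time
  interval [0,T] for \<open>generated_sigma\<close>.\<close>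

lemma integral_PiM_zeroI:
  fixes D :: "'a \<Rightarrow> real" and V :: "'i \<Rightarrow> 'a \<Rightarrow> real"
  assumes D: "integrable N D" and V: "\<And>i. i \<in> I \<Longrightarrow> V i \<in> borel_measurable N"
    and zero: "\<And>S l b. finite S \<Longrightarrow> S \<subseteq> I \<Longrightarrow> (\<integral>x. D x * cos ((\<Sum>i\<in>S. l i * V i x) + b) \<partial>N) = 0"
    and h [measurable]: "h \<in> borel_measurable (PiM I (\<lambda>_. borel))" and bound: "\<And>y. \<bar>h y\<bar> \<le> C"
  shows "(\<integral>x. D x * h (\<lambda>i\<in>I. V i x) \<partial>N) = 0"
proof -
  have [measurable]: "D \<in> borel_measurable N" using D by auto
  have VI [measurable]: "(\<lambda>x. \<lambda>i\<in>I. V i x) \<in> measurable N (PiM I (\<lambda>_. borel))"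
    using V by (rule measurable_restrict)
  define D1 D2 where "D1 x = max 0 (D x)" and "D2 x = max 0 (- D x)" for x
  have [measurable]: "D1 \<in> borel_measurable N" "D2 \<in> borel_measurable N"
    unfolding D1_def[abs_def] D2_def[abs_def] by measurable
  have int: "integrable N D1" "integrable N D2"
    unfolding D1_def[abs_def] D2_def[abs_def] using D by auto
  have D12: "D x = D1 x - D2 x" "0 \<le> D1 x" "0 \<le> D2 x" for x by (auto simp: D1_def D2_def)
  note intm = integrable_mult_bounded[OF int(1)] integrable_mult_bounded[OF int(2)]
  define P where "P E = distr (density N (\<lambda>x. ennreal (E x))) (PiM I (\<lambda>_. borel)) (\<lambda>x. \<lambda>i\<in>I. V i x)" for E
  have Pint: "(\<integral>y. g y \<partial>P E) = (\<integral>x. E x * g (\<lambda>i\<in>I. V i x) \<partial>N)"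
    if "\<And>x. 0 \<le> E x" and [measurable]: "E \<in> borel_measurable N" "g \<in> borel_measurable (PiM I (\<lambda>_. borel))"
    for E and g :: "_ \<Rightarrow> real"
    unfolding P_def using that(1) by (simp add: integral_distr integral_density)
  have "P D1 = P D2"
  proof (rule measure_eqI_PiM_infinite)
    show "sets (P D1) = PiM I (\<lambda>_. borel)" "sets (P D2) = PiM I (\<lambda>_. borel)"
      by (simp_all add: P_def)
    have "emeasure (density N (\<lambda>x. ennreal (D1 x))) (space N) = (\<integral>\<^sup>+x. ennreal (D1 x) \<partial>N)"
      by (simp add: emeasure_density cong: nn_integral_cong)
    also have "\<dots> = ennreal (\<integral>x. D1 x \<partial>N)"
      using int D12 by (intro nn_integral_eq_integral) auto
    finally have "finite_measure (density N (\<lambda>x. ennreal (D1 x)))"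
      by (intro finite_measureI) simp
    then show "finite_measure (P D1)"
      unfolding P_def by (rule finite_measure.finite_measure_distr) simp
  next
    fix A :: "'i \<Rightarrow> real set" and J assume J: "finite J" "J \<subseteq> I" and A: "\<And>i. i \<in> J \<Longrightarrow> A i \<in> sets borel"
    let ?X = "prod_emb I (\<lambda>_. borel) J (Pi\<^sub>E J A)"
    have X: "?X \<in> sets (PiM I (\<lambda>_. borel))" using J A by (intro sets_PiM_I) auto
    have ind: "indicator ?X (\<lambda>i\<in>I. V i x) = (\<Prod>i\<in>J. indicator (A i) (V i x) :: real)" for x
    proof -
      have "(\<lambda>i\<in>I. V i x) \<in> ?X \<longleftrightarrow> (\<forall>i\<in>J. V i x \<in> A i)"
        using J(2) by (auto simp: prod_emb_def PiE_def extensional_def space_PiM Pi_def restrict_def subset_iff)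
      moreover have "(\<Prod>i\<in>J. indicator (A i) (V i x) :: real) = (if \<forall>i\<in>J. V i x \<in> A i then 1 else 0)"
        using J(1) by (auto simp: indicator_def intro!: prod.neutral prod_zero)
      ultimately show ?thesis by (simp add: indicator_def)
    qed
    have i1: "integrable N (\<lambda>x. D1 x * indicator ?X (\<lambda>i\<in>I. V i x))"
      "integrable N (\<lambda>x. D2 x * indicator ?X (\<lambda>i\<in>I. V i x))"
      using X by (intro intm[where C=1] measurable_compose[OF VI borel_measurable_indicator]; simp add: indicator_def)+
    have em: "emeasure (P E) ?X = ennreal (\<integral>x. E x * indicator ?X (\<lambda>i\<in>I. V i x) \<partial>N)"
      if E: "integrable N (\<lambda>x. E x * indicator ?X (\<lambda>i\<in>I. V i x))" "\<And>x. 0 \<le> E x"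
        and [measurable]: "E \<in> borel_measurable N" for E
    proof -
      have "emeasure (P E) ?X = (\<integral>\<^sup>+y. indicator ?X y \<partial>P E)"
        using X by (subst nn_integral_indicator) (simp_all add: P_def)
      also have "\<dots> = (\<integral>\<^sup>+x. ennreal (E x) * indicator ?X (\<lambda>i\<in>I. V i x) \<partial>N)"
        unfolding P_def using X by (simp add: nn_integral_distr nn_integral_density del: nn_integral_indicator)
      also have "\<dots> = (\<integral>\<^sup>+x. ennreal (E x * indicator ?X (\<lambda>i\<in>I. V i x)) \<partial>N)"
        by (rule nn_integral_cong) (simp add: indicator_def)
      also have "\<dots> = ennreal (\<integral>x. E x * indicator ?X (\<lambda>i\<in>I. V i x) \<partial>N)"
        using E by (intro nn_integral_eq_integral) auto
      finally show ?thesis .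
    qed
    \<comment> \<open>Zero frequencies and zero phase turn the cosine into 1 and leave the
      indicators alone.\<close>
    have "(\<integral>x. D x * (\<Prod>i\<in>J. indicator (A i) (V i x)) * cos ((\<Sum>i\<in>J. 0 * V i x) + 0) \<partial>N) = 0"
      by (rule integral_prod_indicator_zeroI[OF D, where S=J and b=0 and l="\<lambda>_. 0"])
        (use J A zero V in auto)
    then have "(\<integral>x. D x * indicator ?X (\<lambda>i\<in>I. V i x) \<partial>N) = 0" by (simp add: ind)
    then have "(\<integral>x. D1 x * indicator ?X (\<lambda>i\<in>I. V i x) \<partial>N) = (\<integral>x. D2 x * indicator ?X (\<lambda>i\<in>I. V i x) \<partial>N)"
      using i1 by (simp add: D12(1) left_diff_distrib)
    then show "emeasure (P D1) ?X = emeasure (P D2) ?X"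
      using em[OF i1(1) D12(2)] em[OF i1(2) D12(3)] by simp
  qed
  then have "(\<integral>y. h y \<partial>P D1) = (\<integral>y. h y \<partial>P D2)" by simp
  then have "(\<integral>x. D1 x * h (\<lambda>i\<in>I. V i x) \<partial>N) = (\<integral>x. D2 x * h (\<lambda>i\<in>I. V i x) \<partial>N)"
    by (simp add: Pint D12)
  moreover have "integrable N (\<lambda>x. D1 x * h (\<lambda>i\<in>I. V i x))" "integrable N (\<lambda>x. D2 x * h (\<lambda>i\<in>I. V i x))"
    by (rule intm[where C=C]; use bound in simp)+
  ultimately show ?thesis by (simp add: D12(1) left_diff_distrib)
qed

section \<open>Bounded smooth functions of finitely many variables\<close>

lemma smooth_bounded_cong:
  "smooth_bounded n f \<Longrightarrow> (\<And>i. i < n \<Longrightarrow> x i = y i) \<Longrightarrow> f x = f y"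
  unfolding smooth_bounded_def by blast

lemma smooth_bounded_bound:
  assumes "smooth_bounded n f"
  obtains K where "\<And>x. \<bar>f x\<bar> \<le> K"
proof -
  have "bounded (range f)"
    using assms unfolding smooth_bounded_def Let_def by (metis empty_subsetI foldr.simps(1) id_apply list.set(1))
  then show ?thesis using that by (auto simp: bounded_iff)
qed

lemma smooth_bounded_differentiable:
  assumes "smooth_bounded n f" "i < n"
  shows "((\<lambda>s. f (x(i := s))) has_real_derivative partial_deriv i f (x(i := s))) (at s)"
proof -
  have "\<forall>i<n. \<forall>x. (\<lambda>s. f (x(i := s))) field_differentiable at (x i)"
    using assms unfolding smooth_bounded_def Let_def by (metis empty_subsetI foldr.simps(1) id_apply list.set(1))
  from this[rule_format, OF assms(2), of "x(i := s)"]
  have "(\<lambda>s. f (x(i := s))) field_differentiable at s" by simp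
  then show ?thesis
    unfolding partial_deriv_def by (simp add: DERIV_deriv_iff_field_differentiable)
qed

lemma smooth_bounded_partial:
  assumes "smooth_bounded n f" "i < n"
  shows "smooth_bounded n (partial_deriv i f)"
  unfolding smooth_bounded_def
proof (intro conjI allI impI)
  fix x y :: "nat \<Rightarrow> real" assume xy: "\<forall>i<n. x i = y i"
  have "(\<lambda>s. f (x(i := s))) = (\<lambda>s. f (y(i := s)))"
    using xy by (intro ext smooth_bounded_cong[OF assms(1)]) simp
  then show "partial_deriv i f x = partial_deriv i f y"
    using xy assms(2) by (simp add: partial_deriv_def)
next
  fix js assume js: "set js \<subseteq> {..<n}"
  have eq: "foldr partial_deriv js (partial_deriv i f) = foldr partial_deriv (js @ [i]) f" by simp
  have "set (js @ [i]) \<subseteq> {..<n}" using js assms(2) by simp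
  then show "let g = foldr partial_deriv js (partial_deriv i f) in
       bounded (range g) \<and> (\<forall>i<n. \<forall>x. (\<lambda>s. g (x(i := s))) field_differentiable at (x i))"
    using assms(1) unfolding smooth_bounded_def eq by blast
qed

text \<open>Coordinates are exchanged one at a time, and each exchange is estimated by the mean
  value inequality with a bound common to all partial derivatives.\<close>

lemma smooth_bounded_lipschitz:
  assumes f: "smooth_bounded n f"
  obtains K where "K \<ge> 0" "\<And>x y. \<bar>f x - f y\<bar> \<le> K * (\<Sum>i<n. \<bar>x i - y i\<bar>)"
proof -
  have "\<exists>C. \<forall>x. \<bar>partial_deriv i f x\<bar> \<le> C" if "i < n" for i
    using smooth_bounded_bound[OF smooth_bounded_partial[OF f that]] by metis
  then obtain C where C: "\<And>i x. i < n \<Longrightarrow> \<bar>partial_deriv i f x\<bar> \<le> C i" by metis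
  define K where "K = (\<Sum>i<n. \<bar>C i\<bar>)"
  have K: "\<bar>partial_deriv i f x\<bar> \<le> K" if "i < n" for i x
  proof -
    have "\<bar>C i\<bar> \<le> K" unfolding K_def using that by (intro member_le_sum) auto
    then show ?thesis using C[OF that, of x] by simp
  qed
  have "K \<ge> 0" by (simp add: K_def sum_nonneg)
  moreover have "\<bar>f x - f y\<bar> \<le> K * (\<Sum>i<n. \<bar>x i - y i\<bar>)" for x y
  proof -
    define z where "z k = (\<lambda>i. if i < k then x i else y i)" for k
    have step: "\<bar>f (z (Suc k)) - f (z k)\<bar> \<le> K * \<bar>x k - y k\<bar>" if "k < n" for k
    proof -
      have zz: "z (Suc k) = (z k)(k := x k)" "z k = (z k)(k := y k)"
        by (auto simp: z_def fun_eq_iff less_Suc_eq)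
      have "norm (f ((z k)(k := x k)) - f ((z k)(k := y k))) \<le> K * norm (x k - y k)"
        by (rule field_differentiable_bound[of UNIV "\<lambda>s. f ((z k)(k := s))" "\<lambda>s. partial_deriv k f ((z k)(k := s))"])
          (use smooth_bounded_differentiable[OF f that] K[OF that] in auto)
      then show ?thesis using zz by simp
    qed
    have "f x - f y = f (z n) - f (z 0)"
    proof -
      have "f x = f (z n)" by (rule smooth_bounded_cong[OF f]) (simp add: z_def)
      then show ?thesis by (simp add: z_def)
    qed
    also have "\<dots> = (\<Sum>k<n. f (z (Suc k)) - f (z k))" by (rule sum_lessThan_telescope[symmetric])
    also have "\<bar>\<dots>\<bar> \<le> (\<Sum>k<n. K * \<bar>x k - y k\<bar>)"
      by (rule order_trans[OF sum_abs sum_mono]) (use step in auto)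
    finally show ?thesis by (simp add: sum_distrib_left)
  qed
  ultimately show ?thesis using that by blast
qed

text \<open>A first-order Taylor estimate whose remainder is uniform in x, because x will be the
  value of an unbounded random vector. The mean value theorem along each coordinate leaves an
  increment of a partial derivative, which is Lipschitz since it belongs to the class again.\<close>

lemma smooth_bounded_directional:
  assumes f: "smooth_bounded n f"
  obtains K where "K \<ge> 0"
    "\<And>x h. \<bar>f (\<lambda>i. x i + h * c i) - f x - h * (\<Sum>i<n. c i * partial_deriv i f x)\<bar> \<le> K * h\<^sup>2"
proof -
  have "\<exists>C\<ge>0. \<forall>x y. \<bar>partial_deriv i f x - partial_deriv i f y\<bar> \<le> C * (\<Sum>i<n. \<bar>x i - y i\<bar>)" if "i < n" for i
    using smooth_bounded_lipschitz[OF smooth_bounded_partial[OF f that]] by metis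
  then obtain C where C: "\<And>i. i < n \<Longrightarrow> 0 \<le> C i"
    "\<And>i x y. i < n \<Longrightarrow> \<bar>partial_deriv i f x - partial_deriv i f y\<bar> \<le> C i * (\<Sum>i<n. \<bar>x i - y i\<bar>)" by metis
  define s where "s = (\<Sum>i<n. \<bar>c i\<bar>)"
  define K where "K = (\<Sum>k<n. \<bar>c k\<bar> * (C k * s))"
  have s: "s \<ge> 0" by (simp add: s_def sum_nonneg)
  have "K \<ge> 0" unfolding K_def using C s by (intro sum_nonneg mult_nonneg_nonneg) auto
  moreover have "\<bar>f (\<lambda>i. x i + h * c i) - f x - h * (\<Sum>i<n. c i * partial_deriv i f x)\<bar> \<le> K * h\<^sup>2" for x h
  proof -
    define z where "z k = (\<lambda>i. if i < k then x i + h * c i else x i)" for k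
    have step: "\<bar>f (z (Suc k)) - f (z k) - h * c k * partial_deriv k f x\<bar> \<le> \<bar>c k\<bar> * (C k * s) * h\<^sup>2"
      if "k < n" for k
    proof -
      \<comment> \<open>The segment from \<open>z k\<close> at u = 0 to \<open>z (Suc k)\<close> at
        u = 1.\<close>
      define w where "w u = (z k)(k := x k + u * (h * c k))" for u
      have zz: "z (Suc k) = w 1" "z k = w 0"
        by (auto simp: z_def w_def fun_eq_iff less_Suc_eq)
      have der: "((\<lambda>u. f (w u)) has_real_derivative partial_deriv k f (w u) * (h * c k)) (at u)" for u
      proof -
        have "((\<lambda>u. x k + u * (h * c k)) has_real_derivative h * c k) (at u)"
          by (auto intro!: derivative_eq_intros)
        from DERIV_chain2[OF smooth_bounded_differentiable[OF f that, of "z k"] this]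
        show ?thesis unfolding w_def .
      qed
      obtain u where u: "0 < u" "u < 1" "f (w 1) - f (w 0) = partial_deriv k f (w u) * (h * c k)"
        using MVT2[of 0 1 "\<lambda>u. f (w u)" "\<lambda>u. partial_deriv k f (w u) * (h * c k)"] der by auto
      have "(\<Sum>i<n. \<bar>w u i - x i\<bar>) \<le> (\<Sum>i<n. \<bar>h\<bar> * \<bar>c i\<bar>)"
      proof (rule sum_mono)
        fix i
        have "u * (\<bar>h\<bar> * \<bar>c k\<bar>) \<le> 1 * (\<bar>h\<bar> * \<bar>c k\<bar>)" using u by (intro mult_right_mono) auto
        then show "\<bar>w u i - x i\<bar> \<le> \<bar>h\<bar> * \<bar>c i\<bar>"
          using u(1) by (auto simp: w_def z_def abs_mult)
      qed
      then have "\<bar>partial_deriv k f (w u) - partial_deriv k f x\<bar> \<le> C k * (\<bar>h\<bar> * s)"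
        using C[OF that] by (intro order_trans[OF C(2)[OF that]] mult_left_mono) (auto simp: s_def sum_distrib_left)
      then have "\<bar>partial_deriv k f (w u) - partial_deriv k f x\<bar> * (\<bar>h\<bar> * \<bar>c k\<bar>) \<le> C k * (\<bar>h\<bar> * s) * (\<bar>h\<bar> * \<bar>c k\<bar>)"
        by (rule mult_right_mono) simp
      also have "\<dots> = \<bar>c k\<bar> * (C k * s) * h\<^sup>2"
        using abs_mult_self_eq[of h] by (simp add: power2_eq_square mult_ac)
      finally show ?thesis unfolding zz u(3) by (simp add: abs_mult[symmetric] algebra_simps)
    qed
    have "f (\<lambda>i. x i + h * c i) - f x = f (z n) - f (z 0)"
    proof -
      have "f (\<lambda>i. x i + h * c i) = f (z n)" by (rule smooth_bounded_cong[OF f]) (simp add: z_def)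
      then show ?thesis by (simp add: z_def)
    qed
    also have "\<dots> = (\<Sum>k<n. f (z (Suc k)) - f (z k))" by (rule sum_lessThan_telescope[symmetric])
    finally have "f (\<lambda>i. x i + h * c i) - f x - h * (\<Sum>i<n. c i * partial_deriv i f x)
      = (\<Sum>k<n. f (z (Suc k)) - f (z k) - h * c k * partial_deriv k f x)"
      by (simp add: sum_subtractf sum_distrib_left mult.assoc)
    also have "\<bar>\<dots>\<bar> \<le> (\<Sum>k<n. \<bar>c k\<bar> * (C k * s) * h\<^sup>2)"
      by (rule order_trans[OF sum_abs sum_mono]) (use step in auto)
    finally show ?thesis by (simp add: K_def sum_distrib_right)
  qed
  ultimately show ?thesis using that by blast
qed

text \<open>Being Lipschitz, f is continuous on the product space of all sequences. Measurability of
  \<open>W i\<close> is given for i < n, so the remaining coordinates are replaced by 0, a change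
  that f does not see.\<close>

lemma smooth_bounded_measurable:
  assumes f: "smooth_bounded n f"
    and W: "\<And>i. i < n \<Longrightarrow> W i \<in> borel_measurable N"
  shows "(\<lambda>\<omega>. f (\<lambda>i. W i \<omega>)) \<in> borel_measurable N"
proof -
  obtain K where K: "K \<ge> 0" "\<And>x y. \<bar>f x - f y\<bar> \<le> K * (\<Sum>i<n. \<bar>x i - y i\<bar>)"
    using smooth_bounded_lipschitz[OF f] by metis
  have "isCont f x" for x
    unfolding isCont_def
  proof (rule LIM_zero_cancel, rule Lim_null_comparison)
    show "\<forall>\<^sub>F y in at x. norm (f y - f x) \<le> K * (\<Sum>i<n. \<bar>y i - x i\<bar>)" using K by simp
    have "((\<lambda>y. y i) \<longlongrightarrow> x i) (at x)" for i
      using continuous_on_product_coordinates[of i] by (auto simp: continuous_on_def)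
    then have "((\<lambda>y. K * (\<Sum>i<n. \<bar>y i - x i\<bar>)) \<longlongrightarrow> K * (\<Sum>i<n. \<bar>x i - x i\<bar>)) (at x)"
      by (intro tendsto_intros)
    then show "((\<lambda>y. K * (\<Sum>i<n. \<bar>y i - x i\<bar>)) \<longlongrightarrow> 0) (at x)" by simp
  qed
  then have [measurable]: "f \<in> borel_measurable borel"
    by (intro borel_measurable_continuous_onI continuous_at_imp_continuous_on) auto
  have "(\<lambda>\<omega>. if i < n then W i \<omega> else 0) \<in> borel_measurable N" for i
    using W by (cases "i < n") auto
  then have "(\<lambda>\<omega> i. if i < n then W i \<omega> else 0) \<in> borel_measurable N"
    by (rule measurable_coordinatewise_then_product)
  from measurable_compose[OF this \<open>f \<in> borel_measurable borel\<close>]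
  have "(\<lambda>\<omega>. f (\<lambda>i. if i < n then W i \<omega> else 0)) \<in> borel_measurable N" .
  moreover have "(\<lambda>\<omega>. f (\<lambda>i. if i < n then W i \<omega> else 0)) = (\<lambda>\<omega>. f (\<lambda>i. W i \<omega>))"
    by (intro ext smooth_bounded_cong[OF f]) simp
  ultimately show ?thesis by simp
qed

section \<open>From trigonometric to smooth test functions\<close>

lemma (in pair_sigma_finite) integrable_product_mult:
  fixes f :: "'a \<Rightarrow> real" and g :: "'b \<Rightarrow> real"
  assumes f: "integrable M1 f" and g: "integrable M2 g"
  shows "integrable (M1 \<Otimes>\<^sub>M M2) (\<lambda>(x, y). f x * g y)"
proof (rule Fubini_integrable)
  have [measurable]: "f \<in> borel_measurable M1" "g \<in> borel_measurable M2" using f g by auto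
  show "(\<lambda>(x, y). f x * g y) \<in> borel_measurable (M1 \<Otimes>\<^sub>M M2)" by measurable
  show "integrable M1 (\<lambda>x. \<integral>y. norm (case (x, y) of (x, y) \<Rightarrow> f x * g y) \<partial>M2)"
    using f by (simp add: abs_mult)
  show "AE x in M1. integrable M2 (\<lambda>y. case (x, y) of (x, y) \<Rightarrow> f x * g y)"
    using g by simp
qed

context prob_space
begin

text \<open>Averaging over a shift: \<open>u \<in> [0,t]\<close> carries the weight \<open>D1\<close> and the shift \<open>u\<close>, and two further
  unit intervals carry \<open>D2\<close> at the end points \<open>0\<close> and \<open>t\<close>.\<close>

lemma shift_integral:
  fixes k :: "'a \<Rightarrow> real \<Rightarrow> real"
  assumes D1: "integrable M D1" and D2: "integrable M D2" and "t > 0"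
    and k [measurable]: "(\<lambda>(\<omega>, u). k \<omega> u) \<in> borel_measurable (M \<Otimes>\<^sub>M borel)"
    and bound: "\<And>\<omega> u. \<bar>k \<omega> u\<bar> \<le> C"
  defines "D \<equiv> \<lambda>(\<omega>, u). D1 \<omega> * indicator {0..t} u + D2 \<omega> * (indicator {-1..<0} u - indicator {t<..t + 1} u)"
  shows "integrable (M \<Otimes>\<^sub>M lborel) D"
    and "(\<integral>x. D x * k (fst x) (max 0 (min t (snd x))) \<partial>(M \<Otimes>\<^sub>M lborel))
      = (\<integral>u. indicator {0..t} u * (\<integral>\<omega>. D1 \<omega> * k \<omega> u \<partial>M) \<partial>lborel)
        + (\<integral>\<omega>. D2 \<omega> * k \<omega> 0 \<partial>M) - (\<integral>\<omega>. D2 \<omega> * k \<omega> t \<partial>M)"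
    and "integrable lborel (\<lambda>u. indicator {0..t} u * (\<integral>\<omega>. D1 \<omega> * k \<omega> u \<partial>M))"
proof -
  interpret P: pair_sigma_finite M lborel ..
  have [measurable]: "D1 \<in> borel_measurable M" "D2 \<in> borel_measurable M" using D1 D2 by auto
  have k' [measurable]: "(\<lambda>(\<omega>, u). k \<omega> u) \<in> borel_measurable (M \<Otimes>\<^sub>M lborel)"
    using k by (simp add: measurable_lborel2 cong: measurable_cong_sets sets_pair_measure_cong)
  have ku [measurable]: "(\<lambda>\<omega>. k \<omega> u) \<in> borel_measurable M" for u
    using measurable_compose[OF measurable_Pair[OF measurable_ident measurable_const] k, of u] by simp
  define e where "e u = (indicator {-1..<0} u - indicator {t<..t + 1} u :: real)" for u
  have ia: "integrable lborel (indicator {0..t} :: real \<Rightarrow> real)"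
    "integrable lborel (indicator {-1..<0} :: real \<Rightarrow> real)"
    "integrable lborel (indicator {t<..t + 1} :: real \<Rightarrow> real)"
    using \<open>t > 0\<close> by (auto simp: integrable_indicator_iff)
  have ie: "integrable lborel e"
    unfolding e_def[abs_def] using ia by (intro Bochner_Integration.integrable_diff)
  have D_eq: "D = (\<lambda>(\<omega>, u). D1 \<omega> * indicator {0..t} u + D2 \<omega> * e u)"
    by (simp add: D_def e_def)
  show intD: "integrable (M \<Otimes>\<^sub>M lborel) D"
    using Bochner_Integration.integrable_add[OF P.integrable_product_mult[OF D1 ia(1)] P.integrable_product_mult[OF D2 ie]]
    by (simp add: D_eq case_prod_beta')
  have intk: "integrable M (\<lambda>\<omega>. D1 \<omega> * k \<omega> u)" "integrable M (\<lambda>\<omega>. D2 \<omega> * k \<omega> u)" for u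
    by (rule integrable_mult_bounded[where C=C]; use D1 D2 bound in simp)+
  show intl: "integrable lborel (\<lambda>u. indicator {0..t} u * (\<integral>\<omega>. D1 \<omega> * k \<omega> u \<partial>M))"
  proof (rule integrable_mult_bounded[where C="C * (\<integral>\<omega>. \<bar>D1 \<omega>\<bar> \<partial>M)", OF ia(1)])
    show "(\<lambda>u. \<integral>\<omega>. D1 \<omega> * k \<omega> u \<partial>M) \<in> borel_measurable lborel"
    proof (rule borel_measurable_lebesgue_integral)
      have "(\<lambda>(u, \<omega>). (\<omega>, u)) \<in> measurable (lborel \<Otimes>\<^sub>M M) (M \<Otimes>\<^sub>M lborel)" by measurable
      from measurable_compose[OF this k']
      have [measurable]: "(\<lambda>(u, \<omega>). k \<omega> u) \<in> borel_measurable (lborel \<Otimes>\<^sub>M M)"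
        by (simp add: case_prod_beta')
      have "(\<lambda>x. D1 (snd x) * (\<lambda>(u, \<omega>). k \<omega> u) x) \<in> borel_measurable (lborel \<Otimes>\<^sub>M M)" by measurable
      then show "(\<lambda>(u, \<omega>). D1 \<omega> * k \<omega> u) \<in> borel_measurable (lborel \<Otimes>\<^sub>M M)"
        by (simp add: case_prod_beta')
    qed
    fix u
    show "\<bar>\<integral>\<omega>. D1 \<omega> * k \<omega> u \<partial>M\<bar> \<le> C * (\<integral>\<omega>. \<bar>D1 \<omega>\<bar> \<partial>M)"
      by (rule integral_abs_mult_le[OF D1 intk(1) bound])
  qed
  have [measurable]: "D \<in> borel_measurable (M \<Otimes>\<^sub>M lborel)" using intD by auto
  have kcl: "(\<lambda>x. k (fst x) (max 0 (min t (snd x)))) \<in> borel_measurable (M \<Otimes>\<^sub>M lborel)"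
  proof -
    have "(\<lambda>x. (fst x, max 0 (min t (snd x)))) \<in> measurable (M \<Otimes>\<^sub>M lborel) (M \<Otimes>\<^sub>M lborel)" by measurable
    from measurable_compose[OF this k'] show ?thesis by simp
  qed
  have "integrable (M \<Otimes>\<^sub>M lborel) (\<lambda>x. D x * k (fst x) (max 0 (min t (snd x))))"
    using bound by (intro integrable_mult_bounded[OF intD kcl]) auto
  then have int_split: "integrable (M \<Otimes>\<^sub>M lborel) (case_prod (\<lambda>\<omega> u. D (\<omega>, u) * k \<omega> (max 0 (min t u))))"
    by (simp add: case_prod_beta')
  \<comment> \<open>Clamping sends [-1,0) to the shift 0 and (t,t+1] to the shift t. Both intervals
    have length 1, so integrating over the shift leaves exactly the two end point terms.\<close>
  have inner: "(\<integral>\<omega>. D (\<omega>, u) * k \<omega> (max 0 (min t u)) \<partial>M)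
      = indicator {0..t} u * (\<integral>\<omega>. D1 \<omega> * k \<omega> u \<partial>M)
        + (indicator {-1..<0} u * (\<integral>\<omega>. D2 \<omega> * k \<omega> 0 \<partial>M) - indicator {t<..t + 1} u * (\<integral>\<omega>. D2 \<omega> * k \<omega> t \<partial>M))" for u
  proof -
    consider "u \<in> {0..t}" | "u \<in> {-1..<0}" | "u \<in> {t<..t + 1}" | "u < -1 \<or> u > t + 1"
      using \<open>t > 0\<close> by fastforce
    then show ?thesis
      by cases (use \<open>t > 0\<close> in \<open>auto simp: D_def indicator_def max_def min_def\<close>)
  qed
  have unit: "measure lborel {-1..<0::real} = 1" "measure lborel {t<..t + 1} = 1"
    by (simp_all add: measure_def)
  have "(\<integral>x. D x * k (fst x) (max 0 (min t (snd x))) \<partial>(M \<Otimes>\<^sub>M lborel))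
      = (\<integral>u. (\<integral>\<omega>. D (\<omega>, u) * k \<omega> (max 0 (min t u)) \<partial>M) \<partial>lborel)"
    using P.integral_snd[OF int_split] by (simp add: case_prod_beta')
  also have "\<dots> = (\<integral>u. indicator {0..t} u * (\<integral>\<omega>. D1 \<omega> * k \<omega> u \<partial>M) \<partial>lborel)
        + ((\<integral>u. indicator {-1..<0::real} u * (\<integral>\<omega>. D2 \<omega> * k \<omega> 0 \<partial>M) \<partial>lborel)
        - (\<integral>u. indicator {t<..t + 1} u * (\<integral>\<omega>. D2 \<omega> * k \<omega> t \<partial>M) \<partial>lborel))"
  proof -
    note i2 = integrable_mult_left[OF ia(2)] and i3 = integrable_mult_left[OF ia(3)]
    show ?thesis
      unfolding inner Bochner_Integration.integral_add[OF intl Bochner_Integration.integrable_diff[OF i2 i3]]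
        Bochner_Integration.integral_diff[OF i2 i3] ..
  qed
  also have "\<dots> = (\<integral>u. indicator {0..t} u * (\<integral>\<omega>. D1 \<omega> * k \<omega> u \<partial>M) \<partial>lborel)
        + (\<integral>\<omega>. D2 \<omega> * k \<omega> 0 \<partial>M) - (\<integral>\<omega>. D2 \<omega> * k \<omega> t \<partial>M)"
    by (simp add: unit)
  finally show "(\<integral>x. D x * k (fst x) (max 0 (min t (snd x))) \<partial>(M \<Otimes>\<^sub>M lborel))
      = (\<integral>u. indicator {0..t} u * (\<integral>\<omega>. D1 \<omega> * k \<omega> u \<partial>M) \<partial>lborel)
        + (\<integral>\<omega>. D2 \<omega> * k \<omega> 0 \<partial>M) - (\<integral>\<omega>. D2 \<omega> * k \<omega> t \<partial>M)" .
qed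

text \<open>Integration by parts for trigonometric functions extends to \<open>C\<^sub>b\<^sup>\<infinity>\<close>. The derivative of \<open>f\<close> is
  replaced by the increment along the direction \<open>c\<close>, which turns the identity into the vanishing
  of a signed measure; that can be checked on characteristic functions.\<close>

lemma integration_by_parts:
  fixes W :: "nat \<Rightarrow> 'a \<Rightarrow> real"
  assumes f: "smooth_bounded n f" and W: "\<And>i. i < n \<Longrightarrow> W i \<in> borel_measurable M"
    and D1: "integrable M D1" and D2: "integrable M D2"
    and trig: "\<And>l b. (\<integral>\<omega>. D1 \<omega> * cos ((\<Sum>i<n. l i * W i \<omega>) + b) \<partial>M)
      = - (\<Sum>i<n. l i * c i) * (\<integral>\<omega>. D2 \<omega> * sin ((\<Sum>i<n. l i * W i \<omega>) + b) \<partial>M)"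
  shows "(\<integral>\<omega>. D1 \<omega> * f (\<lambda>i. W i \<omega>) \<partial>M)
    = (\<integral>\<omega>. D2 \<omega> * (\<Sum>i<n. c i * partial_deriv i f (\<lambda>i. W i \<omega>)) \<partial>M)"
proof -
  interpret P: pair_sigma_finite M lborel ..
  have [measurable]: "D1 \<in> borel_measurable M" "D2 \<in> borel_measurable M" using D1 D2 by auto
  note Wm [measurable] = W
  obtain C where C: "\<And>x. \<bar>f x\<bar> \<le> C" by (rule smooth_bounded_bound[OF f]) blast
  define q where "q \<omega> u = f (\<lambda>i. W i \<omega> + u * c i)" for \<omega> u
  have q: "(\<lambda>(\<omega>, u). q \<omega> u) \<in> borel_measurable (M \<Otimes>\<^sub>M borel)"
    unfolding q_def case_prod_beta' by (rule smooth_bounded_measurable[OF f]) measurable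
  have qu [measurable]: "(\<lambda>\<omega>. q \<omega> u) \<in> borel_measurable M" for u
    unfolding q_def by (rule smooth_bounded_measurable[OF f]) measurable
  \<comment> \<open>The integrated form of the claim: E D2 q(t) - E D2 q(0) equals the integral of E
    D1 q(u) over [0,t]. It contains values of f but no derivatives, so it can be read as the
    vanishing of a signed measure.\<close>
  have zero: "(\<integral>u. indicator {0..t} u * (\<integral>\<omega>. D1 \<omega> * q \<omega> u \<partial>M) \<partial>lborel)
        + (\<integral>\<omega>. D2 \<omega> * q \<omega> 0 \<partial>M) - (\<integral>\<omega>. D2 \<omega> * q \<omega> t \<partial>M) = 0" if "t > 0" for t
  proof -
    define D where "D = (\<lambda>(\<omega>, u). D1 \<omega> * indicator {0..t} u + D2 \<omega> * (indicator {-1..<0} u - indicator {t<..t + 1} u :: real))"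
    note shift = shift_integral[OF D1 D2 \<open>t > 0\<close>, folded D_def]
    define V where "V i = (\<lambda>x. W i (fst x) + max 0 (min t (snd x)) * c i)" for i
    have Vm: "V i \<in> borel_measurable (M \<Otimes>\<^sub>M lborel)" if "i < n" for i
      unfolding V_def using W[OF that] by measurable
    have "(\<integral>x. D x * f (\<lambda>i\<in>{..<n}. V i x) \<partial>(M \<Otimes>\<^sub>M lborel)) = 0"
    proof (rule integral_PiM_zeroI[where I="{..<n}"])
      show "integrable (M \<Otimes>\<^sub>M lborel) D" by (rule shift(1)[OF q, of C]) (simp add: q_def C)
      fix S and l :: "nat \<Rightarrow> real" and b assume S: "finite S" "S \<subseteq> {..<n}"
      \<comment> \<open>Padding with zero frequencies makes \<open>trig\<close> applicable, which
        speaks of all n coordinates.\<close>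
      define l' where "l' i = (if i \<in> S then l i else 0)" for i
      define r where "r = (\<Sum>i<n. l' i * c i)"
      define A where "A \<omega> = (\<Sum>i<n. l' i * W i \<omega>)" for \<omega>
      have [measurable]: "A \<in> borel_measurable M" unfolding A_def[abs_def] by measurable
      have sum: "(\<Sum>i\<in>S. l i * V i x) = A (fst x) + max 0 (min t (snd x)) * r" for x
      proof -
        have "(\<Sum>i\<in>S. l i * V i x) = (\<Sum>i<n. l' i * V i x)"
          using S by (intro sum.mono_neutral_cong_left) (auto simp: l'_def)
        then show ?thesis
          by (simp add: V_def A_def r_def algebra_simps sum.distrib sum_distrib_left)
      qed
      define k where "k \<omega> u = cos (A \<omega> + u * r + b)" for \<omega> u
      have km: "(\<lambda>(\<omega>, u). k \<omega> u) \<in> borel_measurable (M \<Otimes>\<^sub>M borel)"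
        unfolding k_def by measurable
      define a a' where "a = (\<integral>\<omega>. D2 \<omega> * cos (A \<omega> + b) \<partial>M)" and "a' = (\<integral>\<omega>. D2 \<omega> * sin (A \<omega> + b) \<partial>M)"
      have int2: "integrable M (\<lambda>\<omega>. D2 \<omega> * cos (A \<omega> + b))" "integrable M (\<lambda>\<omega>. D2 \<omega> * sin (A \<omega> + b))"
        by (rule integrable_mult_bounded[OF D2, where C=1]; simp)+
      have cosu: "(\<integral>\<omega>. D2 \<omega> * cos (A \<omega> + u * r + b) \<partial>M) = cos (u * r) * a - sin (u * r) * a'" for u
      proof -
        have "(\<integral>\<omega>. D2 \<omega> * cos (A \<omega> + u * r + b) \<partial>M)
            = (\<integral>\<omega>. cos (u * r) * (D2 \<omega> * cos (A \<omega> + b)) - sin (u * r) * (D2 \<omega> * sin (A \<omega> + b)) \<partial>M)"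
        proof (rule Bochner_Integration.integral_cong[OF refl])
          fix \<omega>
          have "A \<omega> + u * r + b = u * r + (A \<omega> + b)" by simp
          then show "D2 \<omega> * cos (A \<omega> + u * r + b)
            = cos (u * r) * (D2 \<omega> * cos (A \<omega> + b)) - sin (u * r) * (D2 \<omega> * sin (A \<omega> + b))"
            by (simp only: cos_add) (simp add: algebra_simps)
        qed
        then show ?thesis using int2 by (simp add: a_def a'_def)
      qed
      have sinu: "(\<integral>\<omega>. D2 \<omega> * sin (A \<omega> + u * r + b) \<partial>M) = sin (u * r) * a + cos (u * r) * a'" for u
      proof -
        have "(\<integral>\<omega>. D2 \<omega> * sin (A \<omega> + u * r + b) \<partial>M)
            = (\<integral>\<omega>. sin (u * r) * (D2 \<omega> * cos (A \<omega> + b)) + cos (u * r) * (D2 \<omega> * sin (A \<omega> + b)) \<partial>M)"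
        proof (rule Bochner_Integration.integral_cong[OF refl])
          fix \<omega>
          have "A \<omega> + u * r + b = u * r + (A \<omega> + b)" by simp
          then show "D2 \<omega> * sin (A \<omega> + u * r + b)
            = sin (u * r) * (D2 \<omega> * cos (A \<omega> + b)) + cos (u * r) * (D2 \<omega> * sin (A \<omega> + b))"
            by (simp only: sin_add) (simp add: algebra_simps)
        qed
        then show ?thesis using int2 by (simp add: a_def a'_def)
      qed
      have d1: "(\<integral>\<omega>. D1 \<omega> * k \<omega> u \<partial>M) = - r * (sin (u * r) * a + cos (u * r) * a')" for u
        using trig[of l' "u * r + b"] unfolding k_def A_def[symmetric] r_def[symmetric] sinu[symmetric]
        by (simp add: add.assoc)
      \<comment> \<open>By \<open>trig\<close>, E D1 k(u) is the derivative in u of E D2 k(u):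
        differentiating the cosine in its phase u r yields -r times the sine.\<close>
      have "(\<integral>u. indicator {0..t} u *\<^sub>R (- r * (sin (u * r) * a + cos (u * r) * a')) \<partial>lborel)
          = (cos (t * r) * a - sin (t * r) * a') - (cos (0 * r) * a - sin (0 * r) * a')"
        by (rule integral_FTC_atLeastAtMost)
          (use \<open>t > 0\<close> in \<open>auto intro!: derivative_eq_intros continuous_intros
            simp: has_real_derivative_iff_has_vector_derivative[symmetric] algebra_simps\<close>)
      then have "(\<integral>u. indicator {0..t} u * (\<integral>\<omega>. D1 \<omega> * k \<omega> u \<partial>M) \<partial>lborel)
        + (\<integral>\<omega>. D2 \<omega> * k \<omega> 0 \<partial>M) - (\<integral>\<omega>. D2 \<omega> * k \<omega> t \<partial>M) = 0"
        unfolding d1 unfolding k_def cosu by simp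
      with shift(2)[OF km, of 1]
      show "(\<integral>x. D x * cos ((\<Sum>i\<in>S. l i * V i x) + b) \<partial>(M \<Otimes>\<^sub>M lborel)) = 0"
        unfolding sum by (simp add: k_def)
    next
      show "f \<in> borel_measurable (PiM {..<n} (\<lambda>_. borel))"
        using smooth_bounded_measurable[OF f, of "\<lambda>i y. y i" "PiM {..<n} (\<lambda>_. borel)"]
        by (simp add: measurable_component_singleton)
    qed (use Vm C in auto)
    moreover have "f (\<lambda>i\<in>{..<n}. V i x) = q (fst x) (max 0 (min t (snd x)))" for x
      unfolding q_def by (rule smooth_bounded_cong[OF f]) (simp add: V_def)
    ultimately show ?thesis
      using shift(2)[OF q, of C] C by (simp add: q_def)
  qed
  obtain K where K: "K \<ge> 0"
    "\<And>x h. \<bar>f (\<lambda>i. x i + h * c i) - f x - h * (\<Sum>i<n. c i * partial_deriv i f x)\<bar> \<le> K * h\<^sup>2"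
    using smooth_bounded_directional[OF f, of c] by metis
  obtain L where L: "L \<ge> 0" "\<And>x y. \<bar>f x - f y\<bar> \<le> L * (\<Sum>i<n. \<bar>x i - y i\<bar>)"
    using smooth_bounded_lipschitz[OF f] by metis
  define s where "s = (\<Sum>i<n. \<bar>c i\<bar>)"
  define d where "d \<omega> = (\<Sum>i<n. c i * partial_deriv i f (\<lambda>i. W i \<omega>))" for \<omega>
  have dm [measurable]: "d \<in> borel_measurable M"
    unfolding d_def[abs_def]
    by (intro borel_measurable_sum borel_measurable_times borel_measurable_const
        smooth_bounded_measurable[OF smooth_bounded_partial[OF f]] W) auto
  define \<alpha> \<beta> where "\<alpha> = (\<integral>\<omega>. D1 \<omega> * f (\<lambda>i. W i \<omega>) \<partial>M)" and "\<beta> = (\<integral>\<omega>. D2 \<omega> * d \<omega> \<partial>M)"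
  define E1 E2 where "E1 = (\<integral>\<omega>. \<bar>D1 \<omega>\<bar> \<partial>M)" and "E2 = (\<integral>\<omega>. \<bar>D2 \<omega>\<bar> \<partial>M)"
  have E: "E1 \<ge> 0" "E2 \<ge> 0" by (auto simp: E1_def E2_def)
  have s0: "s \<ge> 0" by (simp add: s_def sum_nonneg)
  have intq: "integrable M (\<lambda>\<omega>. D1 \<omega> * q \<omega> u)" "integrable M (\<lambda>\<omega>. D2 \<omega> * q \<omega> u)" for u
    by (rule integrable_mult_bounded[where C=C]; use D1 D2 C in \<open>simp add: q_def[abs_def]\<close>; fail | use D1 D2 C qu in \<open>simp add: q_def\<close>)+
  have intd: "integrable M (\<lambda>\<omega>. D2 \<omega> * d \<omega>)"
  proof -
    have "\<exists>B. \<forall>x. \<bar>partial_deriv i f x\<bar> \<le> B" if "i < n" for i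
      using smooth_bounded_bound[OF smooth_bounded_partial[OF f that]] by metis
    then obtain B where B: "\<And>i x. i < n \<Longrightarrow> \<bar>partial_deriv i f x\<bar> \<le> B i" by metis
    have "\<bar>d \<omega>\<bar> \<le> (\<Sum>i<n. \<bar>c i\<bar> * B i)" for \<omega>
      unfolding d_def by (rule order_trans[OF sum_abs sum_mono]) (auto simp: abs_mult intro!: mult_left_mono B)
    then show ?thesis by (intro integrable_mult_bounded[OF D2 dm])
  qed
  \<comment> \<open>Both sides of the integrated identity are expanded at t = 0 up to an error of
    order t^2. After division by t, the distance of \<alpha> and \<beta> is at most a multiple of
    t.\<close>
  have main: "t * \<bar>\<alpha> - \<beta>\<bar> \<le> (L * s * E1 + K * E2) * t\<^sup>2" if "t > 0" for t
  proof -
    have "\<bar>(\<integral>\<omega>. D2 \<omega> * q \<omega> t \<partial>M) - (\<integral>\<omega>. D2 \<omega> * q \<omega> 0 \<partial>M) - t * \<beta>\<bar> \<le> K * t\<^sup>2 * E2"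
    proof -
      have "(\<integral>\<omega>. D2 \<omega> * q \<omega> t \<partial>M) - (\<integral>\<omega>. D2 \<omega> * q \<omega> 0 \<partial>M) - t * \<beta>
          = (\<integral>\<omega>. D2 \<omega> * q \<omega> t - D2 \<omega> * q \<omega> 0 - t * (D2 \<omega> * d \<omega>) \<partial>M)"
        using intq intd by (simp add: \<beta>_def)
      also have "\<dots> = (\<integral>\<omega>. D2 \<omega> * (q \<omega> t - q \<omega> 0 - t * d \<omega>) \<partial>M)"
        by (simp add: algebra_simps)
      also have "\<bar>\<dots>\<bar> \<le> K * t\<^sup>2 * E2"
        unfolding E2_def
      proof (rule integral_abs_mult_le[OF D2])
        have "integrable M (\<lambda>\<omega>. D2 \<omega> * q \<omega> t - D2 \<omega> * q \<omega> 0 - t * (D2 \<omega> * d \<omega>))"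
          using intq intd by simp
        then show "integrable M (\<lambda>\<omega>. D2 \<omega> * (q \<omega> t - q \<omega> 0 - t * d \<omega>))"
          by (simp add: algebra_simps)
        show "\<bar>q \<omega> t - q \<omega> 0 - t * d \<omega>\<bar> \<le> K * t\<^sup>2" for \<omega>
          using K(2)[of "\<lambda>i. W i \<omega>" t] by (simp add: q_def d_def)
      qed
      finally show ?thesis .
    qed
    moreover have "\<bar>(\<integral>u. indicator {0..t} u * (\<integral>\<omega>. D1 \<omega> * q \<omega> u \<partial>M) \<partial>lborel) - t * \<alpha>\<bar> \<le> L * t * s * E1 * t"
    proof -
      have ia: "integrable lborel (indicator {0..t} :: real \<Rightarrow> real)"
        using that by (auto simp: integrable_indicator_iff)
      have iq: "integrable lborel (\<lambda>u. indicator {0..t} u * (\<integral>\<omega>. D1 \<omega> * q \<omega> u \<partial>M))"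
        by (rule shift_integral(3)[OF D1 D2 that q, of C]) (simp add: q_def C)
      have ii: "integrable lborel (\<lambda>u. indicator {0..t} u * ((\<integral>\<omega>. D1 \<omega> * q \<omega> u \<partial>M) - \<alpha>))"
        using Bochner_Integration.integrable_diff[OF iq integrable_mult_left[OF ia, of \<alpha>]]
        by (simp add: right_diff_distrib)
      have "(\<integral>u. indicator {0..t} u * (\<integral>\<omega>. D1 \<omega> * q \<omega> u \<partial>M) \<partial>lborel) - t * \<alpha>
        = (\<integral>u. indicator {0..t} u * ((\<integral>\<omega>. D1 \<omega> * q \<omega> u \<partial>M) - \<alpha>) \<partial>lborel)"
        unfolding right_diff_distrib
        by (subst Bochner_Integration.integral_diff[OF iq integrable_mult_left[OF ia]]) (use that in simp)
      also have "\<bar>\<dots>\<bar> \<le> (\<integral>u. \<bar>indicator {0..t} u * ((\<integral>\<omega>. D1 \<omega> * q \<omega> u \<partial>M) - \<alpha>)\<bar> \<partial>lborel)"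
        by (rule integral_abs_bound)
      also have "\<dots> \<le> (\<integral>u. indicator {0..t} u * (L * t * s * E1) \<partial>lborel)"
      proof (rule integral_mono)
        fix u
        have "\<bar>(\<integral>\<omega>. D1 \<omega> * q \<omega> u \<partial>M) - \<alpha>\<bar> \<le> L * t * s * E1" if u: "u \<in> {0..t}"
        proof -
          have i0: "integrable M (\<lambda>\<omega>. D1 \<omega> * f (\<lambda>i. W i \<omega>))" using intq(1)[of 0] by (simp add: q_def)
          have "(\<integral>\<omega>. D1 \<omega> * q \<omega> u \<partial>M) - \<alpha> = (\<integral>\<omega>. D1 \<omega> * (q \<omega> u - f (\<lambda>i. W i \<omega>)) \<partial>M)"
            using i0 intq(1)[of u] by (simp add: \<alpha>_def right_diff_distrib)
          also have "\<bar>\<dots>\<bar> \<le> L * t * s * E1"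
            unfolding E1_def
          proof (rule integral_abs_mult_le[OF D1])
            show "integrable M (\<lambda>\<omega>. D1 \<omega> * (q \<omega> u - f (\<lambda>i. W i \<omega>)))"
              using i0 intq(1)[of u] by (simp add: right_diff_distrib)
            fix \<omega>
            have "\<bar>q \<omega> u - f (\<lambda>i. W i \<omega>)\<bar> \<le> L * (\<Sum>i<n. \<bar>u * c i\<bar>)"
              using L(2)[of "\<lambda>i. W i \<omega> + u * c i" "\<lambda>i. W i \<omega>"] by (simp add: q_def)
            also have "(\<Sum>i<n. \<bar>u * c i\<bar>) = u * s" using u by (simp add: s_def sum_distrib_left abs_mult)
            also have "L * (u * s) \<le> L * (t * s)" using u L s0 by (intro mult_left_mono mult_right_mono) auto
            finally show "\<bar>q \<omega> u - f (\<lambda>i. W i \<omega>)\<bar> \<le> L * t * s" by simp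
          qed
          finally show ?thesis .
        qed
        then show "\<bar>indicator {0..t} u * ((\<integral>\<omega>. D1 \<omega> * q \<omega> u \<partial>M) - \<alpha>)\<bar> \<le> indicator {0..t} u * (L * t * s * E1)"
          by (auto simp: indicator_def)
      qed (use ii ia in \<open>auto intro!: integrable_mult_left integrable_abs\<close>)
      also have "\<dots> = L * t * s * E1 * t" using that by simp
      finally show ?thesis .
    qed
    ultimately have "\<bar>t * \<alpha> - t * \<beta>\<bar> \<le> L * t * s * E1 * t + K * t\<^sup>2 * E2"
      using zero[OF that] by linarith
    moreover have "t * \<bar>\<alpha> - \<beta>\<bar> = \<bar>t * \<alpha> - t * \<beta>\<bar>"
      using that by (simp add: abs_mult flip: right_diff_distrib)
    moreover have "L * t * s * E1 * t + K * t\<^sup>2 * E2 = (L * s * E1 + K * E2) * t\<^sup>2"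
      by (simp add: power2_eq_square algebra_simps)
    ultimately show ?thesis by simp
  qed
  have "\<bar>\<alpha> - \<beta>\<bar> \<le> 0"
  proof (rule field_le_epsilon)
    fix e :: real assume "e > 0"
    define B where "B = L * s * E1 + K * E2"
    have "B \<ge> 0" using L K s0 E by (simp add: B_def)
    define t where "t = e / (B + 1)"
    have t: "t > 0" "B * t \<le> e" using \<open>e > 0\<close> \<open>B \<ge> 0\<close> by (auto simp: t_def field_simps)
    have "t * \<bar>\<alpha> - \<beta>\<bar> \<le> t * (B * t)" using main[OF t(1)] by (simp add: B_def power2_eq_square mult_ac)
    then have "\<bar>\<alpha> - \<beta>\<bar> \<le> B * t" using t(1) by simp
    then show "\<bar>\<alpha> - \<beta>\<bar> \<le> 0 + e" using t(2) by simp
  qed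
  then show ?thesis by (simp add: \<alpha>_def \<beta>_def d_def)
qed

end

context gaussian_space
begin

text \<open>In the language of Malliavin calculus: the divergence of the direction L with random
  factor K is K L - E(K L). Trigonometric test functions also serve when the variables
  \<open>W i\<close> are linearly dependent and have no joint density.\<close>

lemma G_integration_by_parts:
  assumes f: "smooth_bounded n f" and W: "\<And>i. i < n \<Longrightarrow> W i \<in> G" and K: "K \<in> G" and L: "L \<in> G"
  shows "(\<integral>\<omega>. (K \<omega> * L \<omega> - (\<integral>\<omega>. K \<omega> * L \<omega> \<partial>M)) * f (\<lambda>i. W i \<omega>) \<partial>M)
    = (\<integral>\<omega>. K \<omega> * (\<Sum>i<n. (\<integral>\<omega>. W i \<omega> * L \<omega> \<partial>M) * partial_deriv i f (\<lambda>i. W i \<omega>)) \<partial>M)"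
proof (rule integration_by_parts[OF f])
  show "W i \<in> borel_measurable M" if "i < n" for i using W[OF that] by measurable
  show "integrable M (\<lambda>\<omega>. K \<omega> * L \<omega> - (\<integral>\<omega>. K \<omega> * L \<omega> \<partial>M))"
    using integrable_sq_int_mult[OF G_sq_int[OF K] G_sq_int[OF L]] by simp
  show "integrable M K" by (intro sq_int_integrable G_sq_int K)
  fix l :: "nat \<Rightarrow> real" and b
  have A: "(\<lambda>\<omega>. \<Sum>i<n. l i * W i \<omega>) \<in> G" by (intro G_sum G_cmult W) simp
  have "(\<integral>\<omega>. (\<Sum>i<n. l i * W i \<omega>) * L \<omega> \<partial>M) = (\<Sum>i<n. l i * (\<integral>\<omega>. W i \<omega> * L \<omega> \<partial>M))"
  proof -
    have "(\<integral>\<omega>. (\<Sum>i<n. l i * W i \<omega>) * L \<omega> \<partial>M) = (\<integral>\<omega>. (\<Sum>i<n. l i * (W i \<omega> * L \<omega>)) \<partial>M)"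
      by (simp add: sum_distrib_right mult.assoc)
    also have "\<dots> = (\<Sum>i<n. \<integral>\<omega>. l i * (W i \<omega> * L \<omega>) \<partial>M)"
      by (intro Bochner_Integration.integral_sum integrable_mult_right integrable_sq_int_mult G_sq_int W L) simp
    finally show ?thesis by simp
  qed
  then show "(\<integral>\<omega>. (K \<omega> * L \<omega> - (\<integral>\<omega>. K \<omega> * L \<omega> \<partial>M)) * cos ((\<Sum>i<n. l i * W i \<omega>) + b) \<partial>M)
      = - (\<Sum>i<n. l i * (\<integral>\<omega>. W i \<omega> * L \<omega> \<partial>M)) * (\<integral>\<omega>. K \<omega> * sin ((\<Sum>i<n. l i * W i \<omega>) + b) \<partial>M)"
    using G_mult_mult_cos[OF A K L, of b] by simp
qed

end

section \<open>Riemann--Stieltjes integrals and the Langevin equation\<close>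

lemma RS_partition_mem:
  fixes t \<xi> :: "nat \<Rightarrow> real"
  assumes "\<And>i. i < n \<Longrightarrow> t i \<le> t (Suc i)" "i \<le> n"
  shows "t 0 \<le> t i" "t i \<le> t n"
proof -
  show "t 0 \<le> t i" using assms
  proof (induction i)
    case (Suc i) then show ?case using order_trans[of "t 0" "t i" "t (Suc i)"] by simp
  qed simp
  show "t i \<le> t n" using \<open>i \<le> n\<close>
  proof (induction rule: inc_induct)
    case (step k) then show ?case using assms(1)[of k] by simp
  qed simp
qed

text \<open>\<open>RS_integral\<close> is a definite description, so uniqueness is what gives it a
  value. One equidistant partition, finer than both tolerances, brings I and J closer than 2 e,
  which is their distance.\<close>

lemma RS_integral_unique:
  assumes "a \<le> b" and I: "has_RS_integral f g a b I" and J: "has_RS_integral f g a b J"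
  shows "I = J"
proof (rule ccontr)
  assume "I \<noteq> J"
  define e where "e = \<bar>I - J\<bar> / 2"
  have "e > 0" using \<open>I \<noteq> J\<close> by (simp add: e_def)
  obtain \<eta>1 where 1: "\<eta>1 > 0" "\<And>(n::nat) t \<xi>. t 0 = a \<and> t n = b \<and>
        (\<forall>i<n. t i \<le> \<xi> i \<and> \<xi> i \<le> t (Suc i) \<and> t (Suc i) - t i < \<eta>1) \<Longrightarrow>
        \<bar>(\<Sum>i<n. f (\<xi> i) * (g (t (Suc i)) - g (t i))) - I\<bar> < e"
    using I \<open>e > 0\<close> unfolding has_RS_integral_def by meson
  obtain \<eta>2 where 2: "\<eta>2 > 0" "\<And>(n::nat) t \<xi>. t 0 = a \<and> t n = b \<and>
        (\<forall>i<n. t i \<le> \<xi> i \<and> \<xi> i \<le> t (Suc i) \<and> t (Suc i) - t i < \<eta>2) \<Longrightarrow>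
        \<bar>(\<Sum>i<n. f (\<xi> i) * (g (t (Suc i)) - g (t i))) - J\<bar> < e"
    using J \<open>e > 0\<close> unfolding has_RS_integral_def by meson
  obtain N :: nat where N: "real N > (b - a) / min \<eta>1 \<eta>2" using reals_Archimedean2 by blast
  define n where "n = Suc N"
  define t where "t i = a + real i * ((b - a) / n)" for i
  have h: "(b - a) / n < min \<eta>1 \<eta>2"
  proof -
    have "(b - a) / min \<eta>1 \<eta>2 < real n" using N by (simp add: n_def)
    moreover have "min \<eta>1 \<eta>2 > 0" "real n > 0" using 1 2 by (auto simp: n_def)
    ultimately show ?thesis by (simp only: pos_divide_less_eq mult.commute)
  qed
  have step: "t (Suc i) - t i = (b - a) / n" for i by (simp add: t_def distrib_right add_divide_distrib)
  have le: "t i \<le> t (Suc i)" for i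
    using step[of i] divide_nonneg_nonneg[of "b - a" "real n"] \<open>a \<le> b\<close> by linarith
  have part: "t 0 = a \<and> t n = b \<and> (\<forall>i<n. t i \<le> t i \<and> t i \<le> t (Suc i) \<and> t (Suc i) - t i < \<eta>)"
    if "(b - a) / n < \<eta>" for \<eta>
    using that le step by (auto simp: t_def n_def)
  have "\<bar>(\<Sum>i<n. f (t i) * (g (t (Suc i)) - g (t i))) - I\<bar> < e"
    by (rule 1(2), rule part) (use h in simp)
  moreover have "\<bar>(\<Sum>i<n. f (t i) * (g (t (Suc i)) - g (t i))) - J\<bar> < e"
    by (rule 2(2), rule part) (use h in simp)
  moreover have "\<bar>I - J\<bar> \<le> \<bar>x - I\<bar> + \<bar>x - J\<bar>" for x by linarith
  ultimately have "\<bar>I - J\<bar> < e + e" by (meson add_strict_mono order_le_less_trans)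
  then show False by (simp add: e_def)
qed

text \<open>Each term of a Riemann--Stieltjes sum is an increment of \<open>f g\<close> minus two increments of \<open>f\<close>
  with frozen \<open>g\<close>.\<close>

lemma has_RS_integral_by_parts:
  assumes "a \<le> b" and f: "\<And>s. (f has_real_derivative f' s) (at s)"
    and f': "continuous_on {a..b} f'" and g: "continuous_on {a..b} g"
  shows "has_RS_integral f g a b (f b * g b - f a * g a - integral {a..b} (\<lambda>s. f' s * g s))"
  unfolding has_RS_integral_def
proof (intro allI impI)
  fix \<epsilon> :: real assume "\<epsilon> > 0"
  obtain C where C: "C \<ge> 0" "\<And>s. s \<in> {a..b} \<Longrightarrow> \<bar>f' s\<bar> \<le> C"
  proof -
    have "bounded (f' ` {a..b})" using f' by (intro compact_imp_bounded compact_continuous_image) auto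
    then obtain C where "\<forall>s\<in>{a..b}. norm (f' s) \<le> C" by (auto simp: bounded_iff)
    then have "\<bar>f' s\<bar> \<le> max 0 C" if "s \<in> {a..b}" for s
      using that by (simp add: le_max_iff_disj)
    then show ?thesis using that[of "max 0 C"] by simp
  qed
  define e where "e = \<epsilon> / (C * (b - a) + 1)"
  have pos: "C * (b - a) + 1 > 0" using C \<open>a \<le> b\<close> by (simp add: add_nonneg_pos)
  then have "e > 0" using \<open>\<epsilon> > 0\<close> by (simp add: e_def)
  have eC: "e * C * (b - a) < \<epsilon>"
  proof -
    have "e * (C * (b - a)) < e * (C * (b - a) + 1)" using \<open>e > 0\<close> by simp
    also have "\<dots> = \<epsilon>" using pos by (simp add: e_def)
    finally show ?thesis by (simp add: mult.assoc)
  qed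
  have "uniformly_continuous_on {a..b} g"
    using g by (intro compact_uniformly_continuous) auto
  then obtain \<eta> where \<eta>: "\<eta> > 0" "\<And>s u. s \<in> {a..b} \<Longrightarrow> u \<in> {a..b} \<Longrightarrow> \<bar>s - u\<bar> < \<eta> \<Longrightarrow> \<bar>g s - g u\<bar> < e"
    using \<open>e > 0\<close> unfolding uniformly_continuous_on_def dist_real_def by metis
  define F where "F s = integral {a..s} (\<lambda>s. f' s * g s)" for s
  have cont: "continuous_on {a..b} (\<lambda>s. f' s * g s)" by (intro continuous_intros f' g)
  have piece: "\<bar>g c * (f v - f u) - (F v - F u)\<bar> \<le> e * C * (v - u)"
    if uv: "a \<le> u" "u \<le> v" "v \<le> b" and c: "c \<in> {a..b}" "\<And>s. s \<in> {u..v} \<Longrightarrow> \<bar>c - s\<bar> < \<eta>" for c u v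
  proof -
    have sub: "{u..v} \<subseteq> {a..b}" using uv by auto
    have "F u + integral {u..v} (\<lambda>s. f' s * g s) = F v"
      unfolding F_def using uv
      by (intro Henstock_Kurzweil_Integration.integral_combine integrable_continuous_real
          continuous_on_subset[OF cont]) auto
    moreover have "(f' has_integral (f v - f u)) {u..v}"
      using uv by (intro fundamental_theorem_of_calculus)
        (auto simp: has_real_derivative_iff_has_vector_derivative[symmetric] intro: f has_field_derivative_at_within)
    then have gc: "((\<lambda>s. g c * f' s) has_integral g c * (f v - f u)) {u..v}" by (rule has_integral_mult_right)
    moreover have "(\<lambda>s. f' s * g s) integrable_on {u..v}"
      by (intro integrable_continuous_real continuous_on_subset[OF cont sub])
    ultimately have eq: "g c * (f v - f u) - (F v - F u) = integral {u..v} (\<lambda>s. g c * f' s - f' s * g s)"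
      using Henstock_Kurzweil_Integration.integral_diff[OF has_integral_integrable[OF gc]] integral_unique[OF gc]
      by (metis add_diff_cancel_left')
    have "norm (integral {u..v} (\<lambda>s. g c * f' s - f' s * g s)) \<le> (e * C) * (v - u)"
    proof (rule integral_bound[OF uv(2)])
      show "continuous_on {u..v} (\<lambda>s. g c * f' s - f' s * g s)"
        by (intro continuous_intros continuous_on_subset[OF f' sub] continuous_on_subset[OF g sub])
      fix s assume s: "s \<in> {u..v}"
      have "\<bar>g c - g s\<bar> * \<bar>f' s\<bar> \<le> e * C"
        using \<eta>(2)[of c s] c s sub C \<open>e > 0\<close> by (intro mult_mono) (auto intro: less_imp_le)
      then show "norm (g c * f' s - f' s * g s) \<le> e * C"
        by (simp add: abs_mult[symmetric] algebra_simps)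
    qed
    then show ?thesis unfolding eq by simp
  qed
  show "\<exists>\<eta>>0. \<forall>(n::nat) t \<xi>. t 0 = a \<and> t n = b \<and>
        (\<forall>i<n. t i \<le> \<xi> i \<and> \<xi> i \<le> t (Suc i) \<and> t (Suc i) - t i < \<eta>) \<longrightarrow>
        \<bar>(\<Sum>i<n. f (\<xi> i) * (g (t (Suc i)) - g (t i)))
          - (f b * g b - f a * g a - integral {a..b} (\<lambda>s. f' s * g s))\<bar> < \<epsilon>"
  proof (intro exI[of _ \<eta>] conjI allI impI \<eta>(1))
    fix n :: nat and t \<xi>
    assume A: "t 0 = a \<and> t n = b \<and> (\<forall>i<n. t i \<le> \<xi> i \<and> \<xi> i \<le> t (Suc i) \<and> t (Suc i) - t i < \<eta>)"
    have mono: "t i \<le> t (Suc i)" if "i < n" for i using A that order_trans by blast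
    have mem: "a \<le> t i" "t i \<le> b" if "i \<le> n" for i
      using RS_partition_mem[of n t i] mono that A by auto
    define S where "S i = f (\<xi> i) * (g (t (Suc i)) - g (t i))" for i
    define P where "P s = f s * g s - F s" for s
    have term_le: "\<bar>S i - (P (t (Suc i)) - P (t i))\<bar> \<le> e * C * (t (Suc i) - t i)" if i: "i < n" for i
    proof -
      have x: "t i \<le> \<xi> i" "\<xi> i \<le> t (Suc i)" "t (Suc i) - t i < \<eta>" using A i by auto
      have m: "a \<le> t i" "t (Suc i) \<le> b" using mem[of i] mem[of "Suc i"] i by auto
      have "\<bar>g (t (Suc i)) * (f (t (Suc i)) - f (\<xi> i)) - (F (t (Suc i)) - F (\<xi> i))\<bar> \<le> e * C * (t (Suc i) - \<xi> i)"
        using x m by (intro piece) auto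
      moreover have "\<bar>g (t i) * (f (\<xi> i) - f (t i)) - (F (\<xi> i) - F (t i))\<bar> \<le> e * C * (\<xi> i - t i)"
        using x m by (intro piece) auto
      moreover have "S i - (P (t (Suc i)) - P (t i)) =
         - ((g (t (Suc i)) * (f (t (Suc i)) - f (\<xi> i)) - (F (t (Suc i)) - F (\<xi> i)))
          + (g (t i) * (f (\<xi> i) - f (t i)) - (F (\<xi> i) - F (t i))))"
        by (simp add: S_def P_def algebra_simps)
      moreover have "e * C * (t (Suc i) - \<xi> i) + e * C * (\<xi> i - t i) = e * C * (t (Suc i) - t i)"
        by (simp add: algebra_simps)
      ultimately show ?thesis by linarith
    qed
    have "(\<Sum>i<n. P (t (Suc i)) - P (t i)) = P b - P a"
      using A sum_lessThan_telescope[of "\<lambda>i. P (t i)" n] by simp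
    also have "\<dots> = f b * g b - f a * g a - integral {a..b} (\<lambda>s. f' s * g s)"
      by (simp add: P_def F_def)
    finally have "(\<Sum>i<n. S i) - (f b * g b - f a * g a - integral {a..b} (\<lambda>s. f' s * g s))
      = (\<Sum>i<n. S i - (P (t (Suc i)) - P (t i)))" by (simp add: sum_subtractf)
    also have "\<bar>\<dots>\<bar> \<le> (\<Sum>i<n. e * C * (t (Suc i) - t i))"
      by (rule order_trans[OF sum_abs sum_mono]) (use term_le in auto)
    also have "\<dots> = e * C * (b - a)"
      using A sum_lessThan_telescope[of t n] by (simp add: sum_distrib_left[symmetric])
    also have "\<dots> < \<epsilon>" by (rule eC)
    finally show "\<bar>(\<Sum>i<n. f (\<xi> i) * (g (t (Suc i)) - g (t i)))
          - (f b * g b - f a * g a - integral {a..b} (\<lambda>s. f' s * g s))\<bar> < \<epsilon>"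
      by (simp add: S_def)
  qed
qed

text \<open>The integrator is merely continuous, so the integral exists through the smoothness of
  the exponential and is evaluated by parts.\<close>

lemma RS_integral_exp:
  assumes "0 \<le> t" and g: "continuous_on {0..t} g"
  shows "RS_integral (\<lambda>s. exp (- s)) g 0 t = exp (- t) * g t - g 0 + integral {0..t} (\<lambda>s. exp (- s) * g s)"
proof -
  have "has_RS_integral (\<lambda>s. exp (- s)) g 0 t
     (exp (- t) * g t - exp (- 0) * g 0 - integral {0..t} (\<lambda>s. (- exp (- s)) * g s))"
    by (rule has_RS_integral_by_parts[OF assms(1) _ _ g]) (auto intro!: derivative_eq_intros continuous_intros)
  then have *: "has_RS_integral (\<lambda>s. exp (- s)) g 0 t
     (exp (- t) * g t - g 0 + integral {0..t} (\<lambda>s. exp (- s) * g s))" by simp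
  then show ?thesis
    unfolding RS_integral_def by (intro the_equality RS_integral_unique[OF assms(1) _ *])
qed

text \<open>Variation of constants, with the integrating factor exp(c s). The equation will be
  solved for X - V in terms of V, and for the integral of X in terms of Y.\<close>

lemma linear_integral_equation:
  fixes g R :: "real \<Rightarrow> real"
  assumes g: "continuous_on {0..T} g" and R: "continuous_on {0..T} R"
    and eq: "\<And>t. t \<in> {0..T} \<Longrightarrow> R t = r0 + integral {0..t} (\<lambda>s. g s - c * R s)"
    and t: "t \<in> {0..T}"
  shows "R t = exp (- c * t) * r0 + integral {0..t} (\<lambda>s. exp (- c * (t - s)) * g s)"
proof -
  have cont: "continuous_on {0..T} (\<lambda>s. g s - c * R s)" by (intro continuous_intros g R)
  have der: "(R has_real_derivative (g s - c * R s)) (at s within {0..T})" if s: "s \<in> {0..T}" for s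
  proof (rule has_field_derivative_transform_within[OF _ zero_less_one s])
    show "((\<lambda>u. r0 + integral {0..u} (\<lambda>s. g s - c * R s)) has_real_derivative (g s - c * R s)) (at s within {0..T})"
      by (rule DERIV_cong[OF DERIV_add[OF DERIV_const integral_has_real_derivative[OF cont s]]]) simp
  qed (use eq in simp)
  have "((\<lambda>s. exp (c * s) * g s) has_integral (exp (c * t) * R t - exp (c * 0) * R 0)) {0..t}"
  proof (rule fundamental_theorem_of_calculus)
    show "0 \<le> t" using t by simp
    fix s assume s: "s \<in> {0..t}"
    have "((\<lambda>s. exp (c * s) * R s) has_real_derivative
        (exp (c * s) * c) * R s + (g s - c * R s) * exp (c * s)) (at s within {0..T})"
      using s t by (intro DERIV_mult der) (auto intro!: derivative_eq_intros)
    moreover have "(exp (c * s) * c) * R s + (g s - c * R s) * exp (c * s) = exp (c * s) * g s"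
      by (simp add: algebra_simps)
    ultimately have "((\<lambda>s. exp (c * s) * R s) has_real_derivative exp (c * s) * g s) (at s within {0..t})"
      using t by (auto elim: has_field_derivative_subset)
    then show "((\<lambda>s. exp (c * s) * R s) has_vector_derivative exp (c * s) * g s) (at s within {0..t})"
      by (simp add: has_real_derivative_iff_has_vector_derivative)
  qed
  moreover have "R 0 = r0" using eq[of 0] t by simp
  ultimately have "integral {0..t} (\<lambda>s. exp (c * s) * g s) = exp (c * t) * R t - r0"
    by (simp add: integral_unique)
  moreover have "integral {0..t} (\<lambda>s. exp (- c * (t - s)) * g s) = exp (- c * t) * integral {0..t} (\<lambda>s. exp (c * s) * g s)"
  proof -
    have "- c * (t - s) = - c * t + c * s" for s by (simp add: algebra_simps)
    then have "exp (- c * (t - s)) * g s = exp (- c * t) * (exp (c * s) * g s)" for s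
      by (simp only: exp_add mult.assoc)
    then show ?thesis by (simp only: integral_mult_right)
  qed
  moreover have "exp (- c * t) * (exp (c * t) * R t) = R t"
    by (simp add: exp_minus)
  ultimately show ?thesis by (simp add: right_diff_distrib)
qed

section \<open>Covariance of increments of fractional Brownian motion\<close>

lemma convex_abs_powr:
  fixes p :: real
  assumes "1 \<le> p"
  shows "convex_on UNIV (\<lambda>x::real. \<bar>x\<bar> powr p)"
proof (rule convex_onI)
  fix t x y :: real assume t: "0 < t" "t < 1"
  \<comment> \<open>Convexity of the power is invoked for nonzero x and y; a zero argument reduces
    to this bound.\<close>
  have small: "s powr p \<le> s" if "0 < s" "s < 1" for s
    using powr_mono'[OF assms, of s] that by simp
  have "\<bar>(1 - t) * x + t * y\<bar> powr p \<le> ((1 - t) * \<bar>x\<bar> + t * \<bar>y\<bar>) powr p"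
  proof (rule powr_mono2)
    show "\<bar>(1 - t) * x + t * y\<bar> \<le> (1 - t) * \<bar>x\<bar> + t * \<bar>y\<bar>"
      using abs_triangle_ineq[of "(1 - t) * x" "t * y"] t by (simp add: abs_mult)
  qed (use assms in auto)
  also have "\<dots> \<le> (1 - t) * \<bar>x\<bar> powr p + t * \<bar>y\<bar> powr p"
  proof (cases "x = 0 \<or> y = 0")
    case True
    then show ?thesis
    proof
      assume "x = 0"
      have "(t * \<bar>y\<bar>) powr p \<le> t * \<bar>y\<bar> powr p"
        using small[OF t] t by (subst powr_mult) (auto intro!: mult_right_mono)
      then show ?thesis using \<open>x = 0\<close> assms by simp
    next
      assume "y = 0"
      have "((1 - t) * \<bar>x\<bar>) powr p \<le> (1 - t) * \<bar>x\<bar> powr p"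
        using small[of "1 - t"] t by (subst powr_mult) (auto intro!: mult_right_mono)
      then show ?thesis using \<open>y = 0\<close> assms by simp
    qed
  next
    case False
    then show ?thesis
      using convex_onD[OF powr_convex[OF assms], of t "\<bar>x\<bar>" "\<bar>y\<bar>"] t by simp
  qed
  finally show "\<bar>(1 - t) *\<^sub>R x + t *\<^sub>R y\<bar> powr p \<le> (1 - t) * \<bar>x\<bar> powr p + t * \<bar>y\<bar> powr p" by simp
qed simp

text \<open>Both u and v lie between q and p and have the same sum as q and p; moving a pair apart
  at constant sum does not decrease the sum of a convex function. The weight t that expresses u is
  mirrored to express v.\<close>

lemma convex_on_outer_pair:
  fixes f :: "real \<Rightarrow> real"
  assumes f: "convex_on UNIV f" and "q \<le> u" "q \<le> v" and sum: "u + v = p + q"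
  shows "f u + f v \<le> f p + f q"
proof (cases "p = q")
  case True then show ?thesis using assms by (smt (verit))
next
  case False
  define t where "t = (u - q) / (p - q)"
  have "p > q" using assms False by linarith
  then have t: "0 \<le> t" "t \<le> 1" using assms by (auto simp: t_def field_simps)
  have u: "u = (1 - t) * q + t * p"
  proof -
    have "t * (p - q) = u - q" using \<open>p > q\<close> by (simp add: t_def)
    then show ?thesis by (simp add: algebra_simps)
  qed
  have v: "v = (1 - t) * p + t * q"
    using sum u by (simp add: algebra_simps)
  have "f u \<le> (1 - t) * f q + t * f p"
    using convex_onD[OF f t, of q p] u by simp
  moreover have "f v \<le> (1 - t) * f p + t * f q"
    using convex_onD[OF f t, of p q] v by simp
  ultimately show ?thesis by (simp add: algebra_simps)
qed

text \<open>The single powers cancel. What remains compares |x|^(2H) at b - d, a - c with its values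
  at b - c, a - d; the two pairs have the same sum and the second is further apart, so convexity for
  2H >= 1 decides.\<close>

lemma fbm_cov_increments_nonneg:
  assumes "1 / 2 < H" "a \<le> b" "c \<le> d"
  shows "0 \<le> fbm_cov H b d - fbm_cov H b c - fbm_cov H a d + fbm_cov H a c"
proof -
  have "\<bar>b - d\<bar> powr (2 * H) + \<bar>a - c\<bar> powr (2 * H) \<le> \<bar>b - c\<bar> powr (2 * H) + \<bar>a - d\<bar> powr (2 * H)"
    by (rule convex_on_outer_pair[OF convex_abs_powr]) (use assms in auto)
  then show ?thesis unfolding fbm_cov_def by (simp add: field_simps)
qed

text \<open>Passage from the density in the definition to the form of Gaussianity that
  \<open>gaussian_space\<close> asks for.\<close>

lemma centered_gaussian_rv_cos:
  assumes "prob_space M" and Z: "centered_gaussian_rv M Z"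
  shows "Z \<in> sq_int M" "(\<integral>\<omega>. cos (Z \<omega>) \<partial>M) = exp (- ((rms M Z)\<^sup>2 / 2))" "(\<integral>\<omega>. sin (Z \<omega>) \<partial>M) = 0"
proof -
  interpret prob_space M by fact
  have Zm [measurable]: "Z \<in> borel_measurable M" using Z by (simp add: centered_gaussian_rv_def)
  have "Z \<in> sq_int M \<and> (\<integral>\<omega>. cos (Z \<omega>) \<partial>M) = exp (- ((rms M Z)\<^sup>2 / 2)) \<and> (\<integral>\<omega>. sin (Z \<omega>) \<partial>M) = 0"
  proof (cases "AE \<omega> in M. Z \<omega> = 0")
    case True
    have i: "integrable M (\<lambda>\<omega>. (Z \<omega>)\<^sup>2) = integrable M (\<lambda>\<omega>. 0 :: real)"
      by (rule integrable_cong_AE) (use True in auto)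
    have "(\<integral>\<omega>. (Z \<omega>)\<^sup>2 \<partial>M) = (\<integral>\<omega>. 0 \<partial>M)" by (rule integral_cong_AE) (use True in auto)
    moreover have "(\<integral>\<omega>. cos (Z \<omega>) \<partial>M) = (\<integral>\<omega>. 1 \<partial>M)" by (rule integral_cong_AE) (use True in auto)
    moreover have "(\<integral>\<omega>. sin (Z \<omega>) \<partial>M) = (\<integral>\<omega>. 0 \<partial>M)" by (rule integral_cong_AE) (use True in auto)
    ultimately show ?thesis using i by (simp add: sq_int_def rms_square prob_space)
  next
    case False
    then obtain \<sigma> where \<sigma>: "\<sigma> > 0" and D: "distributed M lborel Z (\<lambda>x. ennreal (normal_density 0 \<sigma> x))"
      using Z unfolding centered_gaussian_rv_def by blast
    define S where "S = (\<lambda>\<omega>. Z \<omega> / \<sigma>)"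
    have [measurable]: "S \<in> borel_measurable M" by (simp add: S_def)
    have "distributed M lborel S (\<lambda>x. ennreal (std_normal_density x))"
      using D normal_standard_normal_convert[OF \<sigma>, of Z 0] by (simp add: S_def)
    then have "distr M lborel S = std_normal_distribution" by (rule distributed_distr_eq_density)
    then have eq: "distr M borel S = std_normal_distribution"
      by (simp cong: distr_cong)
    have Zs: "Z \<omega> = \<sigma> * S \<omega>" for \<omega> using \<sigma> by (simp add: S_def)
    have "integrable (distr M borel S) (\<lambda>x. x\<^sup>2)"
      unfolding eq by (rule integrable_std_normal_distribution_moment)
    then have i: "integrable M (\<lambda>\<omega>. (S \<omega>)\<^sup>2)" by (simp add: integrable_distr_eq)
    have "(\<integral>x. x\<^sup>2 \<partial>distr M borel S) = 1"
      unfolding eq using std_normal_distribution_even_moments(1)[of 1] by simp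
    then have e: "(\<integral>\<omega>. (S \<omega>)\<^sup>2 \<partial>M) = 1" by (simp add: integral_distr)
    have "char (distr M borel S) \<sigma> = complex_of_real (exp (- (\<sigma>\<^sup>2) / 2))"
      unfolding eq char_std_normal_distribution ..
    moreover have "char (distr M borel S) \<sigma> = Complex (\<integral>\<omega>. cos (\<sigma> * S \<omega>) \<partial>M) (\<integral>\<omega>. sin (\<sigma> * S \<omega>) \<partial>M)"
      by (subst char_cos_sin) (simp_all add: real_distribution_distr integral_distr)
    ultimately have "(\<integral>\<omega>. cos (Z \<omega>) \<partial>M) = exp (- (\<sigma>\<^sup>2) / 2)" "(\<integral>\<omega>. sin (Z \<omega>) \<partial>M) = 0"
      unfolding Zs by (simp_all add: complex_of_real_def)
    moreover have "Z \<in> sq_int M" "(rms M Z)\<^sup>2 = \<sigma>\<^sup>2"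
      using i e by (auto simp: sq_int_def rms_square Zs[abs_def] power_mult_distrib)
    ultimately show ?thesis by simp
  qed
  then show "Z \<in> sq_int M" "(\<integral>\<omega>. cos (Z \<omega>) \<partial>M) = exp (- ((rms M Z)\<^sup>2 / 2))" "(\<integral>\<omega>. sin (Z \<omega>) \<partial>M) = 0"
    by auto
qed

section \<open>The Gaussian space of a process\<close>

definition process_span :: "(real \<Rightarrow> 'w \<Rightarrow> real) \<Rightarrow> ('w \<Rightarrow> real) set" where
  "process_span B = {\<lambda>\<omega>. \<Sum>t\<in>F. c t * B t \<omega> | F c. finite F \<and> F \<subseteq> {0..}}"

text \<open>The first Wiener chaos of B, that is, the mean-square closure of its linear span.
  Phrased by approximation within every e, its closedness is a matter of the triangle
  inequality.\<close>

definition process_space :: "'w measure \<Rightarrow> (real \<Rightarrow> 'w \<Rightarrow> real) \<Rightarrow> ('w \<Rightarrow> real) set" where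
  "process_space M B = {Z \<in> sq_int M. \<forall>e>0. \<exists>Y\<in>process_span B. rms M (\<lambda>\<omega>. Z \<omega> - Y \<omega>) < e}"

lemma process_span_lin:
  assumes "Z \<in> process_span B" "W \<in> process_span B"
  shows "(\<lambda>\<omega>. a * Z \<omega> + b * W \<omega>) \<in> process_span B"
proof -
  obtain F c where F: "finite F" "F \<subseteq> {0..}" and Z: "Z = (\<lambda>\<omega>. \<Sum>t\<in>F. c t * B t \<omega>)"
    using assms(1) by (auto simp: process_span_def)
  obtain F' c' where F': "finite F'" "F' \<subseteq> {0..}" and W: "W = (\<lambda>\<omega>. \<Sum>t\<in>F'. c' t * B t \<omega>)"
    using assms(2) by (auto simp: process_span_def)
  define d where "d t = a * (if t \<in> F then c t else 0) + b * (if t \<in> F' then c' t else 0)" for t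
  have "a * Z \<omega> + b * W \<omega> = (\<Sum>t\<in>F \<union> F'. d t * B t \<omega>)" for \<omega>
  proof -
    have "(\<Sum>t\<in>F \<union> F'. (if t \<in> F then c t else 0) * B t \<omega>) = Z \<omega>"
      unfolding Z by (rule sum.mono_neutral_cong_right) (use F F' in auto)
    moreover have "(\<Sum>t\<in>F \<union> F'. (if t \<in> F' then c' t else 0) * B t \<omega>) = W \<omega>"
      unfolding W by (rule sum.mono_neutral_cong_right) (use F F' in auto)
    ultimately show ?thesis
      by (simp add: d_def distrib_right sum.distrib mult.assoc flip: sum_distrib_left)
  qed
  then have eq: "(\<lambda>\<omega>. a * Z \<omega> + b * W \<omega>) = (\<lambda>\<omega>. \<Sum>t\<in>F \<union> F'. d t * B t \<omega>)" by auto
  show ?thesis unfolding eq process_span_def using F F' by blast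
qed

text \<open>Both sides of the characteristic-function identity are continuous in mean square.\<close>

lemma gaussian_space_process_space:
  assumes "prob_space M" and B: "centered_gaussian_process M B"
  shows "gaussian_space M (process_space M B)"
proof -
  interpret prob_space M by fact
  have span: "Y \<in> sq_int M" "(\<integral>\<omega>. cos (Y \<omega>) \<partial>M) = exp (- ((rms M Y)\<^sup>2 / 2))" "(\<integral>\<omega>. sin (Y \<omega>) \<partial>M) = 0"
    if "Y \<in> process_span B" for Y
    using that B centered_gaussian_rv_cos[OF \<open>prob_space M\<close>]
    unfolding process_span_def centered_gaussian_process_def by auto
  have approx: "\<exists>Y. (\<forall>n. Y n \<in> process_span B) \<and> (\<lambda>n. rms M (\<lambda>\<omega>. Y n \<omega> - Z \<omega>)) \<longlonglongrightarrow> 0"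
    if "Z \<in> process_space M B" for Z
  proof -
    have "\<exists>Y\<in>process_span B. rms M (\<lambda>\<omega>. Z \<omega> - Y \<omega>) < inverse (Suc n)" for n
      using that by (simp add: process_space_def)
    then obtain Y where Y: "\<And>n. Y n \<in> process_span B" "\<And>n. rms M (\<lambda>\<omega>. Z \<omega> - Y n \<omega>) < inverse (Suc n)"
      by metis
    have "(\<lambda>n. rms M (\<lambda>\<omega>. Y n \<omega> - Z \<omega>)) \<longlonglongrightarrow> 0"
      by (rule Lim_null_comparison[OF _ LIMSEQ_inverse_real_of_nat])
        (use Y(2) in \<open>auto simp: rms_minus_commute[of M "Y _"] intro!: always_eventually less_imp_le\<close>)
    with Y show ?thesis by blast
  qed
  have lip: "(\<lambda>n. \<integral>\<omega>. f (Y n \<omega>) \<partial>M) \<longlonglongrightarrow> (\<integral>\<omega>. f (Z \<omega>) \<partial>M)"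
    if Y: "\<And>n. Y n \<in> sq_int M" and Z: "Z \<in> sq_int M" and lim: "(\<lambda>n. rms M (\<lambda>\<omega>. Y n \<omega> - Z \<omega>)) \<longlonglongrightarrow> 0"
      and f: "\<And>x y. \<bar>f x - f y\<bar> \<le> \<bar>x - y\<bar>" "\<And>x. \<bar>f x\<bar> \<le> 1" and [measurable]: "f \<in> borel_measurable borel"
    for Y Z and f :: "real \<Rightarrow> real"
  proof (rule Lim_null[THEN iffD2], rule Lim_null_comparison[OF _ lim], rule always_eventually, rule allI)
    fix n
    have [measurable]: "Y n \<in> borel_measurable M" "Z \<in> borel_measurable M" using Y Z by (auto intro: sq_int_measurable)
    have i: "integrable M (\<lambda>\<omega>. f (Y n \<omega>))" "integrable M (\<lambda>\<omega>. f (Z \<omega>))"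
      by (rule integrable_const_bound[of _ 1]; use f in simp)+
    have "(\<integral>\<omega>. f (Y n \<omega>) \<partial>M) - (\<integral>\<omega>. f (Z \<omega>) \<partial>M) = (\<integral>\<omega>. f (Y n \<omega>) - f (Z \<omega>) \<partial>M)" using i by simp
    also have "\<bar>\<dots>\<bar> \<le> (\<integral>\<omega>. \<bar>f (Y n \<omega>) - f (Z \<omega>)\<bar> \<partial>M)" by (rule integral_abs_bound)
    also have "\<dots> \<le> (\<integral>\<omega>. \<bar>Y n \<omega> - Z \<omega>\<bar> \<partial>M)"
      using i f integrable_abs[OF sq_int_integrable[OF sq_int_diff[OF Y Z]]]
      by (intro integral_mono) (auto intro!: integrable_abs)
    also have "\<dots> \<le> rms M (\<lambda>\<omega>. Y n \<omega> - Z \<omega>)" by (intro expectation_abs_le_rms sq_int_diff Y Z)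
    finally show "norm ((\<integral>\<omega>. f (Y n \<omega>) \<partial>M) - (\<integral>\<omega>. f (Z \<omega>) \<partial>M)) \<le> rms M (\<lambda>\<omega>. Y n \<omega> - Z \<omega>)" by simp
  qed
  have lip_trig: "\<bar>sin x - sin y\<bar> \<le> \<bar>x - y\<bar>" "\<bar>cos x - cos y\<bar> \<le> \<bar>x - y\<bar>" for x y :: real
    using field_differentiable_bound[of UNIV sin cos 1 x y] field_differentiable_bound[of UNIV cos "\<lambda>x. - sin x" 1 x y]
    by (auto intro!: derivative_eq_intros)
  show ?thesis
  proof (unfold_locales)
    show "Z \<in> sq_int M" if "Z \<in> process_space M B" for Z using that by (simp add: process_space_def)
    show "(\<lambda>\<omega>. 0) \<in> process_space M B"
    proof -
      have "(\<lambda>\<omega>. 0) \<in> process_span B" unfolding process_span_def by (auto intro!: exI[of _ "{}"])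
      then show ?thesis by (auto simp: process_space_def rms_def intro!: bexI[of _ "\<lambda>\<omega>. 0"])
    qed
    show "(\<lambda>\<omega>. a * Z \<omega> + b * W \<omega>) \<in> process_space M B"
      if ZW: "Z \<in> process_space M B" "W \<in> process_space M B" for Z W a b
      unfolding process_space_def
    proof (intro CollectI conjI allI impI)
      have sq: "Z \<in> sq_int M" "W \<in> sq_int M" using ZW by (auto simp: process_space_def)
      then show "(\<lambda>\<omega>. a * Z \<omega> + b * W \<omega>) \<in> sq_int M" by (intro sq_int_add sq_int_cmult)
      fix e :: real assume "e > 0"
      define d where "d = e / (\<bar>a\<bar> + \<bar>b\<bar> + 1)"
      have pos: "\<bar>a\<bar> + \<bar>b\<bar> + 1 > 0" by simp
      have "d > 0" using \<open>e > 0\<close> pos by (simp add: d_def)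
      obtain Y Y' where Y: "Y \<in> process_span B" "rms M (\<lambda>\<omega>. Z \<omega> - Y \<omega>) < d"
        "Y' \<in> process_span B" "rms M (\<lambda>\<omega>. W \<omega> - Y' \<omega>) < d"
        using ZW \<open>d > 0\<close> unfolding process_space_def by blast
      have "rms M (\<lambda>\<omega>. (a * Z \<omega> + b * W \<omega>) - (a * Y \<omega> + b * Y' \<omega>))
        = rms M (\<lambda>\<omega>. a * (Z \<omega> - Y \<omega>) + b * (W \<omega> - Y' \<omega>))" by (simp add: algebra_simps)
      also have "\<dots> \<le> \<bar>a\<bar> * rms M (\<lambda>\<omega>. Z \<omega> - Y \<omega>) + \<bar>b\<bar> * rms M (\<lambda>\<omega>. W \<omega> - Y' \<omega>)"
        unfolding rms_cmult[symmetric] using sq span(1) Y by (intro rms_add_le sq_int_cmult sq_int_diff) auto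
      also have "\<dots> \<le> \<bar>a\<bar> * d + \<bar>b\<bar> * d" using Y by (intro add_mono mult_left_mono) auto
      also have "\<dots> < (\<bar>a\<bar> + \<bar>b\<bar> + 1) * d" using \<open>d > 0\<close> by (simp add: algebra_simps)
      also have "\<dots> = e" using pos by (simp add: d_def)
      finally show "\<exists>V\<in>process_span B. rms M (\<lambda>\<omega>. (a * Z \<omega> + b * W \<omega>) - V \<omega>) < e"
        by (rule bexI[OF _ process_span_lin[OF Y(1,3)]])
    qed
    show "L \<in> process_space M B"
      if Zs: "\<And>n. Zs n \<in> process_space M B" and L: "L \<in> sq_int M"
        and lim: "(\<lambda>n. rms M (\<lambda>\<omega>. Zs n \<omega> - L \<omega>)) \<longlonglongrightarrow> 0" for Zs L
      unfolding process_space_def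
    proof (intro CollectI conjI allI impI L)
      fix e :: real assume "e > 0"
      then have "\<forall>\<^sub>F n in sequentially. rms M (\<lambda>\<omega>. Zs n \<omega> - L \<omega>) < e / 2"
        using order_tendstoD(2)[OF lim, of "e / 2"] by simp
      then obtain n where n: "rms M (\<lambda>\<omega>. Zs n \<omega> - L \<omega>) < e / 2"
        using eventually_happens' sequentially_bot by blast
      obtain Y where Y: "Y \<in> process_span B" "rms M (\<lambda>\<omega>. Zs n \<omega> - Y \<omega>) < e / 2"
        using Zs[of n] half_gt_zero[OF \<open>e > 0\<close>] unfolding process_space_def by blast
      have sq: "Zs n \<in> sq_int M" using Zs[of n] by (simp add: process_space_def)
      have "rms M (\<lambda>\<omega>. L \<omega> - Y \<omega>) \<le> rms M (\<lambda>\<omega>. L \<omega> - Zs n \<omega>) + rms M (\<lambda>\<omega>. Zs n \<omega> - Y \<omega>)"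
        by (rule rms_triangle[OF L sq span(1)[OF Y(1)]])
      also have "\<dots> < e" using n Y(2) by (simp add: rms_minus_commute[of M L])
      finally show "\<exists>Y\<in>process_span B. rms M (\<lambda>\<omega>. L \<omega> - Y \<omega>) < e" using Y(1) by blast
    qed
    fix Z assume Z: "Z \<in> process_space M B"
    then have sq: "Z \<in> sq_int M" by (simp add: process_space_def)
    obtain Y where Y: "\<And>n. Y n \<in> process_span B" "(\<lambda>n. rms M (\<lambda>\<omega>. Y n \<omega> - Z \<omega>)) \<longlonglongrightarrow> 0"
      using approx[OF Z] by blast
    note lim = lip[OF span(1)[OF Y(1)] sq Y(2)]
    have "(\<lambda>n. exp (- ((rms M (Y n))\<^sup>2 / 2))) \<longlonglongrightarrow> exp (- ((rms M Z)\<^sup>2 / 2))"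
      by (intro tendsto_exp tendsto_minus tendsto_divide tendsto_power tendsto_const
          rms_tendsto[OF span(1)[OF Y(1)] sq Y(2)]) simp
    then show "(\<integral>\<omega>. cos (Z \<omega>) \<partial>M) = exp (- ((rms M Z)\<^sup>2 / 2))"
      using lim[of cos] lip_trig span(2)[OF Y(1)] by (auto intro: LIMSEQ_unique)
    show "(\<integral>\<omega>. sin (Z \<omega>) \<partial>M) = 0"
      using lim[of sin] lip_trig span(3)[OF Y(1)] by (auto simp: LIMSEQ_const_iff)
  qed
qed

lemma process_spaceI:
  assumes "Z \<in> process_span B" "Z \<in> sq_int M"
  shows "Z \<in> process_space M B"
  using assms by (auto simp: process_space_def rms_def intro!: bexI[of _ Z])

section \<open>The Ornstein--Uhlenbeck process of the second kind\<close>

locale second_kind_ou =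
  fixes M :: "'w measure" and B X :: "real \<Rightarrow> 'w \<Rightarrow> real" and H \<theta> :: real
  assumes H_half: "1 / 2 < H" and H_one: "H < 1" and theta: "1 < \<theta>"
    and fbm: "fractional_brownian_motion M H B"
    and langevin: "\<And>\<omega>. \<omega> \<in> space M \<Longrightarrow> langevin_solution \<theta> (\<lambda>t. noise2 H B t \<omega>) (\<lambda>t. X t \<omega>)"
begin

lemma H_pos: "0 < H" using H_half by simp

abbreviation "G \<equiv> process_space M B"
abbreviation "Y \<equiv> noise2 H B"

sublocale gaussian_space M G
  using fbm by (intro gaussian_space_process_space) (auto simp: fractional_brownian_motion_def)

text \<open>The time change under which \<open>noise2\<close> reads the fractional Brownian
  motion.\<close>

definition clock :: "real \<Rightarrow> real" where
  "clock s = H * exp (s / H)"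

text \<open>The Lamperti transform of the driving motion, a stationary process.\<close>

definition V :: "real \<Rightarrow> 'w \<Rightarrow> real" where
  "V s \<omega> = exp (- s) * B (clock s) \<omega>"

lemma clock_pos: "0 < clock s"
  using H_pos by (simp add: clock_def)

lemma clock_mono: "s \<le> t \<Longrightarrow> clock s \<le> clock t"
  using H_pos by (simp add: clock_def divide_right_mono)

lemma B_G:
  assumes "0 \<le> t"
  shows "B t \<in> G"
proof (rule process_spaceI)
  have B: "B t = (\<lambda>\<omega>. \<Sum>s\<in>{t}. 1 * B s \<omega>)" by simp
  have gp: "centered_gaussian_process M B" using fbm by (simp add: fractional_brownian_motion_def)
  have "centered_gaussian_rv M (B t)"
    unfolding B by (rule gp[unfolded centered_gaussian_process_def, rule_format]) (use assms in simp)
  then show "B t \<in> sq_int M" by (rule centered_gaussian_rv_cos(1)[OF prob_space_axioms])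
  show "B t \<in> process_span B"
    unfolding process_span_def
    by (rule CollectI, rule exI[of _ "{t}"], rule exI[of _ "\<lambda>_. 1"]) (use assms in simp)
qed

lemma B_cov: "0 \<le> t \<Longrightarrow> 0 \<le> s \<Longrightarrow> (\<integral>\<omega>. B t \<omega> * B s \<omega> \<partial>M) = fbm_cov H t s"
  using fbm by (simp add: fractional_brownian_motion_def)

lemma B_increments_nonneg:
  assumes "0 \<le> a" "a \<le> b" "0 \<le> c" "c \<le> d"
  shows "0 \<le> (\<integral>\<omega>. (B b \<omega> - B a \<omega>) * (B d \<omega> - B c \<omega>) \<partial>M)"
proof -
  have sq: "B a \<in> sq_int M" "B b \<in> sq_int M" "B c \<in> sq_int M" "B d \<in> sq_int M"
    using assms by (auto intro!: G_sq_int B_G)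
  have "(\<integral>\<omega>. (B b \<omega> - B a \<omega>) * (B d \<omega> - B c \<omega>) \<partial>M)
    = (\<integral>\<omega>. B b \<omega> * B d \<omega> - B b \<omega> * B c \<omega> - B a \<omega> * B d \<omega> + B a \<omega> * B c \<omega> \<partial>M)"
    by (rule arg_cong[where f="integral\<^sup>L M"]) (auto simp: algebra_simps)
  also have "\<dots> = fbm_cov H b d - fbm_cov H b c - fbm_cov H a d + fbm_cov H a c"
    using assms sq by (simp add: integrable_sq_int_mult B_cov)
  also have "\<dots> \<ge> 0" using assms H_half by (intro fbm_cov_increments_nonneg)
  finally show ?thesis .
qed

lemma B_cont: "\<omega> \<in> space M \<Longrightarrow> continuous_on S (\<lambda>s. B (clock s) \<omega>)"
proof -
  assume "\<omega> \<in> space M"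
  then have "continuous_on {0..} (\<lambda>t. B t \<omega>)" using fbm by (simp add: fractional_brownian_motion_def)
  moreover have "continuous_on S clock" unfolding clock_def by (intro continuous_intros) (use H_pos in auto)
  ultimately show ?thesis
    by (rule continuous_on_compose2) (use clock_pos in \<open>auto intro: less_imp_le\<close>)
qed

lemma V_cont: "\<omega> \<in> space M \<Longrightarrow> continuous_on S (\<lambda>s. V s \<omega>)"
  unfolding V_def by (rule continuous_on_mult[OF _ B_cont]) (intro continuous_intros)

lemma V_G: "V s \<in> G"
  unfolding V_def[abs_def] by (rule G_cmult[OF B_G[OF less_imp_le[OF clock_pos]]])

section \<open>Stationarity and decay of the Lamperti transform\<close>

lemma clock_powr: "clock s powr (2 * H) = H powr (2 * H) * exp (2 * s)"
proof -
  have "ln (clock s) = ln H + s / H" using H_pos by (simp add: clock_def ln_mult)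
  moreover have "2 * H * (ln H + s / H) = 2 * H * ln H + 2 * s" using H_pos by (simp add: distrib_left)
  ultimately show ?thesis using clock_pos[of s] H_pos by (simp add: powr_def exp_add)
qed

text \<open>The factor exp(2 s) in \<open>clock_powr\<close> is what the factor exp(-s) in V
  compensates, so only t - s survives. The difference of the two clocks is the fraction q = 1 -
  exp(-(t - s)/H) of the later one.\<close>

lemma V_cov:
  assumes "s \<le> t"
  shows "(\<integral>\<omega>. V t \<omega> * V s \<omega> \<partial>M) = H powr (2 * H) / 2 *
    (exp (t - s) + exp (- (t - s)) - exp (t - s) * (1 - exp (- (t - s) / H)) powr (2 * H))"
proof -
  define q where "q = 1 - exp (- (t - s) / H)"
  have q: "q \<ge> 0" using assms H_pos divide_nonpos_pos[of "s - t" H] by (simp add: q_def)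
  have e: "exp (t / H) * exp (- (t - s) / H) = exp (s / H)"
    by (simp add: exp_add[symmetric] diff_divide_distrib)
  have "clock t - clock s = clock t * q"
    using e by (simp add: clock_def q_def right_diff_distrib mult.assoc)
  then have "\<bar>clock t - clock s\<bar> powr (2 * H) = clock t powr (2 * H) * q powr (2 * H)"
    using q clock_pos[of t] by (simp add: abs_mult powr_mult)
  then have B: "(\<integral>\<omega>. B (clock t) \<omega> * B (clock s) \<omega> \<partial>M)
      = H powr (2 * H) / 2 * (exp (2 * t) + exp (2 * s) - exp (2 * t) * q powr (2 * H))"
    using B_cov[OF less_imp_le[OF clock_pos] less_imp_le[OF clock_pos], of t s]
    by (simp only: fbm_cov_def clock_powr) (simp add: field_simps)
  have V: "(\<integral>\<omega>. V t \<omega> * V s \<omega> \<partial>M) = exp (- t - s) * (\<integral>\<omega>. B (clock t) \<omega> * B (clock s) \<omega> \<partial>M)"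
  proof -
    have "V t \<omega> * V s \<omega> = exp (- t - s) * (B (clock t) \<omega> * B (clock s) \<omega>)" for \<omega>
      by (simp add: V_def exp_diff exp_minus divide_inverse mult_ac)
    then show ?thesis by simp
  qed
  have E: "exp (- t - s) * (exp (2 * t) + exp (2 * s) - exp (2 * t) * q powr (2 * H))
    = exp (t - s) + exp (- (t - s)) - exp (t - s) * q powr (2 * H)"
  proof -
    have "exp (- t - s) * exp (2 * t) = exp (t - s)" "exp (- t - s) * exp (2 * s) = exp (- (t - s))"
      by (simp_all add: exp_add[symmetric])
    then show ?thesis by (simp add: algebra_simps)
  qed
  show ?thesis
    unfolding V B mult.left_commute[of "exp (- t - s)"] E by (simp add: q_def)
qed

text \<open>The decay rate of the covariance of V. With x = exp(-\<tau>/H) the slow part of the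
  covariance is exp(\<tau>) (1 - (1 - x)^(2H)), of order exp(\<tau>) x = exp(-(1/H - 1)
  \<tau>).\<close>

definition \<kappa> :: real where "\<kappa> = 1 / H - 1"

lemma kappa: "0 < \<kappa>" "\<kappa> < 1" "\<kappa> < \<theta>"
proof -
  show "0 < \<kappa>" "\<kappa> < 1" using H_half H_one by (auto simp: \<kappa>_def field_simps)
  then show "\<kappa> < \<theta>" using theta by simp
qed

text \<open>The prefactor H^(2H)/2 of \<open>V_cov\<close> times 3, where 2 comes from the slow part
  and 1 from exp(-\<tau>).\<close>

definition CV :: real where "CV = 3 / 2 * H powr (2 * H)"

lemma CV_nonneg: "0 \<le> CV" by (simp add: CV_def)

lemma V_cov_bound: "\<bar>\<integral>\<omega>. V t \<omega> * V s \<omega> \<partial>M\<bar> \<le> CV * exp (- \<kappa> * \<bar>t - s\<bar>)"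
proof -
  have le: "\<bar>\<integral>\<omega>. V t \<omega> * V s \<omega> \<partial>M\<bar> \<le> CV * exp (- \<kappa> * (t - s))" if "s \<le> t" for s t
  proof -
    define \<tau> x q where "\<tau> = t - s" and "x = exp (- \<tau> / H)" and "q = 1 - x"
    have \<tau>: "\<tau> \<ge> 0" using that by (simp add: \<tau>_def)
    have x: "0 < x" "x \<le> 1" using \<tau> H_pos by (auto simp: x_def)
    have q: "0 \<le> q" "q \<le> 1" using x by (auto simp: q_def)
    \<comment> \<open>As q is at most 1 and 2H < 2, the power with exponent 2H is at least q^2 = (1
      - x)^2, which is at least 1 - 2 x.\<close>
    have "q powr 2 \<le> q powr (2 * H)" using q H_one by (intro powr_mono') auto
    moreover have "q powr 2 = q\<^sup>2" using q by (simp add: powr_numeral)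
    moreover have "q\<^sup>2 \<ge> 1 - 2 * x" by (simp add: q_def power2_diff)
    ultimately have q2: "1 - q powr (2 * H) \<le> 2 * x" by linarith
    have "q powr (2 * H) \<le> 1" using q H_pos by (simp add: powr_le1)
    then have low: "0 \<le> exp \<tau> + exp (- \<tau>) - exp \<tau> * q powr (2 * H)"
      using mult_left_mono[of "q powr (2 * H)" 1 "exp \<tau>"] exp_ge_zero[of "- \<tau>"]
      by (smt (verit) exp_ge_zero mult.right_neutral)
    have "exp \<tau> * (1 - q powr (2 * H)) \<le> exp \<tau> * (2 * x)" using q2 by (intro mult_left_mono) auto
    also have "\<dots> = 2 * exp (- \<kappa> * \<tau>)"
      by (simp add: x_def \<kappa>_def exp_add[symmetric] algebra_simps)
    finally have "exp \<tau> * (1 - q powr (2 * H)) \<le> 2 * exp (- \<kappa> * \<tau>)" .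
    \<comment> \<open>This is where \<kappa> < 1 enters, that is, H > 1/2.\<close>
    moreover have "exp (- \<tau>) \<le> exp (- \<kappa> * \<tau>)"
      using \<tau> kappa mult_right_mono[of \<kappa> 1 \<tau>] by simp
    moreover have "exp \<tau> * (1 - q powr (2 * H)) = exp \<tau> - exp \<tau> * q powr (2 * H)"
      by (simp add: right_diff_distrib)
    ultimately have up: "exp \<tau> + exp (- \<tau>) - exp \<tau> * q powr (2 * H) \<le> 3 * exp (- \<kappa> * \<tau>)"
      by linarith
    have "(\<integral>\<omega>. V t \<omega> * V s \<omega> \<partial>M) = H powr (2 * H) / 2 * (exp \<tau> + exp (- \<tau>) - exp \<tau> * q powr (2 * H))"
      unfolding V_cov[OF that] by (simp add: q_def x_def \<tau>_def)
    also have "\<bar>\<dots>\<bar> \<le> H powr (2 * H) / 2 * (3 * exp (- \<kappa> * \<tau>))"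
      using low up by (subst abs_of_nonneg) (auto intro!: mult_left_mono mult_nonneg_nonneg)
    finally show ?thesis by (simp add: CV_def \<tau>_def)
  qed
  show ?thesis
  proof (cases "s \<le> t")
    case True then show ?thesis using le[OF True] by simp
  next
    case False
    then show ?thesis using le[of t s] by (simp add: mult.commute[of "V t _"])
  qed
qed

text \<open>Stationarity leaves 2 - exp(\<tau>) - exp(-\<tau>), which is non-positive, and one term
  in q; with q <= \<tau>/H the factor H^(2H) cancels. The exponent 2H > 1 is what will make the
  quadratic variation vanish.\<close>

lemma V_holder:
  assumes "0 \<le> s" "s \<le> t" "t \<le> T"
  shows "(rms M (\<lambda>\<omega>. V t \<omega> - V s \<omega>))\<^sup>2 \<le> exp T * (t - s) powr (2 * H)"
proof -
  define \<tau> q where "\<tau> = t - s" and "q = 1 - exp (- \<tau> / H)"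
  have \<tau>: "\<tau> \<ge> 0" "\<tau> \<le> T" using assms by (auto simp: \<tau>_def)
  have q: "0 \<le> q" "q \<le> \<tau> / H"
    using \<tau> H_pos exp_ge_add_one_self[of "- \<tau> / H"] by (auto simp: q_def)
  have sq: "V t \<in> sq_int M" "V s \<in> sq_int M" by (intro G_sq_int V_G)+
  have "(rms M (\<lambda>\<omega>. V t \<omega> - V s \<omega>))\<^sup>2 = (\<integral>\<omega>. V t \<omega> * V t \<omega> + V s \<omega> * V s \<omega> - 2 * (V t \<omega> * V s \<omega>) \<partial>M)"
    unfolding rms_square by (rule arg_cong[where f="integral\<^sup>L M"]) (auto simp: power2_eq_square algebra_simps)
  also have "\<dots> = (\<integral>\<omega>. V t \<omega> * V t \<omega> \<partial>M) + (\<integral>\<omega>. V s \<omega> * V s \<omega> \<partial>M) - 2 * (\<integral>\<omega>. V t \<omega> * V s \<omega> \<partial>M)"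
    using sq by (simp add: integrable_sq_int_mult)
  also have "\<dots> = H powr (2 * H) * (2 - exp \<tau> - exp (- \<tau>) + exp \<tau> * q powr (2 * H))"
  proof -
    have "(\<integral>\<omega>. V u \<omega> * V u \<omega> \<partial>M) = H powr (2 * H)" for u
      using V_cov[of u u] H_pos by simp
    moreover have "(\<integral>\<omega>. V t \<omega> * V s \<omega> \<partial>M) = H powr (2 * H) / 2 * (exp \<tau> + exp (- \<tau>) - exp \<tau> * q powr (2 * H))"
      using V_cov[OF assms(2)] by (simp only: \<tau>_def q_def)
    ultimately show ?thesis by (simp only:) (simp add: field_simps)
  qed
  also have "\<dots> \<le> H powr (2 * H) * (exp \<tau> * q powr (2 * H))"
  proof (intro mult_left_mono)
    have "0 \<le> (exp (\<tau> / 2) - exp (- \<tau> / 2))\<^sup>2" by simp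
    also have "\<dots> = exp \<tau> + exp (- \<tau>) - 2"
    proof -
      have "(exp (\<tau> / 2))\<^sup>2 = exp \<tau>" "(exp (- \<tau> / 2))\<^sup>2 = exp (- \<tau>)"
        "exp (\<tau> / 2) * exp (- \<tau> / 2) = 1"
        by (simp_all add: exp_add[symmetric] power2_eq_square)
      then show ?thesis by (simp only: power2_diff mult.assoc)
    qed
    finally show "2 - exp \<tau> - exp (- \<tau>) + exp \<tau> * q powr (2 * H) \<le> exp \<tau> * q powr (2 * H)" by simp
  qed simp
  also have "\<dots> \<le> H powr (2 * H) * (exp T * (\<tau> / H) powr (2 * H))"
    using q \<tau> H_pos by (intro mult_left_mono mult_mono powr_mono2) auto
  also have "\<dots> = exp T * \<tau> powr (2 * H)"
    using H_pos \<tau> by (simp add: powr_divide)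
  finally show ?thesis by (simp add: \<tau>_def)
qed

section \<open>Representations of Y and X in the Gaussian space\<close>

lemma G_cong:
  assumes "Z \<in> G" "\<And>\<omega>. \<omega> \<in> space M \<Longrightarrow> Z' \<omega> = Z \<omega>"
  shows "Z' \<in> G"
proof (rule G_pointwise_limit(1)[of "\<lambda>_. Z"])
  show "(\<lambda>n. Z \<omega>) \<longlonglongrightarrow> Z' \<omega>" if "\<omega> \<in> space M" for \<omega>
    using assms(2)[OF that] by simp
qed (rule assms(1))

text \<open>In differential form, dY = dV + V dt: the noise is expressed through the stationary
  process alone.\<close>

lemma Y_eq:
  assumes "\<omega> \<in> space M" "0 \<le> t"
  shows "Y t \<omega> = V t \<omega> - V 0 \<omega> + integral {0..t} (\<lambda>s. V s \<omega>)"
  using RS_integral_exp[OF assms(2) B_cont[OF assms(1)]]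
  by (simp add: noise2_def V_def clock_def)

lemma Y_G:
  assumes "0 \<le> t"
  shows "Y t \<in> G"
proof (rule G_cong)
  show "Y t \<omega> = V t \<omega> - V 0 \<omega> + integral {0..t} (\<lambda>s. V s \<omega>)" if "\<omega> \<in> space M" for \<omega>
    by (rule Y_eq[OF that assms])
  have "(\<lambda>\<omega>. integral {0..t} (\<lambda>s. V s \<omega>)) \<in> G"
    by (rule G_integral[OF assms V_G V_cont])
  then show "(\<lambda>\<omega>. V t \<omega> - V 0 \<omega> + integral {0..t} (\<lambda>s. V s \<omega>)) \<in> G"
    by (rule G_add[OF G_diff[OF V_G V_G]])
qed

lemma Y_zero: "\<omega> \<in> space M \<Longrightarrow> Y 0 \<omega> = 0"
  using Y_eq[of \<omega> 0] by simp

lemma X_zero: "\<omega> \<in> space M \<Longrightarrow> X 0 \<omega> = 0"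
  by (rule langevin[unfolded langevin_solution_def, THEN conjunct1])

lemma X_cont: "\<omega> \<in> space M \<Longrightarrow> S \<subseteq> {0..} \<Longrightarrow> continuous_on S (\<lambda>s. X s \<omega>)"
  by (rule continuous_on_subset[OF langevin[unfolded langevin_solution_def, THEN conjunct2, THEN conjunct1]])

lemma X_integral_eq: "\<omega> \<in> space M \<Longrightarrow> 0 \<le> t \<Longrightarrow> X t \<omega> = - \<theta> * integral {0..t} (\<lambda>s. X s \<omega>) + Y t \<omega>"
  by (rule langevin[unfolded langevin_solution_def, THEN conjunct2, THEN conjunct2, rule_format])

lemma X_integrable: "\<omega> \<in> space M \<Longrightarrow> 0 \<le> s \<Longrightarrow> (\<lambda>u. X u \<omega>) integrable_on {s..t}"
  by (intro integrable_continuous_real X_cont) auto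

lemma V_integrable: "\<omega> \<in> space M \<Longrightarrow> (\<lambda>u. V u \<omega>) integrable_on {s..t}"
  by (intro integrable_continuous_real V_cont)

lemma Y_cont: "\<omega> \<in> space M \<Longrightarrow> continuous_on {0..T} (\<lambda>s. Y s \<omega>)"
proof -
  assume w: "\<omega> \<in> space M"
  have "continuous_on {0..T} (\<lambda>s. X s \<omega> + \<theta> * integral {0..s} (\<lambda>s. X s \<omega>))"
    by (rule continuous_on_add[OF X_cont[OF w] continuous_on_mult_left[OF indefinite_integral_continuous_1[OF X_integrable[OF w]]]]) auto
  then show ?thesis
    by (rule continuous_on_eq) (use X_integral_eq[OF w] in auto)
qed

text \<open>The difference X - V solves a linear equation with the continuous forcing (1 - \<theta>)
  V in place of the rough noise, so X becomes an explicit linear functional of V. The covariance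
  estimates for X start from here.\<close>

lemma X_eq_V:
  assumes w: "\<omega> \<in> space M" and t: "0 \<le> t"
  shows "X t \<omega> = V t \<omega> - exp (- \<theta> * t) * V 0 \<omega>
    + (1 - \<theta>) * integral {0..t} (\<lambda>s. exp (- \<theta> * (t - s)) * V s \<omega>)"
proof -
  define R where "R s = X s \<omega> - V s \<omega>" for s
  have "R t = exp (- \<theta> * t) * (- V 0 \<omega>) + integral {0..t} (\<lambda>s. exp (- \<theta> * (t - s)) * ((1 - \<theta>) * V s \<omega>))"
  proof (rule linear_integral_equation[where T=t])
    show "continuous_on {0..t} (\<lambda>s. (1 - \<theta>) * V s \<omega>)" "continuous_on {0..t} R"
      unfolding R_def by (rule continuous_on_mult_left[OF V_cont[OF w]],
          rule continuous_on_diff[OF X_cont[OF w] V_cont[OF w]]) simp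
    fix s assume s: "s \<in> {0..t}"
    have "integral {0..s} (\<lambda>u. (1 - \<theta>) * V u \<omega> - \<theta> * R u) = integral {0..s} (\<lambda>u. V u \<omega> - \<theta> * X u \<omega>)"
      by (simp add: R_def algebra_simps)
    also have "\<dots> = integral {0..s} (\<lambda>u. V u \<omega>) - \<theta> * integral {0..s} (\<lambda>u. X u \<omega>)"
      by (subst Henstock_Kurzweil_Integration.integral_diff)
        (auto intro!: integrable_continuous_real continuous_on_mult_left V_cont X_cont w)
    finally show "R s = - V 0 \<omega> + integral {0..s} (\<lambda>u. (1 - \<theta>) * V u \<omega> - \<theta> * R u)"
      using X_integral_eq[OF w, of s] Y_eq[OF w, of s] s by (simp add: R_def)
  qed (use t in simp)
  moreover have "integral {0..t} (\<lambda>s. exp (- \<theta> * (t - s)) * ((1 - \<theta>) * V s \<omega>))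
    = (1 - \<theta>) * integral {0..t} (\<lambda>s. exp (- \<theta> * (t - s)) * V s \<omega>)"
    by (subst integral_mult_right[symmetric]) (simp only: mult.left_commute)
  ultimately show ?thesis by (simp add: R_def)
qed

text \<open>A second representation, by the values of Y on [0,t]. Measurability of X with respect to
  the \<sigma>-algebra of Y is read off from this one.\<close>

lemma X_eq_Y:
  assumes w: "\<omega> \<in> space M" and t: "0 \<le> t"
  shows "X t \<omega> = Y t \<omega> - \<theta> * integral {0..t} (\<lambda>s. exp (- \<theta> * (t - s)) * Y s \<omega>)"
proof -
  define P where "P s = integral {0..s} (\<lambda>u. X u \<omega>)" for s
  have "P t = exp (- \<theta> * t) * 0 + integral {0..t} (\<lambda>s. exp (- \<theta> * (t - s)) * Y s \<omega>)"
  proof (rule linear_integral_equation[where T=t])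
    show "continuous_on {0..t} (\<lambda>s. Y s \<omega>)" by (rule Y_cont[OF w])
    show "continuous_on {0..t} P"
      unfolding P_def by (intro indefinite_integral_continuous_1 X_integrable w) auto
    fix s assume s: "s \<in> {0..t}"
    have "integral {0..s} (\<lambda>u. Y u \<omega> - \<theta> * P u) = integral {0..s} (\<lambda>u. X u \<omega>)"
      using X_integral_eq[OF w] by (intro integral_cong) (simp add: P_def)
    then show "P s = 0 + integral {0..s} (\<lambda>u. Y u \<omega> - \<theta> * P u)" by (simp add: P_def)
  qed (use t in simp)
  then show ?thesis using X_integral_eq[OF w t] by (simp add: P_def)
qed

lemma exp_V_cont: "\<omega> \<in> space M \<Longrightarrow> continuous_on S (\<lambda>u. exp (c * (s - u)) * V u \<omega>)"
  by (rule continuous_on_mult[OF _ V_cont]) (intro continuous_intros)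

lemma exp_V_integral_G:
  assumes "0 \<le> s"
  shows "(\<lambda>\<omega>. integral {0..s} (\<lambda>u. exp (- \<theta> * (s - u)) * V u \<omega>)) \<in> G"
proof (rule G_integral[OF assms])
  show "(\<lambda>\<omega>. exp (- \<theta> * (s - u)) * V u \<omega>) \<in> G" for u by (rule G_cmult[OF V_G])
qed (rule exp_V_cont)

lemma X_G:
  assumes "0 \<le> t"
  shows "X t \<in> G"
proof (rule G_cong)
  show "X t \<omega> = V t \<omega> - exp (- \<theta> * t) * V 0 \<omega>
    + (1 - \<theta>) * integral {0..t} (\<lambda>s. exp (- \<theta> * (t - s)) * V s \<omega>)" if "\<omega> \<in> space M" for \<omega>
    by (rule X_eq_V[OF that assms])
  show "(\<lambda>\<omega>. V t \<omega> - exp (- \<theta> * t) * V 0 \<omega>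
    + (1 - \<theta>) * integral {0..t} (\<lambda>s. exp (- \<theta> * (t - s)) * V s \<omega>)) \<in> G"
    by (rule G_add[OF G_diff[OF V_G G_cmult[OF V_G]] G_cmult[OF exp_V_integral_G[OF assms]]])
qed

lemma X_ms:
  assumes "0 \<le> a"
  shows "ms_process M a b X"
proof (rule G_ms_process)
  show "X s \<in> G" if "s \<in> {a..b}" for s using that assms by (intro X_G) simp
  show "continuous_on {a..b} (\<lambda>s. X s \<omega>)" if "\<omega> \<in> space M" for \<omega>
    using assms by (intro X_cont[OF that]) auto
qed

section \<open>Covariance of X and its exponential decay\<close>

lemma V_ms: "ms_process M a b V"
proof (rule G_ms_process)
  show "V s \<in> G" for s by (rule V_G)
  show "continuous_on {a..b} (\<lambda>s. V s \<omega>)" if "\<omega> \<in> space M" for \<omega> by (rule V_cont[OF that])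
qed

lemma exp_V_ms: "ms_process M a b (\<lambda>u \<omega>. exp (c * (s - u)) * V u \<omega>)"
proof (rule G_ms_process)
  show "(\<lambda>\<omega>. exp (c * (s - u)) * V u \<omega>) \<in> G" for u by (rule G_cmult[OF V_G])
  show "continuous_on {a..b} (\<lambda>u. exp (c * (s - u)) * V u \<omega>)" if "\<omega> \<in> space M" for \<omega>
    by (rule exp_V_cont[OF that])
qed

text \<open>The representation by V, tested against an arbitrary factor W. Values of V and X as W
  yield the decay of the covariance; an increment of B as W yields the lower bound for the
  variance.\<close>

lemma expectation_X:
  assumes W: "W \<in> sq_int M" and t: "0 \<le> t"
  shows "(\<integral>\<omega>. W \<omega> * X t \<omega> \<partial>M) = (\<integral>\<omega>. W \<omega> * V t \<omega> \<partial>M) - exp (- \<theta> * t) * (\<integral>\<omega>. W \<omega> * V 0 \<omega> \<partial>M)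
    + (1 - \<theta>) * integral {0..t} (\<lambda>u. exp (- \<theta> * (t - u)) * (\<integral>\<omega>. W \<omega> * V u \<omega> \<partial>M))"
proof -
  let ?I = "\<lambda>\<omega>. integral {0..t} (\<lambda>s. exp (- \<theta> * (t - s)) * V s \<omega>)"
  have sq: "V u \<in> sq_int M" "?I \<in> sq_int M" for u
    by (rule G_sq_int[OF V_G], rule G_sq_int[OF exp_V_integral_G[OF t]])
  have "(\<integral>\<omega>. W \<omega> * X t \<omega> \<partial>M)
      = (\<integral>\<omega>. W \<omega> * V t \<omega> - exp (- \<theta> * t) * (W \<omega> * V 0 \<omega>) + (1 - \<theta>) * (W \<omega> * ?I \<omega>) \<partial>M)"
  proof (rule Bochner_Integration.integral_cong[OF refl])
    fix \<omega> assume "\<omega> \<in> space M"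
    then have X: "X t \<omega> = V t \<omega> - exp (- \<theta> * t) * V 0 \<omega> + (1 - \<theta>) * ?I \<omega>" by (rule X_eq_V[OF _ t])
    have "w * (v - e * v0 + c * i) = w * v - e * (w * v0) + c * (w * i)" for w v e v0 c i :: real
      by (simp add: algebra_simps)
    then show "W \<omega> * X t \<omega> = W \<omega> * V t \<omega> - exp (- \<theta> * t) * (W \<omega> * V 0 \<omega>) + (1 - \<theta>) * (W \<omega> * ?I \<omega>)"
      unfolding X .
  qed
  also have "\<dots> = (\<integral>\<omega>. W \<omega> * V t \<omega> \<partial>M) - exp (- \<theta> * t) * (\<integral>\<omega>. W \<omega> * V 0 \<omega> \<partial>M)
      + (1 - \<theta>) * (\<integral>\<omega>. W \<omega> * ?I \<omega> \<partial>M)"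
    using W sq by (simp add: integrable_sq_int_mult)
  also have "(\<integral>\<omega>. W \<omega> * ?I \<omega> \<partial>M) = integral {0..t} (\<lambda>u. \<integral>\<omega>. W \<omega> * (exp (- \<theta> * (t - u)) * V u \<omega>) \<partial>M)"
    by (rule expectation_mult_integral[OF exp_V_ms t W])
  also have "\<dots> = integral {0..t} (\<lambda>u. exp (- \<theta> * (t - u)) * (\<integral>\<omega>. W \<omega> * V u \<omega> \<partial>M))"
  proof -
    have "(\<integral>\<omega>. W \<omega> * (e * V u \<omega>) \<partial>M) = e * (\<integral>\<omega>. W \<omega> * V u \<omega> \<partial>M)" for e u
      by (simp only: mult.left_commute[of _ e] integral_mult_right_zero)
    then show ?thesis by (simp only:)
  qed
  finally show ?thesis .
qed

text \<open>One unit for each of the terms with \<open>V t\<close> and \<open>V 0\<close> in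
  \<open>expectation_X\<close>, and for the convolution \<theta> - 1 times the integral of
  exp(-(\<theta> - \<kappa>) v) over the half-line.\<close>

definition CL :: real where "CL = 2 + (\<theta> - 1) / (\<theta> - \<kappa>)"

lemma CL_nonneg: "0 \<le> CL" using kappa theta by (simp add: CL_def)

text \<open>Convolution with exp(-\<theta> v) preserves decay at the slower rate \<kappa> <
  \<theta>. The factor W is general so that the estimate can be applied to each argument of a
  covariance in turn.\<close>

lemma expectation_X_decay:
  assumes W: "W \<in> sq_int M" and "0 \<le> s" "0 \<le> t" and "0 \<le> C"
    and decay: "\<And>u. 0 \<le> u \<Longrightarrow> \<bar>\<integral>\<omega>. W \<omega> * V u \<omega> \<partial>M\<bar> \<le> C * exp (- \<kappa> * \<bar>u - s\<bar>)"
  shows "\<bar>\<integral>\<omega>. W \<omega> * X t \<omega> \<partial>M\<bar> \<le> C * CL * exp (- \<kappa> * \<bar>t - s\<bar>)"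
proof -
  define g where "g u = (\<integral>\<omega>. W \<omega> * V u \<omega> \<partial>M)" for u
  define E where "E = exp (- \<kappa> * \<bar>t - s\<bar>)"
  have g_cont: "continuous_on {0..t} g"
    unfolding g_def by (rule continuous_on_expectation_mult[OF V_ms W])
  have 1: "\<bar>g t\<bar> \<le> C * E" using decay[OF \<open>0 \<le> t\<close>] by (simp add: g_def E_def)
  have 2: "exp (- \<theta> * t) * \<bar>g 0\<bar> \<le> C * E"
  proof -
    have "exp (- \<theta> * t) * \<bar>g 0\<bar> \<le> exp (- \<theta> * t) * (C * exp (- \<kappa> * s))"
      using decay[of 0] \<open>0 \<le> s\<close> by (intro mult_left_mono) (auto simp: g_def)
    also have "\<dots> = C * exp (- (\<theta> * t + \<kappa> * s))"
      by (simp add: exp_add[symmetric] exp_diff exp_minus divide_inverse mult_ac)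
    also have "\<dots> \<le> C * E"
    proof -
      have "\<kappa> * \<bar>t - s\<bar> \<le> \<kappa> * (t + s)" using assms kappa by (intro mult_left_mono) auto
      also have "\<dots> \<le> \<theta> * t + \<kappa> * s" using kappa \<open>0 \<le> t\<close> by (simp add: distrib_left mult_right_mono)
      finally show ?thesis using \<open>0 \<le> C\<close> by (auto simp: E_def intro!: mult_left_mono)
    qed
    finally show ?thesis .
  qed
  have 3: "\<bar>integral {0..t} (\<lambda>u. exp (- \<theta> * (t - u)) * g u)\<bar> \<le> C * E / (\<theta> - \<kappa>)"
  proof -
    have hi: "((\<lambda>u. C * E * exp (- (\<theta> - \<kappa>) * (t - u))) has_integral
        (C * E * (exp (- (\<theta> - \<kappa>) * (t - t)) / (\<theta> - \<kappa>)) - C * E * (exp (- (\<theta> - \<kappa>) * (t - 0)) / (\<theta> - \<kappa>)))) {0..t}"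
      by (rule fundamental_theorem_of_calculus[OF \<open>0 \<le> t\<close>])
        (use kappa in \<open>auto intro!: derivative_eq_intros simp: has_real_derivative_iff_has_vector_derivative[symmetric]\<close>)
    have "norm (integral {0..t} (\<lambda>u. exp (- \<theta> * (t - u)) * g u))
      \<le> integral {0..t} (\<lambda>u. C * E * exp (- (\<theta> - \<kappa>) * (t - u)))"
    proof (rule integral_norm_bound_integral)
      show "(\<lambda>u. exp (- \<theta> * (t - u)) * g u) integrable_on {0..t}"
        by (intro integrable_continuous_real continuous_intros g_cont)
      show "(\<lambda>u. C * E * exp (- (\<theta> - \<kappa>) * (t - u))) integrable_on {0..t}" using hi by blast
      fix u assume u: "u \<in> {0..t}"
      have "norm (exp (- \<theta> * (t - u)) * g u) \<le> exp (- \<theta> * (t - u)) * (C * exp (- \<kappa> * \<bar>u - s\<bar>))"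
        using decay[of u] u by (simp add: abs_mult g_def)
      also have "\<dots> = C * exp (- (\<theta> * (t - u) + \<kappa> * \<bar>u - s\<bar>))"
        by (simp add: exp_add[symmetric] algebra_simps)
      \<comment> \<open>The triangle inequality |t - s| <= (t - u) + |u - s|, paid for by lowering
        the rate of the kernel from \<theta> to \<theta> - \<kappa>.\<close>
      also have "\<dots> \<le> C * exp (- \<kappa> * \<bar>t - s\<bar> + - (\<theta> - \<kappa>) * (t - u))"
      proof -
        have "\<kappa> * \<bar>t - s\<bar> \<le> \<kappa> * ((t - u) + \<bar>u - s\<bar>)" using u kappa by (intro mult_left_mono) auto
        then show ?thesis using \<open>0 \<le> C\<close> by (auto simp: algebra_simps intro!: mult_left_mono)
      qed
      also have "\<dots> = C * E * exp (- (\<theta> - \<kappa>) * (t - u))" by (simp only: E_def exp_add mult.assoc)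
      finally show "norm (exp (- \<theta> * (t - u)) * g u) \<le> C * E * exp (- (\<theta> - \<kappa>) * (t - u))" .
    qed
    also have "\<dots> \<le> C * E / (\<theta> - \<kappa>)"
      unfolding integral_unique[OF hi] using kappa \<open>0 \<le> C\<close> by (simp add: E_def)
    finally show ?thesis by simp
  qed
  have "\<bar>\<integral>\<omega>. W \<omega> * X t \<omega> \<partial>M\<bar> \<le> \<bar>g t\<bar> + exp (- \<theta> * t) * \<bar>g 0\<bar>
      + (\<theta> - 1) * \<bar>integral {0..t} (\<lambda>u. exp (- \<theta> * (t - u)) * g u)\<bar>"
  proof -
    define I where "I = integral {0..t} (\<lambda>u. exp (- \<theta> * (t - u)) * g u)"
    have "\<bar>exp (- \<theta> * t) * g 0\<bar> = exp (- \<theta> * t) * \<bar>g 0\<bar>" "\<bar>(1 - \<theta>) * I\<bar> = (\<theta> - 1) * \<bar>I\<bar>"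
      using theta by (simp_all add: abs_mult)
    then show ?thesis
      unfolding expectation_X[OF W \<open>0 \<le> t\<close>] g_def[symmetric] I_def[symmetric] by linarith
  qed
  also have "\<dots> \<le> C * E + C * E + (\<theta> - 1) * (C * E / (\<theta> - \<kappa>))"
    using theta by (intro add_mono 1 2 mult_left_mono 3) auto
  also have "\<dots> = C * CL * E" by (simp add: CL_def algebra_simps)
  finally show ?thesis by (simp add: E_def)
qed

definition CX :: real where "CX = CV * CL * CL"

lemma CX_nonneg: "0 \<le> CX" using CV_nonneg CL_nonneg by (simp add: CX_def)

text \<open>The decay passes from V to X in one argument of the covariance and then in the other,
  hence the two factors \<open>CL\<close> in \<open>CX\<close>.\<close>

lemma X_cov_bound:
  assumes "0 \<le> s" "0 \<le> t"
  shows "\<bar>\<integral>\<omega>. X s \<omega> * X t \<omega> \<partial>M\<bar> \<le> CX * exp (- \<kappa> * \<bar>t - s\<bar>)"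
  unfolding CX_def
proof (rule expectation_X_decay[OF G_sq_int[OF X_G] assms])
  show "0 \<le> CV * CL" using CV_nonneg CL_nonneg by simp
  fix u :: real assume u: "0 \<le> u"
  have "\<bar>\<integral>\<omega>. V u \<omega> * X s \<omega> \<partial>M\<bar> \<le> CV * CL * exp (- \<kappa> * \<bar>s - u\<bar>)"
    by (rule expectation_X_decay[OF G_sq_int[OF V_G] u assms(1) CV_nonneg])
      (simp only: abs_minus_commute[of _ u], rule V_cov_bound)
  then show "\<bar>\<integral>\<omega>. X s \<omega> * V u \<omega> \<partial>M\<bar> \<le> CV * CL * exp (- \<kappa> * \<bar>u - s\<bar>)"
    by (simp add: mult.commute abs_minus_commute)
qed (use assms in auto)

lemma X_rms_bound: "0 \<le> t \<Longrightarrow> (rms M (X t))\<^sup>2 \<le> CX"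
  unfolding rms_square unfolding power2_eq_square using X_cov_bound[of t t] by simp

text \<open>Riemann sums of \<open>V\<close> turn into sums of increments of \<open>B\<close> with positive weights.\<close>

lemma Y_increment_limit:
  assumes "0 \<le> s" "s \<le> t"
  shows "\<exists>S. (\<forall>n. S n \<in> G) \<and> (\<lambda>n. rms M (\<lambda>\<omega>. S n \<omega> - (Y t \<omega> - Y s \<omega>))) \<longlonglongrightarrow> 0 \<and>
    (\<forall>n. \<exists>c r. (\<forall>i<n. 0 \<le> c i) \<and> (\<forall>i<n. 0 \<le> r i \<and> r i \<le> r (Suc i)) \<and>
      S n = (\<lambda>\<omega>. \<Sum>i<n. c i * (B (r (Suc i)) \<omega> - B (r i) \<omega>)))"
proof -
  define h where "h n = (t - s) / real n" for n
  define u where "u n i = s + real i * h n" for n i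
  \<comment> \<open>With the exponential taken at the right end point, the first product in each
    term is exactly a value of V, and the sum telescopes up to a multiple 1 - exp(-h) of values of
    V.\<close>
  define S where "S n = (\<lambda>\<omega>. \<Sum>i<n. exp (- u n (Suc i)) * (B (clock (u n (Suc i))) \<omega> - B (clock (u n i)) \<omega>))" for n
  have h: "0 \<le> h n" for n using assms by (simp add: h_def)
  have u: "u n (Suc i) = u n i + h n" for n i by (simp add: u_def distrib_right)
  have SG: "S n \<in> G" for n
    unfolding S_def using clock_pos by (intro G_sum G_cmult G_diff B_G) (auto intro: less_imp_le)
  have Seq: "S n \<omega> = V t \<omega> - V s \<omega> + (1 - exp (- h n)) * (\<Sum>i<n. V (u n i) \<omega>)" if "n > 0" for n \<omega>
  proof -
    have "exp (- u n (Suc i)) * (B (clock (u n (Suc i))) \<omega> - B (clock (u n i)) \<omega>)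
      = (V (u n (Suc i)) \<omega> - V (u n i) \<omega>) + (1 - exp (- h n)) * V (u n i) \<omega>" for i
    proof -
      have "exp (- u n (Suc i)) = exp (- h n) * exp (- u n i)"
        unfolding u by (simp add: exp_add[symmetric])
      then have "exp (- u n (Suc i)) * B (clock (u n i)) \<omega> = exp (- h n) * V (u n i) \<omega>"
        by (simp only: V_def mult.assoc)
      then show ?thesis
        by (simp only: right_diff_distrib left_diff_distrib mult_1 V_def[of "u n (Suc i)", symmetric])
    qed
    then have "S n \<omega> = (\<Sum>i<n. V (u n (Suc i)) \<omega> - V (u n i) \<omega>) + (1 - exp (- h n)) * (\<Sum>i<n. V (u n i) \<omega>)"
      by (simp add: S_def sum.distrib sum_distrib_left)
    also have "(\<Sum>i<n. V (u n (Suc i)) \<omega> - V (u n i) \<omega>) = V (u n n) \<omega> - V (u n 0) \<omega>"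
      by (rule sum_lessThan_telescope)
    finally show ?thesis using that by (simp add: u_def h_def)
  qed
  have lim: "(\<lambda>n. S n \<omega>) \<longlonglongrightarrow> Y t \<omega> - Y s \<omega>" if w: "\<omega> \<in> space M" for \<omega>
  proof -
    have Yst: "Y t \<omega> - Y s \<omega> = V t \<omega> - V s \<omega> + integral {s..t} (\<lambda>u. V u \<omega>)"
      using Y_eq[OF w, of t] Y_eq[OF w, of s] assms
        Henstock_Kurzweil_Integration.integral_combine[OF assms V_integrable[OF w]] by simp
    show ?thesis
    proof (cases "s = t")
      case True
      have "\<forall>\<^sub>F n in sequentially. S n \<omega> = 0"
        using eventually_gt_at_top[of 0] by eventually_elim (simp add: Seq, simp add: True h_def)
      then show ?thesis using True by (simp add: tendsto_eventually)
    next
      case False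
      then have hpos: "0 < h n" if "n > 0" for n using assms that by (simp add: h_def)
      have hlim: "filterlim h (at 0) sequentially"
        unfolding filterlim_at
      proof
        have "(\<lambda>n. (t - s) * inverse (real n)) \<longlonglongrightarrow> (t - s) * 0"
          by (intro tendsto_mult tendsto_const lim_inverse_n)
        then show "h \<longlonglongrightarrow> 0" by (simp add: h_def[abs_def] divide_inverse)
        show "\<forall>\<^sub>F n in sequentially. h n \<in> UNIV \<and> h n \<noteq> 0"
          using eventually_gt_at_top[of 0]
        proof eventually_elim
          case (elim n) then show ?case using hpos[OF elim] by simp
        qed
      qed
      \<comment> \<open>1 - exp(-h) is asymptotic to the mesh h, so the remaining sum behaves like a
        Riemann sum of V.\<close>
      have "((\<lambda>x::real. - exp (- x)) has_real_derivative 1) (at 0)"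
        by (auto intro!: derivative_eq_intros)
      then have "((\<lambda>x::real. (1 - exp (- x)) / x) \<longlongrightarrow> 1) (at 0)"
        by (simp add: DERIV_def)
      from filterlim_compose[OF this hlim] have q: "(\<lambda>n. (1 - exp (- h n)) / h n) \<longlonglongrightarrow> 1" .
      have "(\<lambda>n. riemann_sum (\<lambda>s. V s \<omega>) s t n) \<longlonglongrightarrow> integral {s..t} (\<lambda>s. V s \<omega>)"
        by (rule riemann_sum_tendsto[OF assms(2) V_cont[OF w]])
      from tendsto_add[OF tendsto_const[of "V t \<omega> - V s \<omega>"] tendsto_mult[OF q this]]
      have "(\<lambda>n. V t \<omega> - V s \<omega> + (1 - exp (- h n)) / h n * riemann_sum (\<lambda>s. V s \<omega>) s t n) \<longlonglongrightarrow> Y t \<omega> - Y s \<omega>"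
        unfolding Yst by simp
      then show ?thesis
      proof (rule Lim_transform_eventually)
        show "\<forall>\<^sub>F n in sequentially. V t \<omega> - V s \<omega> + (1 - exp (- h n)) / h n * riemann_sum (\<lambda>s. V s \<omega>) s t n = S n \<omega>"
          using eventually_gt_at_top[of 0]
        proof eventually_elim
          case (elim n)
          have "riemann_sum (\<lambda>s. V s \<omega>) s t n = h n * (\<Sum>i<n. V (u n i) \<omega>)"
            unfolding riemann_sum_def by (simp add: h_def u_def sum_distrib_left)
          then show ?case using hpos[OF elim] by (simp add: Seq[OF elim])
        qed
      qed
    qed
  qed
  have repr: "\<exists>c r. (\<forall>i<n. 0 \<le> c i) \<and> (\<forall>i<n. 0 \<le> r i \<and> r i \<le> r (Suc i)) \<and>
      S n = (\<lambda>\<omega>. \<Sum>i<n. c i * (B (r (Suc i)) \<omega> - B (r i) \<omega>))" for n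
  proof (intro exI conjI allI impI)
    show "S n = (\<lambda>\<omega>. \<Sum>i<n. exp (- u n (Suc i)) * (B (clock (u n (Suc i))) \<omega> - B (clock (u n i)) \<omega>))"
      by (simp only: S_def)
    show "clock (u n i) \<le> clock (u n (Suc i))" for i using h[of n] by (intro clock_mono) (simp add: u)
  qed (simp_all add: less_imp_le[OF clock_pos])
  show ?thesis
    by (intro exI[of _ S] conjI allI SG G_pointwise_limit(2)[OF SG lim] repr)
qed

text \<open>The property holds for increments of B and passes to their combinations with
  non-negative weights; the two approximations are then removed one after the other. It will bound
  the Hilbert seminorm by the supremum norm.\<close>

lemma Y_increments_nonneg:
  assumes "0 \<le> a" "a \<le> b" "0 \<le> c" "c \<le> d"
  shows "0 \<le> (\<integral>\<omega>. (Y b \<omega> - Y a \<omega>) * (Y d \<omega> - Y c \<omega>) \<partial>M)"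
proof -
  obtain S where S: "\<And>n. S n \<in> G" "(\<lambda>n. rms M (\<lambda>\<omega>. S n \<omega> - (Y b \<omega> - Y a \<omega>))) \<longlonglongrightarrow> 0"
    "\<And>n. \<exists>c r. (\<forall>i<n. 0 \<le> c i) \<and> (\<forall>i<n. 0 \<le> r i \<and> r i \<le> r (Suc i)) \<and>
      S n = (\<lambda>\<omega>. \<Sum>i<n. c i * (B (r (Suc i)) \<omega> - B (r i) \<omega>))"
    using Y_increment_limit[OF assms(1,2)] by blast
  obtain S' where S': "\<And>n. S' n \<in> G" "(\<lambda>n. rms M (\<lambda>\<omega>. S' n \<omega> - (Y d \<omega> - Y c \<omega>))) \<longlonglongrightarrow> 0"
    "\<And>n. \<exists>c r. (\<forall>i<n. 0 \<le> c i) \<and> (\<forall>i<n. 0 \<le> r i \<and> r i \<le> r (Suc i)) \<and>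
      S' n = (\<lambda>\<omega>. \<Sum>i<n. c i * (B (r (Suc i)) \<omega> - B (r i) \<omega>))"
    using Y_increment_limit[OF assms(3,4)] by blast
  have YG: "(\<lambda>\<omega>. Y b \<omega> - Y a \<omega>) \<in> sq_int M" "(\<lambda>\<omega>. Y d \<omega> - Y c \<omega>) \<in> sq_int M"
    using assms by (auto intro!: G_sq_int G_diff Y_G)
  have nonneg: "0 \<le> (\<integral>\<omega>. S n \<omega> * S' m \<omega> \<partial>M)" for n m
  proof -
    obtain c r where cr: "\<And>i. i < n \<Longrightarrow> 0 \<le> c i" "\<And>i. i < n \<Longrightarrow> 0 \<le> r i \<and> r i \<le> r (Suc i)"
      and Sn: "S n = (\<lambda>\<omega>. \<Sum>i<n. c i * (B (r (Suc i)) \<omega> - B (r i) \<omega>))" using S(3)[of n] by blast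
    obtain c' r' where cr': "\<And>i. i < m \<Longrightarrow> 0 \<le> c' i" "\<And>i. i < m \<Longrightarrow> 0 \<le> r' i \<and> r' i \<le> r' (Suc i)"
      and Sm: "S' m = (\<lambda>\<omega>. \<Sum>i<m. c' i * (B (r' (Suc i)) \<omega> - B (r' i) \<omega>))" using S'(3)[of m] by blast
    let ?P = "\<lambda>i j \<omega>. (c i * c' j) * ((B (r (Suc i)) \<omega> - B (r i) \<omega>) * (B (r' (Suc j)) \<omega> - B (r' j) \<omega>))"
    have int: "integrable M (?P i j)" if "i < n" "j < m" for i j
    proof -
      have "0 \<le> r (Suc i)" "0 \<le> r i" "0 \<le> r' (Suc j)" "0 \<le> r' j" using cr(2)[OF that(1)] cr'(2)[OF that(2)] by auto
      then show ?thesis by (intro integrable_mult_right integrable_sq_int_mult G_sq_int G_diff B_G)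
    qed
    have "(\<integral>\<omega>. S n \<omega> * S' m \<omega> \<partial>M) = (\<integral>\<omega>. (\<Sum>i<n. \<Sum>j<m. ?P i j \<omega>) \<partial>M)"
      unfolding Sn Sm sum_product by (simp only: mult_ac)
    also have "\<dots> = (\<Sum>i<n. \<integral>\<omega>. (\<Sum>j<m. ?P i j \<omega>) \<partial>M)"
      by (intro Bochner_Integration.integral_sum Bochner_Integration.integrable_sum int) auto
    also have "\<dots> = (\<Sum>i<n. \<Sum>j<m. \<integral>\<omega>. ?P i j \<omega> \<partial>M)"
      by (intro sum.cong refl Bochner_Integration.integral_sum int) auto
    also have "\<dots> \<ge> 0"
    proof (intro sum_nonneg)
      fix i j assume "i \<in> {..<n}" "j \<in> {..<m}"
      then have ij: "i < n" "j < m" by auto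
      have "0 \<le> (\<integral>\<omega>. (B (r (Suc i)) \<omega> - B (r i) \<omega>) * (B (r' (Suc j)) \<omega> - B (r' j) \<omega>) \<partial>M)"
        using cr(2)[OF ij(1)] cr'(2)[OF ij(2)] by (intro B_increments_nonneg) auto
      then show "0 \<le> (\<integral>\<omega>. ?P i j \<omega> \<partial>M)" using cr(1)[OF ij(1)] cr'(1)[OF ij(2)] by simp
    qed
    finally show ?thesis .
  qed
  have step: "0 \<le> (\<integral>\<omega>. S n \<omega> * (Y d \<omega> - Y c \<omega>) \<partial>M)" for n
    by (rule LIMSEQ_le_const[OF integral_mult_tendsto[OF G_sq_int[OF S'(1)] YG(2) G_sq_int[OF S(1)] S'(2)]])
      (use nonneg in auto)
  have "(\<lambda>n. \<integral>\<omega>. (Y d \<omega> - Y c \<omega>) * S n \<omega> \<partial>M) \<longlonglongrightarrow> (\<integral>\<omega>. (Y d \<omega> - Y c \<omega>) * (Y b \<omega> - Y a \<omega>) \<partial>M)"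
    by (rule integral_mult_tendsto[OF G_sq_int[OF S(1)] YG(1) YG(2) S(2)])
  then have "0 \<le> (\<integral>\<omega>. (Y d \<omega> - Y c \<omega>) * (Y b \<omega> - Y a \<omega>) \<partial>M)"
    by (rule LIMSEQ_le_const) (use step in \<open>auto simp: mult.commute\<close>)
  then show ?thesis by (simp add: mult.commute)
qed

end

section \<open>The energy\<close>

context gaussian_space
begin

text \<open>By \<open>G_square_square\<close> the second moment of the product is at most 3 times
  the product of the variances, and 2 is a convenient bound for the root of 3. Mean-square estimates
  thus carry over from factors to products.\<close>

lemma G_mult_rms_le:
  assumes "A \<in> G" "B \<in> G"
  shows "rms M (\<lambda>\<omega>. A \<omega> * B \<omega>) \<le> 2 * (rms M A * rms M B)"
proof (rule power2_le_imp_le)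
  define a b c where "a = rms M A" and "b = rms M B" and "c = (\<integral>\<omega>. A \<omega> * B \<omega> \<partial>M)"
  have "\<bar>c\<bar> \<le> a * b"
    unfolding a_def b_def c_def by (intro cauchy_schwarz_integral G_sq_int assms)
  then have c: "c\<^sup>2 \<le> (a * b)\<^sup>2"
    using abs_le_square_iff[of c "a * b"] by (simp add: a_def b_def)
  have "(rms M (\<lambda>\<omega>. A \<omega> * B \<omega>))\<^sup>2 = a\<^sup>2 * b\<^sup>2 + 2 * c\<^sup>2"
    unfolding rms_square power_mult_distrib a_def b_def c_def G_square_square[OF assms] ..
  also have "\<dots> \<le> 4 * (a * b)\<^sup>2" unfolding power_mult_distrib[symmetric] using c zero_le_power2[of "a * b"] by linarith
  finally show "(rms M (\<lambda>\<omega>. A \<omega> * B \<omega>))\<^sup>2 \<le> (2 * (rms M A * rms M B))\<^sup>2"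
    by (simp add: a_def b_def power_mult_distrib)
qed simp

end

lemma integral_exp_abs_le:
  assumes "0 < k" "0 \<le> t" "t \<le> T"
  shows "integral {0..T} (\<lambda>s. exp (- k * \<bar>t - s\<bar>)) \<le> 2 / (k::real)"
proof -
  have 1: "((\<lambda>s. exp (- k * \<bar>t - s\<bar>)) has_integral (exp (- k * (t - t)) / k - exp (- k * (t - 0)) / k)) {0..t}"
  proof (rule has_integral_eq[rotated])
    show "((\<lambda>s. exp (- k * (t - s))) has_integral (exp (- k * (t - t)) / k - exp (- k * (t - 0)) / k)) {0..t}"
      by (rule fundamental_theorem_of_calculus[OF assms(2)])
        (use assms in \<open>auto intro!: derivative_eq_intros simp: has_real_derivative_iff_has_vector_derivative[symmetric]\<close>)
  qed auto
  have 2: "((\<lambda>s. exp (- k * \<bar>t - s\<bar>)) has_integral (- exp (- k * (T - t)) / k - (- exp (- k * (t - t)) / k))) {t..T}"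
  proof (rule has_integral_eq[rotated])
    show "((\<lambda>s. exp (- k * (s - t))) has_integral (- exp (- k * (T - t)) / k - (- exp (- k * (t - t)) / k))) {t..T}"
      by (rule fundamental_theorem_of_calculus[OF assms(3)])
        (use assms in \<open>auto intro!: derivative_eq_intros simp: has_real_derivative_iff_has_vector_derivative[symmetric]\<close>)
  qed auto
  have "integral {0..T} (\<lambda>s. exp (- k * \<bar>t - s\<bar>))
    = exp (- k * (t - t)) / k - exp (- k * (t - 0)) / k + (- exp (- k * (T - t)) / k - (- exp (- k * (t - t)) / k))"
    by (rule integral_unique[OF has_integral_combine[OF assms(2,3) 1 2]])
  also have "\<dots> = (2 - exp (- k * t) - exp (- k * (T - t))) / k"
    by (simp add: diff_divide_distrib)
  also have "\<dots> \<le> 2 / k"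
    using assms(1) exp_gt_zero[of "- k * t"] exp_gt_zero[of "- k * (T - t)"]
    by (intro divide_right_mono) linarith+
  finally show ?thesis .
qed

context second_kind_ou
begin

text \<open>Bounds the mean-square size of V - \<theta> X, the derivative of X - V.\<close>

definition KX :: real where "KX = sqrt CV + \<theta> * sqrt CX"

lemma V_rms_le: "rms M (V s) \<le> sqrt CV"
proof (rule real_le_rsqrt)
  show "(rms M (V s))\<^sup>2 \<le> CV"
    unfolding rms_square unfolding power2_eq_square using V_cov_bound[of s s] by simp
qed

lemma X_rms_le: "0 \<le> s \<Longrightarrow> rms M (X s) \<le> sqrt CX"
  by (rule real_le_rsqrt[OF X_rms_bound])

lemma X_increment_eq:
  assumes w: "\<omega> \<in> space M" and "0 \<le> s" "s \<le> t"
  shows "X t \<omega> - X s \<omega> = (Y t \<omega> - Y s \<omega>) - \<theta> * integral {s..t} (\<lambda>u. X u \<omega>)"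
proof -
  have "integral {0..s} (\<lambda>u. X u \<omega>) + integral {s..t} (\<lambda>u. X u \<omega>) = integral {0..t} (\<lambda>u. X u \<omega>)"
    by (rule Henstock_Kurzweil_Integration.integral_combine[OF assms(2,3) X_integrable[OF w]]) simp
  from this[symmetric] show ?thesis
    using X_integral_eq[OF w, of t] X_integral_eq[OF w, of s] assms(2,3) by (simp add: algebra_simps)
qed

lemma Y_increment_eq:
  assumes w: "\<omega> \<in> space M" and "0 \<le> s" "s \<le> t"
  shows "Y t \<omega> - Y s \<omega> = (V t \<omega> - V s \<omega>) + integral {s..t} (\<lambda>u. V u \<omega>)"
proof -
  have "integral {0..s} (\<lambda>u. V u \<omega>) + integral {s..t} (\<lambda>u. V u \<omega>) = integral {0..t} (\<lambda>u. V u \<omega>)"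
    by (rule Henstock_Kurzweil_Integration.integral_combine[OF assms(2,3) V_integrable[OF w]])
  from this[symmetric] show ?thesis
    using Y_eq[OF w, of t] Y_eq[OF w, of s] assms(2,3) by simp
qed

lemma rms_cong: "(\<And>\<omega>. \<omega> \<in> space M \<Longrightarrow> Z \<omega> = Z' \<omega>) \<Longrightarrow> rms M Z = rms M Z'"
  unfolding rms_def by (intro arg_cong[where f=sqrt] Bochner_Integration.integral_cong) auto

text \<open>X differs from V by a differentiable path, so its increments are those of V, of order (t
  - s)^H, plus a term of order t - s.\<close>

lemma X_holder:
  assumes "0 \<le> s" "s \<le> t" "t \<le> T"
  shows "(rms M (\<lambda>\<omega>. X t \<omega> - X s \<omega>))\<^sup>2 \<le> 2 * exp T * (t - s) powr (2 * H) + 2 * KX\<^sup>2 * (t - s)\<^sup>2"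
proof -
  let ?Q = "\<lambda>u \<omega>. V u \<omega> - \<theta> * X u \<omega>"
  have QG: "?Q u \<in> G" if "u \<in> {s..t}" for u
    using that assms(1) by (intro G_diff V_G G_cmult X_G) simp
  have Q: "ms_process M s t ?Q"
  proof (rule G_ms_process[OF QG])
    show "continuous_on {s..t} (\<lambda>u. ?Q u \<omega>)" if w: "\<omega> \<in> space M" for \<omega>
      using assms(1) by (intro continuous_on_diff V_cont[OF w] continuous_on_mult_left X_cont[OF w]) auto
  qed
  have K: "rms M (?Q u) \<le> KX" if "u \<in> {s..t}" for u
  proof -
    have u: "0 \<le> u" using that assms by simp
    have "rms M (?Q u) \<le> rms M (V u) + rms M (\<lambda>\<omega>. \<theta> * X u \<omega>)"
      by (intro rms_diff_le G_sq_int V_G G_cmult X_G u)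
    also have "\<dots> \<le> KX"
      unfolding rms_cmult KX_def using theta by (intro add_mono V_rms_le mult_mono X_rms_le u) auto
    finally show ?thesis .
  qed
  have eq: "X t \<omega> - X s \<omega> = (V t \<omega> - V s \<omega>) + integral {s..t} (\<lambda>u. ?Q u \<omega>)" if w: "\<omega> \<in> space M" for \<omega>
  proof -
    have "integral {s..t} (\<lambda>u. ?Q u \<omega>) = integral {s..t} (\<lambda>u. V u \<omega>) - \<theta> * integral {s..t} (\<lambda>u. X u \<omega>)"
      using assms(1)
      by (subst Henstock_Kurzweil_Integration.integral_diff)
        (auto intro!: integrable_continuous_real continuous_on_mult_left V_cont X_cont w)
    then show ?thesis
      using X_increment_eq[OF w assms(1,2)] Y_increment_eq[OF w assms(1,2)] by simp
  qed
  define a b where "a = rms M (\<lambda>\<omega>. V t \<omega> - V s \<omega>)" and "b = rms M (\<lambda>\<omega>. integral {s..t} (\<lambda>u. ?Q u \<omega>))"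
  have "rms M (\<lambda>\<omega>. X t \<omega> - X s \<omega>) = rms M (\<lambda>\<omega>. (V t \<omega> - V s \<omega>) + integral {s..t} (\<lambda>u. ?Q u \<omega>))"
    by (rule rms_cong[OF eq])
  also have "\<dots> \<le> a + b"
    unfolding a_def b_def by (intro rms_add_le sq_int_diff G_sq_int V_G ms_integral_sq_int[OF Q assms(2)])
  finally have "(rms M (\<lambda>\<omega>. X t \<omega> - X s \<omega>))\<^sup>2 \<le> (a + b)\<^sup>2" by (intro power_mono) auto
  also have "\<dots> \<le> 2 * a\<^sup>2 + 2 * b\<^sup>2"
    using zero_le_power2[of "a - b"] by (simp add: power2_sum power2_diff)
  also have "\<dots> \<le> 2 * (exp T * (t - s) powr (2 * H)) + 2 * ((t - s) * KX)\<^sup>2"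
  proof -
    have "a\<^sup>2 \<le> exp T * (t - s) powr (2 * H)" unfolding a_def by (rule V_holder[OF assms])
    moreover have "b \<le> (t - s) * KX"
      unfolding b_def by (rule ms_process_integral_rms_le[OF Q assms(2) K])
    then have "b\<^sup>2 \<le> ((t - s) * KX)\<^sup>2" by (intro power_mono) (auto simp: b_def)
    ultimately show ?thesis by simp
  qed
  finally show ?thesis by (simp add: power_mult_distrib mult_ac)
qed

text \<open>The increment \<open>\<Delta>\<close> of \<open>B\<close> over the last unit of time has non-negative correlation with every
  other increment, so \<open>X\<close> has a correlation with it that is bounded below.\<close>

definition cX :: real where
  "cX = exp (- (\<theta> - 1)) * (H * (1 - exp (- 1 / H))) powr H"

lemma cX_pos: "0 < cX"
  using H_pos by (simp add: cX_def)

text \<open>By Cauchy-Schwarz it suffices to bound E(\<Delta> X(t)) from below. With \<beta>(u) =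
  E(\<Delta> B(clock u)) it is, formally, exp(-\<theta> t) times the integral of exp((\<theta> - 1)
  u) d\<beta>(u) over [0,t]. As \<beta> is nondecreasing, only the last unit of time is kept, over
  which \<beta> grows by the variance of \<Delta>. Since \<Delta> has size exp(t) times a constant,
  all powers of exp(t) cancel.\<close>

lemma X_rms_lower:
  assumes t: "1 \<le> t"
  shows "cX \<le> rms M (X t)"
proof -
  define \<Delta> where "\<Delta> = (\<lambda>\<omega>. B (clock t) \<omega> - B (clock (t - 1)) \<omega>)"
  define \<beta> where "\<beta> s = (\<integral>\<omega>. \<Delta> \<omega> * B (clock s) \<omega> \<partial>M)" for s
  note cp = less_imp_le[OF clock_pos]
  have BG: "B (clock s) \<in> sq_int M" for s by (rule G_sq_int[OF B_G[OF cp]])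
  have D: "\<Delta> \<in> sq_int M" unfolding \<Delta>_def by (intro sq_int_diff BG)
  have \<beta>_diff: "\<beta> v - \<beta> u = (\<integral>\<omega>. \<Delta> \<omega> * (B (clock v) \<omega> - B (clock u) \<omega>) \<partial>M)" for u v
    using integrable_sq_int_mult[OF D BG] by (simp add: \<beta>_def right_diff_distrib)
  have \<beta>_mono: "\<beta> u \<le> \<beta> v" if "u \<le> v" for u v
  proof -
    have "0 \<le> \<beta> v - \<beta> u" unfolding \<beta>_diff \<Delta>_def
      using that by (intro B_increments_nonneg cp clock_mono) auto
    then show ?thesis by simp
  qed
  have \<beta>_last: "\<beta> t - \<beta> (t - 1) = (rms M \<Delta>)\<^sup>2"
    unfolding \<beta>_diff rms_square unfolding power2_eq_square by (simp add: \<Delta>_def)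
  have \<beta>V: "(\<integral>\<omega>. \<Delta> \<omega> * V u \<omega> \<partial>M) = exp (- u) * \<beta> u" for u
    unfolding \<beta>_def V_def by (simp only: mult.left_commute[of _ "exp (- u)"] integral_mult_right_zero)
  define \<gamma> where "\<gamma> = \<theta> - 1"
  have \<gamma>: "\<gamma> > 0" using theta by (simp add: \<gamma>_def)
  define E where "E u = exp (\<gamma> * u)" for u
  have E_mono: "E u \<le> E v" if "u \<le> v" for u v using that \<gamma> by (simp add: E_def)
  have expE: "exp (- \<theta> * (t - u)) * (exp (- u) * \<beta> u) = exp (- \<theta> * t) * (E u * \<beta> u)" for u
  proof -
    have "- \<theta> * (t - u) + - u = - \<theta> * t + \<gamma> * u" by (simp add: \<gamma>_def algebra_simps)
    then have "exp (- \<theta> * (t - u)) * exp (- u) = exp (- \<theta> * t) * E u"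
      unfolding E_def exp_add[symmetric] by (rule arg_cong)
    then show ?thesis by (simp only: mult.assoc[symmetric])
  qed
  have E_int: "((\<lambda>u. \<gamma> * (E u * c)) has_integral (E b * c - E a * c)) {a..b}" if "a \<le> b" for a b c
    unfolding E_def by (rule fundamental_theorem_of_calculus[OF that])
      (auto intro!: derivative_eq_intros simp: has_real_derivative_iff_has_vector_derivative[symmetric])
  have \<beta>_cont: "continuous_on {a..b} (\<lambda>u. E u * \<beta> u)" for a b
  proof -
    have "continuous_on {a..b} (\<lambda>u. exp u * (\<integral>\<omega>. \<Delta> \<omega> * V u \<omega> \<partial>M))"
      by (intro continuous_on_mult continuous_on_exp continuous_on_id continuous_on_expectation_mult[OF V_ms D])
    then have "continuous_on {a..b} \<beta>" by (simp add: \<beta>V mult.assoc[symmetric] exp_minus)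
    then show ?thesis unfolding E_def by (intro continuous_intros)
  qed
  define I where "I a b = integral {a..b} (\<lambda>u. \<gamma> * (E u * \<beta> u))" for a b
  have Iint: "(\<lambda>u. \<gamma> * (E u * \<beta> u)) integrable_on {a..b}" for a b
    by (intro integrable_continuous_real continuous_on_mult_left \<beta>_cont)
  \<comment> \<open>After integration by parts, bounding \<beta> by its value at the right end of
    [a,b] amounts to bounding the weight E in the formal integral of E d\<beta> by its value at the
    left end.\<close>
  have I_le: "I a b \<le> E b * \<beta> b - E a * \<beta> b" if "a \<le> b" for a b
    unfolding I_def integral_unique[OF E_int[OF that], symmetric]
  proof (rule integral_le[OF Iint])
    show "(\<lambda>u. \<gamma> * (E u * \<beta> b)) integrable_on {a..b}" using E_int[OF that] by (rule has_integral_integrable)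
    show "\<gamma> * (E u * \<beta> u) \<le> \<gamma> * (E u * \<beta> b)" if "u \<in> {a..b}" for u
      using \<gamma> that by (intro mult_left_mono \<beta>_mono) (auto simp: E_def)
  qed
  have "I 0 t = I 0 (t - 1) + I (t - 1) t"
    unfolding I_def by (rule Henstock_Kurzweil_Integration.integral_combine[symmetric, OF _ _ Iint]) (use t in auto)
  also have "\<dots> \<le> (E (t - 1) * \<beta> (t - 1) - E 0 * \<beta> (t - 1)) + (E t * \<beta> t - E (t - 1) * \<beta> t)"
    using t by (intro add_mono I_le) auto
  finally have "E (t - 1) * (\<beta> t - \<beta> (t - 1)) + (\<beta> (t - 1) - \<beta> 0) \<le> E t * \<beta> t - \<beta> 0 - I 0 t"
    by (simp add: E_def algebra_simps)
  then have low: "E (t - 1) * (rms M \<Delta>)\<^sup>2 \<le> E t * \<beta> t - \<beta> 0 - I 0 t"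
    using \<beta>_mono[of 0 "t - 1"] t \<beta>_last by simp
  have "(\<integral>\<omega>. \<Delta> \<omega> * X t \<omega> \<partial>M) = exp (- \<theta> * t) * (E t * \<beta> t - \<beta> 0 - I 0 t)"
  proof -
    have "exp (- t) * \<beta> t = exp (- \<theta> * t) * (E t * \<beta> t)" using expE[of t] by simp
    moreover have "(1 - \<theta>) * integral {0..t} (\<lambda>u. exp (- \<theta> * (t - u)) * (exp (- u) * \<beta> u)) = - exp (- \<theta> * t) * I 0 t"
      unfolding expE I_def integral_mult_right \<gamma>_def by (simp add: algebra_simps)
    moreover have "(\<integral>\<omega>. \<Delta> \<omega> * X t \<omega> \<partial>M) = exp (- t) * \<beta> t - exp (- \<theta> * t) * (exp (- 0) * \<beta> 0)
      + (1 - \<theta>) * integral {0..t} (\<lambda>u. exp (- \<theta> * (t - u)) * (exp (- u) * \<beta> u))"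
      using expectation_X[OF D, of t] t unfolding \<beta>V by simp
    ultimately show ?thesis by (simp add: right_diff_distrib)
  qed
  then have "exp (- \<theta> * t) * (E (t - 1) * (rms M \<Delta>)\<^sup>2) \<le> (\<integral>\<omega>. \<Delta> \<omega> * X t \<omega> \<partial>M)"
    using low by (simp add: mult_left_mono)
  also have "\<dots> \<le> rms M \<Delta> * rms M (X t)"
    using cauchy_schwarz_integral[OF D G_sq_int[OF X_G], of t] t by simp
  finally have "(exp (- \<theta> * t) * E (t - 1) * rms M \<Delta>) * rms M \<Delta> \<le> rms M (X t) * rms M \<Delta>"
    by (simp add: power2_eq_square mult_ac)
  moreover have rD: "rms M \<Delta> = (clock t - clock (t - 1)) powr H"
  proof -
    define a b where "a = clock (t - 1)" and "b = clock t"
    have ab: "0 < a" "a \<le> b" using clock_pos clock_mono by (auto simp: a_def b_def)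
    have sq: "B a \<in> sq_int M" "B b \<in> sq_int M" using BG by (auto simp: a_def b_def)
    have "(rms M \<Delta>)\<^sup>2 = (\<integral>\<omega>. B b \<omega> * B b \<omega> - 2 * (B b \<omega> * B a \<omega>) + B a \<omega> * B a \<omega> \<partial>M)"
      unfolding rms_square \<Delta>_def a_def b_def
      by (rule arg_cong[where f="integral\<^sup>L M"]) (auto simp: power2_eq_square algebra_simps)
    also have "\<dots> = fbm_cov H b b - 2 * fbm_cov H b a + fbm_cov H a a"
      using ab sq by (simp add: integrable_sq_int_mult B_cov)
    also have "\<dots> = (b - a) powr (2 * H)" using ab H_pos by (simp add: fbm_cov_def field_simps)
    also have "\<dots> = ((b - a) powr H)\<^sup>2"
      using powr_add[of "b - a" H H] by (simp add: power2_eq_square)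
    finally show ?thesis
      using power2_eq_iff_nonneg[of "rms M \<Delta>" "(b - a) powr H"] by (simp add: a_def b_def)
  qed
  have cl: "clock t - clock (t - 1) = exp (t / H) * (H * (1 - exp (- 1 / H)))"
  proof -
    have "exp ((t - 1) / H) = exp (t / H) * exp (- 1 / H)"
      by (simp add: exp_add[symmetric] diff_divide_distrib)
    then show ?thesis by (simp add: clock_def algebra_simps)
  qed
  have q: "0 < H * (1 - exp (- 1 / H))" using H_pos by simp
  have "rms M \<Delta> = exp t * (H * (1 - exp (- 1 / H))) powr H"
    unfolding rD cl using q H_pos by (simp add: powr_mult powr_def[of "exp (t / H)"])
  moreover have "(H * (1 - exp (- 1 / H))) powr H > 0"
    by (rule powr_gt_zero[THEN iffD2]) (use q in linarith)
  with calculation have "rms M \<Delta> > 0" by (simp only: zero_less_mult_iff) simp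
  ultimately have "exp (- \<theta> * t) * E (t - 1) * (exp t * (H * (1 - exp (- 1 / H))) powr H) \<le> rms M (X t)"
    by (simp add: mult_le_cancel_right)
  moreover have "exp (- \<theta> * t) * E (t - 1) * exp t = exp (- (\<theta> - 1))"
  proof -
    have "- \<theta> * t + \<gamma> * (t - 1) + t = - (\<theta> - 1)" by (simp add: \<gamma>_def algebra_simps)
    then show ?thesis unfolding E_def exp_add[symmetric] by (rule arg_cong)
  qed
  ultimately show ?thesis by (simp only: cX_def mult.assoc[symmetric])
qed

section \<open>Mean and variance of the energy\<close>

definition energy :: "real \<Rightarrow> 'w \<Rightarrow> real" where
  "energy T \<omega> = integral {0..T} (\<lambda>t. (X t \<omega>)\<^sup>2)"

text \<open>A difference of squares is a product of two members of the Gaussian space, one small by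
  mean-square continuity of X, the other bounded by the uniform variance bound.\<close>

lemma X_square_ms: "ms_process M 0 T (\<lambda>t \<omega>. (X t \<omega>)\<^sup>2)"
  unfolding ms_process_def
proof (intro conjI ballI allI impI)
  show "(\<lambda>\<omega>. (X s \<omega>)\<^sup>2) \<in> sq_int M" if "s \<in> {0..T}" for s
    using that by (intro G_square_sq_int X_G) simp
  show "continuous_on {0..T} (\<lambda>s. (X s \<omega>)\<^sup>2)" if "\<omega> \<in> space M" for \<omega>
    by (intro continuous_on_power X_cont[OF that]) auto
  fix e :: real assume "e > 0"
  define K where "K = 2 * sqrt CX"
  define e' where "e' = e / (2 * K + 1)"
  have K: "K \<ge> 0" using CX_nonneg by (simp add: K_def)
  have e': "e' > 0" "2 * (e' * K) < e"
    using \<open>e > 0\<close> K by (auto simp: e'_def field_simps)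
  have "ms_process M 0 T X" by (rule X_ms) simp
  then obtain d where d: "d > 0"
    "\<forall>s\<in>{0..T}. \<forall>r\<in>{0..T}. \<bar>s - r\<bar> < d \<longrightarrow> rms M (\<lambda>\<omega>. X s \<omega> - X r \<omega>) < e'"
    unfolding ms_process_def using e'(1) by metis
  show "\<exists>d>0. \<forall>s\<in>{0..T}. \<forall>r\<in>{0..T}. \<bar>s - r\<bar> < d \<longrightarrow> rms M (\<lambda>\<omega>. (X s \<omega>)\<^sup>2 - (X r \<omega>)\<^sup>2) < e"
  proof (intro exI[of _ d] conjI ballI impI d(1))
    fix s r assume s: "s \<in> {0..T}" and r: "r \<in> {0..T}" and sr: "\<bar>s - r\<bar> < d"
    have XG: "X s \<in> G" "X r \<in> G" using s r by (auto intro!: X_G)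
    have "rms M (\<lambda>\<omega>. (X s \<omega>)\<^sup>2 - (X r \<omega>)\<^sup>2) = rms M (\<lambda>\<omega>. (X s \<omega> - X r \<omega>) * (X s \<omega> + X r \<omega>))"
      by (simp add: power2_eq_square algebra_simps)
    also have "\<dots> \<le> 2 * (rms M (\<lambda>\<omega>. X s \<omega> - X r \<omega>) * rms M (\<lambda>\<omega>. X s \<omega> + X r \<omega>))"
      by (intro G_mult_rms_le G_diff G_add XG)
    also have "\<dots> \<le> 2 * (e' * K)"
    proof -
      have "rms M (\<lambda>\<omega>. X s \<omega> + X r \<omega>) \<le> rms M (X s) + rms M (X r)"
        by (intro rms_add_le G_sq_int XG)
      also have "\<dots> \<le> K" using X_rms_le[of s] X_rms_le[of r] s r by (simp add: K_def)
      finally have "rms M (\<lambda>\<omega>. X s \<omega> + X r \<omega>) \<le> K" .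
      moreover have "rms M (\<lambda>\<omega>. X s \<omega> - X r \<omega>) \<le> e'" using d(2) s r sr by (intro less_imp_le) simp
      ultimately show ?thesis using e' by (intro mult_left_mono mult_mono) auto
    qed
    also have "\<dots> < e" by (rule e'(2))
    finally show "rms M (\<lambda>\<omega>. (X s \<omega>)\<^sup>2 - (X r \<omega>)\<^sup>2) < e" .
  qed
qed

lemma energy_sq_int: "0 \<le> T \<Longrightarrow> energy T \<in> sq_int M"
  unfolding energy_def[abs_def] by (rule ms_integral_sq_int[OF X_square_ms])

lemma expectation_mult_energy:
  "0 \<le> T \<Longrightarrow> W \<in> sq_int M \<Longrightarrow> (\<integral>\<omega>. W \<omega> * energy T \<omega> \<partial>M) = integral {0..T} (\<lambda>t. \<integral>\<omega>. W \<omega> * (X t \<omega>)\<^sup>2 \<partial>M)"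
  unfolding energy_def by (rule expectation_mult_integral[OF X_square_ms])

lemma expectation_energy: "0 \<le> T \<Longrightarrow> (\<integral>\<omega>. energy T \<omega> \<partial>M) = integral {0..T} (\<lambda>t. (rms M (X t))\<^sup>2)"
  using expectation_mult_energy[of T "\<lambda>_. 1"] by (simp add: rms_square)

lemma X_rms_square_continuous: "continuous_on {0..T} (\<lambda>t. (rms M (X t))\<^sup>2)"
  using continuous_on_expectation_mult[OF X_square_ms sq_int_const[of 1], of T] by (simp add: rms_square)

text \<open>The lower bound for the variance looks back one unit of time, so it is available from t
  = 1 on; the integral over the first unit is only known to be non-negative.\<close>

lemma expectation_energy_lower:
  assumes "1 \<le> T"
  shows "cX\<^sup>2 * (T - 1) \<le> (\<integral>\<omega>. energy T \<omega> \<partial>M)"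
proof -
  let ?f = "\<lambda>t. (rms M (X t))\<^sup>2"
  have int: "?f integrable_on {a..b}" if "0 \<le> a" for a b
    using that by (intro integrable_continuous_real continuous_on_subset[OF X_rms_square_continuous[of b]]) auto
  have "cX\<^sup>2 * (T - 1) = integral {1..T} (\<lambda>t. cX\<^sup>2)" using assms by simp
  also have "\<dots> \<le> integral {1..T} ?f"
  proof (rule integral_le)
    show "(\<lambda>t. cX\<^sup>2) integrable_on {1..T}" by (rule integrable_const_ivl)
    show "?f integrable_on {1..T}" by (rule int) simp
    show "cX\<^sup>2 \<le> ?f t" if "t \<in> {1..T}" for t
      using X_rms_lower[of t] cX_pos that by (intro power_mono) auto
  qed
  also have "\<dots> \<le> integral {0..1} ?f + integral {1..T} ?f"
    using integral_nonneg[OF int[of 0 1]] by simp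
  also have "\<dots> = integral {0..T} ?f"
    using assms by (intro Henstock_Kurzweil_Integration.integral_combine int) auto
  finally show ?thesis using expectation_energy[of T] assms by simp
qed

text \<open>By the fourth-moment formula the variance is a double integral of 2 Cov(X(t), X(s))^2.
  It is organized around the centered energy J: the inner integral E(J X(t)^2) is bounded uniformly
  in t and T by the decay of the covariance, and the outer one contributes the factor T.\<close>

lemma energy_variance:
  assumes "0 \<le> T"
  shows "(rms M (\<lambda>\<omega>. energy T \<omega> - (\<integral>\<omega>. energy T \<omega> \<partial>M)))\<^sup>2 \<le> 4 * CX\<^sup>2 / \<kappa> * T"
proof -
  define m where "m = (\<integral>\<omega>. energy T \<omega> \<partial>M)"
  define J where "J = (\<lambda>\<omega>. energy T \<omega> - m)"
  note I = energy_sq_int[OF assms]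
  have J: "J \<in> sq_int M" unfolding J_def by (intro sq_int_diff I sq_int_const)
  have EJ: "(\<integral>\<omega>. J \<omega> \<partial>M) = 0"
    using sq_int_integrable[OF I] by (simp add: J_def m_def prob_space)
  have Q: "(\<lambda>\<omega>. (X t \<omega>)\<^sup>2) \<in> sq_int M" if "0 \<le> t" for t using that by (intro G_square_sq_int X_G)
  have inner: "\<bar>\<integral>\<omega>. J \<omega> * (X t \<omega>)\<^sup>2 \<partial>M\<bar> \<le> 4 * CX\<^sup>2 / \<kappa>" if t: "t \<in> {0..T}" for t
  proof -
    have t0: "0 \<le> t" using t by simp
    have Jm: "J \<omega> * (X t \<omega>)\<^sup>2 = (X t \<omega>)\<^sup>2 * energy T \<omega> - m * (X t \<omega>)\<^sup>2" for \<omega>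
      by (simp add: J_def algebra_simps)
    have "(\<integral>\<omega>. J \<omega> * (X t \<omega>)\<^sup>2 \<partial>M) = (\<integral>\<omega>. (X t \<omega>)\<^sup>2 * energy T \<omega> \<partial>M) - m * (rms M (X t))\<^sup>2"
      unfolding Jm rms_square using integrable_sq_int_mult[OF Q[OF t0] I] sq_int_integrable[OF Q[OF t0]] by simp
    also have "\<dots> = integral {0..T} (\<lambda>s. \<integral>\<omega>. (X t \<omega>)\<^sup>2 * (X s \<omega>)\<^sup>2 \<partial>M) - integral {0..T} (\<lambda>s. (rms M (X s))\<^sup>2) * (rms M (X t))\<^sup>2"
      unfolding expectation_mult_energy[OF assms Q[OF t0]] m_def expectation_energy[OF assms] ..
    also have "\<dots> = integral {0..T} (\<lambda>s. (\<integral>\<omega>. (X t \<omega>)\<^sup>2 * (X s \<omega>)\<^sup>2 \<partial>M) - (rms M (X s))\<^sup>2 * (rms M (X t))\<^sup>2)"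
      by (subst Henstock_Kurzweil_Integration.integral_diff)
        (auto intro!: integrable_continuous_real continuous_on_mult_right X_rms_square_continuous
          continuous_on_expectation_mult[OF X_square_ms Q[OF t0]])
    also have "\<dots> = integral {0..T} (\<lambda>s. 2 * (\<integral>\<omega>. X t \<omega> * X s \<omega> \<partial>M)\<^sup>2)"
    proof (rule integral_cong)
      fix s assume "s \<in> {0..T}"
      then show "(\<integral>\<omega>. (X t \<omega>)\<^sup>2 * (X s \<omega>)\<^sup>2 \<partial>M) - (rms M (X s))\<^sup>2 * (rms M (X t))\<^sup>2 = 2 * (\<integral>\<omega>. X t \<omega> * X s \<omega> \<partial>M)\<^sup>2"
        using G_square_square[OF X_G[OF t0] X_G[of s]] by (simp add: rms_square)
    qed
    finally have eq: "(\<integral>\<omega>. J \<omega> * (X t \<omega>)\<^sup>2 \<partial>M) = integral {0..T} (\<lambda>s. 2 * (\<integral>\<omega>. X t \<omega> * X s \<omega> \<partial>M)\<^sup>2)" .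
    have "norm (integral {0..T} (\<lambda>s. 2 * (\<integral>\<omega>. X t \<omega> * X s \<omega> \<partial>M)\<^sup>2))
        \<le> integral {0..T} (\<lambda>s. 2 * CX\<^sup>2 * exp (- \<kappa> * \<bar>t - s\<bar>))"
    proof (rule integral_norm_bound_integral)
      show "(\<lambda>s. 2 * (\<integral>\<omega>. X t \<omega> * X s \<omega> \<partial>M)\<^sup>2) integrable_on {0..T}"
        by (intro integrable_continuous_real continuous_on_mult_left continuous_on_power
            continuous_on_expectation_mult[OF X_ms G_sq_int[OF X_G[OF t0]]]) simp
      show "(\<lambda>s. 2 * CX\<^sup>2 * exp (- \<kappa> * \<bar>t - s\<bar>)) integrable_on {0..T}"
        by (intro integrable_continuous_real continuous_intros)
      fix s assume s: "s \<in> {0..T}"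
      \<comment> \<open>As x is at most 1, also x^2 <= x. The squared covariance is thus estimated
        by the kernel at rate \<kappa>, whose integral is at most 2/\<kappa>.\<close>
      define x where "x = exp (- \<kappa> * \<bar>t - s\<bar>)"
      have x: "0 \<le> x" "x \<le> 1" using kappa by (auto simp: x_def)
      have "\<bar>\<integral>\<omega>. X t \<omega> * X s \<omega> \<partial>M\<bar> \<le> CX * x"
        using X_cov_bound[of t s] t0 s by (simp add: x_def abs_minus_commute)
      then have "\<bar>\<integral>\<omega>. X t \<omega> * X s \<omega> \<partial>M\<bar>\<^sup>2 \<le> (CX * x)\<^sup>2" by (intro power_mono) auto
      also have "\<dots> \<le> CX\<^sup>2 * x"
      proof -
        have "(CX * x)\<^sup>2 = CX\<^sup>2 * (x * x)" by (simp add: power2_eq_square)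
        also have "\<dots> \<le> CX\<^sup>2 * x" using x by (intro mult_left_mono mult_left_le) auto
        finally show ?thesis .
      qed
      finally show "norm (2 * (\<integral>\<omega>. X t \<omega> * X s \<omega> \<partial>M)\<^sup>2) \<le> 2 * CX\<^sup>2 * exp (- \<kappa> * \<bar>t - s\<bar>)"
        by (simp add: x_def)
    qed
    also have "\<dots> = 2 * CX\<^sup>2 * integral {0..T} (\<lambda>s. exp (- \<kappa> * \<bar>t - s\<bar>))" by (rule integral_mult_right)
    also have "\<dots> \<le> 2 * CX\<^sup>2 * (2 / \<kappa>)"
      using t kappa by (intro mult_left_mono integral_exp_abs_le) auto
    finally show ?thesis unfolding eq by simp
  qed
  have "(rms M J)\<^sup>2 = (\<integral>\<omega>. J \<omega> * energy T \<omega> - m * J \<omega> \<partial>M)"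
    unfolding rms_square by (rule arg_cong[where f="integral\<^sup>L M"]) (auto simp: J_def power2_eq_square algebra_simps)
  also have "\<dots> = (\<integral>\<omega>. J \<omega> * energy T \<omega> \<partial>M)"
    using integrable_sq_int_mult[OF J I] sq_int_integrable[OF J] EJ by simp
  also have "\<dots> = integral {0..T} (\<lambda>t. \<integral>\<omega>. J \<omega> * (X t \<omega>)\<^sup>2 \<partial>M)"
    by (rule expectation_mult_energy[OF assms J])
  also have "\<dots> \<le> norm (integral {0..T} (\<lambda>t. \<integral>\<omega>. J \<omega> * (X t \<omega>)\<^sup>2 \<partial>M))" by simp
  also have "\<dots> \<le> 4 * CX\<^sup>2 / \<kappa> * (T - 0)"
    by (rule integral_bound[OF assms continuous_on_expectation_mult[OF X_square_ms J]]) (use inner in simp)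
  finally show ?thesis by (simp add: J_def m_def)
qed

end

section \<open>Step functions and the Hilbert space\<close>

text \<open>The elementary Wiener integral of a step function. With indicators in place of Y the
  same expression is the step function itself, so linearity is proved once for both.\<close>

definition step_rv :: "(real \<Rightarrow> 'w \<Rightarrow> real) \<Rightarrow> step \<Rightarrow> 'w \<Rightarrow> real" where
  "step_rv Y \<phi> \<omega> = (\<Sum>t\<in>Poly_Mapping.keys \<phi>. Poly_Mapping.lookup \<phi> t * Y t \<omega>)"

lemma step_fun_eq: "step_fun \<phi> = step_rv (\<lambda>t. indicator {0..t}) \<phi>"
  by (simp add: step_fun_def step_rv_def fun_eq_iff)

lemma step_rv_superset:
  "finite S \<Longrightarrow> Poly_Mapping.keys \<phi> \<subseteq> S \<Longrightarrow> step_rv Y \<phi> \<omega> = (\<Sum>t\<in>S. Poly_Mapping.lookup \<phi> t * Y t \<omega>)"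
  unfolding step_rv_def by (rule sum.mono_neutral_left) (auto simp: in_keys_iff)

lemma step_rv_add: "step_rv Y (\<phi> + \<psi>) \<omega> = step_rv Y \<phi> \<omega> + step_rv Y \<psi> \<omega>"
proof -
  let ?S = "Poly_Mapping.keys \<phi> \<union> Poly_Mapping.keys \<psi>"
  have *: "finite ?S" "Poly_Mapping.keys \<phi> \<subseteq> ?S" "Poly_Mapping.keys \<psi> \<subseteq> ?S"
    "Poly_Mapping.keys (\<phi> + \<psi>) \<subseteq> ?S"
    by (auto dest: keys_add[THEN subsetD])
  show ?thesis
    unfolding step_rv_superset[OF *(1,2)] step_rv_superset[OF *(1,3)] step_rv_superset[OF *(1,4)]
    by (simp add: lookup_add distrib_right sum.distrib)
qed

lemma step_rv_diff: "step_rv Y (\<phi> - \<psi>) \<omega> = step_rv Y \<phi> \<omega> - step_rv Y \<psi> \<omega>"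
  using step_rv_add[of Y "\<phi> - \<psi>" \<psi> \<omega>] by simp

lemma step_rv_zero [simp]: "step_rv Y 0 \<omega> = 0"
  by (simp add: step_rv_def)

lemma step_rv_sum: "step_rv Y (\<Sum>i\<in>I. \<phi> i) \<omega> = (\<Sum>i\<in>I. step_rv Y (\<phi> i) \<omega>)"
  by (induction I rule: infinite_finite_induct) (auto simp: step_rv_add)

lemma step_rv_single: "step_rv Y (Poly_Mapping.single t c) \<omega> = c * Y t \<omega>"
  by (simp add: step_rv_def)

lemma lookup_step_scale: "Poly_Mapping.lookup (step_scale c \<phi>) t = c * Poly_Mapping.lookup \<phi> t"
  by (simp add: step_scale_def Poly_Mapping.map.rep_eq when_def)

lemma keys_step_scale: "Poly_Mapping.keys (step_scale c \<phi>) \<subseteq> Poly_Mapping.keys \<phi>"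
  by (auto simp: in_keys_iff lookup_step_scale)

lemma step_rv_scale: "step_rv Y (step_scale c \<phi>) \<omega> = c * step_rv Y \<phi> \<omega>"
  unfolding step_rv_superset[OF finite_keys keys_step_scale]
  by (simp add: step_rv_def lookup_step_scale sum_distrib_left mult.assoc)

lemma steps_diff: "\<phi> \<in> steps T \<Longrightarrow> \<psi> \<in> steps T \<Longrightarrow> \<phi> - \<psi> \<in> steps T"
  unfolding steps_def using keys_diff[of \<phi> \<psi>] by auto

lemma steps_scale: "\<phi> \<in> steps T \<Longrightarrow> step_scale c \<phi> \<in> steps T"
  unfolding steps_def using keys_step_scale[of c \<phi>] by auto

lemma steps_sum:
  assumes "\<And>i. i \<in> I \<Longrightarrow> \<phi> i \<in> steps T"
  shows "(\<Sum>i\<in>I. \<phi> i) \<in> steps T"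
proof -
  have "(\<Union>i\<in>I. Poly_Mapping.keys (\<phi> i)) \<subseteq> {0..T}" using assms by (auto simp: steps_def)
  then show ?thesis using keys_sum[of \<phi> I] by (auto simp: steps_def)
qed

lemma steps_single: "t \<in> {0..T} \<Longrightarrow> Poly_Mapping.single t c \<in> steps T"
  by (simp add: steps_def)

section \<open>Inner products of step functions and summation by parts\<close>

lemma expectation_sum_mult:
  assumes "\<And>i. i \<in> I \<Longrightarrow> Z i \<in> sq_int M" "W \<in> sq_int M"
  shows "(\<integral>\<omega>. (\<Sum>i\<in>I. a i * Z i \<omega>) * W \<omega> \<partial>M) = (\<Sum>i\<in>I. a i * (\<integral>\<omega>. Z i \<omega> * W \<omega> \<partial>M))"
proof -
  have "(\<integral>\<omega>. (\<Sum>i\<in>I. a i * Z i \<omega>) * W \<omega> \<partial>M) = (\<integral>\<omega>. (\<Sum>i\<in>I. a i * (Z i \<omega> * W \<omega>)) \<partial>M)"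
    by (simp only: sum_distrib_right mult.assoc)
  also have "\<dots> = (\<Sum>i\<in>I. \<integral>\<omega>. a i * (Z i \<omega> * W \<omega>) \<partial>M)"
    by (intro Bochner_Integration.integral_sum integrable_mult_right integrable_sq_int_mult assms)
  also have "\<dots> = (\<Sum>i\<in>I. a i * (\<integral>\<omega>. Z i \<omega> * W \<omega> \<partial>M))"
    by (simp only: integral_mult_right_zero)
  finally show ?thesis .
qed

lemma expectation_sum_mult_sum:
  assumes "\<And>i. i \<in> I \<Longrightarrow> Z i \<in> sq_int M" "\<And>j. j \<in> J \<Longrightarrow> W j \<in> sq_int M"
  shows "(\<integral>\<omega>. (\<Sum>i\<in>I. a i * Z i \<omega>) * (\<Sum>j\<in>J. b j * W j \<omega>) \<partial>M)
    = (\<Sum>i\<in>I. \<Sum>j\<in>J. a i * b j * (\<integral>\<omega>. Z i \<omega> * W j \<omega> \<partial>M))"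
proof -
  have W: "(\<lambda>\<omega>. \<Sum>j\<in>J. b j * W j \<omega>) \<in> sq_int M" by (intro sq_int_sum sq_int_cmult assms)
  have "(\<integral>\<omega>. Z i \<omega> * (\<Sum>j\<in>J. b j * W j \<omega>) \<partial>M) = (\<Sum>j\<in>J. b j * (\<integral>\<omega>. Z i \<omega> * W j \<omega> \<partial>M))"
    if "i \<in> I" for i
    using expectation_sum_mult[OF assms(2) assms(1)[OF that], where a=b and I=J] by (simp only: mult.commute[of _ "Z i _"])
  then show ?thesis
    by (subst expectation_sum_mult[OF assms(1) W])
      (auto simp only: sum_distrib_left mult.assoc intro!: sum.cong)
qed

lemma step_inner_eq:
  assumes Y: "\<And>t. t \<in> {0..T} \<Longrightarrow> Y t \<in> sq_int M" and "\<phi> \<in> steps T" "\<psi> \<in> steps T"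
  shows "step_inner M Y \<phi> \<psi> = (\<integral>\<omega>. step_rv Y \<phi> \<omega> * step_rv Y \<psi> \<omega> \<partial>M)"
  unfolding step_inner_def step_rv_def
  by (rule expectation_sum_mult_sum[symmetric]) (use assms in \<open>auto simp: steps_def\<close>)

text \<open>The sum of the \<open>p k\<close> over k > i is the value on cell i of the step function
  with coefficients \<open>p\<close>. The formula thus rewrites its Wiener integral as a sum of
  values times increments.\<close>

lemma abel_summation:
  fixes p y :: "nat \<Rightarrow> real"
  shows "(\<Sum>k\<le>n. p k * y k) = (\<Sum>i<n. (\<Sum>k\<in>{Suc i..n}. p k) * (y (Suc i) - y i)) + (\<Sum>k\<le>n. p k) * y 0"
proof (induction n)
  case (Suc n)
  have "(\<Sum>i<Suc n. (\<Sum>k\<in>{Suc i..Suc n}. p k) * (y (Suc i) - y i))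
    = (\<Sum>i<n. ((\<Sum>k\<in>{Suc i..n}. p k) + p (Suc n)) * (y (Suc i) - y i)) + p (Suc n) * (y (Suc n) - y n)"
    by simp
  also have "\<dots> = (\<Sum>i<n. (\<Sum>k\<in>{Suc i..n}. p k) * (y (Suc i) - y i))
      + p (Suc n) * (\<Sum>i<n. y (Suc i) - y i) + p (Suc n) * (y (Suc n) - y n)"
    by (simp only: distrib_right sum.distrib sum_distrib_left)
  also have "(\<Sum>i<n. y (Suc i) - y i) = y n - y 0" by (rule sum_lessThan_telescope)
  finally show ?case using Suc.IH by (simp add: algebra_simps)
qed simp

text \<open>Monotonicity is recorded as an equivalence of orders, because it will decide which
  indicators are on at a given node.\<close>

lemma sorted_grid:
  fixes S :: "real set"
  assumes "finite S" "a \<in> S" "b \<in> S" "S \<subseteq> {a..b}"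
  shows "\<exists>(s :: nat \<Rightarrow> real) n. s 0 = a \<and> s n = b \<and> (\<forall>i\<le>n. \<forall>j\<le>n. s i \<le> s j \<longleftrightarrow> i \<le> j) \<and> bij_betw s {..n} S"
proof -
  define xs where "xs = sorted_list_of_set S"
  have xs: "set xs = S" "sorted_wrt (<) xs" "distinct xs" using assms(1) by (auto simp: xs_def)
  define n where "n = length xs - 1"
  define s where "s i = xs ! i" for i
  have "xs \<noteq> []" using xs(1) assms(2) by auto
  then have len: "length xs = Suc n" by (simp add: n_def)
  have less: "s i < s j" if "i < j" "j \<le> n" for i j
    using sorted_wrt_nth_less[OF xs(2) that(1)] that(2) len by (simp add: s_def)
  have ord: "s i \<le> s j \<longleftrightarrow> i \<le> j" if "i \<le> n" "j \<le> n" for i j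
    using less[of i j] less[of j i] that by (cases i j rule: linorder_cases) auto
  have bij: "bij_betw s {..n} S"
    using bij_betw_nth[OF xs(3), of "{..n}" S] xs(1) len by (simp add: s_def[abs_def] lessThan_Suc_atMost)
  have mem: "s i \<in> {a..b}" if "i \<le> n" for i
    using bij_betwE[OF bij] that assms(4) by auto
  obtain k where k: "k \<le> n" "s k = a" using bij assms(2) by (force simp: bij_betw_def)
  obtain l where l: "l \<le> n" "s l = b" using bij assms(3) by (force simp: bij_betw_def)
  have "s 0 = a" using ord[of 0 k] k mem[of 0] by simp
  moreover have "s n = b" using ord[of l n] l mem[of n] by simp
  ultimately show ?thesis using ord bij by (intro exI[of _ s] exI[of _ n]) simp
qed

context second_kind_ou
begin

lemma Y_sq_int: "0 \<le> t \<Longrightarrow> Y t \<in> sq_int M"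
  by (rule G_sq_int[OF Y_G])

lemma step_rv_G:
  assumes "\<phi> \<in> steps T"
  shows "step_rv Y \<phi> \<in> G"
proof -
  have "(\<lambda>\<omega>. \<Sum>t\<in>Poly_Mapping.keys \<phi>. Poly_Mapping.lookup \<phi> t * Y t \<omega>) \<in> G"
    by (intro G_sum G_cmult Y_G) (use assms in \<open>auto simp: steps_def\<close>)
  then show ?thesis by (simp only: step_rv_def[abs_def])
qed

lemma step_inner_rv:
  "\<phi> \<in> steps T \<Longrightarrow> \<psi> \<in> steps T \<Longrightarrow> step_inner M Y \<phi> \<psi> = (\<integral>\<omega>. step_rv Y \<phi> \<omega> * step_rv Y \<psi> \<omega> \<partial>M)"
  by (rule step_inner_eq[of T]) (auto intro: Y_sq_int)

lemma step_inner_self: "\<phi> \<in> steps T \<Longrightarrow> step_inner M Y \<phi> \<phi> = (rms M (step_rv Y \<phi>))\<^sup>2"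
  unfolding rms_square unfolding power2_eq_square by (rule step_inner_rv)

text \<open>The increments are non-negatively correlated, so replacing the coefficients by the bound \<open>C\<close> can
  only increase the second moment.\<close>

lemma rms_increments_le:
  assumes s: "\<And>i. i < n \<Longrightarrow> 0 \<le> s i \<and> s i \<le> s (Suc i)" and a: "\<And>i. i < n \<Longrightarrow> \<bar>a i\<bar> \<le> C" and "0 \<le> C"
  shows "rms M (\<lambda>\<omega>. \<Sum>i<n. a i * (Y (s (Suc i)) \<omega> - Y (s i) \<omega>)) \<le> C * rms M (\<lambda>\<omega>. Y (s n) \<omega> - Y (s 0) \<omega>)"
proof (rule power2_le_imp_le)
  define D where "D i \<omega> = Y (s (Suc i)) \<omega> - Y (s i) \<omega>" for i \<omega>
  have D: "D i \<in> sq_int M" if "i \<in> {..<n}" for i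
    unfolding D_def[abs_def] using s[of i] that by (intro sq_int_diff Y_sq_int) auto
  have nonneg: "0 \<le> (\<integral>\<omega>. D i \<omega> * D j \<omega> \<partial>M)" if "i \<in> {..<n}" "j \<in> {..<n}" for i j
    unfolding D_def using s[of i] s[of j] that by (intro Y_increments_nonneg) auto
  have expand: "(rms M (\<lambda>\<omega>. \<Sum>i<n. c i * D i \<omega>))\<^sup>2 = (\<Sum>i<n. \<Sum>j<n. c i * c j * (\<integral>\<omega>. D i \<omega> * D j \<omega> \<partial>M))" for c
    unfolding rms_square unfolding power2_eq_square by (rule expectation_sum_mult_sum[OF D D])
  have "(rms M (\<lambda>\<omega>. \<Sum>i<n. a i * D i \<omega>))\<^sup>2 \<le> (\<Sum>i<n. \<Sum>j<n. C * C * (\<integral>\<omega>. D i \<omega> * D j \<omega> \<partial>M))"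
    unfolding expand
  proof (intro sum_mono mult_right_mono nonneg)
    fix i j assume ij: "i \<in> {..<n}" "j \<in> {..<n}"
    have "a i * a j \<le> \<bar>a i\<bar> * \<bar>a j\<bar>" by (simp add: abs_mult[symmetric])
    also have "\<dots> \<le> C * C" using a ij \<open>0 \<le> C\<close> by (intro mult_mono) auto
    finally show "a i * a j \<le> C * C" .
  qed
  also have "\<dots> = (rms M (\<lambda>\<omega>. \<Sum>i<n. C * D i \<omega>))\<^sup>2" by (rule expand[symmetric])
  also have "(\<lambda>\<omega>. \<Sum>i<n. C * D i \<omega>) = (\<lambda>\<omega>. C * (Y (s n) \<omega> - Y (s 0) \<omega>))"
  proof
    fix \<omega>
    have "(\<Sum>i<n. D i \<omega>) = Y (s n) \<omega> - Y (s 0) \<omega>"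
      unfolding D_def by (rule sum_lessThan_telescope)
    then show "(\<Sum>i<n. C * D i \<omega>) = C * (Y (s n) \<omega> - Y (s 0) \<omega>)" by (simp only: sum_distrib_left[symmetric])
  qed
  finally show "(rms M (\<lambda>\<omega>. \<Sum>i<n. a i * (Y (s (Suc i)) \<omega> - Y (s i) \<omega>)))\<^sup>2 \<le> (C * rms M (\<lambda>\<omega>. Y (s n) \<omega> - Y (s 0) \<omega>))\<^sup>2"
    using \<open>0 \<le> C\<close> by (simp only: D_def rms_cmult abs_of_nonneg)
qed (use \<open>0 \<le> C\<close> in simp)

lemma Y_increment_zero_rms: "rms M (\<lambda>\<omega>. Y t \<omega> - Y 0 \<omega>) = rms M (Y t)"
  by (rule rms_cong) (simp add: Y_zero)

text \<open>Written as values times increments of Y, the integral is dominated by that of the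
  constant C, because the increments are non-negatively correlated. Uniform convergence of step
  functions therefore implies convergence in the Hilbert space.\<close>

lemma step_rv_rms_le:
  assumes "0 \<le> T" and \<phi>: "\<phi> \<in> steps T" and C: "\<And>x. x \<in> {0..T} \<Longrightarrow> \<bar>step_fun \<phi> x\<bar> \<le> C"
  shows "rms M (step_rv Y \<phi>) \<le> C * rms M (Y T)"
proof -
  \<comment> \<open>With 0 and T among the nodes the increments fill [0,T] and add up to
    \<open>Y T\<close>.\<close>
  let ?S = "insert 0 (insert T (Poly_Mapping.keys \<phi>))"
  have S: "finite ?S" "0 \<in> ?S" "T \<in> ?S" "?S \<subseteq> {0..T}" "Poly_Mapping.keys \<phi> \<subseteq> ?S"
    using assms by (auto simp: steps_def)
  obtain s :: "nat \<Rightarrow> real" and n where grid: "s 0 = 0 \<and> s n = T \<and> (\<forall>i\<le>n. \<forall>j\<le>n. s i \<le> s j \<longleftrightarrow> i \<le> j) \<and> bij_betw s {..n} ?S"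
    using sorted_grid[OF S(1-4)] by (elim exE)
  then have s: "s 0 = 0" "s n = T" "\<And>i j. i \<le> n \<Longrightarrow> j \<le> n \<Longrightarrow> s i \<le> s j \<longleftrightarrow> i \<le> j" "bij_betw s {..n} ?S"
    by simp_all
  have mem: "s i \<in> {0..T}" if "i \<le> n" for i using that by (intro subsetD[OF S(4)] bij_betwE[OF s(4), rule_format]) simp
  define p where "p k = Poly_Mapping.lookup \<phi> (s k)" for k
  define a where "a i = (\<Sum>k\<in>{Suc i..n}. p k)" for i
  have reindex: "step_rv Z \<phi> x = (\<Sum>k\<le>n. p k * Z (s k) x)" for Z :: "real \<Rightarrow> 'z \<Rightarrow> real" and x
    unfolding step_rv_superset[OF S(1,5)] p_def
    by (rule sum.reindex_bij_betw[OF s(4), symmetric])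
  have "\<bar>a i\<bar> \<le> C" if i: "i < n" for i
  proof -
    \<comment> \<open>The value on cell i is read at its right end: the closed intervals [0, s k]
      containing that point are those with k >= i + 1, just as in the coefficient
      \<open>a i\<close>.\<close>
    have "step_fun \<phi> (s (Suc i)) = (\<Sum>k\<le>n. p k * indicator {0..s k} (s (Suc i)))"
      unfolding step_fun_eq by (rule reindex)
    also have "\<dots> = (\<Sum>k\<in>{Suc i..n}. p k)"
    proof (rule sum.mono_neutral_cong_right)
      show "\<forall>k\<in>{..n} - {Suc i..n}. p k * indicator {0..s k} (s (Suc i)) = 0"
        using s(3)[of "Suc i"] i by (auto simp: indicator_def)
      show "p k * indicator {0..s k} (s (Suc i)) = p k" if "k \<in> {Suc i..n}" for k
        using s(3)[of "Suc i" k] i that mem[of "Suc i"] by (auto simp: indicator_def)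
    qed auto
    finally show ?thesis using C[OF mem[of "Suc i"]] i by (simp add: a_def)
  qed
  moreover have "0 \<le> s i \<and> s i \<le> s (Suc i)" if "i < n" for i
    using s(3)[of i "Suc i"] mem[of i] that by simp
  moreover have "0 \<le> C" using C[of 0] assms(1) by (simp add: order_trans[OF abs_ge_zero])
  ultimately have "rms M (\<lambda>\<omega>. \<Sum>i<n. a i * (Y (s (Suc i)) \<omega> - Y (s i) \<omega>)) \<le> C * rms M (\<lambda>\<omega>. Y (s n) \<omega> - Y (s 0) \<omega>)"
    by (intro rms_increments_le)
  moreover have "rms M (step_rv Y \<phi>) = rms M (\<lambda>\<omega>. \<Sum>i<n. a i * (Y (s (Suc i)) \<omega> - Y (s i) \<omega>))"
  proof (rule rms_cong)
    fix \<omega> assume "\<omega> \<in> space M"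
    then show "step_rv Y \<phi> \<omega> = (\<Sum>i<n. a i * (Y (s (Suc i)) \<omega> - Y (s i) \<omega>))"
      unfolding reindex a_def abel_summation[of p "\<lambda>k. Y (s k) \<omega>"] by (simp add: s(1) Y_zero)
  qed
  ultimately show ?thesis by (simp only: s(1,2) Y_increment_zero_rms)
qed

lemma step_rv_diff_rms_le:
  assumes "0 \<le> T" "\<phi> \<in> steps T" "\<psi> \<in> steps T"
    and "\<And>x. x \<in> {0..T} \<Longrightarrow> \<bar>step_fun \<phi> x - step_fun \<psi> x\<bar> \<le> C"
  shows "rms M (\<lambda>\<omega>. step_rv Y \<phi> \<omega> - step_rv Y \<psi> \<omega>) \<le> C * rms M (Y T)"
proof -
  have "rms M (step_rv Y (\<phi> - \<psi>)) \<le> C * rms M (Y T)"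
  proof (rule step_rv_rms_le[OF assms(1) steps_diff[OF assms(2,3)]])
    show "\<bar>step_fun (\<phi> - \<psi>) x\<bar> \<le> C" if "x \<in> {0..T}" for x
      using assms(4)[OF that] by (simp add: step_fun_eq step_rv_diff)
  qed
  moreover have "step_rv Y (\<phi> - \<psi>) = (\<lambda>\<omega>. step_rv Y \<phi> \<omega> - step_rv Y \<psi> \<omega>)"
    by (rule ext) (rule step_rv_diff)
  ultimately show ?thesis by simp
qed

text \<open>With two equal sequences this is the Cauchy property; with two different ones it says
  that a function determines its element of the Hilbert space.\<close>

lemma uniform_limit_steps_rms:
  assumes "0 \<le> T" and \<Phi>: "\<And>k. \<Phi> k \<in> steps T" and \<Psi>: "\<And>k. \<Psi> k \<in> steps T"
    and "uniform_limit {0..T} (\<lambda>k. step_fun (\<Phi> k)) g sequentially"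
    and "uniform_limit {0..T} (\<lambda>k. step_fun (\<Psi> k)) g sequentially" and "e > 0"
  shows "\<exists>N. \<forall>m\<ge>N. \<forall>k\<ge>N. rms M (\<lambda>\<omega>. step_rv Y (\<Phi> m) \<omega> - step_rv Y (\<Psi> k) \<omega>) < e"
proof -
  define d where "d = e / (2 * rms M (Y T) + 1) / 2"
  have pos: "2 * rms M (Y T) + 1 > 0" using rms_nonneg[of M "Y T"] by linarith
  then have d: "d > 0" using \<open>e > 0\<close> by (simp add: d_def)
  have "\<forall>\<^sub>F k in sequentially. \<forall>x\<in>{0..T}. dist (step_fun (\<Phi> k) x) (g x) < d"
    by (rule uniform_limitD[OF assms(4) d])
  then obtain N1 where N1: "\<And>k x. k \<ge> N1 \<Longrightarrow> x \<in> {0..T} \<Longrightarrow> \<bar>step_fun (\<Phi> k) x - g x\<bar> < d"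
    unfolding eventually_sequentially dist_real_def by metis
  have "\<forall>\<^sub>F k in sequentially. \<forall>x\<in>{0..T}. dist (step_fun (\<Psi> k) x) (g x) < d"
    by (rule uniform_limitD[OF assms(5) d])
  then obtain N2 where N2: "\<And>k x. k \<ge> N2 \<Longrightarrow> x \<in> {0..T} \<Longrightarrow> \<bar>step_fun (\<Psi> k) x - g x\<bar> < d"
    unfolding eventually_sequentially dist_real_def by metis
  have "rms M (\<lambda>\<omega>. step_rv Y (\<Phi> m) \<omega> - step_rv Y (\<Psi> k) \<omega>) < e" if mk: "m \<ge> max N1 N2" "k \<ge> max N1 N2" for m k
  proof -
    have "rms M (\<lambda>\<omega>. step_rv Y (\<Phi> m) \<omega> - step_rv Y (\<Psi> k) \<omega>) \<le> (2 * d) * rms M (Y T)"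
    proof (rule step_rv_diff_rms_le[OF assms(1) \<Phi> \<Psi>])
      fix x assume x: "x \<in> {0..T}"
      show "\<bar>step_fun (\<Phi> m) x - step_fun (\<Psi> k) x\<bar> \<le> 2 * d"
        using N1[OF _ x, of m] N2[OF _ x, of k] mk by linarith
    qed
    also have "\<dots> < d * (2 * rms M (Y T) + 1)" using d by (simp add: algebra_simps)
    also have "\<dots> = e / 2" unfolding d_def using pos by (simp add: divide_simps)
    also have "\<dots> < e" using \<open>e > 0\<close> by simp
    finally show ?thesis .
  qed
  then show ?thesis by blast
qed

section \<open>Cauchy sequences of step functions\<close>

lemma hilbI:
  assumes \<Phi>: "\<And>k. \<Phi> k \<in> steps T"
    and Cauchy: "\<And>e. e > 0 \<Longrightarrow> \<exists>N. \<forall>m\<ge>N. \<forall>k\<ge>N. rms M (\<lambda>\<omega>. step_rv Y (\<Phi> m) \<omega> - step_rv Y (\<Phi> k) \<omega>) < e"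
  shows "\<Phi> \<in> hilb M Y T"
  unfolding hilb_def
proof (intro CollectI conjI allI impI \<Phi>)
  fix \<epsilon> :: real assume "\<epsilon> > 0"
  then obtain N where N: "\<forall>m\<ge>N. \<forall>k\<ge>N. rms M (\<lambda>\<omega>. step_rv Y (\<Phi> m) \<omega> - step_rv Y (\<Phi> k) \<omega>) < sqrt \<epsilon>"
    using Cauchy[of "sqrt \<epsilon>"] by auto
  have "step_inner M Y (\<Phi> m - \<Phi> k) (\<Phi> m - \<Phi> k) < \<epsilon>" if "m \<ge> N" "k \<ge> N" for m k
  proof -
    have "step_rv Y (\<Phi> m - \<Phi> k) = (\<lambda>\<omega>. step_rv Y (\<Phi> m) \<omega> - step_rv Y (\<Phi> k) \<omega>)"
      by (rule ext) (rule step_rv_diff)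
    then have "rms M (step_rv Y (\<Phi> m - \<Phi> k)) < sqrt \<epsilon>" using N that by simp
    then have "(rms M (step_rv Y (\<Phi> m - \<Phi> k)))\<^sup>2 < (sqrt \<epsilon>)\<^sup>2" by (intro power_strict_mono) auto
    then show ?thesis using \<open>\<epsilon> > 0\<close> by (simp add: step_inner_self[OF steps_diff[OF \<Phi> \<Phi>]])
  qed
  then show "\<exists>N. \<forall>m\<ge>N. \<forall>k\<ge>N. step_inner M Y (\<Phi> m - \<Phi> k) (\<Phi> m - \<Phi> k) < \<epsilon>" by blast
qed

lemma hilb_steps: "\<Phi> \<in> hilb M Y T \<Longrightarrow> \<Phi> k \<in> steps T"
  by (simp add: hilb_def)

lemma hilb_Cauchy:
  assumes "\<Phi> \<in> hilb M Y T" "e > 0"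
  shows "\<exists>N. \<forall>m\<ge>N. \<forall>k\<ge>N. rms M (\<lambda>\<omega>. step_rv Y (\<Phi> m) \<omega> - step_rv Y (\<Phi> k) \<omega>) < e"
proof -
  note \<Phi> = hilb_steps[OF assms(1)]
  have "e\<^sup>2 > 0" using assms(2) by simp
  then obtain N where N: "\<forall>m\<ge>N. \<forall>k\<ge>N. step_inner M Y (\<Phi> m - \<Phi> k) (\<Phi> m - \<Phi> k) < e\<^sup>2"
    using assms(1) unfolding hilb_def mem_Collect_eq by metis
  have "rms M (\<lambda>\<omega>. step_rv Y (\<Phi> m) \<omega> - step_rv Y (\<Phi> k) \<omega>) < e" if "m \<ge> N" "k \<ge> N" for m k
  proof -
    have eq: "step_rv Y (\<Phi> m - \<Phi> k) = (\<lambda>\<omega>. step_rv Y (\<Phi> m) \<omega> - step_rv Y (\<Phi> k) \<omega>)"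
      by (rule ext) (rule step_rv_diff)
    have "(rms M (step_rv Y (\<Phi> m - \<Phi> k)))\<^sup>2 < e\<^sup>2"
      using N that by (simp add: step_inner_self[OF steps_diff[OF \<Phi> \<Phi>], symmetric])
    then have "rms M (step_rv Y (\<Phi> m - \<Phi> k)) < e"
      by (rule power2_less_imp_less) (use assms(2) in simp)
    then show ?thesis by (simp only: eq)
  qed
  then show ?thesis by blast
qed

text \<open>The \<open>lim\<close> in \<open>hilb_inner\<close> is meaningful only for convergent
  sequences. Convergence comes from Cauchy-Schwarz and completeness of the reals.\<close>

lemma hilb_convergent:
  assumes \<Phi>: "\<Phi> \<in> hilb M Y T" and W: "W \<in> sq_int M"
  shows "convergent (\<lambda>k. \<integral>\<omega>. W \<omega> * step_rv Y (\<Phi> k) \<omega> \<partial>M)"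
proof (rule Cauchy_convergent, rule metric_CauchyI)
  fix e :: real assume "e > 0"
  define d where "d = e / (rms M W + 1)"
  have pos: "rms M W + 1 > 0" using rms_nonneg[of M W] by linarith
  have "d > 0" using \<open>e > 0\<close> pos by (simp add: d_def)
  then obtain N where N: "\<forall>m\<ge>N. \<forall>k\<ge>N. rms M (\<lambda>\<omega>. step_rv Y (\<Phi> m) \<omega> - step_rv Y (\<Phi> k) \<omega>) < d"
    using hilb_Cauchy[OF \<Phi>] by blast
  have sq: "step_rv Y (\<Phi> k) \<in> sq_int M" for k by (rule G_sq_int[OF step_rv_G[OF hilb_steps[OF \<Phi>]]])
  have "dist (\<integral>\<omega>. W \<omega> * step_rv Y (\<Phi> m) \<omega> \<partial>M) (\<integral>\<omega>. W \<omega> * step_rv Y (\<Phi> k) \<omega> \<partial>M) < e" if "m \<ge> N" "k \<ge> N" for m k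
  proof -
    have "(\<integral>\<omega>. W \<omega> * step_rv Y (\<Phi> m) \<omega> \<partial>M) - (\<integral>\<omega>. W \<omega> * step_rv Y (\<Phi> k) \<omega> \<partial>M)
      = (\<integral>\<omega>. W \<omega> * (step_rv Y (\<Phi> m) \<omega> - step_rv Y (\<Phi> k) \<omega>) \<partial>M)"
      using integrable_sq_int_mult[OF W sq] by (simp add: right_diff_distrib)
    also have "\<bar>\<dots>\<bar> \<le> rms M W * rms M (\<lambda>\<omega>. step_rv Y (\<Phi> m) \<omega> - step_rv Y (\<Phi> k) \<omega>)"
      by (intro cauchy_schwarz_integral W sq_int_diff sq)
    also have "\<dots> \<le> rms M W * d" using less_imp_le[OF N[rule_format, OF that]] by (intro mult_left_mono) auto
    also have "\<dots> < (rms M W + 1) * d" using \<open>d > 0\<close> by simp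
    also have "\<dots> = e" using pos by (simp add: d_def)
    finally show ?thesis by (simp add: dist_real_def)
  qed
  then show "\<exists>N. \<forall>m\<ge>N. \<forall>n\<ge>N. dist (\<integral>\<omega>. W \<omega> * step_rv Y (\<Phi> m) \<omega> \<partial>M) (\<integral>\<omega>. W \<omega> * step_rv Y (\<Phi> n) \<omega> \<partial>M) < e"
    by blast
qed

lemma hilb_const: "\<psi> \<in> steps T \<Longrightarrow> (\<lambda>_. \<psi>) \<in> hilb M Y T"
  by (rule hilbI) (auto simp: rms_def)

text \<open>On \<open>(t\<^sub>i, t\<^sub>i\<^sub>+\<^sub>1]\<close> the step function below takes the value \<open>x t\<^sub>i\<close>. At \<open>0\<close> it vanishes, since all
  the intervals \<open>[0,t]\<close> contain \<open>0\<close>; this is harmless as \<open>x 0 = 0\<close>.\<close>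

definition grid :: "real \<Rightarrow> nat \<Rightarrow> nat \<Rightarrow> real" where
  "grid T k i = real i * (T / real (Suc k))"

definition grid_step :: "real \<Rightarrow> (real \<Rightarrow> real) \<Rightarrow> nat \<Rightarrow> step" where
  "grid_step T x k = (\<Sum>i<Suc k. Poly_Mapping.single (grid T k (Suc i)) (x (grid T k i))
     - Poly_Mapping.single (grid T k i) (x (grid T k i)))"

lemma grid_props:
  assumes "0 \<le> T"
  shows "grid T k 0 = 0" "grid T k (Suc k) = T" "0 \<le> grid T k i" "grid T k i \<le> grid T k (Suc i)"
    "grid T k (Suc i) - grid T k i = T / real (Suc k)" "i \<le> Suc k \<Longrightarrow> grid T k i \<in> {0..T}"
proof -
  show "grid T k 0 = 0" "grid T k (Suc k) = T" "0 \<le> grid T k i" using assms by (simp_all add: grid_def)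
  show d: "grid T k (Suc i) - grid T k i = T / real (Suc k)"
    by (simp only: grid_def left_diff_distrib[symmetric]) simp
  then show "grid T k i \<le> grid T k (Suc i)" using assms divide_nonneg_nonneg[of T "real (Suc k)"] by linarith
  show "i \<le> Suc k \<Longrightarrow> grid T k i \<in> {0..T}"
    using grid_mem[of 0 T i "Suc k"] assms by (simp add: grid_def)
qed

lemma step_rv_grid_step:
  "step_rv Z (grid_step T x k) \<omega> = (\<Sum>i<Suc k. x (grid T k i) * (Z (grid T k (Suc i)) \<omega> - Z (grid T k i) \<omega>))"
  unfolding grid_step_def step_rv_sum step_rv_diff step_rv_single right_diff_distrib ..

lemma grid_step_steps: "0 \<le> T \<Longrightarrow> grid_step T x k \<in> steps T"
  unfolding grid_step_def by (intro steps_sum steps_diff steps_single grid_props(6)) auto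

text \<open>For u > 0 the only nonzero difference of indicators belongs to the cell that contains u,
  so the error at u is the variation of x between u and the left end of that cell.\<close>

lemma grid_step_uniform_limit:
  assumes "0 \<le> T" and x: "continuous_on {0..T} x" and "x 0 = 0"
  shows "uniform_limit {0..T} (\<lambda>k. step_fun (grid_step T x k)) x sequentially"
proof (rule uniform_limitI)
  fix e :: real assume "e > 0"
  have "uniformly_continuous_on {0..T} x" using x by (intro compact_uniformly_continuous) auto
  moreover have e2: "e / 2 > 0" using \<open>e > 0\<close> by simp
  ultimately obtain d where d: "d > 0" "\<And>s u. s \<in> {0..T} \<Longrightarrow> u \<in> {0..T} \<Longrightarrow> \<bar>s - u\<bar> < d \<Longrightarrow> \<bar>x s - x u\<bar> < e / 2"
    unfolding uniformly_continuous_on_def dist_real_def by metis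
  have "(\<lambda>k. T * inverse (real (Suc k))) \<longlonglongrightarrow> T * 0"
    by (intro tendsto_mult tendsto_const LIMSEQ_inverse_real_of_nat)
  then have "\<forall>\<^sub>F k in sequentially. T * inverse (real (Suc k)) < d"
    using d(1) by (intro order_tendstoD(2)) auto
  then show "\<forall>\<^sub>F k in sequentially. \<forall>u\<in>{0..T}. dist (step_fun (grid_step T x k) u) (x u) < e"
  proof eventually_elim
    case (elim k)
    note g = grid_props[OF assms(1), of k]
    show ?case
    proof
      fix u assume u: "u \<in> {0..T}"
      define I where "I i = (indicator {0..grid T k i} u :: real)" for i
      have f: "step_fun (grid_step T x k) u = (\<Sum>i<Suc k. x (grid T k i) * (I (Suc i) - I i))"
        unfolding step_fun_eq step_rv_grid_step I_def ..
      show "dist (step_fun (grid_step T x k) u) (x u) < e"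
      proof (cases "u = 0")
        case True
        then have "I i = 1" for i using g(3)[of i] by (simp add: I_def)
        then show ?thesis using f True assms(3) \<open>e > 0\<close> by simp
      next
        case False
        have tel: "(\<Sum>i<Suc k. I (Suc i) - I i) = 1"
          unfolding sum_lessThan_telescope using False u g(1,2) by (simp add: I_def)
        have "step_fun (grid_step T x k) u - x u = (\<Sum>i<Suc k. (x (grid T k i) - x u) * (I (Suc i) - I i))"
        proof -
          have "(\<Sum>i\<in>A. (p i - c) * q i) = (\<Sum>i\<in>A. p i * q i) - c * (\<Sum>i\<in>A. q i)"
            for A :: "nat set" and p q :: "nat \<Rightarrow> real" and c
            by (simp add: left_diff_distrib sum_subtractf sum_distrib_left)
          then show ?thesis by (simp only: f tel mult_1_right)
        qed
        also have "\<bar>\<dots>\<bar> \<le> (\<Sum>i<Suc k. e / 2 * (I (Suc i) - I i))"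
        proof (rule order_trans[OF sum_abs sum_mono])
          fix i assume i: "i \<in> {..<Suc k}"
          show "\<bar>(x (grid T k i) - x u) * (I (Suc i) - I i)\<bar> \<le> e / 2 * (I (Suc i) - I i)"
          proof (cases "grid T k i < u \<and> u \<le> grid T k (Suc i)")
            case True
            have "\<bar>grid T k i - u\<bar> < d"
              using True g(5)[of i] elim by (simp add: divide_inverse)
            then have "\<bar>x (grid T k i) - x u\<bar> < e / 2" using i u by (intro d(2) grid_props(6)[OF assms(1)]) auto
            then show ?thesis using True u by (simp add: I_def)
          next
            case False
            then have "I (Suc i) = I i" using g(4)[of i] u by (auto simp: I_def indicator_def)
            then show ?thesis by simp
          qed
        qed
        also have "\<dots> = e / 2" unfolding sum_distrib_left[symmetric] tel by simp
        also have "\<dots> < e" using \<open>e > 0\<close> by simp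
        finally show ?thesis by (simp add: dist_real_def)
      qed
    qed
  qed
qed

text \<open>An explicit representative of the path of X in the Hilbert space. Its k-th term is built
  from finitely many values of X, so measurability and moments can be computed term by term.\<close>

definition pathU :: "real \<Rightarrow> 'w \<Rightarrow> nat \<Rightarrow> step" where
  "pathU T \<omega> = grid_step T (\<lambda>t. X t \<omega>)"

lemma pathU_represents:
  assumes "0 \<le> T" "\<omega> \<in> space M"
  shows "represents M Y T (\<lambda>t. X t \<omega>) (pathU T \<omega>)"
proof -
  have u: "uniform_limit {0..T} (\<lambda>k. step_fun (pathU T \<omega> k)) (\<lambda>t. X t \<omega>) sequentially"
    unfolding pathU_def using assms by (intro grid_step_uniform_limit X_cont X_zero) auto
  have s: "pathU T \<omega> k \<in> steps T" for k unfolding pathU_def by (rule grid_step_steps[OF assms(1)])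
  have "pathU T \<omega> \<in> hilb M Y T"
    by (rule hilbI[OF s uniform_limit_steps_rms[OF assms(1) s s u u]])
  then show ?thesis using u by (simp add: represents_def)
qed

text \<open>\<open>has_skorokhod_integral\<close> leaves the representing sequence open. The
  uniqueness argument sees that sequence through inner products with step functions, which do not
  depend on the choice.\<close>

lemma represents_inner_unique:
  assumes "0 \<le> T" and \<psi>: "\<psi> \<in> steps T" and U: "represents M Y T g U" and U': "represents M Y T g U'"
  shows "hilb_inner M Y (\<lambda>_. \<psi>) U = hilb_inner M Y (\<lambda>_. \<psi>) U'"
proof -
  have h: "U \<in> hilb M Y T" "U' \<in> hilb M Y T"
    and u: "uniform_limit {0..T} (\<lambda>k. step_fun (U k)) g sequentially"
      "uniform_limit {0..T} (\<lambda>k. step_fun (U' k)) g sequentially"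
    using U U' by (auto simp: represents_def)
  note s = hilb_steps[OF h(1)] hilb_steps[OF h(2)]
  have W: "step_rv Y \<psi> \<in> sq_int M" by (rule G_sq_int[OF step_rv_G[OF \<psi>]])
  have sq: "step_rv Y (U k) \<in> sq_int M" "step_rv Y (U' k) \<in> sq_int M" for k
    by (rule G_sq_int[OF step_rv_G[OF s(1)]], rule G_sq_int[OF step_rv_G[OF s(2)]])
  have lim: "(\<lambda>k. rms M (\<lambda>\<omega>. step_rv Y (U k) \<omega> - step_rv Y (U' k) \<omega>)) \<longlonglongrightarrow> 0"
  proof (rule LIMSEQ_I)
    fix e :: real assume "e > 0"
    obtain N where N: "\<forall>m\<ge>N. \<forall>k\<ge>N. rms M (\<lambda>\<omega>. step_rv Y (U m) \<omega> - step_rv Y (U' k) \<omega>) < e"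
      using uniform_limit_steps_rms[OF assms(1) s u \<open>e > 0\<close>] by blast
    then show "\<exists>N. \<forall>k\<ge>N. norm (rms M (\<lambda>\<omega>. step_rv Y (U k) \<omega> - step_rv Y (U' k) \<omega>) - 0) < e"
      by (intro exI[of _ N]) simp
  qed
  obtain a where a: "(\<lambda>k. \<integral>\<omega>. step_rv Y \<psi> \<omega> * step_rv Y (U k) \<omega> \<partial>M) \<longlonglongrightarrow> a"
    using hilb_convergent[OF h(1) W] by (auto simp: convergent_def)
  obtain b where b: "(\<lambda>k. \<integral>\<omega>. step_rv Y \<psi> \<omega> * step_rv Y (U' k) \<omega> \<partial>M) \<longlonglongrightarrow> b"
    using hilb_convergent[OF h(2) W] by (auto simp: convergent_def)
  have "(\<lambda>k. (\<integral>\<omega>. step_rv Y \<psi> \<omega> * step_rv Y (U k) \<omega> \<partial>M) - (\<integral>\<omega>. step_rv Y \<psi> \<omega> * step_rv Y (U' k) \<omega> \<partial>M)) \<longlonglongrightarrow> 0"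
  proof (rule Lim_null_comparison)
    show "(\<lambda>k. rms M (step_rv Y \<psi>) * rms M (\<lambda>\<omega>. step_rv Y (U k) \<omega> - step_rv Y (U' k) \<omega>)) \<longlonglongrightarrow> 0"
      using tendsto_mult[OF tendsto_const lim] by simp
    show "\<forall>\<^sub>F k in sequentially. norm ((\<integral>\<omega>. step_rv Y \<psi> \<omega> * step_rv Y (U k) \<omega> \<partial>M) - (\<integral>\<omega>. step_rv Y \<psi> \<omega> * step_rv Y (U' k) \<omega> \<partial>M))
        \<le> rms M (step_rv Y \<psi>) * rms M (\<lambda>\<omega>. step_rv Y (U k) \<omega> - step_rv Y (U' k) \<omega>)"
    proof (rule always_eventually, rule allI)
      fix k
      have "(\<integral>\<omega>. step_rv Y \<psi> \<omega> * step_rv Y (U k) \<omega> \<partial>M) - (\<integral>\<omega>. step_rv Y \<psi> \<omega> * step_rv Y (U' k) \<omega> \<partial>M)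
        = (\<integral>\<omega>. step_rv Y \<psi> \<omega> * (step_rv Y (U k) \<omega> - step_rv Y (U' k) \<omega>) \<partial>M)"
        using integrable_sq_int_mult[OF W sq(1)] integrable_sq_int_mult[OF W sq(2)] by (simp add: right_diff_distrib)
      then show "norm ((\<integral>\<omega>. step_rv Y \<psi> \<omega> * step_rv Y (U k) \<omega> \<partial>M) - (\<integral>\<omega>. step_rv Y \<psi> \<omega> * step_rv Y (U' k) \<omega> \<partial>M))
        \<le> rms M (step_rv Y \<psi>) * rms M (\<lambda>\<omega>. step_rv Y (U k) \<omega> - step_rv Y (U' k) \<omega>)"
        using cauchy_schwarz_integral[OF W sq_int_diff[OF sq(1) sq(2)]] by simp
    qed
  qed
  from LIMSEQ_unique[OF this tendsto_diff[OF a b]] have "a = b" by simp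
  then show ?thesis
    unfolding hilb_inner_def step_inner_rv[OF \<psi> s(1)] step_inner_rv[OF \<psi> s(2)] using limI[OF a] limI[OF b] by simp
qed

end

section \<open>Uniqueness of the Skorokhod integral\<close>

text \<open>Writing -sin as a cosine shifted by pi/2 keeps the family of multiples of shifted
  cosines closed under partial derivatives, so all orders are handled by one induction.\<close>

lemma partial_deriv_cos:
  assumes "i < n"
  shows "partial_deriv i (\<lambda>x. c * cos ((\<Sum>j<n. l j * x j) + b)) = (\<lambda>x. (c * l i) * cos ((\<Sum>j<n. l j * x j) + (b + pi / 2)))"
proof
  fix x :: "nat \<Rightarrow> real"
  define r where "r = (\<Sum>j\<in>{..<n} - {i}. l j * x j)"
  have sum: "(\<Sum>j<n. l j * (x(i := s)) j) = l i * s + r" for s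
  proof -
    have "(\<Sum>j<n. l j * (x(i := s)) j) = l i * (x(i := s)) i + (\<Sum>j\<in>{..<n} - {i}. l j * (x(i := s)) j)"
      using assms by (intro sum.remove) auto
    also have "(\<Sum>j\<in>{..<n} - {i}. l j * (x(i := s)) j) = r"
      unfolding r_def by (intro sum.cong) auto
    finally show ?thesis by simp
  qed
  have "((\<lambda>s. c * cos (l i * s + r + b)) has_real_derivative c * (- sin (l i * x i + r + b) * l i)) (at (x i))"
    by (auto intro!: derivative_eq_intros)
  then have "deriv (\<lambda>s. c * cos (l i * s + r + b)) (x i) = c * (- sin (l i * x i + r + b) * l i)"
    by (rule DERIV_imp_deriv)
  moreover have "(\<Sum>j<n. l j * x j) = l i * x i + r" using sum[of "x i"] by simp
  moreover have "cos (l i * x i + r + (b + pi / 2)) = - sin (l i * x i + r + b)"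
    by (simp add: cos_add add.assoc[symmetric])
  ultimately show "partial_deriv i (\<lambda>x. c * cos ((\<Sum>j<n. l j * x j) + b)) x = (c * l i) * cos ((\<Sum>j<n. l j * x j) + (b + pi / 2))"
    unfolding partial_deriv_def sum by simp
qed

lemma cos_partial_differentiable:
  fixes l :: "nat \<Rightarrow> real"
  assumes "i < n"
  shows "(\<lambda>s. c * cos ((\<Sum>j<n. l j * (x(i := s)) j) + b)) field_differentiable (at (x i))"
proof -
  have "((\<lambda>s. \<Sum>j<n. l j * (x(i := s)) j) has_real_derivative (\<Sum>j<n. if j = i then l j else 0)) (at (x i))"
    by (rule DERIV_sum) (auto intro!: derivative_eq_intros)
  from DERIV_cmult[OF DERIV_chain2[OF DERIV_cos DERIV_add[OF this DERIV_const]]] show ?thesis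
    unfolding field_differentiable_def by (rule exI)
qed

lemma smooth_bounded_cos:
  "smooth_bounded n (\<lambda>x. c * cos ((\<Sum>j<n. l j * x j) + b))"
proof -
  have iter: "\<exists>c' b'. foldr partial_deriv js (\<lambda>x. c * cos ((\<Sum>j<n. l j * x j) + b)) = (\<lambda>x. c' * cos ((\<Sum>j<n. l j * x j) + b'))"
    if "set js \<subseteq> {..<n}" for js
    using that
  proof (induction js)
    case (Cons i js)
    then obtain c' b' where IH: "foldr partial_deriv js (\<lambda>x. c * cos ((\<Sum>j<n. l j * x j) + b)) = (\<lambda>x. c' * cos ((\<Sum>j<n. l j * x j) + b'))"
      by auto
    have i: "i < n" using Cons.prems by simp
    show ?case
      by (intro exI[of _ "c' * l i"] exI[of _ "b' + pi / 2"]) (simp only: foldr.simps o_apply IH partial_deriv_cos[OF i])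
  qed auto
  show ?thesis
    unfolding smooth_bounded_def Let_def
  proof (intro conjI allI impI)
    fix x y :: "nat \<Rightarrow> real" assume "\<forall>i<n. x i = y i"
    then have "(\<Sum>j<n. l j * x j) = (\<Sum>j<n. l j * y j)" by (intro sum.cong) auto
    then show "c * cos ((\<Sum>j<n. l j * x j) + b) = c * cos ((\<Sum>j<n. l j * y j) + b)" by simp
  next
    fix js assume "set js \<subseteq> {..<n}"
    then obtain c' b' where eq: "foldr partial_deriv js (\<lambda>x. c * cos ((\<Sum>j<n. l j * x j) + b)) = (\<lambda>x. c' * cos ((\<Sum>j<n. l j * x j) + b'))"
      using iter by blast
    show "bounded (range (foldr partial_deriv js (\<lambda>x. c * cos ((\<Sum>j<n. l j * x j) + b))))"
      unfolding eq bounded_iff by (rule exI[of _ "\<bar>c'\<bar>"]) (auto simp: abs_mult intro!: mult_left_le)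
    fix i x assume "i < n"
    then show "(\<lambda>s. foldr partial_deriv js (\<lambda>x. c * cos ((\<Sum>j<n. l j * x j) + b)) (x(i := s))) field_differentiable (at (x i))"
      unfolding eq by (rule cos_partial_differentiable)
  qed
qed

section \<open>The \<sigma>-algebra generated by the noise\<close>

lemma space_generated_sigma: "space (generated_sigma M Y T) = space M"
  unfolding generated_sigma_def by (rule space_measure_of) auto

lemma sets_generated_sigma:
  "sets (generated_sigma M Y T) = sigma_sets (space M) {Y t -` A \<inter> space M | t A. t \<in> {0..T} \<and> A \<in> sets borel}"
  unfolding generated_sigma_def by (rule sets_measure_of) auto

lemma generated_sigma_measurable:
  assumes "t \<in> {0..T}"
  shows "Y t \<in> borel_measurable (generated_sigma M Y T)"
proof (rule measurableI)
  fix A :: "real set" assume "A \<in> sets borel"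
  then show "Y t -` A \<inter> space (generated_sigma M Y T) \<in> sets (generated_sigma M Y T)"
    unfolding space_generated_sigma sets_generated_sigma using assms by (intro sigma_sets.Basic) blast
qed simp

lemma generated_sigma_measurable_sub:
  fixes f :: "'w \<Rightarrow> real"
  assumes Y: "\<And>t. t \<in> {0..T} \<Longrightarrow> Y t \<in> borel_measurable M"
    and f: "f \<in> borel_measurable (generated_sigma M Y T)"
  shows "f \<in> borel_measurable M"
proof (rule measurableI)
  have sub: "sets (generated_sigma M Y T) \<subseteq> sets M"
    unfolding sets_generated_sigma by (rule sets.sigma_sets_subset) (auto intro: measurable_sets[OF Y])
  fix A :: "real set" assume "A \<in> sets borel"
  then show "f -` A \<inter> space M \<in> sets M"
    using measurable_sets[OF f] sub by (auto simp: space_generated_sigma)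
qed simp

text \<open>The preimages of measurable sets of the product space under the whole path on [0,T] form
  a \<sigma>-algebra that contains the generators. This connects \<open>generated_sigma\<close> with
  \<open>integral_PiM_zeroI\<close>.\<close>

lemma generated_sigma_set:
  assumes "S \<in> sets (generated_sigma M Y T)"
  shows "\<exists>A\<in>sets (PiM {0..T} (\<lambda>_. borel)). S = (\<lambda>\<omega>. \<lambda>t\<in>{0..T}. Y t \<omega>) -` A \<inter> space M"
proof -
  let ?P = "PiM {0..T} (\<lambda>_. borel :: real measure)" and ?V = "\<lambda>\<omega>. \<lambda>t\<in>{0..T}. Y t \<omega>"
  have V: "?V \<in> space M \<rightarrow> space ?P" by (auto simp: space_PiM)
  have "sets (generated_sigma M Y T) \<subseteq> sets (vimage_algebra (space M) ?V ?P)"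
    unfolding sets_generated_sigma
  proof (rule sets.sigma_sets_subset[of _ "vimage_algebra (space M) ?V ?P", simplified])
    show "{Y t -` A \<inter> space M |t A. t \<in> {0..T} \<and> A \<in> sets borel} \<subseteq> sets (vimage_algebra (space M) ?V ?P)"
    proof
      fix B assume "B \<in> {Y t -` A \<inter> space M |t A. t \<in> {0..T} \<and> A \<in> sets borel}"
      then obtain t A where B: "B = Y t -` A \<inter> space M" and t: "t \<in> {0..T}" and A: "A \<in> sets borel" by blast
      have "(\<lambda>y. y t) -` A \<inter> space ?P \<in> sets ?P"
        by (rule measurable_sets[OF measurable_component_singleton[OF t] A])
      moreover have "B = ?V -` ((\<lambda>y. y t) -` A \<inter> space ?P) \<inter> space M"
        using V t by (auto simp: B)
      ultimately show "B \<in> sets (vimage_algebra (space M) ?V ?P)"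
        unfolding sets_vimage_algebra2[OF V] by blast
    qed
  qed
  then have "S \<in> {?V -` A \<inter> space M |A. A \<in> sets ?P}"
    using assms unfolding sets_vimage_algebra2[OF V] by blast
  then show ?thesis by blast
qed

context second_kind_ou
begin

lemma Y_measurable: "0 \<le> t \<Longrightarrow> Y t \<in> borel_measurable M"
  by (rule sq_int_measurable[OF Y_sq_int])

lemma gen_measurable_sub:
  "f \<in> borel_measurable (generated_sigma M Y T) \<Longrightarrow> (f :: _ \<Rightarrow> real) \<in> borel_measurable M"
  by (rule generated_sigma_measurable_sub[of T]) (auto intro: Y_measurable)

text \<open>\<open>X t\<close> is the limit of the Riemann sums of \<open>X_eq_Y\<close>, whose
  nodes lie in [0,t].\<close>

lemma X_gen:
  assumes t: "t \<in> {0..T}"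
  shows "X t \<in> borel_measurable (generated_sigma M Y T)"
proof (rule borel_measurable_LIMSEQ_real)
  have t0: "0 \<le> t" using t by simp
  show "(\<lambda>n. Y t \<omega> - \<theta> * riemann_sum (\<lambda>s. exp (- \<theta> * (t - s)) * Y s \<omega>) 0 t n) \<longlonglongrightarrow> X t \<omega>"
    if "\<omega> \<in> space (generated_sigma M Y T)" for \<omega>
  proof -
    have w: "\<omega> \<in> space M" using that by (simp only: space_generated_sigma)
    have "continuous_on {0..t} (\<lambda>s. exp (- \<theta> * (t - s)) * Y s \<omega>)"
      by (rule continuous_on_mult[OF _ Y_cont[OF w]]) (intro continuous_intros)
    then show ?thesis
      unfolding X_eq_Y[OF w t0] by (intro tendsto_diff tendsto_mult tendsto_const riemann_sum_tendsto t0)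
  qed
  fix n
  show "(\<lambda>\<omega>. Y t \<omega> - \<theta> * riemann_sum (\<lambda>s. exp (- \<theta> * (t - s)) * Y s \<omega>) 0 t n) \<in> borel_measurable (generated_sigma M Y T)"
    unfolding riemann_sum_def
  proof (intro borel_measurable_diff borel_measurable_times borel_measurable_const borel_measurable_sum generated_sigma_measurable t)
    fix i assume "i \<in> {..<n}"
    then show "0 + real i * ((t - 0) / real n) \<in> {0..T}"
      using grid_mem[OF t0, of i n] t by auto
  qed
qed

lemma energy_gen:
  assumes "0 \<le> T"
  shows "energy T \<in> borel_measurable (generated_sigma M Y T)"
proof (rule borel_measurable_LIMSEQ_real)
  show "(\<lambda>n. riemann_sum (\<lambda>t. (X t \<omega>)\<^sup>2) 0 T n) \<longlonglongrightarrow> energy T \<omega>"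
    if "\<omega> \<in> space (generated_sigma M Y T)" for \<omega>
    unfolding energy_def using that
    by (intro riemann_sum_tendsto assms continuous_on_power X_cont) (auto simp: space_generated_sigma)
  fix n
  show "(\<lambda>\<omega>. riemann_sum (\<lambda>t. (X t \<omega>)\<^sup>2) 0 T n) \<in> borel_measurable (generated_sigma M Y T)"
    unfolding riemann_sum_def
    by (intro borel_measurable_sum borel_measurable_times borel_measurable_const borel_measurable_power
        X_gen grid_mem assms) simp
qed

text \<open>Since \<open>Y\<close> has vanishing quadratic variation, the path-wise integral of \<open>X\<close> against \<open>Y\<close> is
  \<open>X\<^sub>T\<^sup>2 / 2 + \<theta> \<integral> X\<^sup>2\<close>. The Skorokhod integral differs from it by a constant, which makes it centered.\<close>

definition pathint :: "real \<Rightarrow> 'w \<Rightarrow> real" where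
  "pathint T \<omega> = (X T \<omega>)\<^sup>2 / 2 + \<theta> * energy T \<omega>"

definition skor :: "real \<Rightarrow> 'w \<Rightarrow> real" where
  "skor T \<omega> = pathint T \<omega> - (\<integral>\<omega>. pathint T \<omega> \<partial>M)"

lemma pathint_sq_int: "0 \<le> T \<Longrightarrow> pathint T \<in> sq_int M"
proof -
  assume T: "0 \<le> T"
  have "(\<lambda>\<omega>. 1 / 2 * (X T \<omega>)\<^sup>2 + \<theta> * energy T \<omega>) \<in> sq_int M"
    by (intro sq_int_add sq_int_cmult G_square_sq_int X_G energy_sq_int T)
  then show ?thesis by (simp add: pathint_def[abs_def])
qed

lemma skor_sq_int: "0 \<le> T \<Longrightarrow> skor T \<in> sq_int M"
  unfolding skor_def[abs_def] by (intro sq_int_diff pathint_sq_int sq_int_const)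

lemma skor_gen:
  assumes "0 \<le> T"
  shows "skor T \<in> borel_measurable (generated_sigma M Y T)"
  unfolding skor_def[abs_def] pathint_def
  by (intro borel_measurable_diff borel_measurable_add borel_measurable_divide borel_measurable_power
      borel_measurable_times borel_measurable_const energy_gen X_gen assms) (use assms in simp)

section \<open>Malliavin derivatives under the isometry\<close>

lemma hilb_bounded:
  assumes "U \<in> hilb M Y T"
  obtains K where "\<And>k. rms M (step_rv Y (U k)) \<le> K"
proof -
  have sq: "step_rv Y (U k) \<in> sq_int M" for k by (rule G_sq_int[OF step_rv_G[OF hilb_steps[OF assms]]])
  obtain N where N: "\<forall>m\<ge>N. \<forall>k\<ge>N. rms M (\<lambda>\<omega>. step_rv Y (U m) \<omega> - step_rv Y (U k) \<omega>) < 1"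
    using hilb_Cauchy[OF assms zero_less_one] by (elim exE)
  define K where "K = (\<Sum>k\<le>N. rms M (step_rv Y (U k))) + 1"
  have "rms M (step_rv Y (U k)) \<le> K" for k
  proof (cases "k \<le> N")
    case True
    then have "rms M (step_rv Y (U k)) \<le> (\<Sum>k\<le>N. rms M (step_rv Y (U k)))"
      by (intro member_le_sum) auto
    then show ?thesis by (simp add: K_def)
  next
    case False
    have "rms M (\<lambda>\<omega>. (step_rv Y (U k) \<omega> - step_rv Y (U N) \<omega>) + step_rv Y (U N) \<omega>)
      \<le> rms M (\<lambda>\<omega>. step_rv Y (U k) \<omega> - step_rv Y (U N) \<omega>) + rms M (step_rv Y (U N))"
      by (intro rms_add_le sq_int_diff sq)
    moreover have "rms M (\<lambda>\<omega>. step_rv Y (U k) \<omega> - step_rv Y (U N) \<omega>) < 1" using N False by simp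
    moreover have "rms M (step_rv Y (U N)) \<le> (\<Sum>k\<le>N. rms M (step_rv Y (U k)))"
      by (intro member_le_sum) auto
    ultimately show ?thesis by (simp add: K_def)
  qed
  then show ?thesis by (rule that)
qed

text \<open>One Cauchy sequence is exchanged for its Wiener integral W. The error is controlled by
  Cauchy-Schwarz because the other sequence is bounded.\<close>

lemma step_inner_tendsto:
  assumes \<Phi>: "\<Phi> \<in> hilb M Y T" and U: "U \<in> hilb M Y T" and W: "W \<in> sq_int M"
    and lim: "(\<lambda>k. rms M (\<lambda>\<omega>. step_rv Y (\<Phi> k) \<omega> - W \<omega>)) \<longlonglongrightarrow> 0"
  shows "(\<lambda>k. step_inner M Y (\<Phi> k) (U k)) \<longlonglongrightarrow> lim (\<lambda>k. \<integral>\<omega>. W \<omega> * step_rv Y (U k) \<omega> \<partial>M)"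
proof -
  obtain K where K: "\<And>k. rms M (step_rv Y (U k)) \<le> K" by (rule hilb_bounded[OF U]) (rule that)
  have sqU: "step_rv Y (U k) \<in> sq_int M" for k by (rule G_sq_int[OF step_rv_G[OF hilb_steps[OF U]]])
  have sqP: "step_rv Y (\<Phi> k) \<in> sq_int M" for k by (rule G_sq_int[OF step_rv_G[OF hilb_steps[OF \<Phi>]]])
  have "(\<lambda>k. \<integral>\<omega>. W \<omega> * step_rv Y (U k) \<omega> \<partial>M) \<longlonglongrightarrow> lim (\<lambda>k. \<integral>\<omega>. W \<omega> * step_rv Y (U k) \<omega> \<partial>M)"
    using hilb_convergent[OF U W] by (simp add: convergent_LIMSEQ_iff)
  moreover have "(\<lambda>k. \<integral>\<omega>. (step_rv Y (\<Phi> k) \<omega> - W \<omega>) * step_rv Y (U k) \<omega> \<partial>M) \<longlonglongrightarrow> 0"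
  proof (rule Lim_null_comparison)
    show "(\<lambda>k. rms M (\<lambda>\<omega>. step_rv Y (\<Phi> k) \<omega> - W \<omega>) * K) \<longlonglongrightarrow> 0"
      using tendsto_mult[OF lim tendsto_const[of K]] by simp
    show "\<forall>\<^sub>F k in sequentially. norm (\<integral>\<omega>. (step_rv Y (\<Phi> k) \<omega> - W \<omega>) * step_rv Y (U k) \<omega> \<partial>M)
        \<le> rms M (\<lambda>\<omega>. step_rv Y (\<Phi> k) \<omega> - W \<omega>) * K"
    proof (rule always_eventually, rule allI)
      fix k
      have "\<bar>\<integral>\<omega>. (step_rv Y (\<Phi> k) \<omega> - W \<omega>) * step_rv Y (U k) \<omega> \<partial>M\<bar>
        \<le> rms M (\<lambda>\<omega>. step_rv Y (\<Phi> k) \<omega> - W \<omega>) * rms M (step_rv Y (U k))"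
        by (intro cauchy_schwarz_integral sq_int_diff sqP sqU W)
      also have "\<dots> \<le> rms M (\<lambda>\<omega>. step_rv Y (\<Phi> k) \<omega> - W \<omega>) * K"
        by (intro mult_left_mono K rms_nonneg)
      finally show "norm (\<integral>\<omega>. (step_rv Y (\<Phi> k) \<omega> - W \<omega>) * step_rv Y (U k) \<omega> \<partial>M)
        \<le> rms M (\<lambda>\<omega>. step_rv Y (\<Phi> k) \<omega> - W \<omega>) * K" by simp
    qed
  qed
  ultimately have "(\<lambda>k. (\<integral>\<omega>. W \<omega> * step_rv Y (U k) \<omega> \<partial>M) + (\<integral>\<omega>. (step_rv Y (\<Phi> k) \<omega> - W \<omega>) * step_rv Y (U k) \<omega> \<partial>M))
     \<longlonglongrightarrow> lim (\<lambda>k. \<integral>\<omega>. W \<omega> * step_rv Y (U k) \<omega> \<partial>M) + 0"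
    by (rule tendsto_add)
  moreover have "(\<integral>\<omega>. W \<omega> * step_rv Y (U k) \<omega> \<partial>M) + (\<integral>\<omega>. (step_rv Y (\<Phi> k) \<omega> - W \<omega>) * step_rv Y (U k) \<omega> \<partial>M)
      = step_inner M Y (\<Phi> k) (U k)" for k
    unfolding step_inner_rv[OF hilb_steps[OF \<Phi>] hilb_steps[OF U]] left_diff_distrib
    using integrable_sq_int_mult[OF W sqU] integrable_sq_int_mult[OF sqP sqU] by simp
  ultimately show ?thesis by simp
qed

lemma step_inner_sum:
  assumes \<phi>: "\<And>i. i \<in> I \<Longrightarrow> \<phi> i \<in> steps T" and \<psi>: "\<psi> \<in> steps T"
  shows "step_inner M Y (\<Sum>i\<in>I. step_scale (c i) (\<phi> i)) \<psi> = (\<Sum>i\<in>I. c i * step_inner M Y (\<phi> i) \<psi>)"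
proof -
  have "(\<Sum>i\<in>I. step_scale (c i) (\<phi> i)) \<in> steps T" by (intro steps_sum steps_scale \<phi>)
  then have "step_inner M Y (\<Sum>i\<in>I. step_scale (c i) (\<phi> i)) \<psi>
    = (\<integral>\<omega>. (\<Sum>i\<in>I. c i * step_rv Y (\<phi> i) \<omega>) * step_rv Y \<psi> \<omega> \<partial>M)"
    by (simp add: step_inner_rv[OF _ \<psi>] step_rv_sum step_rv_scale)
  also have "\<dots> = (\<Sum>i\<in>I. c i * (\<integral>\<omega>. step_rv Y (\<phi> i) \<omega> * step_rv Y \<psi> \<omega> \<partial>M))"
    by (intro expectation_sum_mult G_sq_int step_rv_G[OF \<phi>] step_rv_G[OF \<psi>])
  also have "\<dots> = (\<Sum>i\<in>I. c i * step_inner M Y (\<phi> i) \<psi>)"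
    by (intro sum.cong refl) (simp add: step_inner_rv[OF \<phi> \<psi>])
  finally show ?thesis .
qed

text \<open>The derivative is a combination of the \<open>\<Phi> i\<close> with coefficients frozen
  at \<omega>, so its inner product with U is the same combination of inner products. Those are
  limits of expectations of \<open>W i\<close> times step integrals, in which the integration
  variable is unrelated to the outer \<omega>.\<close>

lemma hilb_inner_malliavin:
  assumes \<Phi>: "\<And>i. i < n \<Longrightarrow> \<Phi> i \<in> hilb M Y T" and U: "U \<in> hilb M Y T" and W: "\<And>i. i < n \<Longrightarrow> W i \<in> sq_int M"
    and lim: "\<And>i. i < n \<Longrightarrow> (\<lambda>k. rms M (\<lambda>\<omega>. step_rv Y (\<Phi> i k) \<omega> - W i \<omega>)) \<longlonglongrightarrow> 0"
  shows "hilb_inner M Y (malliavin_deriv n f \<Phi> W \<omega>) U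
    = (\<Sum>i<n. partial_deriv i f (\<lambda>j. W j \<omega>) * lim (\<lambda>k. \<integral>\<omega>. W i \<omega> * step_rv Y (U k) \<omega> \<partial>M))"
proof -
  let ?p = "\<lambda>i. partial_deriv i f (\<lambda>j. W j \<omega>)"
  have "(\<lambda>k. \<Sum>i<n. ?p i * step_inner M Y (\<Phi> i k) (U k))
    \<longlonglongrightarrow> (\<Sum>i<n. ?p i * lim (\<lambda>k. \<integral>\<omega>. W i \<omega> * step_rv Y (U k) \<omega> \<partial>M))"
    by (intro tendsto_sum tendsto_mult tendsto_const step_inner_tendsto[OF \<Phi> U W lim]) simp_all
  moreover have "step_inner M Y (malliavin_deriv n f \<Phi> W \<omega> k) (U k) = (\<Sum>i<n. ?p i * step_inner M Y (\<Phi> i k) (U k))" for k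
    unfolding malliavin_deriv_def by (rule step_inner_sum[OF hilb_steps[OF \<Phi>] hilb_steps[OF U]]) simp
  ultimately show ?thesis unfolding hilb_inner_def by (simp add: limI)
qed

text \<open>Duality tested on a cosine of finitely many values of Y. On the right, U appears only
  through inner products with indicators of [0,t], which are determined by the represented
  path.\<close>

lemma divergence_test:
  assumes T: "0 \<le> T" and div: "has_divergence M Y T U Z" and S: "finite S" "S \<subseteq> {0..T}"
  shows "(\<integral>\<omega>. Z \<omega> * cos ((\<Sum>t\<in>S. l t * Y t \<omega>) + b) \<partial>M)
    = (\<integral>\<omega>. (\<Sum>t\<in>S. l t * cos ((\<Sum>t\<in>S. l t * Y t \<omega>) + (b + pi / 2))
        * hilb_inner M Y (\<lambda>_. Poly_Mapping.single t 1) (U \<omega>)) \<partial>M)"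
proof -
  \<comment> \<open>Smooth functionals take variables numbered from 0, hence an enumeration of
    S.\<close>
  obtain ts where ts: "bij_betw ts {0..<card S} S" using ex_bij_betw_nat_finite[OF S(1)] by blast
  define n where "n = card S"
  have bij: "bij_betw ts {..<n} S" using ts by (simp add: n_def atLeast0LessThan)
  define f where "f x = 1 * cos ((\<Sum>i<n. l (ts i) * x i) + b)" for x :: "nat \<Rightarrow> real"
  define \<Phi> where "\<Phi> i = (\<lambda>k::nat. Poly_Mapping.single (ts i) (1::real))" for i
  define W where "W i = Y (ts i)" for i
  have mem: "ts i \<in> {0..T}" if "i < n" for i
    using that by (intro subsetD[OF S(2)] bij_betwE[OF bij, rule_format]) simp
  have \<Phi>: "\<Phi> i \<in> hilb M Y T" if "i < n" for i
    unfolding \<Phi>_def by (intro hilb_const steps_single mem that)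
  have W: "W i \<in> sq_int M" if "i < n" for i unfolding W_def using mem[OF that] by (intro Y_sq_int) simp
  have rv: "step_rv Y (\<Phi> i k) = W i" for i k by (rule ext) (simp add: \<Phi>_def W_def step_rv_single)
  have wi: "has_wiener_integral M Y (\<Phi> i) (W i)" if "i < n" for i
    unfolding has_wiener_integral_def step_rv_def[symmetric] rv
    using sq_int_measurable[OF W[OF that]] sq_int_square[OF W[OF that]] by simp
  have reindex: "(\<Sum>i<n. g (ts i)) = (\<Sum>t\<in>S. g t)" for g :: "real \<Rightarrow> real"
    by (rule sum.reindex_bij_betw[OF bij])
  have sumW: "(\<Sum>i<n. l (ts i) * W i \<omega>) = (\<Sum>t\<in>S. l t * Y t \<omega>)" for \<omega>
    unfolding W_def by (rule reindex[of "\<lambda>t. l t * Y t \<omega>"])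
  have smooth: "smooth_bounded n f" unfolding f_def[abs_def] by (rule smooth_bounded_cos)
  have Uh: "U \<omega> \<in> hilb M Y T" if "\<omega> \<in> space M" for \<omega>
    using div that by (simp add: has_divergence_def L2_hilb_def)
  have dual: "(\<integral>\<omega>. smooth_functional f W \<omega> * Z \<omega> \<partial>M) = (\<integral>\<omega>. hilb_inner M Y (malliavin_deriv n f \<Phi> W \<omega>) (U \<omega>) \<partial>M)"
    using div smooth \<Phi> wi unfolding has_divergence_def by simp
  have lim0: "(\<lambda>k. rms M (\<lambda>\<omega>. step_rv Y (\<Phi> i k) \<omega> - W i \<omega>)) \<longlonglongrightarrow> 0" for i
    unfolding rv by (simp add: rms_def)
  have inner: "hilb_inner M Y (malliavin_deriv n f \<Phi> W \<omega>) (U \<omega>)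
      = (\<Sum>t\<in>S. l t * cos ((\<Sum>t\<in>S. l t * Y t \<omega>) + (b + pi / 2)) * hilb_inner M Y (\<lambda>_. Poly_Mapping.single t 1) (U \<omega>))"
    if w: "\<omega> \<in> space M" for \<omega>
  proof -
    have "hilb_inner M Y (malliavin_deriv n f \<Phi> W \<omega>) (U \<omega>)
      = (\<Sum>i<n. partial_deriv i f (\<lambda>j. W j \<omega>) * lim (\<lambda>k. \<integral>\<omega>'. W i \<omega>' * step_rv Y (U \<omega> k) \<omega>' \<partial>M))"
      by (rule hilb_inner_malliavin[OF \<Phi> Uh[OF w] W lim0])
    also have "\<dots> = (\<Sum>i<n. l (ts i) * cos ((\<Sum>t\<in>S. l t * Y t \<omega>) + (b + pi / 2)) * hilb_inner M Y (\<lambda>_. Poly_Mapping.single (ts i) 1) (U \<omega>))"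
    proof (rule sum.cong[OF refl])
      fix i assume "i \<in> {..<n}"
      then have i: "i < n" by simp
      have "partial_deriv i f (\<lambda>j. W j \<omega>) = l (ts i) * cos ((\<Sum>t\<in>S. l t * Y t \<omega>) + (b + pi / 2))"
        unfolding f_def[abs_def] partial_deriv_cos[OF i] sumW by simp
      moreover have "hilb_inner M Y (\<Phi> i) (U \<omega>) = lim (\<lambda>k. \<integral>\<omega>'. W i \<omega>' * step_rv Y (U \<omega> k) \<omega>' \<partial>M)"
        unfolding hilb_inner_def by (rule limI[OF step_inner_tendsto[OF \<Phi>[OF i] Uh[OF w] W[OF i] lim0]])
      ultimately show "partial_deriv i f (\<lambda>j. W j \<omega>) * lim (\<lambda>k. \<integral>\<omega>'. W i \<omega>' * step_rv Y (U \<omega> k) \<omega>' \<partial>M)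
        = l (ts i) * cos ((\<Sum>t\<in>S. l t * Y t \<omega>) + (b + pi / 2)) * hilb_inner M Y (\<lambda>_. Poly_Mapping.single (ts i) 1) (U \<omega>)"
        by (simp add: \<Phi>_def)
    qed
    also have "\<dots> = (\<Sum>t\<in>S. l t * cos ((\<Sum>t\<in>S. l t * Y t \<omega>) + (b + pi / 2)) * hilb_inner M Y (\<lambda>_. Poly_Mapping.single t 1) (U \<omega>))"
      by (rule reindex)
    finally show ?thesis .
  qed
  have "(\<integral>\<omega>. Z \<omega> * cos ((\<Sum>t\<in>S. l t * Y t \<omega>) + b) \<partial>M) = (\<integral>\<omega>. smooth_functional f W \<omega> * Z \<omega> \<partial>M)"
    by (simp only: smooth_functional_def f_def mult_1 sumW mult.commute[of _ "Z _"])
  also have "\<dots> = (\<integral>\<omega>. (\<Sum>t\<in>S. l t * cos ((\<Sum>t\<in>S. l t * Y t \<omega>) + (b + pi / 2))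
        * hilb_inner M Y (\<lambda>_. Poly_Mapping.single t 1) (U \<omega>)) \<partial>M)"
    unfolding dual by (rule Bochner_Integration.integral_cong[OF refl inner])
  finally show ?thesis .
qed

text \<open>Two candidates have the same expectation against every trigonometric function of Y,
  hence against every bounded measurable function of the path of Y on [0,T]. As their difference is
  measurable with respect to that path, the event Z > Z' may serve as the test. Exchanging the
  candidates gives equality.\<close>

lemma divergence_le:
  assumes T: "0 \<le> T"
    and U: "AE \<omega> in M. represents M Y T (\<lambda>t. X t \<omega>) (U \<omega>)" "has_divergence M Y T U Z"
    and U': "AE \<omega> in M. represents M Y T (\<lambda>t. X t \<omega>) (U' \<omega>)" "has_divergence M Y T U' Z'"
  shows "AE \<omega> in M. Z \<omega> \<le> Z' \<omega>"
proof -
  have gen: "Z \<in> borel_measurable (generated_sigma M Y T)" "Z' \<in> borel_measurable (generated_sigma M Y T)"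
    using U(2) U'(2) by (simp_all add: has_divergence_def)
  have sq: "Z \<in> sq_int M" "Z' \<in> sq_int M"
    using gen_measurable_sub[OF gen(1)] gen_measurable_sub[OF gen(2)] U(2) U'(2)
    by (simp_all add: sq_int_def has_divergence_def)
  define D where "D \<omega> = Z \<omega> - Z' \<omega>" for \<omega>
  have D: "integrable M D"
    unfolding D_def[abs_def] by (intro Bochner_Integration.integrable_diff sq_int_integrable sq)
  have zero: "(\<integral>\<omega>. D \<omega> * cos ((\<Sum>t\<in>S. l t * Y t \<omega>) + b) \<partial>M) = 0" if S: "finite S" "S \<subseteq> {0..T}" for S l b
  proof -
    have Ym: "(\<lambda>\<omega>. (\<Sum>t\<in>S. l t * Y t \<omega>) + b) \<in> borel_measurable M" for b
      using S(2) by (intro borel_measurable_add borel_measurable_sum borel_measurable_times borel_measurable_const Y_measurable) auto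
    have cosm: "(\<lambda>\<omega>. cos ((\<Sum>t\<in>S. l t * Y t \<omega>) + b)) \<in> borel_measurable M" for b
      by (rule measurable_compose[OF Ym borel_measurable_continuous_onI]) (intro continuous_intros)
    have hm: "(\<lambda>\<omega>. hilb_inner M Y (\<lambda>_. Poly_Mapping.single t 1) (R \<omega>)) \<in> borel_measurable M"
      if "has_divergence M Y T R z" "t \<in> S" for R z t
    proof (rule gen_measurable_sub)
      have "Poly_Mapping.single t 1 \<in> steps T" using that(2) S(2) by (intro steps_single) auto
      then show "(\<lambda>\<omega>. hilb_inner M Y (\<lambda>_. Poly_Mapping.single t 1) (R \<omega>)) \<in> borel_measurable (generated_sigma M Y T)"
        using that(1) by (simp add: has_divergence_def L2_hilb_def)
    qed
    let ?R = "\<lambda>U \<omega>. \<Sum>t\<in>S. l t * cos ((\<Sum>t\<in>S. l t * Y t \<omega>) + (b + pi / 2)) * hilb_inner M Y (\<lambda>_. Poly_Mapping.single t 1) (U \<omega>)"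
    have "(\<integral>\<omega>. ?R U \<omega> \<partial>M) = (\<integral>\<omega>. ?R U' \<omega> \<partial>M)"
    proof (rule integral_cong_AE)
      show "?R U \<in> borel_measurable M" "?R U' \<in> borel_measurable M"
        by (intro borel_measurable_sum borel_measurable_times borel_measurable_const cosm hm[OF U(2)] hm[OF U'(2)]; assumption)+
      show "AE \<omega> in M. ?R U \<omega> = ?R U' \<omega>"
        using U(1) U'(1)
      proof eventually_elim
        case (elim \<omega>)
        have "hilb_inner M Y (\<lambda>_. Poly_Mapping.single t 1) (U \<omega>) = hilb_inner M Y (\<lambda>_. Poly_Mapping.single t 1) (U' \<omega>)"
          if "t \<in> S" for t
          using that S(2) by (intro represents_inner_unique[OF T _ elim] steps_single) auto
        then show ?case by simp
      qed
    qed
    then have "(\<integral>\<omega>. Z \<omega> * cos ((\<Sum>t\<in>S. l t * Y t \<omega>) + b) \<partial>M) = (\<integral>\<omega>. Z' \<omega> * cos ((\<Sum>t\<in>S. l t * Y t \<omega>) + b) \<partial>M)"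
      unfolding divergence_test[OF T U(2) S] divergence_test[OF T U'(2) S] .
    moreover have "integrable M (\<lambda>\<omega>. Z \<omega> * cos ((\<Sum>t\<in>S. l t * Y t \<omega>) + b))" "integrable M (\<lambda>\<omega>. Z' \<omega> * cos ((\<Sum>t\<in>S. l t * Y t \<omega>) + b))"
      by (rule integrable_mult_bounded[OF sq_int_integrable[OF sq(1)] cosm abs_cos_le_one],
          rule integrable_mult_bounded[OF sq_int_integrable[OF sq(2)] cosm abs_cos_le_one])
    ultimately show ?thesis by (simp add: D_def left_diff_distrib)
  qed
  define P where "P = {\<omega> \<in> space (generated_sigma M Y T). 0 < D \<omega>}"
  have "P \<in> sets (generated_sigma M Y T)"
    unfolding P_def D_def using gen by measurable
  from generated_sigma_set[OF this]
  obtain A where A: "A \<in> sets (PiM {0..T} (\<lambda>_. borel))" "P = (\<lambda>\<omega>. \<lambda>t\<in>{0..T}. Y t \<omega>) -` A \<inter> space M"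
    by (elim bexE)
  have "(\<integral>\<omega>. D \<omega> * indicator A (\<lambda>t\<in>{0..T}. Y t \<omega>) \<partial>M) = 0"
  proof (rule integral_PiM_zeroI[OF D _ zero])
    show "Y t \<in> borel_measurable M" if "t \<in> {0..T}" for t using that by (intro Y_measurable) simp
    show "indicator A \<in> borel_measurable (PiM {0..T} (\<lambda>_. borel))" using A(1) by (rule borel_measurable_indicator)
    show "\<bar>indicator A y :: real\<bar> \<le> 1" for y by (simp add: indicator_def)
  qed
  moreover have "(\<integral>\<omega>. D \<omega> * indicator A (\<lambda>t\<in>{0..T}. Y t \<omega>) \<partial>M) = (\<integral>\<omega>. max 0 (D \<omega>) \<partial>M)"
  proof (rule Bochner_Integration.integral_cong[OF refl])
    fix \<omega> assume w: "\<omega> \<in> space M"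
    have "(\<lambda>t\<in>{0..T}. Y t \<omega>) \<in> A \<longleftrightarrow> \<omega> \<in> P" using A(2) w by simp
    also have "\<dots> \<longleftrightarrow> 0 < D \<omega>" using w by (simp add: P_def space_generated_sigma)
    finally show "D \<omega> * indicator A (\<lambda>t\<in>{0..T}. Y t \<omega>) = max 0 (D \<omega>)" by (simp add: indicator_def)
  qed
  ultimately have "AE \<omega> in M. max 0 (D \<omega>) = 0"
    using integral_nonneg_eq_0_iff_AE[of M "\<lambda>\<omega>. max 0 (D \<omega>)"] D by simp
  then show ?thesis by eventually_elim (simp add: D_def max_def split: if_splits)
qed

end

section \<open>The Skorokhod integral of the process\<close>

lemma rms_abs: "rms M (\<lambda>\<omega>. \<bar>Z \<omega>\<bar>) = rms M Z"
  by (simp add: rms_def)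

lemma expectation_abs_mult_le:
  assumes "W \<in> sq_int M" "Z \<in> sq_int M"
  shows "(\<integral>\<omega>. \<bar>W \<omega> * Z \<omega>\<bar> \<partial>M) \<le> rms M W * rms M Z"
proof -
  have "(\<lambda>\<omega>. \<bar>W \<omega>\<bar>) \<in> sq_int M" "(\<lambda>\<omega>. \<bar>Z \<omega>\<bar>) \<in> sq_int M" using assms by (auto simp: sq_int_def)
  from cauchy_schwarz_integral[OF this] show ?thesis by (simp add: rms_abs abs_mult)
qed

lemma integral_bounded_mult_tendsto:
  fixes g :: "'w \<Rightarrow> real" and A :: "nat \<Rightarrow> 'w \<Rightarrow> real"
  assumes A: "\<And>k. integrable M (A k)" and P: "integrable M P"
    and g: "g \<in> borel_measurable M" "\<And>\<omega>. \<bar>g \<omega>\<bar> \<le> C"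
    and lim: "(\<lambda>k. \<integral>\<omega>. \<bar>A k \<omega> - P \<omega>\<bar> \<partial>M) \<longlonglongrightarrow> 0"
  shows "(\<lambda>k. \<integral>\<omega>. A k \<omega> * g \<omega> \<partial>M) \<longlonglongrightarrow> (\<integral>\<omega>. P \<omega> * g \<omega> \<partial>M)"
proof -
  have D: "integrable M (\<lambda>\<omega>. A k \<omega> - P \<omega>)" for k by (rule Bochner_Integration.integrable_diff[OF A P])
  have "(\<lambda>k. (\<integral>\<omega>. A k \<omega> * g \<omega> \<partial>M) - (\<integral>\<omega>. P \<omega> * g \<omega> \<partial>M)) \<longlonglongrightarrow> 0"
  proof (rule Lim_null_comparison)
    show "(\<lambda>k. C * (\<integral>\<omega>. \<bar>A k \<omega> - P \<omega>\<bar> \<partial>M)) \<longlonglongrightarrow> 0" using tendsto_mult[OF tendsto_const lim] by simp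
    show "\<forall>\<^sub>F k in sequentially. norm ((\<integral>\<omega>. A k \<omega> * g \<omega> \<partial>M) - (\<integral>\<omega>. P \<omega> * g \<omega> \<partial>M)) \<le> C * (\<integral>\<omega>. \<bar>A k \<omega> - P \<omega>\<bar> \<partial>M)"
    proof (rule always_eventually, rule allI)
      fix k
      have "(\<integral>\<omega>. A k \<omega> * g \<omega> \<partial>M) - (\<integral>\<omega>. P \<omega> * g \<omega> \<partial>M) = (\<integral>\<omega>. (A k \<omega> - P \<omega>) * g \<omega> \<partial>M)"
        using integrable_mult_bounded[OF A g] integrable_mult_bounded[OF P g] by (simp add: left_diff_distrib)
      then show "norm ((\<integral>\<omega>. A k \<omega> * g \<omega> \<partial>M) - (\<integral>\<omega>. P \<omega> * g \<omega> \<partial>M)) \<le> C * (\<integral>\<omega>. \<bar>A k \<omega> - P \<omega>\<bar> \<partial>M)"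
        using integral_abs_mult_le[OF D integrable_mult_bounded[OF D g] g(2)] by simp
    qed
  qed
  then show ?thesis by (rule LIM_zero_cancel)
qed

context second_kind_ou
begin

definition path_sum :: "real \<Rightarrow> nat \<Rightarrow> 'w \<Rightarrow> real" where
  "path_sum T k \<omega> = (\<Sum>i<Suc k. X (grid T k i) \<omega> * (Y (grid T k (Suc i)) \<omega> - Y (grid T k i) \<omega>))"

text \<open>The error of the left rectangle rule for the integral of X over one cell.\<close>

definition grid_defect :: "real \<Rightarrow> nat \<Rightarrow> nat \<Rightarrow> 'w \<Rightarrow> real" where
  "grid_defect T k i \<omega> = integral {grid T k i..grid T k (Suc i)} (\<lambda>u. X u \<omega> - X (grid T k i) \<omega>)"

text \<open>Insert dY = dX + \<theta> X dt and use x (y - x) = (y^2 - x^2)/2 - (y - x)^2/2. The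
  squares telescope; there remain the discrete quadratic variation, the rectangle errors and the
  error of the Riemann sum of X^2.\<close>

lemma path_sum_eq:
  assumes w: "\<omega> \<in> space M" and T: "0 \<le> T"
  shows "path_sum T k \<omega> - pathint T \<omega> =
    (\<Sum>i<Suc k. - 1 / 2 * (X (grid T k (Suc i)) \<omega> - X (grid T k i) \<omega>)\<^sup>2)
    + (\<Sum>i<Suc k. \<theta> * (X (grid T k i) \<omega> * grid_defect T k i \<omega>))
    + \<theta> * (riemann_sum (\<lambda>t. (X t \<omega>)\<^sup>2) 0 T (Suc k) - energy T \<omega>)"
proof -
  let ?g = "grid T k" and ?h = "T / real (Suc k)"
  let ?X = "\<lambda>i. X (?g i) \<omega>"
  note g = grid_props[OF T, of k]
  have summand: "?X i * (Y (?g (Suc i)) \<omega> - Y (?g i) \<omega>)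
    = ((?X (Suc i))\<^sup>2 / 2 - (?X i)\<^sup>2 / 2) + - 1 / 2 * (?X (Suc i) - ?X i)\<^sup>2
      + \<theta> * (?X i * grid_defect T k i \<omega>) + \<theta> * (?h * (?X i)\<^sup>2)" for i
  proof -
    have "grid_defect T k i \<omega> = integral {?g i..?g (Suc i)} (\<lambda>u. X u \<omega>) - (?g (Suc i) - ?g i) * ?X i"
      unfolding grid_defect_def using g(3)[of i] g(4)[of i] X_integrable[OF w, of "?g i" "?g (Suc i)"]
      by (subst Henstock_Kurzweil_Integration.integral_diff) auto
    then have d: "integral {?g i..?g (Suc i)} (\<lambda>u. X u \<omega>) = grid_defect T k i \<omega> + ?h * ?X i"
      unfolding g(5) by simp
    have dY: "Y (?g (Suc i)) \<omega> - Y (?g i) \<omega> = (?X (Suc i) - ?X i) + \<theta> * (grid_defect T k i \<omega> + ?h * ?X i)"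
      using X_increment_eq[OF w g(3) g(4), of i] unfolding d by linarith
    show ?thesis unfolding dY unfolding power2_eq_square by (simp add: field_simps)
  qed
  have tele: "(\<Sum>i<Suc k. (?X (Suc i))\<^sup>2 / 2 - (?X i)\<^sup>2 / 2) = (X T \<omega>)\<^sup>2 / 2"
    using sum_lessThan_telescope[of "\<lambda>i. (?X i)\<^sup>2 / 2" "Suc k"] by (simp only: g(1,2) X_zero[OF w]) simp
  have riem: "(\<Sum>i<Suc k. \<theta> * (?h * (?X i)\<^sup>2)) = \<theta> * riemann_sum (\<lambda>t. (X t \<omega>)\<^sup>2) 0 T (Suc k)"
    unfolding riemann_sum_def sum_distrib_left grid_def by (simp only: diff_zero add_0)
  have "path_sum T k \<omega> = (X T \<omega>)\<^sup>2 / 2 + (\<Sum>i<Suc k. - 1 / 2 * (?X (Suc i) - ?X i)\<^sup>2)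
    + (\<Sum>i<Suc k. \<theta> * (?X i * grid_defect T k i \<omega>)) + \<theta> * riemann_sum (\<lambda>t. (X t \<omega>)\<^sup>2) 0 T (Suc k)"
    unfolding path_sum_def summand sum.distrib tele riem ..
  then show ?thesis unfolding pathint_def by (simp only: right_diff_distrib)
qed

text \<open>The bound of \<open>X_holder\<close> at the mesh of the grid.\<close>

definition mesh_bound :: "real \<Rightarrow> nat \<Rightarrow> real" where
  "mesh_bound T k = 2 * exp T * (T / real (Suc k)) powr (2 * H) + 2 * KX\<^sup>2 * (T / real (Suc k))\<^sup>2"

lemma X_grid_increment:
  assumes T: "0 \<le> T" and i: "i < Suc k" and u: "u \<in> {grid T k i..grid T k (Suc i)}"
  shows "(rms M (\<lambda>\<omega>. X u \<omega> - X (grid T k i) \<omega>))\<^sup>2 \<le> mesh_bound T k"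
proof -
  note g = grid_props[OF T, of k]
  have le: "u \<le> T" using u grid_props(6)[OF T, of "Suc i" k] i by auto
  have h: "0 \<le> u - grid T k i" "u - grid T k i \<le> T / real (Suc k)" using u g(5)[of i] by auto
  have "(rms M (\<lambda>\<omega>. X u \<omega> - X (grid T k i) \<omega>))\<^sup>2
    \<le> 2 * exp T * (u - grid T k i) powr (2 * H) + 2 * KX\<^sup>2 * (u - grid T k i)\<^sup>2"
    using u by (intro X_holder g(3) le) auto
  also have "\<dots> \<le> mesh_bound T k"
    unfolding mesh_bound_def using h H_pos by (intro add_mono mult_left_mono powr_mono2 power_mono) auto
  finally show ?thesis .
qed

lemma grid_defect_sq_int:
  assumes T: "0 \<le> T" and i: "i < Suc k"
  shows "grid_defect T k i \<in> sq_int M" "rms M (grid_defect T k i) \<le> T / real (Suc k) * sqrt (mesh_bound T k)"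
proof -
  note g = grid_props[OF T, of k]
  have ms: "ms_process M (grid T k i) (grid T k (Suc i)) (\<lambda>u \<omega>. X u \<omega> - X (grid T k i) \<omega>)"
  proof (rule G_ms_process)
    fix u assume "u \<in> {grid T k i..grid T k (Suc i)}"
    then show "(\<lambda>\<omega>. X u \<omega> - X (grid T k i) \<omega>) \<in> G" using g(3)[of i] by (intro G_diff X_G) auto
  next
    fix \<omega> assume "\<omega> \<in> space M"
    then show "continuous_on {grid T k i..grid T k (Suc i)} (\<lambda>u. X u \<omega> - X (grid T k i) \<omega>)"
      using g(3)[of i] by (intro continuous_on_diff continuous_on_const X_cont) auto
  qed
  show "grid_defect T k i \<in> sq_int M"
    unfolding grid_defect_def[abs_def] by (rule ms_integral_sq_int[OF ms g(4)])
  show "rms M (grid_defect T k i) \<le> T / real (Suc k) * sqrt (mesh_bound T k)"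
    unfolding grid_defect_def[abs_def] g(5)[of i, symmetric]
    by (rule ms_process_integral_rms_le[OF ms g(4) real_le_rsqrt[OF X_grid_increment[OF T i]]])
qed

lemma path_sum_sq_int:
  assumes T: "0 \<le> T"
  shows "path_sum T k \<in> sq_int M"
  unfolding path_sum_def[abs_def]
  by (intro sq_int_sum G_mult_sq_int G_diff X_G Y_G grid_props(3)[OF T])

text \<open>Convergence in L^1 is aimed at, since smooth functionals are bounded. It calls for
  second moments of increments only: the L^1 norm of a squared increment is its variance, and the
  rectangle errors follow by Cauchy-Schwarz.\<close>

lemma path_sum_error:
  assumes T: "0 \<le> T"
  shows "(\<integral>\<omega>. \<bar>path_sum T k \<omega> - pathint T \<omega>\<bar> \<partial>M)
    \<le> real (Suc k) * mesh_bound T k / 2 + \<theta> * (sqrt CX * (T * sqrt (mesh_bound T k)))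
      + \<theta> * rms M (\<lambda>\<omega>. riemann_sum (\<lambda>t. (X t \<omega>)\<^sup>2) 0 T (Suc k) - energy T \<omega>)"
proof -
  let ?g = "grid T k"
  note g = grid_props[OF T, of k]
  define a where "a i \<omega> = (X (?g (Suc i)) \<omega> - X (?g i) \<omega>)\<^sup>2" for i \<omega>
  define b where "b i \<omega> = X (?g i) \<omega> * grid_defect T k i \<omega>" for i \<omega>
  define c where "c \<omega> = riemann_sum (\<lambda>t. (X t \<omega>)\<^sup>2) 0 T (Suc k) - energy T \<omega>" for \<omega>
  have XG: "X (?g i) \<in> G" for i by (intro X_G g(3))
  have a: "integrable M (a i)" for i
    unfolding a_def[abs_def] by (intro sq_int_square G_sq_int G_diff XG)
  have b: "integrable M (b i)" if "i < Suc k" for i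
    unfolding b_def[abs_def] by (intro integrable_sq_int_mult G_sq_int XG grid_defect_sq_int(1) T that)
  have csq: "c \<in> sq_int M"
    unfolding c_def[abs_def] by (intro sq_int_diff energy_sq_int T riemann_sum_sq_int[OF X_square_ms])
  have c: "integrable M c" by (rule sq_int_integrable[OF csq])
  have "(\<integral>\<omega>. \<bar>path_sum T k \<omega> - pathint T \<omega>\<bar> \<partial>M)
    \<le> (\<integral>\<omega>. (\<Sum>i<Suc k. 1 / 2 * a i \<omega>) + (\<Sum>i<Suc k. \<theta> * \<bar>b i \<omega>\<bar>) + \<theta> * \<bar>c \<omega>\<bar> \<partial>M)"
  proof (rule integral_mono)
    show "integrable M (\<lambda>\<omega>. \<bar>path_sum T k \<omega> - pathint T \<omega>\<bar>)"
      by (intro integrable_abs sq_int_integrable sq_int_diff path_sum_sq_int pathint_sq_int T)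
    show "integrable M (\<lambda>\<omega>. (\<Sum>i<Suc k. 1 / 2 * a i \<omega>) + (\<Sum>i<Suc k. \<theta> * \<bar>b i \<omega>\<bar>) + \<theta> * \<bar>c \<omega>\<bar>)"
      by (intro Bochner_Integration.integrable_add Bochner_Integration.integrable_sum integrable_mult_right integrable_abs a b c) simp
    fix \<omega> assume w: "\<omega> \<in> space M"
    have eq: "path_sum T k \<omega> - pathint T \<omega> = (\<Sum>i<Suc k. - 1 / 2 * a i \<omega>) + (\<Sum>i<Suc k. \<theta> * b i \<omega>) + \<theta> * c \<omega>"
      unfolding a_def b_def c_def by (rule path_sum_eq[OF w T])
    have "\<bar>\<Sum>i<Suc k. - 1 / 2 * a i \<omega>\<bar> \<le> (\<Sum>i<Suc k. \<bar>- 1 / 2 * a i \<omega>\<bar>)" by (rule sum_abs)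
    also have "\<dots> = (\<Sum>i<Suc k. 1 / 2 * a i \<omega>)" by (intro sum.cong refl) (simp add: a_def)
    finally have A: "\<bar>\<Sum>i<Suc k. - 1 / 2 * a i \<omega>\<bar> \<le> (\<Sum>i<Suc k. 1 / 2 * a i \<omega>)" .
    have "\<bar>\<Sum>i<Suc k. \<theta> * b i \<omega>\<bar> \<le> (\<Sum>i<Suc k. \<bar>\<theta> * b i \<omega>\<bar>)" by (rule sum_abs)
    also have "\<dots> = (\<Sum>i<Suc k. \<theta> * \<bar>b i \<omega>\<bar>)" using theta by (intro sum.cong refl) (simp add: abs_mult)
    finally have B: "\<bar>\<Sum>i<Suc k. \<theta> * b i \<omega>\<bar> \<le> (\<Sum>i<Suc k. \<theta> * \<bar>b i \<omega>\<bar>)" .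
    have C: "\<bar>\<theta> * c \<omega>\<bar> = \<theta> * \<bar>c \<omega>\<bar>" using theta by (simp add: abs_mult)
    show "\<bar>path_sum T k \<omega> - pathint T \<omega>\<bar> \<le> (\<Sum>i<Suc k. 1 / 2 * a i \<omega>) + (\<Sum>i<Suc k. \<theta> * \<bar>b i \<omega>\<bar>) + \<theta> * \<bar>c \<omega>\<bar>"
      unfolding eq using A B C by linarith
  qed
  also have "\<dots> = (\<Sum>i<Suc k. 1 / 2 * (\<integral>\<omega>. a i \<omega> \<partial>M)) + (\<Sum>i<Suc k. \<theta> * (\<integral>\<omega>. \<bar>b i \<omega>\<bar> \<partial>M)) + \<theta> * (\<integral>\<omega>. \<bar>c \<omega>\<bar> \<partial>M)"
  proof -
    have A: "(\<integral>\<omega>. (\<Sum>i<Suc k. 1 / 2 * a i \<omega>) \<partial>M) = (\<Sum>i<Suc k. 1 / 2 * (\<integral>\<omega>. a i \<omega> \<partial>M))"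
      by (subst Bochner_Integration.integral_sum) (simp_all add: a)
    have B: "(\<integral>\<omega>. (\<Sum>i<Suc k. \<theta> * \<bar>b i \<omega>\<bar>) \<partial>M) = (\<Sum>i<Suc k. \<theta> * (\<integral>\<omega>. \<bar>b i \<omega>\<bar> \<partial>M))"
      by (subst Bochner_Integration.integral_sum) (auto intro!: integrable_abs b)
    have "integrable M (\<lambda>\<omega>. \<Sum>i<Suc k. 1 / 2 * a i \<omega>)" "integrable M (\<lambda>\<omega>. \<Sum>i<Suc k. \<theta> * \<bar>b i \<omega>\<bar>)" "integrable M (\<lambda>\<omega>. \<theta> * \<bar>c \<omega>\<bar>)"
      by (intro Bochner_Integration.integrable_sum integrable_mult_right integrable_abs a b c; simp)+
    then show ?thesis unfolding A[symmetric] B[symmetric] by (simp only: Bochner_Integration.integral_add Bochner_Integration.integrable_add integral_mult_right_zero)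
  qed
  also have "\<dots> \<le> (\<Sum>i<Suc k. 1 / 2 * mesh_bound T k)
      + (\<Sum>i<Suc k. \<theta> * (sqrt CX * (T / real (Suc k) * sqrt (mesh_bound T k)))) + \<theta> * rms M c"
  proof (intro add_mono sum_mono mult_left_mono)
    fix i assume "i \<in> {..<Suc k}"
    then have i: "i < Suc k" by simp
    show "(\<integral>\<omega>. a i \<omega> \<partial>M) \<le> mesh_bound T k"
      unfolding a_def rms_square[symmetric] using g(4)[of i] by (intro X_grid_increment[OF T i]) simp
    have "(\<integral>\<omega>. \<bar>b i \<omega>\<bar> \<partial>M) \<le> rms M (X (?g i)) * rms M (grid_defect T k i)"
      unfolding b_def by (intro expectation_abs_mult_le G_sq_int XG grid_defect_sq_int(1)[OF T i])
    also have "\<dots> \<le> sqrt CX * (T / real (Suc k) * sqrt (mesh_bound T k))"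
      by (intro mult_mono X_rms_le g(3) grid_defect_sq_int(2)[OF T i] rms_nonneg real_sqrt_ge_zero CX_nonneg)
    finally show "(\<integral>\<omega>. \<bar>b i \<omega>\<bar> \<partial>M) \<le> sqrt CX * (T / real (Suc k) * sqrt (mesh_bound T k))" .
  qed (use theta expectation_abs_le_rms[OF csq] in auto)
  also have "\<dots> = real (Suc k) * mesh_bound T k / 2 + \<theta> * (sqrt CX * (T * sqrt (mesh_bound T k))) + \<theta> * rms M c"
  proof -
    have "real (Suc k) * (\<theta> * (sqrt CX * (T / real (Suc k) * sqrt (mesh_bound T k)))) = \<theta> * (sqrt CX * (T * sqrt (mesh_bound T k)))"
      by (simp del: of_nat_Suc)
    then show ?thesis by simp
  qed
  finally show ?thesis unfolding c_def .
qed

text \<open>The discrete quadratic variation has k + 1 terms of order h^(2H) with h = T/(k + 1), so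
  its expectation is of order h^(2H - 1) and tends to 0 because H > 1/2.\<close>

lemma path_sum_L1:
  assumes T: "0 < T"
  shows "(\<lambda>k. \<integral>\<omega>. \<bar>path_sum T k \<omega> - pathint T \<omega>\<bar> \<partial>M) \<longlonglongrightarrow> 0"
proof -
  define h where "h k = T / real (Suc k)" for k
  have h: "h \<longlonglongrightarrow> 0" and hpos: "0 < h k" for k
    using tendsto_mult[OF tendsto_const LIMSEQ_inverse_real_of_nat, of T] T
    by (simp_all add: h_def[abs_def] divide_inverse)
  have pw: "(\<lambda>k. h k powr p) \<longlonglongrightarrow> 0" if "0 < p" for p
    by (rule tendsto_zero_powrI[OF h tendsto_const]) (use hpos that in \<open>auto intro!: always_eventually less_imp_le\<close>)
  have sq: "(\<lambda>k. (h k)\<^sup>2) \<longlonglongrightarrow> 0" using tendsto_power[OF h, of 2] by simp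
  have mb: "mesh_bound T k = 2 * exp T * h k powr (2 * H) + 2 * KX\<^sup>2 * (h k)\<^sup>2" for k
    by (simp only: mesh_bound_def h_def)
  have "(\<lambda>k. 2 * exp T * h k powr (2 * H) + 2 * KX\<^sup>2 * (h k)\<^sup>2) \<longlonglongrightarrow> 2 * exp T * 0 + 2 * KX\<^sup>2 * 0"
    using H_pos by (intro tendsto_add tendsto_mult tendsto_const pw sq) simp
  then have m0: "mesh_bound T \<longlonglongrightarrow> 0" unfolding mb[abs_def] by simp
  have "(\<lambda>k. T * (2 * exp T * h k powr (2 * H - 1) + 2 * KX\<^sup>2 * h k)) \<longlonglongrightarrow> T * (2 * exp T * 0 + 2 * KX\<^sup>2 * 0)"
    using H_half by (intro tendsto_add tendsto_mult tendsto_const pw h) simp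
  moreover have "real (Suc k) * mesh_bound T k = T * (2 * exp T * h k powr (2 * H - 1) + 2 * KX\<^sup>2 * h k)" for k
  proof -
    have T': "real (Suc k) * h k = T" by (simp add: h_def del: of_nat_Suc)
    have "h k powr (2 * H) = h k * h k powr (2 * H - 1)"
      using hpos[of k] by (simp add: powr_diff)
    then have "mesh_bound T k = h k * (2 * exp T * h k powr (2 * H - 1) + 2 * KX\<^sup>2 * h k)"
      unfolding mb by (simp add: algebra_simps power2_eq_square)
    then have "real (Suc k) * mesh_bound T k = (real (Suc k) * h k) * (2 * exp T * h k powr (2 * H - 1) + 2 * KX\<^sup>2 * h k)"
      by (simp only: mult.assoc)
    then show ?thesis by (simp only: T')
  qed
  ultimately have m1: "(\<lambda>k. real (Suc k) * mesh_bound T k) \<longlonglongrightarrow> 0" by simp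
  have riem: "(\<lambda>k. rms M (\<lambda>\<omega>. riemann_sum (\<lambda>t. (X t \<omega>)\<^sup>2) 0 T (Suc k) - energy T \<omega>)) \<longlonglongrightarrow> 0"
    unfolding energy_def using ms_integral_tendsto[OF X_square_ms less_imp_le[OF T]] by (rule LIMSEQ_Suc)
  have "(\<lambda>k. real (Suc k) * mesh_bound T k / 2 + \<theta> * (sqrt CX * (T * sqrt (mesh_bound T k)))
      + \<theta> * rms M (\<lambda>\<omega>. riemann_sum (\<lambda>t. (X t \<omega>)\<^sup>2) 0 T (Suc k) - energy T \<omega>))
    \<longlonglongrightarrow> 0 / 2 + \<theta> * (sqrt CX * (T * sqrt 0)) + \<theta> * 0"
    by (intro tendsto_add tendsto_mult tendsto_divide tendsto_const tendsto_real_sqrt m0 m1 riem) simp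
  then have bound: "(\<lambda>k. real (Suc k) * mesh_bound T k / 2 + \<theta> * (sqrt CX * (T * sqrt (mesh_bound T k)))
      + \<theta> * rms M (\<lambda>\<omega>. riemann_sum (\<lambda>t. (X t \<omega>)\<^sup>2) 0 T (Suc k) - energy T \<omega>)) \<longlonglongrightarrow> 0"
    by simp
  show ?thesis
    by (rule tendsto_sandwich[OF _ _ tendsto_const bound])
      (use path_sum_error[of T] T in \<open>auto intro!: always_eventually integral_nonneg_AE\<close>)
qed

section \<open>The path of X as a random element of the Hilbert space\<close>

lemma pathU_hilb: "0 \<le> T \<Longrightarrow> \<omega> \<in> space M \<Longrightarrow> pathU T \<omega> \<in> hilb M Y T"
  using pathU_represents by (simp add: represents_def)

lemma increment_sq_int: "0 \<le> T \<Longrightarrow> (\<lambda>\<omega>. Y (grid T k (Suc i)) \<omega> - Y (grid T k i) \<omega>) \<in> sq_int M"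
  by (intro sq_int_diff Y_sq_int grid_props(3))

text \<open>The path is frozen at \<omega> while the expectation runs over \<omega>'. The result is
  a combination of values of X with deterministic coefficients, which makes it measurable and
  Gaussian as a function of \<omega>.\<close>

lemma expectation_mult_pathU:
  assumes "0 \<le> T" "W \<in> sq_int M"
  shows "(\<integral>\<omega>'. W \<omega>' * step_rv Y (pathU T \<omega> k) \<omega>' \<partial>M)
    = (\<Sum>i<Suc k. (\<integral>\<omega>'. W \<omega>' * (Y (grid T k (Suc i)) \<omega>' - Y (grid T k i) \<omega>') \<partial>M) * X (grid T k i) \<omega>)"
proof -
  have "(\<integral>\<omega>'. step_rv Y (pathU T \<omega> k) \<omega>' * W \<omega>' \<partial>M)
    = (\<Sum>i<Suc k. X (grid T k i) \<omega> * (\<integral>\<omega>'. (Y (grid T k (Suc i)) \<omega>' - Y (grid T k i) \<omega>') * W \<omega>' \<partial>M))"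
    unfolding pathU_def step_rv_grid_step by (intro expectation_sum_mult increment_sq_int assms)
  then show ?thesis by (simp only: mult.commute[of _ "W _"] mult.commute[of "X _ \<omega>"])
qed

lemma pathU_inner_measurable:
  assumes T: "0 \<le> T" and \<psi>: "\<psi> \<in> steps T"
  shows "(\<lambda>\<omega>. hilb_inner M Y (\<lambda>_. \<psi>) (pathU T \<omega>)) \<in> borel_measurable (generated_sigma M Y T)"
proof (rule borel_measurable_LIMSEQ_real)
  have W: "step_rv Y \<psi> \<in> sq_int M" by (rule G_sq_int[OF step_rv_G[OF \<psi>]])
  show "(\<lambda>k. \<integral>\<omega>'. step_rv Y \<psi> \<omega>' * step_rv Y (pathU T \<omega> k) \<omega>' \<partial>M) \<longlonglongrightarrow> hilb_inner M Y (\<lambda>_. \<psi>) (pathU T \<omega>)"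
    if "\<omega> \<in> space (generated_sigma M Y T)" for \<omega>
  proof -
    have h: "pathU T \<omega> \<in> hilb M Y T" using that by (intro pathU_hilb T) (simp only: space_generated_sigma)
    show ?thesis
      unfolding hilb_inner_def step_inner_rv[OF \<psi> hilb_steps[OF h]]
      by (rule convergent_LIMSEQ_iff[THEN iffD1, OF hilb_convergent[OF h W]])
  qed
  show "(\<lambda>\<omega>. \<integral>\<omega>'. step_rv Y \<psi> \<omega>' * step_rv Y (pathU T \<omega> k) \<omega>' \<partial>M) \<in> borel_measurable (generated_sigma M Y T)" for k
    unfolding expectation_mult_pathU[OF T W]
    by (intro borel_measurable_sum borel_measurable_times borel_measurable_const X_gen grid_props(6)[OF T]) simp
qed

lemma hilb_norm_tendsto:
  assumes U: "U \<in> hilb M Y T"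
  shows "(\<lambda>k. (rms M (step_rv Y (U k)))\<^sup>2) \<longlonglongrightarrow> hilb_inner M Y U U"
proof -
  have sq: "step_rv Y (U k) \<in> sq_int M" for k by (rule G_sq_int[OF step_rv_G[OF hilb_steps[OF U]]])
  have "Cauchy (\<lambda>k. rms M (step_rv Y (U k)))"
  proof (rule metric_CauchyI)
    fix e :: real assume "e > 0"
    from hilb_Cauchy[OF U this] obtain N where
      N: "\<forall>m\<ge>N. \<forall>k\<ge>N. rms M (\<lambda>\<omega>. step_rv Y (U m) \<omega> - step_rv Y (U k) \<omega>) < e" by (elim exE)
    have le: "rms M (step_rv Y (U m)) \<le> rms M (\<lambda>\<omega>. step_rv Y (U m) \<omega> - step_rv Y (U k) \<omega>) + rms M (step_rv Y (U k))" for m k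
      using rms_add_le[OF sq_int_diff[OF sq[of m] sq[of k]] sq[of k]] by simp
    have "dist (rms M (step_rv Y (U m))) (rms M (step_rv Y (U k))) < e" if "m \<ge> N" "k \<ge> N" for m k
    proof -
      have "rms M (\<lambda>\<omega>. step_rv Y (U m) \<omega> - step_rv Y (U k) \<omega>) < e" "rms M (\<lambda>\<omega>. step_rv Y (U k) \<omega> - step_rv Y (U m) \<omega>) < e"
        using N that by simp_all
      then show ?thesis using le[of m k] le[of k m] unfolding dist_real_def by linarith
    qed
    then show "\<exists>N. \<forall>m\<ge>N. \<forall>n\<ge>N. dist (rms M (step_rv Y (U m))) (rms M (step_rv Y (U n))) < e"
      by (intro exI[of _ N] allI impI)
  qed
  then have "convergent (\<lambda>k. (rms M (step_rv Y (U k)))\<^sup>2)"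
    using real_Cauchy_convergent by (auto simp: convergent_def dest: tendsto_power)
  then show ?thesis
    unfolding hilb_inner_def step_inner_self[OF hilb_steps[OF U]] by (simp only: convergent_LIMSEQ_iff)
qed

text \<open>The squared seminorm is expanded over pairs of cells. The covariances of the increments
  of Y are non-negative, so each second moment of X may be replaced by its bound \<open>CX\<close>,
  after which the increments sum to \<open>Y T\<close>. The bound is the same for every k.\<close>

lemma expectation_pathU_norm_le:
  assumes T: "0 \<le> T"
  shows "integrable M (\<lambda>\<omega>. (rms M (step_rv Y (pathU T \<omega> k)))\<^sup>2)"
    "(\<integral>\<omega>. (rms M (step_rv Y (pathU T \<omega> k)))\<^sup>2 \<partial>M) \<le> CX * (rms M (Y T))\<^sup>2"
proof -
  let ?g = "grid T k"
  define D where "D i \<omega> = Y (?g (Suc i)) \<omega> - Y (?g i) \<omega>" for i \<omega>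
  define c where "c i j = (\<integral>\<omega>. D i \<omega> * D j \<omega> \<partial>M)" for i j
  note g = grid_props[OF T, of k]
  have D: "D i \<in> sq_int M" for i unfolding D_def[abs_def] by (rule increment_sq_int[OF T])
  have c0: "0 \<le> c i j" for i j unfolding c_def D_def by (intro Y_increments_nonneg g)
  have Xs: "X (?g i) \<in> sq_int M" for i by (intro G_sq_int X_G g(3))
  have eq: "(rms M (step_rv Y (pathU T \<omega> k)))\<^sup>2 = (\<Sum>i<Suc k. \<Sum>j<Suc k. X (?g i) \<omega> * X (?g j) \<omega> * c i j)" for \<omega>
  proof -
    have "(rms M (step_rv Y (pathU T \<omega> k)))\<^sup>2
      = (\<integral>\<omega>'. (\<Sum>i<Suc k. X (?g i) \<omega> * D i \<omega>') * (\<Sum>i<Suc k. X (?g i) \<omega> * D i \<omega>') \<partial>M)"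
      unfolding rms_square unfolding power2_eq_square pathU_def step_rv_grid_step D_def ..
    also have "\<dots> = (\<Sum>i<Suc k. \<Sum>j<Suc k. X (?g i) \<omega> * X (?g j) \<omega> * c i j)"
      unfolding c_def by (intro expectation_sum_mult_sum D)
    finally show ?thesis .
  qed
  have int: "integrable M (\<lambda>\<omega>. X (?g i) \<omega> * X (?g j) \<omega> * c i j)" for i j
    by (intro integrable_mult_left integrable_sq_int_mult Xs)
  show "integrable M (\<lambda>\<omega>. (rms M (step_rv Y (pathU T \<omega> k)))\<^sup>2)"
    unfolding eq by (intro Bochner_Integration.integrable_sum int)
  have "(\<integral>\<omega>. (rms M (step_rv Y (pathU T \<omega> k)))\<^sup>2 \<partial>M) = (\<Sum>i<Suc k. \<Sum>j<Suc k. (\<integral>\<omega>. X (?g i) \<omega> * X (?g j) \<omega> \<partial>M) * c i j)"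
    unfolding eq
    by (subst Bochner_Integration.integral_sum, intro Bochner_Integration.integrable_sum int,
        subst Bochner_Integration.integral_sum, rule int, subst integral_mult_left_zero, rule refl)
  also have "\<dots> \<le> (\<Sum>i<Suc k. \<Sum>j<Suc k. CX * c i j)"
  proof (intro sum_mono mult_right_mono c0)
    fix i j
    have "(\<integral>\<omega>. X (?g i) \<omega> * X (?g j) \<omega> \<partial>M) \<le> rms M (X (?g i)) * rms M (X (?g j))"
      by (rule order_trans[OF abs_ge_self cauchy_schwarz_integral[OF Xs Xs]])
    also have "\<dots> \<le> sqrt CX * sqrt CX"
      by (intro mult_mono X_rms_le g(3) rms_nonneg real_sqrt_ge_zero CX_nonneg)
    also have "\<dots> = CX" using CX_nonneg by simp
    finally show "(\<integral>\<omega>. X (?g i) \<omega> * X (?g j) \<omega> \<partial>M) \<le> CX" .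
  qed
  also have "\<dots> = CX * (\<Sum>i<Suc k. \<Sum>j<Suc k. 1 * 1 * c i j)" by (simp only: sum_distrib_left mult_1)
  also have "(\<Sum>i<Suc k. \<Sum>j<Suc k. 1 * 1 * c i j) = (\<integral>\<omega>. (\<Sum>i<Suc k. 1 * D i \<omega>) * (\<Sum>j<Suc k. 1 * D j \<omega>) \<partial>M)"
    unfolding c_def by (intro expectation_sum_mult_sum[symmetric] D)
  also have "\<dots> = (\<integral>\<omega>. (Y T \<omega>)\<^sup>2 \<partial>M)"
  proof (rule Bochner_Integration.integral_cong[OF refl])
    fix \<omega> assume w: "\<omega> \<in> space M"
    have "(\<Sum>i<Suc k. 1 * D i \<omega>) = Y T \<omega>"
      using sum_lessThan_telescope[of "\<lambda>i. Y (?g i) \<omega>" "Suc k"] by (simp only: D_def mult_1 g(1,2) Y_zero[OF w] diff_zero)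
    then show "(\<Sum>i<Suc k. 1 * D i \<omega>) * (\<Sum>j<Suc k. 1 * D j \<omega>) = (Y T \<omega>)\<^sup>2" by (simp only: power2_eq_square)
  qed
  finally show "(\<integral>\<omega>. (rms M (step_rv Y (pathU T \<omega> k)))\<^sup>2 \<partial>M) \<le> CX * (rms M (Y T))\<^sup>2" by (simp only: rms_square)
qed

text \<open>Fatou's lemma with the bound of \<open>expectation_pathU_norm_le\<close>, which is
  uniform in k.\<close>

lemma pathU_norm_integrable:
  assumes T: "0 \<le> T"
  shows "integrable M (\<lambda>\<omega>. hilb_inner M Y (pathU T \<omega>) (pathU T \<omega>))"
proof (rule integrableI_nonneg)
  let ?f = "\<lambda>k \<omega>. (rms M (step_rv Y (pathU T \<omega> k)))\<^sup>2" and ?h = "\<lambda>\<omega>. hilb_inner M Y (pathU T \<omega>) (pathU T \<omega>)"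
  note E = expectation_pathU_norm_le[OF T]
  have lim: "(\<lambda>k. ?f k \<omega>) \<longlonglongrightarrow> ?h \<omega>" if "\<omega> \<in> space M" for \<omega>
    by (rule hilb_norm_tendsto[OF pathU_hilb[OF T that]])
  show "?h \<in> borel_measurable M"
    by (rule borel_measurable_LIMSEQ_real[OF lim borel_measurable_integrable[OF E(1)]])
  show "AE \<omega> in M. 0 \<le> ?h \<omega>"
    by (intro AE_I2 LIMSEQ_le_const[OF lim]) auto
  have "(\<integral>\<^sup>+\<omega>. ennreal (?h \<omega>) \<partial>M) = (\<integral>\<^sup>+\<omega>. liminf (\<lambda>k. ennreal (?f k \<omega>)) \<partial>M)"
  proof (rule nn_integral_cong)
    fix \<omega> assume "\<omega> \<in> space M"
    then have "(\<lambda>k. ennreal (?f k \<omega>)) \<longlonglongrightarrow> ennreal (?h \<omega>)" by (intro tendsto_ennrealI lim)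
    then show "ennreal (?h \<omega>) = liminf (\<lambda>k. ennreal (?f k \<omega>))"
      by (rule lim_imp_Liminf[OF sequentially_bot, symmetric])
  qed
  also have "\<dots> \<le> liminf (\<lambda>k. \<integral>\<^sup>+\<omega>. ennreal (?f k \<omega>) \<partial>M)"
    by (intro nn_integral_liminf measurable_compose[OF borel_measurable_integrable[OF E(1)] measurable_ennreal])
  also have "\<dots> \<le> liminf (\<lambda>k. ennreal (CX * (rms M (Y T))\<^sup>2))"
    by (intro Liminf_mono always_eventually allI) (auto simp: nn_integral_eq_integral[OF E(1)] intro!: ennreal_leI E(2))
  also have "\<dots> < \<infinity>" by (simp add: Liminf_const)
  finally show "(\<integral>\<^sup>+\<omega>. ennreal (?h \<omega>) \<partial>M) < \<infinity>" .
qed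

lemma pathU_L2_hilb: "0 \<le> T \<Longrightarrow> pathU T \<in> L2_hilb M Y T"
  unfolding L2_hilb_def using pathU_hilb pathU_inner_measurable pathU_norm_integrable by simp

lemma wiener_integral_G:
  assumes \<Phi>: "\<Phi> \<in> hilb M Y T" and W: "has_wiener_integral M Y \<Phi> W"
  shows "W \<in> G" "(\<lambda>k. rms M (\<lambda>\<omega>. step_rv Y (\<Phi> k) \<omega> - W \<omega>)) \<longlonglongrightarrow> 0"
proof -
  have sq: "W \<in> sq_int M" using W by (simp add: has_wiener_integral_def sq_int_def)
  show lim: "(\<lambda>k. rms M (\<lambda>\<omega>. step_rv Y (\<Phi> k) \<omega> - W \<omega>)) \<longlonglongrightarrow> 0"
    unfolding rms_tendsto_zero_iff step_rv_def using W by (simp add: has_wiener_integral_def)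
  show "W \<in> G" by (rule G_closed[OF step_rv_G[OF hilb_steps[OF \<Phi>]] sq lim])
qed

text \<open>On the grid the integrand is a finite sum of values of X times cells, and
  \<open>G_integration_by_parts\<close> gives the duality exactly, with the centered sum in place of
  the integral. Then both sides pass to the limit: the inner products in mean square, as they are
  Gaussian and converge at every \<omega>, and the sums in L^1 against the bounded
  functional.\<close>

lemma pathU_dual:
  assumes T: "0 < T" and f: "smooth_bounded n f"
    and \<Phi>: "\<And>i. i < n \<Longrightarrow> \<Phi> i \<in> hilb M Y T" and wi: "\<And>i. i < n \<Longrightarrow> has_wiener_integral M Y (\<Phi> i) (W i)"
  shows "(\<integral>\<omega>. smooth_functional f W \<omega> * skor T \<omega> \<partial>M)
    = (\<integral>\<omega>. hilb_inner M Y (malliavin_deriv n f \<Phi> W \<omega>) (pathU T \<omega>) \<partial>M)"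
proof -
  have T0: "0 \<le> T" using T by simp
  note g = grid_props[OF T0]
  have WG: "W i \<in> G" and Wlim: "(\<lambda>k. rms M (\<lambda>\<omega>. step_rv Y (\<Phi> i k) \<omega> - W i \<omega>)) \<longlonglongrightarrow> 0" if "i < n" for i
    using wiener_integral_G[OF \<Phi>[OF that] wi[OF that]] by simp_all
  have Wsq: "W i \<in> sq_int M" if "i < n" for i by (rule G_sq_int[OF WG[OF that]])
  define F where "F \<omega> = f (\<lambda>i. W i \<omega>)" for \<omega>
  define p where "p i \<omega> = partial_deriv i f (\<lambda>j. W j \<omega>)" for i \<omega>
  define D where "D k j \<omega> = Y (grid T k (Suc j)) \<omega> - Y (grid T k j) \<omega>" for k j \<omega>
  \<comment> \<open>The inner product of \<open>\<Phi> i\<close> with the grid path at \<omega>,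
    which as a function of \<omega> lies in the Gaussian space.\<close>
  define K where "K i k \<omega> = (\<integral>\<omega>'. W i \<omega>' * step_rv Y (pathU T \<omega> k) \<omega>' \<partial>M)" for i k \<omega>
  define L where "L i \<omega> = lim (\<lambda>k. K i k \<omega>)" for i \<omega>
  have DG: "D k j \<in> G" for k j unfolding D_def[abs_def] by (intro G_diff Y_G g(3))
  have Keq: "K i k \<omega> = (\<Sum>j<Suc k. (\<integral>\<omega>. W i \<omega> * D k j \<omega> \<partial>M) * X (grid T k j) \<omega>)" if "i < n" for i k \<omega>
    unfolding K_def D_def by (rule expectation_mult_pathU[OF T0 Wsq[OF that]])
  have KG: "K i k \<in> G" if "i < n" for i k
    unfolding Keq[OF that, abs_def] by (intro G_sum G_cmult X_G g(3))
  have Klim: "(\<lambda>k. K i k \<omega>) \<longlonglongrightarrow> L i \<omega>" if "i < n" "\<omega> \<in> space M" for i \<omega>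
    unfolding L_def K_def
    by (rule convergent_LIMSEQ_iff[THEN iffD1, OF hilb_convergent[OF pathU_hilb[OF T0 that(2)] Wsq[OF that(1)]]])
  have LG: "L i \<in> G" and Lrms: "(\<lambda>k. rms M (\<lambda>\<omega>. K i k \<omega> - L i \<omega>)) \<longlonglongrightarrow> 0" if "i < n" for i
    using G_pointwise_limit[OF KG[OF that] Klim[OF that]] by simp_all
  have psq: "p i \<in> sq_int M" if "i < n" for i
  proof -
    note sp = smooth_bounded_partial[OF f that]
    obtain C where C: "\<And>x. \<bar>partial_deriv i f x\<bar> \<le> C" by (rule smooth_bounded_bound[OF sp]) (rule that)
    have m: "p i \<in> borel_measurable M"
      unfolding p_def[abs_def] by (rule smooth_bounded_measurable[OF sp sq_int_measurable[OF Wsq]])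
    show ?thesis by (rule sq_int_bounded[OF m, where C=C]) (simp only: p_def C)
  qed
  have Fm: "F \<in> borel_measurable M"
    unfolding F_def[abs_def] by (rule smooth_bounded_measurable[OF f sq_int_measurable[OF Wsq]])
  obtain C where C: "\<And>x. \<bar>f x\<bar> \<le> C" by (rule smooth_bounded_bound[OF f]) (rule that)
  then have FC: "\<bar>F \<omega>\<bar> \<le> C" for \<omega> by (simp add: F_def)
  have "(\<lambda>k. \<Sum>i<n. \<integral>\<omega>. p i \<omega> * K i k \<omega> \<partial>M) \<longlonglongrightarrow> (\<Sum>i<n. \<integral>\<omega>. p i \<omega> * L i \<omega> \<partial>M)"
    by (intro tendsto_sum integral_mult_tendsto psq G_sq_int KG LG Lrms) simp_all
  moreover have "(\<Sum>i<n. \<integral>\<omega>. p i \<omega> * L i \<omega> \<partial>M)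
      = (\<integral>\<omega>. hilb_inner M Y (malliavin_deriv n f \<Phi> W \<omega>) (pathU T \<omega>) \<partial>M)"
  proof -
    have "(\<Sum>i<n. \<integral>\<omega>. p i \<omega> * L i \<omega> \<partial>M) = (\<integral>\<omega>. (\<Sum>i<n. p i \<omega> * L i \<omega>) \<partial>M)"
      by (rule Bochner_Integration.integral_sum[symmetric]) (rule integrable_sq_int_mult[OF psq G_sq_int[OF LG]]; simp)
    also have "\<dots> = (\<integral>\<omega>. hilb_inner M Y (malliavin_deriv n f \<Phi> W \<omega>) (pathU T \<omega>) \<partial>M)"
    proof (rule Bochner_Integration.integral_cong[OF refl])
      fix \<omega> assume w: "\<omega> \<in> space M"
      show "(\<Sum>i<n. p i \<omega> * L i \<omega>) = hilb_inner M Y (malliavin_deriv n f \<Phi> W \<omega>) (pathU T \<omega>)"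
        unfolding p_def L_def K_def by (rule hilb_inner_malliavin[OF \<Phi> pathU_hilb[OF T0 w] Wsq Wlim, symmetric])
    qed
    finally show ?thesis .
  qed
  \<comment> \<open>The double sum is reordered so that each cell j shows the derivative of f in the
    direction of the increment \<open>D k j\<close>; there integration by parts applies with the
    factors \<open>?X j\<close> and \<open>D k j\<close>.\<close>
  moreover have "(\<Sum>i<n. \<integral>\<omega>. p i \<omega> * K i k \<omega> \<partial>M) = (\<integral>\<omega>. path_sum T k \<omega> * F \<omega> \<partial>M) - (\<integral>\<omega>. path_sum T k \<omega> \<partial>M) * (\<integral>\<omega>. F \<omega> \<partial>M)" for k
  proof -
    let ?X = "\<lambda>j. X (grid T k j)"
    have XG: "?X j \<in> G" for j by (intro X_G g(3))
    let ?e = "\<lambda>i j. \<integral>\<omega>. W i \<omega> * D k j \<omega> \<partial>M"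
    have int: "integrable M (\<lambda>\<omega>. ?X j \<omega> * (?e i j * p i \<omega>))" if "i < n" for i j
      by (rule integrable_sq_int_mult[OF G_sq_int[OF XG] sq_int_cmult[OF psq[OF that]]])
    have XD: "integrable M (\<lambda>\<omega>. ?X j \<omega> * D k j \<omega>)" for j by (intro integrable_sq_int_mult G_sq_int XG DG)
    have Fi: "integrable M F" by (rule sq_int_integrable[OF sq_int_bounded[OF Fm FC]])
    have "(\<Sum>i<n. \<integral>\<omega>. p i \<omega> * K i k \<omega> \<partial>M) = (\<Sum>i<n. \<integral>\<omega>. (\<Sum>j<Suc k. ?X j \<omega> * (?e i j * p i \<omega>)) \<partial>M)"
    proof (intro sum.cong refl Bochner_Integration.integral_cong)
      fix i \<omega> assume "i \<in> {..<n}"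
      then have i: "i < n" by simp
      show "p i \<omega> * K i k \<omega> = (\<Sum>j<Suc k. ?X j \<omega> * (?e i j * p i \<omega>))"
        unfolding Keq[OF i] sum_distrib_left by (intro sum.cong refl) (simp only: mult_ac)
    qed
    also have "\<dots> = (\<Sum>i<n. \<Sum>j<Suc k. \<integral>\<omega>. ?X j \<omega> * (?e i j * p i \<omega>) \<partial>M)"
      by (intro sum.cong refl Bochner_Integration.integral_sum int) simp
    also have "\<dots> = (\<Sum>j<Suc k. \<Sum>i<n. \<integral>\<omega>. ?X j \<omega> * (?e i j * p i \<omega>) \<partial>M)" by (rule sum.swap)
    also have "\<dots> = (\<Sum>j<Suc k. \<integral>\<omega>. (\<Sum>i<n. ?X j \<omega> * (?e i j * p i \<omega>)) \<partial>M)"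
      by (intro sum.cong refl Bochner_Integration.integral_sum[symmetric] int) simp
    also have "\<dots> = (\<Sum>j<Suc k. \<integral>\<omega>. (?X j \<omega> * D k j \<omega> - (\<integral>\<omega>. ?X j \<omega> * D k j \<omega> \<partial>M)) * F \<omega> \<partial>M)"
      unfolding sum_distrib_left[symmetric] p_def F_def
      by (intro sum.cong refl G_integration_by_parts[OF f WG XG DG, symmetric])
    also have "\<dots> = (\<Sum>j<Suc k. (\<integral>\<omega>. ?X j \<omega> * D k j \<omega> * F \<omega> \<partial>M) - (\<integral>\<omega>. ?X j \<omega> * D k j \<omega> \<partial>M) * (\<integral>\<omega>. F \<omega> \<partial>M))"
    proof (intro sum.cong refl)
      fix j
      have "integrable M (\<lambda>\<omega>. ?X j \<omega> * D k j \<omega> * F \<omega>)" by (rule integrable_mult_bounded[OF XD Fm FC])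
      then show "(\<integral>\<omega>. (?X j \<omega> * D k j \<omega> - (\<integral>\<omega>. ?X j \<omega> * D k j \<omega> \<partial>M)) * F \<omega> \<partial>M)
        = (\<integral>\<omega>. ?X j \<omega> * D k j \<omega> * F \<omega> \<partial>M) - (\<integral>\<omega>. ?X j \<omega> * D k j \<omega> \<partial>M) * (\<integral>\<omega>. F \<omega> \<partial>M)"
        using Fi unfolding left_diff_distrib by simp
    qed
    also have "\<dots> = (\<Sum>j<Suc k. \<integral>\<omega>. ?X j \<omega> * D k j \<omega> * F \<omega> \<partial>M) - (\<Sum>j<Suc k. \<integral>\<omega>. ?X j \<omega> * D k j \<omega> \<partial>M) * (\<integral>\<omega>. F \<omega> \<partial>M)"
      unfolding sum_subtractf sum_distrib_right ..
    also have "(\<Sum>j<Suc k. \<integral>\<omega>. ?X j \<omega> * D k j \<omega> * F \<omega> \<partial>M) = (\<integral>\<omega>. (\<Sum>j<Suc k. ?X j \<omega> * D k j \<omega> * F \<omega>) \<partial>M)"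
      by (rule Bochner_Integration.integral_sum[symmetric]) (rule integrable_mult_bounded[OF XD Fm FC])
    also have "(\<Sum>j<Suc k. \<integral>\<omega>. ?X j \<omega> * D k j \<omega> \<partial>M) = (\<integral>\<omega>. (\<Sum>j<Suc k. ?X j \<omega> * D k j \<omega>) \<partial>M)"
      by (rule Bochner_Integration.integral_sum[symmetric]) (rule XD)
    finally show ?thesis unfolding path_sum_def D_def[symmetric] sum_distrib_right .
  qed
  moreover have "(\<lambda>k. (\<integral>\<omega>. path_sum T k \<omega> * F \<omega> \<partial>M) - (\<integral>\<omega>. path_sum T k \<omega> \<partial>M) * (\<integral>\<omega>. F \<omega> \<partial>M))
    \<longlonglongrightarrow> (\<integral>\<omega>. pathint T \<omega> * F \<omega> \<partial>M) - (\<integral>\<omega>. pathint T \<omega> \<partial>M) * (\<integral>\<omega>. F \<omega> \<partial>M)"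
  proof (intro tendsto_diff tendsto_mult tendsto_const)
    note pi = sq_int_integrable[OF path_sum_sq_int[OF T0]] sq_int_integrable[OF pathint_sq_int[OF T0]]
    show "(\<lambda>k. \<integral>\<omega>. path_sum T k \<omega> * F \<omega> \<partial>M) \<longlonglongrightarrow> (\<integral>\<omega>. pathint T \<omega> * F \<omega> \<partial>M)"
      by (rule integral_bounded_mult_tendsto[OF pi Fm FC path_sum_L1[OF T]])
    show "(\<lambda>k. \<integral>\<omega>. path_sum T k \<omega> \<partial>M) \<longlonglongrightarrow> (\<integral>\<omega>. pathint T \<omega> \<partial>M)"
      using integral_bounded_mult_tendsto[OF pi _ _ path_sum_L1[OF T], of "\<lambda>_. 1" 1] by simp
  qed
  ultimately have "(\<integral>\<omega>. hilb_inner M Y (malliavin_deriv n f \<Phi> W \<omega>) (pathU T \<omega>) \<partial>M)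
    = (\<integral>\<omega>. pathint T \<omega> * F \<omega> \<partial>M) - (\<integral>\<omega>. pathint T \<omega> \<partial>M) * (\<integral>\<omega>. F \<omega> \<partial>M)"
    by (simp only: LIMSEQ_unique)
  moreover have "(\<integral>\<omega>. smooth_functional f W \<omega> * skor T \<omega> \<partial>M)
    = (\<integral>\<omega>. pathint T \<omega> * F \<omega> \<partial>M) - (\<integral>\<omega>. pathint T \<omega> \<partial>M) * (\<integral>\<omega>. F \<omega> \<partial>M)"
  proof -
    have "integrable M (\<lambda>\<omega>. pathint T \<omega> * F \<omega>)"
      by (rule integrable_mult_bounded[OF sq_int_integrable[OF pathint_sq_int[OF T0]] Fm FC])
    moreover have "integrable M F" by (rule sq_int_integrable[OF sq_int_bounded[OF Fm FC]])
    moreover have "smooth_functional f W \<omega> * skor T \<omega> = pathint T \<omega> * F \<omega> - (\<integral>\<omega>. pathint T \<omega> \<partial>M) * F \<omega>" for \<omega>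
      by (simp add: smooth_functional_def skor_def F_def algebra_simps)
    ultimately show ?thesis by simp
  qed
  ultimately show ?thesis by simp
qed

lemma skor_has_divergence:
  assumes "0 < T"
  shows "has_divergence M Y T (pathU T) (skor T)"
  unfolding has_divergence_def
proof (intro conjI allI impI)
  have T: "0 \<le> T" using assms by simp
  show "pathU T \<in> L2_hilb M Y T" "skor T \<in> borel_measurable (generated_sigma M Y T)"
    "integrable M (\<lambda>\<omega>. (skor T \<omega>)\<^sup>2)"
    by (rule pathU_L2_hilb[OF T], rule skor_gen[OF T], rule sq_int_square[OF skor_sq_int[OF T]])
qed (rule pathU_dual[OF assms]; blast)

lemma skor_has_skorokhod_integral:
  assumes "0 < T"
  shows "has_skorokhod_integral M Y T X (skor T)"
  unfolding has_skorokhod_integral_def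
  using assms by (intro exI[of _ "pathU T"] conjI AE_I2 pathU_represents skor_has_divergence) auto

text \<open>The chosen variable has the defining property because \<open>skor T\<close> witnesses
  that some variable has it; \<open>divergence_le\<close> in both directions identifies the
  two.\<close>

lemma skorokhod_integral_eq:
  assumes T: "0 < T"
  shows "skorokhod_integral M Y T X \<in> borel_measurable M" "AE \<omega> in M. skorokhod_integral M Y T X \<omega> = skor T \<omega>"
proof -
  have T0: "0 \<le> T" using T by simp
  let ?Z = "skorokhod_integral M Y T X"
  have "has_skorokhod_integral M Y T X ?Z"
    unfolding skorokhod_integral_def by (rule someI[of _ "skor T"], rule skor_has_skorokhod_integral[OF T])
  then obtain U where U: "AE \<omega> in M. represents M Y T (\<lambda>t. X t \<omega>) (U \<omega>)" "has_divergence M Y T U ?Z"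
    unfolding has_skorokhod_integral_def by (elim exE conjE)
  obtain V where V: "AE \<omega> in M. represents M Y T (\<lambda>t. X t \<omega>) (V \<omega>)" "has_divergence M Y T V (skor T)"
    using skor_has_skorokhod_integral[OF T] unfolding has_skorokhod_integral_def by (elim exE conjE)
  show "?Z \<in> borel_measurable M" using U(2) by (intro gen_measurable_sub[where T=T]) (simp add: has_divergence_def)
  show "AE \<omega> in M. ?Z \<omega> = skor T \<omega>"
    using divergence_le[OF T0 U V] divergence_le[OF T0 V U] by eventually_elim simp
qed

section \<open>Consistency\<close>

lemma rms_const: "rms M (\<lambda>\<omega>. c) = \<bar>c\<bar>"
  by (simp add: rms_def prob_space)

lemma rms_centered_le:
  assumes Z: "Z \<in> sq_int M"
  shows "rms M (\<lambda>\<omega>. Z \<omega> - (\<integral>\<omega>. Z \<omega> \<partial>M)) \<le> 2 * rms M Z"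
proof -
  have "rms M (\<lambda>\<omega>. Z \<omega> - (\<integral>\<omega>. Z \<omega> \<partial>M)) \<le> rms M Z + \<bar>\<integral>\<omega>. Z \<omega> \<partial>M\<bar>"
    using rms_diff_le[OF Z sq_int_const] by (simp only: rms_const)
  moreover have "\<bar>\<integral>\<omega>. Z \<omega> \<partial>M\<bar> \<le> rms M Z"
    using integral_abs_bound[of M Z] expectation_abs_le_rms[OF Z] by linarith
  ultimately show ?thesis by simp
qed

lemma chebyshev:
  assumes Z: "Z \<in> sq_int M" and a: "0 < a"
  shows "prob {\<omega> \<in> space M. a \<le> \<bar>Z \<omega>\<bar>} \<le> (rms M Z)\<^sup>2 / a\<^sup>2"
  unfolding rms_square by (rule second_moment_method[OF sq_int_measurable[OF Z] sq_int_square[OF Z] a])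

text \<open>Bounds the variance of the energy per unit of time, by
  \<open>energy_variance\<close>.\<close>

definition energy_rate :: real where
  "energy_rate = 4 * CX\<^sup>2 / \<kappa>"

lemma energy_rate_nonneg: "0 \<le> energy_rate"
  using kappa by (simp add: energy_rate_def)

text \<open>The end point term X(T)^2 / 2 stays bounded in mean square and the energy fluctuates at
  most like the root of T; since T >= 1, the constant is absorbed in that root.\<close>

lemma skor_rms:
  assumes T: "1 \<le> T"
  shows "(rms M (skor T))\<^sup>2 \<le> (2 * CX + \<theta> * sqrt energy_rate)\<^sup>2 * T"
proof -
  have T0: "0 \<le> T" using T by simp
  define U where "U \<omega> = X T \<omega> * X T \<omega>" for \<omega>
  define E where "E \<omega> = energy T \<omega> - (\<integral>\<omega>. energy T \<omega> \<partial>M)" for \<omega>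
  have U: "U \<in> sq_int M" unfolding U_def[abs_def] by (intro G_mult_sq_int X_G T0)
  have E: "E \<in> sq_int M" unfolding E_def[abs_def] by (intro sq_int_diff energy_sq_int T0 sq_int_const)
  have "(\<integral>\<omega>. pathint T \<omega> \<partial>M) = (\<integral>\<omega>. 1 / 2 * U \<omega> + \<theta> * energy T \<omega> \<partial>M)"
    unfolding pathint_def U_def unfolding power2_eq_square by simp
  also have "\<dots> = 1 / 2 * (\<integral>\<omega>. U \<omega> \<partial>M) + \<theta> * (\<integral>\<omega>. energy T \<omega> \<partial>M)"
    using sq_int_integrable[OF U] sq_int_integrable[OF energy_sq_int[OF T0]] by simp
  finally have "skor T \<omega> = 1 / 2 * (U \<omega> - (\<integral>\<omega>. U \<omega> \<partial>M)) + \<theta> * E \<omega>" for \<omega>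
    unfolding skor_def E_def unfolding pathint_def U_def unfolding power2_eq_square by (simp add: algebra_simps)
  then have "rms M (skor T) = rms M (\<lambda>\<omega>. 1 / 2 * (U \<omega> - (\<integral>\<omega>. U \<omega> \<partial>M)) + \<theta> * E \<omega>)"
    by (intro rms_cong)
  also have "\<dots> \<le> 1 / 2 * rms M (\<lambda>\<omega>. U \<omega> - (\<integral>\<omega>. U \<omega> \<partial>M)) + \<theta> * rms M E"
    using rms_add_le[OF sq_int_cmult[OF sq_int_diff[OF U sq_int_const]] sq_int_cmult[OF E], of "1 / 2" "\<integral>\<omega>. U \<omega> \<partial>M" \<theta>] theta
    unfolding rms_cmult by simp
  \<comment> \<open>The inner 2 comes from \<open>G_mult_rms_le\<close>, the outer one from
    centering.\<close>
  also have "\<dots> \<le> 1 / 2 * (2 * (2 * CX)) + \<theta> * sqrt (energy_rate * T)"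
  proof (intro add_mono mult_left_mono)
    have "rms M U \<le> 2 * (rms M (X T) * rms M (X T))"
      unfolding U_def[abs_def] by (intro G_mult_rms_le X_G T0)
    also have "\<dots> \<le> 2 * CX"
      using X_rms_bound[OF T0] by (simp add: power2_eq_square)
    finally show "rms M (\<lambda>\<omega>. U \<omega> - (\<integral>\<omega>. U \<omega> \<partial>M)) \<le> 2 * (2 * CX)"
      using rms_centered_le[OF U] by linarith
    show "rms M E \<le> sqrt (energy_rate * T)"
      unfolding E_def[abs_def] energy_rate_def by (intro real_le_rsqrt energy_variance T0)
  qed (use theta in auto)
  also have "\<dots> \<le> (2 * CX + \<theta> * sqrt energy_rate) * sqrt T"
  proof -
    have "2 * CX * 1 \<le> 2 * CX * sqrt T" using CX_nonneg T by (intro mult_left_mono) auto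
    then show ?thesis by (simp add: real_sqrt_mult algebra_simps)
  qed
  finally have "(rms M (skor T))\<^sup>2 \<le> ((2 * CX + \<theta> * sqrt energy_rate) * sqrt T)\<^sup>2"
    by (intro power_mono) auto
  then show ?thesis using T by (simp add: power_mult_distrib)
qed

text \<open>The error is minus the quotient of the Skorokhod integral and the energy. If the energy
  exceeds half its mean m and the integral is below \<epsilon> m / 2 in absolute value, the quotient
  is at most \<epsilon>; each of the two exceptional events has probability of order 1/T.\<close>

lemma lse_deviation:
  assumes T: "2 \<le> T" and \<epsilon>: "0 < \<epsilon>"
  defines "E \<equiv> least_squares_estimator M \<theta> Y X T"
  shows "E \<in> borel_measurable M"
    "prob {\<omega> \<in> space M. \<epsilon> < \<bar>E \<omega> - \<theta>\<bar>}
      \<le> 16 * (energy_rate + (2 * CX + \<theta> * sqrt energy_rate)\<^sup>2 / \<epsilon>\<^sup>2) / cX ^ 4 / T"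
proof -
  have T0: "0 \<le> T" "0 < T" "1 \<le> T" using T by auto
  let ?Z = "skorokhod_integral M Y T X"
  note Z = skorokhod_integral_eq[OF T0(2)]
  have E: "E \<omega> = - ((- \<theta> * energy T \<omega> + ?Z \<omega>) / energy T \<omega>)" for \<omega>
    by (simp only: E_def least_squares_estimator_def skorokhod_XdX_def energy_def)
  show Em: "E \<in> borel_measurable M"
    unfolding E[abs_def]
    by (intro borel_measurable_uminus borel_measurable_divide borel_measurable_add borel_measurable_times
        borel_measurable_const Z(1) sq_int_measurable[OF energy_sq_int[OF T0(1)]])
  define m where "m = (\<integral>\<omega>. energy T \<omega> \<partial>M)"
  \<comment> \<open>T >= 2 gives T - 1 >= T / 2, so the lower bound for m becomes proportional to
    T.\<close>
  have cT: "0 < cX\<^sup>2 * (T / 2)" using cX_pos T0 by simp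
  have "cX\<^sup>2 * (T / 2) \<le> cX\<^sup>2 * (T - 1)" using T by (intro mult_left_mono) auto
  then have m: "cX\<^sup>2 * (T / 2) \<le> m" unfolding m_def using expectation_energy_lower[OF T0(3)] by linarith
  then have m0: "0 < m" using cT by linarith
  define D where "D \<omega> = energy T \<omega> - m" for \<omega>
  have Dsq: "D \<in> sq_int M" unfolding D_def[abs_def] by (intro sq_int_diff energy_sq_int T0 sq_int_const)
  let ?A = "{\<omega> \<in> space M. m / 2 \<le> \<bar>D \<omega>\<bar>}" and ?B = "{\<omega> \<in> space M. \<epsilon> * m / 2 \<le> \<bar>skor T \<omega>\<bar>}"
  have meas: "?A \<in> events" "?B \<in> events"
    using sq_int_measurable[OF Dsq] sq_int_measurable[OF skor_sq_int[OF T0(1)]] by measurable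
  have "prob {\<omega> \<in> space M. \<epsilon> < \<bar>E \<omega> - \<theta>\<bar>} \<le> prob (?A \<union> ?B)"
  proof (rule finite_measure_mono_AE)
    show "?A \<union> ?B \<in> events" using meas by (rule sets.Un)
    show "AE \<omega> in M. \<omega> \<in> {\<omega> \<in> space M. \<epsilon> < \<bar>E \<omega> - \<theta>\<bar>} \<longrightarrow> \<omega> \<in> ?A \<union> ?B"
      using Z(2)
    proof eventually_elim
      case (elim \<omega>)
      show ?case
      proof (intro impI, rule ccontr)
        assume a: "\<omega> \<in> {\<omega> \<in> space M. \<epsilon> < \<bar>E \<omega> - \<theta>\<bar>}" and n: "\<omega> \<notin> ?A \<union> ?B"
        have small: "\<bar>D \<omega>\<bar> < m / 2" "\<bar>skor T \<omega>\<bar> < \<epsilon> * m / 2" using a n by auto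
        have e: "m / 2 < energy T \<omega>" using small(1) unfolding D_def by linarith
        then have e0: "0 < energy T \<omega>" using m0 by linarith
        have "E \<omega> - \<theta> = - (skor T \<omega> / energy T \<omega>)"
          unfolding E elim using e0 by (simp add: field_simps)
        then have "\<bar>E \<omega> - \<theta>\<bar> = \<bar>skor T \<omega>\<bar> / energy T \<omega>" using e0 by simp
        also have "\<dots> \<le> \<epsilon>"
        proof -
          have "\<epsilon> * (m / 2) \<le> \<epsilon> * energy T \<omega>" using e \<epsilon> by (intro mult_left_mono) auto
          then show ?thesis using small(2) e0 by (simp add: field_simps)
        qed
        finally show False using a by simp
      qed
    qed
  qed
  also have "\<dots> \<le> prob ?A + prob ?B" by (rule measure_Un_le[OF meas])
  also have "\<dots> \<le> (rms M D)\<^sup>2 / (m / 2)\<^sup>2 + (rms M (skor T))\<^sup>2 / (\<epsilon> * m / 2)\<^sup>2"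
    using m0 \<epsilon> by (intro add_mono chebyshev Dsq skor_sq_int T0) auto
  also have "\<dots> \<le> energy_rate * T / (cX\<^sup>2 * (T / 2) / 2)\<^sup>2
      + (2 * CX + \<theta> * sqrt energy_rate)\<^sup>2 * T / (\<epsilon> * (cX\<^sup>2 * (T / 2)) / 2)\<^sup>2"
  proof (intro add_mono frac_le)
    show "(rms M D)\<^sup>2 \<le> energy_rate * T"
      unfolding D_def[abs_def] m_def energy_rate_def by (rule energy_variance[OF T0(1)])
    show "(rms M (skor T))\<^sup>2 \<le> (2 * CX + \<theta> * sqrt energy_rate)\<^sup>2 * T" by (rule skor_rms[OF T0(3)])
    show "(cX\<^sup>2 * (T / 2) / 2)\<^sup>2 \<le> (m / 2)\<^sup>2" by (intro power_mono divide_right_mono m) (use cT in auto)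
    show "(\<epsilon> * (cX\<^sup>2 * (T / 2)) / 2)\<^sup>2 \<le> (\<epsilon> * m / 2)\<^sup>2"
      by (intro power_mono divide_right_mono mult_left_mono m) (use cT \<epsilon> in auto)
    show "0 \<le> energy_rate * T" using energy_rate_nonneg T0 by simp
    show "0 < (cX\<^sup>2 * (T / 2) / 2)\<^sup>2" "0 < (\<epsilon> * (cX\<^sup>2 * (T / 2)) / 2)\<^sup>2" using cX_pos T0(2) \<epsilon> by simp_all
  qed (use T0 in auto)
  also have "\<dots> = 16 * (energy_rate + (2 * CX + \<theta> * sqrt energy_rate)\<^sup>2 / \<epsilon>\<^sup>2) / cX ^ 4 / T"
    using cX_pos T0 \<epsilon> by (simp add: field_simps power2_eq_square power4_eq_xxxx)
  finally show "prob {\<omega> \<in> space M. \<epsilon> < \<bar>E \<omega> - \<theta>\<bar>}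
      \<le> 16 * (energy_rate + (2 * CX + \<theta> * sqrt energy_rate)\<^sup>2 / \<epsilon>\<^sup>2) / cX ^ 4 / T" .
qed

lemma lse_consistent: "tendsto_in_probability M (least_squares_estimator M \<theta> Y X) \<theta> at_top"
  unfolding tendsto_in_probability_def
proof (intro conjI allI impI)
  show "\<forall>\<^sub>F T in at_top. least_squares_estimator M \<theta> Y X T \<in> borel_measurable M"
    using eventually_ge_at_top[of 2] by eventually_elim (rule lse_deviation(1)[OF _ zero_less_one])
  fix \<epsilon> :: real assume \<epsilon>: "0 < \<epsilon>"
  let ?c = "16 * (energy_rate + (2 * CX + \<theta> * sqrt energy_rate)\<^sup>2 / \<epsilon>\<^sup>2) / cX ^ 4"
  have lim: "((\<lambda>T. ?c / T) \<longlongrightarrow> 0) at_top"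
    by (rule tendsto_divide_0[OF tendsto_const filterlim_at_top_imp_at_infinity[OF filterlim_ident]])
  show "((\<lambda>T. prob {\<omega> \<in> space M. \<epsilon> < \<bar>least_squares_estimator M \<theta> Y X T \<omega> - \<theta>\<bar>}) \<longlongrightarrow> 0) at_top"
  proof (rule tendsto_sandwich[OF _ _ tendsto_const lim])
    show "\<forall>\<^sub>F T in at_top. prob {\<omega> \<in> space M. \<epsilon> < \<bar>least_squares_estimator M \<theta> Y X T \<omega> - \<theta>\<bar>} \<le> ?c / T"
      using eventually_ge_at_top[of 2] by eventually_elim (rule lse_deviation(2)[OF _ \<epsilon>])
  qed simp
qed

end

theorem theorem3p1:
  fixes M :: "'w measure" and B X :: "real \<Rightarrow> 'w \<Rightarrow> real" and H \<theta> :: real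
  assumes "1 / 2 < H" and "H < 1" and "1 < \<theta>"
    and "fractional_brownian_motion M H B"
    and "\<And>\<omega>. \<omega> \<in> space M \<Longrightarrow> langevin_solution \<theta> (\<lambda>t. noise2 H B t \<omega>) (\<lambda>t. X t \<omega>)"
  shows "tendsto_in_probability M (least_squares_estimator M \<theta> (noise2 H B) X) \<theta> at_top"
proof -
  interpret second_kind_ou M B X H \<theta> by unfold_locales (fact assms)+
  show ?thesis by (rule lse_consistent)
qed

end
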